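(* The functor $M\mapsto A_F^+\otimes_SM$ from the category of Wach modules over $S$ to the category of Wach modules over $A_F^+$ is an equivalence of $\otimes$-categories, with $\otimes$-compatible quasi-inverse $N\mapsto N^{\mathbb{F}_p^\times}$ (invariants under $\Gamma_{\mathrm{tor}}\cong\mathbb{F}_p^\times$). Moreover this functor and its quasi-inverse preserve short exact sequences (where a sequence of Wach modules is called exact if it is exact as a sequence of underlying modules).
   Context: Fix a prime $p\geq3$, a perfect field $\kappa$ of characteristic $p$, $O_F=W(\kappa)$. Let $\Gamma_F\cong\mathbb{Z}_p^\times$ (via the cyclotomic character $\chi$) be the Galois group of $F(\mu_{p^\infty})/F$, $F=\mathrm{Frac}(O_F)$; let $\Gamma_0\subset\Gamma_F$ correspond to $1+p\mathbb{Z}_p$ and $\Gamma_{\mathrm{tor}}\cong\mathbb{F}_p^\times$ to the Teichmüller lifts, so $\Gamma_F=\Gamma_0\times\Gamma_{\mathrm{tor}}$. Let $A_F^+=O_F[[\mu]]$, $q=1+\mu$, with Frobenius $\varphi$ (Witt Frobenius on $O_F$, $\varphi(q)=q^p$) and continuous $O_F$-linear $\Gamma_F$-action $g(q)=q^{\chi(g)}$. Set $[p]_q=\frac{q^p-1}{q-1}$, $\mu_0=\sum_{a\in\mathbb{F}_p^\times}(q^{[a]}-1)$, $\tilde p=\mu_0+p$, and $S=O_F[[\mu_0]]=(A_F^+)^{\Gamma_{\mathrm{tor}}}$, which is stable under $\varphi$ and $\Gamma_0$. A Wach module over $A_F^+$: a finite free $A_F^+$-module $N$ with continuous semilinear $\Gamma_F$-action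 trivial on $N/\mu N$, and a Frobenius-semilinear $\varphi\colon N[1/\mu]\to N[1/\varphi(\mu)]$ commuting with $\Gamma_F$ such that for some integers $b\geq a$, $\varphi(\mu^bN)\subset\mu^bN$ and the cokernel of the linearization $\varphi^*(\mu^bN)\to\mu^bN$ is killed by $[p]_q^{b-a}$. A Wach module over $S$: the same with $S,\mu_0,\tilde p,\Gamma_0$ in place of $A_F^+,\mu,[p]_q,\Gamma_F$. Morphisms are linear, $\Gamma$-equivariant maps compatible with $\varphi$ after inverting $\mu$ (resp. $\mu_0$). On $A_F^+\otimes_SM$, $\varphi$ and $\Gamma_0$ act diagonally and $\Gamma_{\mathrm{tor}}$ acts through the factor $A_F^+$. *)

theory Defs
  imports
    "HOL-Computational_Algebra.Formal_Power_Series"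
    "HOL-Analysis.Product_Topology"
    "HOL-Algebra.Module"
begin

section \<open>Tensor categories and tensor equivalences\<close>

record ('o, 'm) cat =
  Obj :: "'o set"
  Arr :: "'m set"
  Dom :: "'m \<Rightarrow> 'o"
  Cod :: "'m \<Rightarrow> 'o"
  Idn :: "'o \<Rightarrow> 'm"
  Cmp :: "'m \<Rightarrow> 'm \<Rightarrow> 'm"  (infixr \<open>\<bullet>\<index>\<close> 55)

definition in_hom :: "('o, 'm, 'x) cat_scheme \<Rightarrow> 'm \<Rightarrow> 'o \<Rightarrow> 'o \<Rightarrow> bool" where
  "in_hom C f X Y \<longleftrightarrow> f \<in> Arr C \<and> Dom C f = X \<and> Cod C f = Y"

definition category :: "('o, 'm, 'x) cat_scheme \<Rightarrow> bool" where
  "category C \<longleftrightarrow>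
    (\<forall>f\<in>Arr C. Dom C f \<in> Obj C \<and> Cod C f \<in> Obj C) \<and>
    (\<forall>X\<in>Obj C. in_hom C (Idn C X) X X) \<and>
    (\<forall>f\<in>Arr C. \<forall>g\<in>Arr C. Dom C g = Cod C f \<longrightarrow>
      in_hom C (g \<bullet>\<^bsub>C\<^esub> f) (Dom C f) (Cod C g)) \<and>
    (\<forall>f\<in>Arr C. f \<bullet>\<^bsub>C\<^esub> Idn C (Dom C f) = f \<and> Idn C (Cod C f) \<bullet>\<^bsub>C\<^esub> f = f) \<and>
    (\<forall>f\<in>Arr C. \<forall>g\<in>Arr C. \<forall>h\<in>Arr C. Dom C g = Cod C f \<and> Dom C h = Cod C g \<longrightarrow>
      h \<bullet>\<^bsub>C\<^esub> (g \<bullet>\<^bsub>C\<^esub> f) = (h \<bullet>\<^bsub>C\<^esub> g) \<bullet>\<^bsub>C\<^esub> f)"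

definition iso_arr :: "('o, 'm, 'x) cat_scheme \<Rightarrow> 'm \<Rightarrow> 'o \<Rightarrow> 'o \<Rightarrow> bool" where
  "iso_arr C f X Y \<longleftrightarrow> in_hom C f X Y \<and>
    (\<exists>g. in_hom C g Y X \<and> g \<bullet>\<^bsub>C\<^esub> f = Idn C X \<and> f \<bullet>\<^bsub>C\<^esub> g = Idn C Y)"

record ('o, 'm, 'p, 'n) func =
  fob :: "'o \<Rightarrow> 'p"
  far :: "'m \<Rightarrow> 'n"

definition is_functor ::
  "('o, 'm, 'x) cat_scheme \<Rightarrow> ('p, 'n, 'y) cat_scheme \<Rightarrow> ('o, 'm, 'p, 'n, 'z) func_scheme \<Rightarrow> bool" where
  "is_functor C D F \<longleftrightarrow>
    (\<forall>X\<in>Obj C. fob F X \<in> Obj D) \<and>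
    (\<forall>f\<in>Arr C. in_hom D (far F f) (fob F (Dom C f)) (fob F (Cod C f))) \<and>
    (\<forall>X\<in>Obj C. far F (Idn C X) = Idn D (fob F X)) \<and>
    (\<forall>f\<in>Arr C. \<forall>g\<in>Arr C. Dom C g = Cod C f \<longrightarrow>
      far F (g \<bullet>\<^bsub>C\<^esub> f) = far F g \<bullet>\<^bsub>D\<^esub> far F f)"

record ('o, 'm) tcat = "('o, 'm) cat" +
  tob :: "'o \<Rightarrow> 'o \<Rightarrow> 'o"
  tar :: "'m \<Rightarrow> 'm \<Rightarrow> 'm"
  tun :: 'o
  asc :: "'o \<Rightarrow> 'o \<Rightarrow> 'o \<Rightarrow> 'm"
  lun :: "'o \<Rightarrow> 'm"
  run :: "'o \<Rightarrow> 'm"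
  brd :: "'o \<Rightarrow> 'o \<Rightarrow> 'm"

text \<open>A tensor category is a symmetric monoidal category: unit and associativity and
  commutativity constraints subject to the pentagon, triangle and hexagon axioms.\<close>

definition tensor_category :: "('o, 'm, 'x) tcat_scheme \<Rightarrow> bool" where
  "tensor_category C \<longleftrightarrow>
    category C \<and>
    tun C \<in> Obj C \<and>
    (\<forall>X\<in>Obj C. \<forall>Y\<in>Obj C. tob C X Y \<in> Obj C) \<and>
    (\<forall>f\<in>Arr C. \<forall>g\<in>Arr C.
      in_hom C (tar C f g) (tob C (Dom C f) (Dom C g)) (tob C (Cod C f) (Cod C g))) \<and>
    (\<forall>X\<in>Obj C. \<forall>Y\<in>Obj C. tar C (Idn C X) (Idn C Y) = Idn C (tob C X Y)) \<and>
    (\<forall>f\<in>Arr C. \<forall>g\<in>Arr C. \<forall>f'\<in>Arr C. \<forall>g'\<in>Arr C.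
      Dom C f' = Cod C f \<and> Dom C g' = Cod C g \<longrightarrow>
      tar C (f' \<bullet>\<^bsub>C\<^esub> f) (g' \<bullet>\<^bsub>C\<^esub> g) = tar C f' g' \<bullet>\<^bsub>C\<^esub> tar C f g) \<and>
    (\<forall>X\<in>Obj C. \<forall>Y\<in>Obj C. \<forall>Z\<in>Obj C.
      iso_arr C (asc C X Y Z) (tob C (tob C X Y) Z) (tob C X (tob C Y Z))) \<and>
    (\<forall>f\<in>Arr C. \<forall>g\<in>Arr C. \<forall>h\<in>Arr C.
      asc C (Cod C f) (Cod C g) (Cod C h) \<bullet>\<^bsub>C\<^esub> tar C (tar C f g) h =
      tar C f (tar C g h) \<bullet>\<^bsub>C\<^esub> asc C (Dom C f) (Dom C g) (Dom C h)) \<and>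
    (\<forall>X\<in>Obj C. iso_arr C (lun C X) (tob C (tun C) X) X \<and> iso_arr C (run C X) (tob C X (tun C)) X) \<and>
    (\<forall>f\<in>Arr C.
      lun C (Cod C f) \<bullet>\<^bsub>C\<^esub> tar C (Idn C (tun C)) f = f \<bullet>\<^bsub>C\<^esub> lun C (Dom C f) \<and>
      run C (Cod C f) \<bullet>\<^bsub>C\<^esub> tar C f (Idn C (tun C)) = f \<bullet>\<^bsub>C\<^esub> run C (Dom C f)) \<and>
    (\<forall>X\<in>Obj C. \<forall>Y\<in>Obj C. iso_arr C (brd C X Y) (tob C X Y) (tob C Y X)) \<and>
    (\<forall>f\<in>Arr C. \<forall>g\<in>Arr C.
      brd C (Cod C f) (Cod C g) \<bullet>\<^bsub>C\<^esub> tar C f g = tar C g f \<bullet>\<^bsub>C\<^esub> brd C (Dom C f) (Dom C g)) \<and>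
    (\<forall>W\<in>Obj C. \<forall>X\<in>Obj C. \<forall>Y\<in>Obj C. \<forall>Z\<in>Obj C.
      asc C W X (tob C Y Z) \<bullet>\<^bsub>C\<^esub> asc C (tob C W X) Y Z =
      tar C (Idn C W) (asc C X Y Z) \<bullet>\<^bsub>C\<^esub> asc C W (tob C X Y) Z \<bullet>\<^bsub>C\<^esub> tar C (asc C W X Y) (Idn C Z)) \<and>
    (\<forall>X\<in>Obj C. \<forall>Y\<in>Obj C.
      tar C (Idn C X) (lun C Y) \<bullet>\<^bsub>C\<^esub> asc C X (tun C) Y = tar C (run C X) (Idn C Y)) \<and>
    (\<forall>X\<in>Obj C. \<forall>Y\<in>Obj C. \<forall>Z\<in>Obj C.
      tar C (Idn C Y) (brd C X Z) \<bullet>\<^bsub>C\<^esub> asc C Y X Z \<bullet>\<^bsub>C\<^esub> tar C (brd C X Y) (Idn C Z) =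
      asc C Y Z X \<bullet>\<^bsub>C\<^esub> brd C X (tob C Y Z) \<bullet>\<^bsub>C\<^esub> asc C X Y Z) \<and>
    (\<forall>X\<in>Obj C. \<forall>Y\<in>Obj C. brd C Y X \<bullet>\<^bsub>C\<^esub> brd C X Y = Idn C (tob C X Y))"

record ('o, 'm, 'p, 'n) tfunc = "('o, 'm, 'p, 'n) func" +
  tmlt :: "'o \<Rightarrow> 'o \<Rightarrow> 'n"  \<comment> \<open>\<open>F X \<otimes> F Y \<rightarrow> F (X \<otimes> Y)\<close>\<close>
  tunt :: 'n                        \<comment> \<open>\<open>1 \<rightarrow> F 1\<close>\<close>

definition tensor_functor ::
  "('o, 'm, 'x) tcat_scheme \<Rightarrow> ('p, 'n, 'y) tcat_scheme \<Rightarrow> ('o, 'm, 'p, 'n) tfunc \<Rightarrow> bool" where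
  "tensor_functor C D F \<longleftrightarrow>
    is_functor C D F \<and>
    (\<forall>X\<in>Obj C. \<forall>Y\<in>Obj C.
      iso_arr D (tmlt F X Y) (tob D (fob F X) (fob F Y)) (fob F (tob C X Y))) \<and>
    (\<forall>f\<in>Arr C. \<forall>g\<in>Arr C.
      far F (tar C f g) \<bullet>\<^bsub>D\<^esub> tmlt F (Dom C f) (Dom C g) =
      tmlt F (Cod C f) (Cod C g) \<bullet>\<^bsub>D\<^esub> tar D (far F f) (far F g)) \<and>
    iso_arr D (tunt F) (tun D) (fob F (tun C)) \<and>
    (\<forall>X\<in>Obj C. \<forall>Y\<in>Obj C. \<forall>Z\<in>Obj C.
      far F (asc C X Y Z) \<bullet>\<^bsub>D\<^esub> tmlt F (tob C X Y) Z \<bullet>\<^bsub>D\<^esub> tar D (tmlt F X Y) (Idn D (fob F Z)) =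
      tmlt F X (tob C Y Z) \<bullet>\<^bsub>D\<^esub> tar D (Idn D (fob F X)) (tmlt F Y Z) \<bullet>\<^bsub>D\<^esub>
        asc D (fob F X) (fob F Y) (fob F Z)) \<and>
    (\<forall>X\<in>Obj C. \<forall>Y\<in>Obj C.
      far F (brd C X Y) \<bullet>\<^bsub>D\<^esub> tmlt F X Y = tmlt F Y X \<bullet>\<^bsub>D\<^esub> brd D (fob F X) (fob F Y)) \<and>
    (\<forall>X\<in>Obj C.
      far F (lun C X) \<bullet>\<^bsub>D\<^esub> tmlt F (tun C) X \<bullet>\<^bsub>D\<^esub> tar D (tunt F) (Idn D (fob F X)) = lun D (fob F X) \<and>
      far F (run C X) \<bullet>\<^bsub>D\<^esub> tmlt F X (tun C) \<bullet>\<^bsub>D\<^esub> tar D (Idn D (fob F X)) (tunt F) = run D (fob F X))"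

definition tensor_nat_iso ::
  "('o, 'm, 'x) tcat_scheme \<Rightarrow> ('p, 'n, 'y) tcat_scheme \<Rightarrow>
    ('o, 'm, 'p, 'n) tfunc \<Rightarrow> ('o, 'm, 'p, 'n) tfunc \<Rightarrow> ('o \<Rightarrow> 'n) \<Rightarrow> bool" where
  "tensor_nat_iso C D F G t \<longleftrightarrow>
    (\<forall>X\<in>Obj C. iso_arr D (t X) (fob F X) (fob G X)) \<and>
    (\<forall>f\<in>Arr C. far G f \<bullet>\<^bsub>D\<^esub> t (Dom C f) = t (Cod C f) \<bullet>\<^bsub>D\<^esub> far F f) \<and>
    (\<forall>X\<in>Obj C. \<forall>Y\<in>Obj C. t (tob C X Y) \<bullet>\<^bsub>D\<^esub> tmlt F X Y = tmlt G X Y \<bullet>\<^bsub>D\<^esub> tar D (t X) (t Y)) \<and>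
    t (tun C) \<bullet>\<^bsub>D\<^esub> tunt F = tunt G"

definition id_tfunc :: "('o, 'm, 'x) tcat_scheme \<Rightarrow> ('o, 'm, 'o, 'm) tfunc" where
  "id_tfunc C = \<lparr>fob = (\<lambda>X. X), far = (\<lambda>f. f),
     tmlt = (\<lambda>X Y. Idn C (tob C X Y)), tunt = Idn C (tun C)\<rparr>"

definition comp_tfunc ::
  "('q, 'l, 'x) tcat_scheme \<Rightarrow> ('p, 'n, 'q, 'l) tfunc \<Rightarrow> ('o, 'm, 'p, 'n) tfunc \<Rightarrow>
    ('o, 'm, 'q, 'l) tfunc" where
  "comp_tfunc E G F = \<lparr>fob = (\<lambda>X. fob G (fob F X)), far = (\<lambda>f. far G (far F f)),
     tmlt = (\<lambda>X Y. far G (tmlt F X Y) \<bullet>\<^bsub>E\<^esub> tmlt G (fob F X) (fob F Y)),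
     tunt = far G (tunt F) \<bullet>\<^bsub>E\<^esub> tunt G\<rparr>"

text \<open>\<open>F\<close> is an equivalence of tensor categories with tensor-compatible quasi-inverse \<open>G\<close>:
  both functors carry tensor structures for which the two composites are isomorphic to the
  identities as tensor functors.\<close>

definition tensor_equivalence ::
  "('o, 'm, 'x) tcat_scheme \<Rightarrow> ('p, 'n, 'y) tcat_scheme \<Rightarrow>
    ('o, 'm, 'p, 'n) func \<Rightarrow> ('p, 'n, 'o, 'm) func \<Rightarrow> bool" where
  "tensor_equivalence C D F G \<longleftrightarrow>
    tensor_category C \<and> tensor_category D \<and>
    (\<exists>JF uF JG uG \<eta> \<epsilon>.
      let F' = func.extend F (tfunc.fields JF uF); G' = func.extend G (tfunc.fields JG uG) in
        tensor_functor C D F' \<and> tensor_functor D C G' \<and>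
        tensor_nat_iso C C (id_tfunc C) (comp_tfunc C G' F') \<eta> \<and>
        tensor_nat_iso D D (comp_tfunc D F' G') (id_tfunc D) \<epsilon>)"


section \<open>Modules, localization, tensor products\<close>

text \<open>Base rings are subrings, given by their carrier, of a fixed type of class
  \<^class>\<open>comm_ring_1\<close>. The fields \<open>mult\<close> and \<open>one\<close> that module records inherit from
  ring records have no meaning and are left undefined.\<close>

definition ring_on :: "'r::comm_ring_1 set \<Rightarrow> 'r ring" where
  "ring_on R = \<lparr>carrier = R, mult = (*), one = 1, zero = 0, add = (+)\<rparr>"

definition span_on :: "'r::comm_ring_1 set \<Rightarrow> ('r, 'u, 'x) module_scheme \<Rightarrow> 'u set \<Rightarrow> 'u set" where
  "span_on R M X = \<Inter> {H. submodule H (ring_on R) M \<and> X \<subseteq> H}"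

definition finite_free :: "'r::comm_ring_1 set \<Rightarrow> ('r, 'u, 'x) module_scheme \<Rightarrow> bool" where
  "finite_free R M \<longleftrightarrow> Module.module (ring_on R) M \<and>
    (\<exists>E. finite E \<and> E \<subseteq> carrier M \<and>
      (\<forall>x\<in>carrier M. \<exists>!c. c \<in> E \<rightarrow>\<^sub>E R \<and> x = finsum M (\<lambda>e. c e \<odot>\<^bsub>M\<^esub> e) E))"

text \<open>\<open>lfrac M s x n\<close> is the fraction \<open>x / s\<^sup>n\<close> and \<open>loc M s\<close> is \<open>M[1/s]\<close>.\<close>

definition loc_rel :: "('r::comm_ring_1, 'u, 'x) module_scheme \<Rightarrow> 'r \<Rightarrow> (('u \<times> nat) \<times> ('u \<times> nat)) set" where
  "loc_rel M s = {((x, m), (y, n)). x \<in> carrier M \<and> y \<in> carrier M \<and>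
     (\<exists>k. s ^ (k + n) \<odot>\<^bsub>M\<^esub> x = s ^ (k + m) \<odot>\<^bsub>M\<^esub> y)}"

definition lfrac :: "('r::comm_ring_1, 'u, 'x) module_scheme \<Rightarrow> 'r \<Rightarrow> 'u \<Rightarrow> nat \<Rightarrow> ('u \<times> nat) set" where
  "lfrac M s x n = loc_rel M s `` {(x, n)}"

definition loc :: "('r::comm_ring_1, 'u, 'x) module_scheme \<Rightarrow> 'r \<Rightarrow> ('r, ('u \<times> nat) set) module" where
  "loc M s = \<lparr>carrier = (carrier M \<times> UNIV) // loc_rel M s, mult = undefined, one = undefined,
     zero = lfrac M s \<zero>\<^bsub>M\<^esub> 0,
     add = (\<lambda>\<xi> \<upsilon>. \<Union>(x, m)\<in>\<xi>. \<Union>(y, n)\<in>\<upsilon>. lfrac M s (s ^ n \<odot>\<^bsub>M\<^esub> x \<oplus>\<^bsub>M\<^esub> s ^ m \<odot>\<^bsub>M\<^esub> y) (m + n)),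
     smult = (\<lambda>c \<xi>. \<Union>(x, m)\<in>\<xi>. lfrac M s (c \<odot>\<^bsub>M\<^esub> x) m)\<rparr>"

text \<open>The extension to \<open>M[1/s]\<close> of a map \<open>f\<close> from \<open>M\<close> to \<open>Q\<close> that is semilinear along the ring
  homomorphism \<open>\<alpha>\<close>, for \<open>\<alpha> s\<close> acting invertibly on \<open>Q\<close>: \<open>x / s\<^sup>n\<close> is sent to
  \<open>\<alpha>(s)\<^sup>-\<^sup>n f(x)\<close>.\<close>

definition loc_ext ::
  "('r::comm_ring_1 \<Rightarrow> 'r) \<Rightarrow> 'r \<Rightarrow> ('r, 'v, 'y) module_scheme \<Rightarrow> ('u \<Rightarrow> 'v) \<Rightarrow> ('u \<times> nat) set \<Rightarrow> 'v" where
  "loc_ext \<alpha> s Q f \<xi> = (THE \<upsilon>. \<upsilon> \<in> carrier Q \<and> (\<forall>(x, n)\<in>\<xi>. \<alpha> s ^ n \<odot>\<^bsub>Q\<^esub> \<upsilon> = f x))"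

definition loc_map ::
  "('r::comm_ring_1 \<Rightarrow> 'r) \<Rightarrow> 'r \<Rightarrow> ('r, 'v, 'y) module_scheme \<Rightarrow> 'r \<Rightarrow> ('u \<Rightarrow> 'v) \<Rightarrow>
    ('u \<times> nat) set \<Rightarrow> ('v \<times> nat) set" where
  "loc_map \<alpha> s N t f = loc_ext \<alpha> s (loc N t) (\<lambda>x. lfrac N t (f x) 0)"

text \<open>The submodule \<open>u\<^sup>b M\<close> of \<open>M[1/s]\<close>, for \<open>b\<close> any integer and \<open>u\<close> a divisor of \<open>s\<close>.\<close>

definition twist :: "('r::comm_ring_1, 'u, 'x) module_scheme \<Rightarrow> 'r \<Rightarrow> 'r \<Rightarrow> int \<Rightarrow> ('u \<times> nat) set set" where
  "twist M s u b = {\<xi> \<in> carrier (loc M s). \<exists>x\<in>carrier M.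
     u ^ nat (- b) \<odot>\<^bsub>loc M s\<^esub> \<xi> = lfrac M s (u ^ nat b \<odot>\<^bsub>M\<^esub> x) 0}"

text \<open>A list of pairs stands for the corresponding sum of pure tensors; two lists are related iff
  these sums agree in the tensor product over \<open>R\<close>.\<close>

inductive teq ::
  "'r set \<Rightarrow> ('r, 'u, 'x) module_scheme \<Rightarrow> ('r, 'v, 'y) module_scheme \<Rightarrow>
    ('u \<times> 'v) list \<Rightarrow> ('u \<times> 'v) list \<Rightarrow> bool"
  for R L M where
  teq_refl: "l \<in> lists (carrier L \<times> carrier M) \<Longrightarrow> teq R L M l l"
| teq_sym: "teq R L M l l' \<Longrightarrow> teq R L M l' l"
| teq_trans: "teq R L M l l' \<Longrightarrow> teq R L M l' l'' \<Longrightarrow> teq R L M l l''"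
| teq_append: "teq R L M l l' \<Longrightarrow> teq R L M k k' \<Longrightarrow> teq R L M (l @ k) (l' @ k')"
| teq_swap: "l \<in> lists (carrier L \<times> carrier M) \<Longrightarrow> k \<in> lists (carrier L \<times> carrier M) \<Longrightarrow>
    teq R L M (l @ k) (k @ l)"
| teq_zero: "y \<in> carrier M \<Longrightarrow> teq R L M [(\<zero>\<^bsub>L\<^esub>, y)] []"
| teq_add_left: "x \<in> carrier L \<Longrightarrow> x' \<in> carrier L \<Longrightarrow> y \<in> carrier M \<Longrightarrow>
    teq R L M [(x \<oplus>\<^bsub>L\<^esub> x', y)] [(x, y), (x', y)]"
| teq_add_right: "x \<in> carrier L \<Longrightarrow> y \<in> carrier M \<Longrightarrow> y' \<in> carrier M \<Longrightarrow>
    teq R L M [(x, y \<oplus>\<^bsub>M\<^esub> y')] [(x, y), (x, y')]"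
| teq_smult: "r \<in> R \<Longrightarrow> x \<in> carrier L \<Longrightarrow> y \<in> carrier M \<Longrightarrow>
    teq R L M [(r \<odot>\<^bsub>L\<^esub> x, y)] [(x, r \<odot>\<^bsub>M\<^esub> y)]"

text \<open>All modules live on subsets of the following type, which is closed under tensor products.
  Since \<open>'b\<close> is arbitrary, every module on a subset of any type has an isomorphic copy
  (via \<open>Atom\<close>). An element of a tensor product is \<open>Tensor l\<close> with \<open>l\<close> a chosen member
  of its class of lists.\<close>

datatype ('r, 'b) univ =
    Scalar (the_scalar: 'r)
  | Atom 'b
  | Tensor (the_list: "(('r, 'b) univ \<times> ('r, 'b) univ) list")

definition tcls ::
  "'r set \<Rightarrow> ('r, ('r, 'b) univ, 'x) module_scheme \<Rightarrow> ('r, ('r, 'b) univ, 'y) module_scheme \<Rightarrow>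
    (('r, 'b) univ \<times> ('r, 'b) univ) list \<Rightarrow> ('r, 'b) univ" where
  "tcls R L M l = Tensor (SOME l'. teq R L M l l')"

definition ptens ::
  "'r set \<Rightarrow> ('r, ('r, 'b) univ, 'x) module_scheme \<Rightarrow> ('r, ('r, 'b) univ, 'y) module_scheme \<Rightarrow>
    ('r, 'b) univ \<Rightarrow> ('r, 'b) univ \<Rightarrow> ('r, 'b) univ" where
  "ptens R L M x y = tcls R L M [(x, y)]"

text \<open>Scalars act through the left factor. They may come from a ring larger than \<open>R\<close>, if \<open>L\<close> is
  a module over it.\<close>

definition tens ::
  "'r set \<Rightarrow> ('r, ('r, 'b) univ, 'x) module_scheme \<Rightarrow> ('r, ('r, 'b) univ, 'y) module_scheme \<Rightarrow>
    ('r, ('r, 'b) univ) module" where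
  "tens R L M = \<lparr>carrier = tcls R L M ` lists (carrier L \<times> carrier M), mult = undefined, one = undefined,
     zero = tcls R L M [],
     add = (\<lambda>u v. tcls R L M (the_list u @ the_list v)),
     smult = (\<lambda>c u. tcls R L M (map (\<lambda>(x, y). (c \<odot>\<^bsub>L\<^esub> x, y)) (the_list u)))\<rparr>"

definition tmap ::
  "'r set \<Rightarrow> ('r, ('r, 'b) univ, 'x) module_scheme \<Rightarrow> ('r, ('r, 'b) univ, 'y) module_scheme \<Rightarrow>
    (('r, 'b) univ \<Rightarrow> ('r, 'b) univ) \<Rightarrow> (('r, 'b) univ \<Rightarrow> ('r, 'b) univ) \<Rightarrow>
    ('r, 'b) univ \<Rightarrow> ('r, 'b) univ" where
  "tmap R L' M' f g u = tcls R L' M' (map (map_prod f g) (the_list u))"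

text \<open>The additive map to \<open>P\<close> induced by a balanced biadditive map \<open>\<beta>\<close>.\<close>

definition tlift ::
  "('r, 'p, 'x) module_scheme \<Rightarrow> (('r, 'b) univ \<Rightarrow> ('r, 'b) univ \<Rightarrow> 'p) \<Rightarrow> ('r, 'b) univ \<Rightarrow> 'p" where
  "tlift P \<beta> u = foldr (\<lambda>(x, y) z. \<beta> x y \<oplus>\<^bsub>P\<^esub> z) (the_list u) \<zero>\<^bsub>P\<^esub>"

definition loc_pure ::
  "'r::comm_ring_1 set \<Rightarrow> ('r, ('r, 'b) univ, 'x) module_scheme \<Rightarrow> ('r, ('r, 'b) univ, 'y) module_scheme \<Rightarrow>
    'r \<Rightarrow> (('r, 'b) univ \<times> nat) set \<Rightarrow> (('r, 'b) univ \<times> nat) set \<Rightarrow> (('r, 'b) univ \<times> nat) set" where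
  "loc_pure R L M s \<xi> \<upsilon> =
    (\<Union>(x, m)\<in>\<xi>. \<Union>(y, n)\<in>\<upsilon>. lfrac (tens R L M) s (ptens R L M x y) (m + n))"

definition scalar_module :: "'r::comm_ring_1 set \<Rightarrow> ('r, ('r, 'b) univ) module" where
  "scalar_module R = \<lparr>carrier = Scalar ` R, mult = undefined, one = undefined, zero = Scalar 0,
     add = (\<lambda>x y. Scalar (the_scalar x + the_scalar y)),
     smult = (\<lambda>c x. Scalar (c * the_scalar x))\<rparr>"


section \<open>Wach modules over a general base\<close>

text \<open>Both kinds of Wach modules are instances of one notion over a base consisting of a ring with
  Frobenius and group action, the element inverted (\<open>\<mu>\<close> or \<open>\<mu>\<^sub>0\<close>), and the element
  bounding the cokernel of Frobenius (\<open>[p]\<^sub>q\<close> or \<open>\<mu>\<^sub>0 + p\<close>).\<close>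

record ('r, 'g) wach_base =
  b_prime :: nat
  b_scal :: "'r set"
  b_frob :: "'r \<Rightarrow> 'r"
  b_grp :: "'g monoid"
  b_top :: "'g topology"
  b_act :: "'g \<Rightarrow> 'r \<Rightarrow> 'r"
  b_mu :: 'r
  b_xi :: 'r

record ('r, 'u, 'g) wach = "('r, 'u) module" +
  gact :: "'g \<Rightarrow> 'u \<Rightarrow> 'u"
  frb :: "('u \<times> nat) set \<Rightarrow> ('u \<times> nat) set"

definition adic_power ::
  "('r::comm_ring_1, 'g) wach_base \<Rightarrow> ('r, 'u, 'x) module_scheme \<Rightarrow> nat \<Rightarrow> 'u set" where
  "adic_power B N n = span_on (b_scal B) N
     {(of_nat (b_prime B) ^ i * b_mu B ^ (n - i)) \<odot>\<^bsub>N\<^esub> x | i x. i \<le> n \<and> x \<in> carrier N}"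

definition adic_topology ::
  "('r::comm_ring_1, 'g) wach_base \<Rightarrow> ('r, 'u, 'x) module_scheme \<Rightarrow> 'u topology" where
  "adic_topology B N = topology_generated_by
     {(\<lambda>z. x \<oplus>\<^bsub>N\<^esub> z) ` adic_power B N n | x n. x \<in> carrier N}"

definition semilinear_action ::
  "('r::comm_ring_1, 'g) wach_base \<Rightarrow> ('r, 'u, 'g, 'x) wach_scheme \<Rightarrow> bool" where
  "semilinear_action B N \<longleftrightarrow>
    (\<forall>g\<in>carrier (b_grp B). \<forall>x\<in>carrier N. gact N g x \<in> carrier N) \<and>
    (\<forall>x\<in>carrier N. gact N \<one>\<^bsub>b_grp B\<^esub> x = x) \<and>
    (\<forall>g\<in>carrier (b_grp B). \<forall>h\<in>carrier (b_grp B). \<forall>x\<in>carrier N.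
      gact N (g \<otimes>\<^bsub>b_grp B\<^esub> h) x = gact N g (gact N h x)) \<and>
    (\<forall>g\<in>carrier (b_grp B). \<forall>x\<in>carrier N. \<forall>y\<in>carrier N.
      gact N g (x \<oplus>\<^bsub>N\<^esub> y) = gact N g x \<oplus>\<^bsub>N\<^esub> gact N g y) \<and>
    (\<forall>g\<in>carrier (b_grp B). \<forall>c\<in>b_scal B. \<forall>x\<in>carrier N.
      gact N g (c \<odot>\<^bsub>N\<^esub> x) = b_act B g c \<odot>\<^bsub>N\<^esub> gact N g x)"

definition semilinear_frobenius ::
  "('r::comm_ring_1, 'g) wach_base \<Rightarrow> ('r, 'u, 'g, 'x) wach_scheme \<Rightarrow> bool" where
  "semilinear_frobenius B N \<longleftrightarrow>
    (let L = loc N (b_mu B); L' = loc N (b_frob B (b_mu B)) in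
      (\<forall>\<xi>\<in>carrier L. frb N \<xi> \<in> carrier L') \<and>
      (\<forall>\<xi>\<in>carrier L. \<forall>\<upsilon>\<in>carrier L. frb N (\<xi> \<oplus>\<^bsub>L\<^esub> \<upsilon>) = frb N \<xi> \<oplus>\<^bsub>L'\<^esub> frb N \<upsilon>) \<and>
      (\<forall>c\<in>b_scal B. \<forall>\<xi>\<in>carrier L. frb N (c \<odot>\<^bsub>L\<^esub> \<xi>) = b_frob B c \<odot>\<^bsub>L'\<^esub> frb N \<xi>) \<and>
      (\<forall>g\<in>carrier (b_grp B). \<forall>\<xi>\<in>carrier L.
        frb N (loc_map (b_act B g) (b_mu B) N (b_mu B) (gact N g) \<xi>) =
        loc_map (b_act B g) (b_frob B (b_mu B)) N (b_frob B (b_mu B)) (gact N g) (frb N \<xi>)))"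

text \<open>The span below is the image of the linearization of Frobenius on \<open>\<mu>\<^sup>b N\<close>.\<close>

definition frobenius_height ::
  "('r::comm_ring_1, 'g) wach_base \<Rightarrow> ('r, 'u, 'g, 'x) wach_scheme \<Rightarrow> int \<Rightarrow> int \<Rightarrow> bool" where
  "frobenius_height B N a b \<longleftrightarrow>
    (let \<mu> = b_mu B; \<mu>' = b_frob B \<mu>; L' = loc N \<mu>' in
      frb N ` twist N \<mu> \<mu> b \<subseteq> twist N \<mu>' \<mu> b \<and>
      (\<forall>\<upsilon>\<in>twist N \<mu>' \<mu> b.
        b_xi B ^ nat (b - a) \<odot>\<^bsub>L'\<^esub> \<upsilon> \<in> span_on (b_scal B) L' (frb N ` twist N \<mu> \<mu> b)))"

definition wach_module ::
  "('r::comm_ring_1, 'g) wach_base \<Rightarrow> ('r, 'u, 'g, 'x) wach_scheme \<Rightarrow> bool" where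
  "wach_module B N \<longleftrightarrow>
    finite_free (b_scal B) N \<and>
    semilinear_action B N \<and>
    continuous_map (prod_topology (b_top B) (adic_topology B N)) (adic_topology B N)
      (\<lambda>(g, x). gact N g x) \<and>
    (\<forall>g\<in>carrier (b_grp B). \<forall>x\<in>carrier N. \<exists>y\<in>carrier N. gact N g x \<ominus>\<^bsub>N\<^esub> x = b_mu B \<odot>\<^bsub>N\<^esub> y) \<and>
    semilinear_frobenius B N \<and>
    (\<exists>a b. a \<le> b \<and> frobenius_height B N a b)"

definition wach_hom ::
  "('r::comm_ring_1, 'g) wach_base \<Rightarrow> ('r, 'u, 'g) wach \<Rightarrow> ('r, 'v, 'g) wach \<Rightarrow> ('u \<Rightarrow> 'v) set" where
  "wach_hom B X Y = {f \<in> carrier X \<rightarrow>\<^sub>E carrier Y.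
    (\<forall>x\<in>carrier X. \<forall>y\<in>carrier X. f (x \<oplus>\<^bsub>X\<^esub> y) = f x \<oplus>\<^bsub>Y\<^esub> f y) \<and>
    (\<forall>c\<in>b_scal B. \<forall>x\<in>carrier X. f (c \<odot>\<^bsub>X\<^esub> x) = c \<odot>\<^bsub>Y\<^esub> f x) \<and>
    (\<forall>g\<in>carrier (b_grp B). \<forall>x\<in>carrier X. f (gact X g x) = gact Y g (f x)) \<and>
    (\<forall>\<xi>\<in>carrier (loc X (b_mu B)).
      loc_map id (b_frob B (b_mu B)) Y (b_frob B (b_mu B)) f (frb X \<xi>) =
      frb Y (loc_map id (b_mu B) Y (b_mu B) f \<xi>))}"

definition wach_unit :: "('r::comm_ring_1, 'g) wach_base \<Rightarrow> ('r, ('r, 'b) univ, 'g) wach" where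
  "wach_unit B =
    (let U = scalar_module (b_scal B) in
      module.extend U (wach.fields
        (\<lambda>g x. Scalar (b_act B g (the_scalar x)))
        (loc_map (b_frob B) (b_mu B) U (b_frob B (b_mu B)) (\<lambda>x. Scalar (b_frob B (the_scalar x))))))"

definition wach_tens ::
  "('r::comm_ring_1, 'g) wach_base \<Rightarrow> ('r, ('r, 'b) univ, 'g) wach \<Rightarrow> ('r, ('r, 'b) univ, 'g) wach \<Rightarrow>
    ('r, ('r, 'b) univ, 'g) wach" where
  "wach_tens B X Y =
    (let R = b_scal B; \<mu> = b_mu B; \<mu>' = b_frob B \<mu>; T = tens R X Y in
      module.extend T (wach.fields
        (\<lambda>g. tmap R X Y (gact X g) (gact Y g))
        (loc_ext (b_frob B) \<mu> (loc T \<mu>')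
          (tlift (loc T \<mu>') (\<lambda>x y. loc_pure R X Y \<mu>' (frb X (lfrac X \<mu> x 0)) (frb Y (lfrac Y \<mu> y 0)))))))"

type_synonym ('r, 'b, 'g) wach_ob = "('r, ('r, 'b) univ, 'g) wach"

type_synonym ('r, 'b, 'g) wach_ar =
  "('r, 'b, 'g) wach_ob \<times> (('r, 'b) univ \<Rightarrow> ('r, 'b) univ) \<times> ('r, 'b, 'g) wach_ob"

definition wach_cat ::
  "('r::comm_ring_1, 'g) wach_base \<Rightarrow> (('r, 'b, 'g) wach_ob, ('r, 'b, 'g) wach_ar) tcat" where
  "wach_cat B =
    (let R = b_scal B; T = wach_tens B; I = wach_unit B in
    \<lparr>Obj = {X. wach_module B X},
     Arr = {(X, f, Y). wach_module B X \<and> wach_module B Y \<and> f \<in> wach_hom B X Y},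
     Dom = (\<lambda>(X, f, Y). X),
     Cod = (\<lambda>(X, f, Y). Y),
     Idn = (\<lambda>X. (X, restrict id (carrier X), X)),
     Cmp = (\<lambda>(Y, g, Z) (X, f, Y'). (X, compose (carrier X) g f, Z)),
     tob = T,
     tar = (\<lambda>(X, f, X') (Y, g, Y').
       (T X Y, restrict (tmap R X' Y' f g) (carrier (T X Y)), T X' Y')),
     tun = I,
     asc = (\<lambda>X Y Z.
       (T (T X Y) Z,
        restrict (tlift (T X (T Y Z)) (\<lambda>u z. tlift (T X (T Y Z))
          (\<lambda>x y. ptens R X (T Y Z) x (ptens R Y Z y z)) u)) (carrier (T (T X Y) Z)),
        T X (T Y Z))),
     lun = (\<lambda>X. (T I X, restrict (tlift X (\<lambda>c x. the_scalar c \<odot>\<^bsub>X\<^esub> x)) (carrier (T I X)), X)),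
     run = (\<lambda>X. (T X I, restrict (tlift X (\<lambda>x c. the_scalar c \<odot>\<^bsub>X\<^esub> x)) (carrier (T X I)), X)),
     brd = (\<lambda>X Y.
       (T X Y, restrict (tlift (T Y X) (\<lambda>x y. ptens R Y X y x)) (carrier (T X Y)), T Y X))\<rparr>)"

definition short_exact ::
  "('r, 'b, 'g) wach_ar \<Rightarrow> ('r, 'b, 'g) wach_ar \<Rightarrow> bool" where
  "short_exact = (\<lambda>(X, f, Y) (Y', g, Z). Y' = Y \<and>
     inj_on f (carrier X) \<and>
     f ` carrier X = {y \<in> carrier Y. g y = \<zero>\<^bsub>Z\<^esub>} \<and>
     g ` carrier Y = carrier Z)"

definition preserves_short_exact ::
  "('r::comm_ring_1, 'g) wach_base \<Rightarrow>
    (('r, 'b, 'g) wach_ob, ('r, 'b, 'g) wach_ar, ('r, 'b, 'g) wach_ob, ('r, 'b, 'g) wach_ar) func \<Rightarrow> bool" where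
  "preserves_short_exact B F \<longleftrightarrow>
    (\<forall>f\<in>Arr (wach_cat B). \<forall>g\<in>Arr (wach_cat B).
      short_exact f g \<longrightarrow> short_exact (far F f) (far F g))"

text \<open>Base change from \<open>B\<close> to \<open>B'\<close>, where \<open>pr\<close> maps the group of \<open>B'\<close> to that of \<open>B\<close>: \<open>g\<close> acts by
  \<open>a \<otimes> x \<mapsto> g(a) \<otimes> pr(g)(x)\<close> and Frobenius by \<open>a \<otimes> x \<mapsto> \<phi>(a) \<otimes> \<phi>(x)\<close>.\<close>

definition base_change_ob ::
  "('r::comm_ring_1, 'g) wach_base \<Rightarrow> ('r, 'g) wach_base \<Rightarrow> ('g \<Rightarrow> 'g) \<Rightarrow>
    ('r, 'b, 'g) wach_ob \<Rightarrow> ('r, 'b, 'g) wach_ob" where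
  "base_change_ob B B' pr X =
    (let R = b_scal B; A = scalar_module (b_scal B'); T = tens R A X;
         \<mu> = b_mu B'; \<mu>' = b_frob B' \<mu>; \<nu> = b_mu B; \<nu>' = b_frob B \<nu>; Q = loc T \<mu>' in
      module.extend T (wach.fields
        (\<lambda>g. tmap R A X (\<lambda>a. Scalar (b_act B' g (the_scalar a))) (gact X (pr g)))
        (loc_ext (b_frob B') \<mu> Q
          (tlift Q (\<lambda>a x. b_frob B' (the_scalar a) \<odot>\<^bsub>Q\<^esub>
            loc_map id \<nu>' T \<mu>' (ptens R A X (Scalar 1)) (frb X (lfrac X \<nu> x 0)))))))"

definition base_change ::
  "('r::comm_ring_1, 'g) wach_base \<Rightarrow> ('r, 'g) wach_base \<Rightarrow> ('g \<Rightarrow> 'g) \<Rightarrow>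
    (('r, 'b, 'g) wach_ob, ('r, 'b, 'g) wach_ar, ('r, 'b, 'g) wach_ob, ('r, 'b, 'g) wach_ar) func" where
  "base_change B B' pr =
    (let F = base_change_ob B B' pr in
    \<lparr>fob = F,
     far = (\<lambda>(X, f, Y).
       (F X, restrict (tmap (b_scal B) (scalar_module (b_scal B')) Y id f) (carrier (F X)), F Y))\<rparr>)"

text \<open>The invariants \<open>M\<close> of \<open>N\<close> under \<open>H\<close>; Frobenius is the restriction of that of \<open>N\<close>
  along the maps from \<open>M[1/\<mu>\<^sub>0]\<close> to \<open>N[1/\<mu>]\<close> and from \<open>M[1/\<phi>(\<mu>\<^sub>0)]\<close> to
  \<open>N[1/\<phi>(\<mu>)]\<close> induced by the inclusion of \<open>M\<close> in \<open>N\<close>.\<close>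

definition invariants_ob ::
  "('r::comm_ring_1, 'g) wach_base \<Rightarrow> ('r, 'g) wach_base \<Rightarrow> 'g set \<Rightarrow>
    ('r, 'b, 'g) wach_ob \<Rightarrow> ('r, 'b, 'g) wach_ob" where
  "invariants_ob B B' H N =
    (let M = N\<lparr>carrier := {x \<in> carrier N. \<forall>h\<in>H. gact N h x = x}\<rparr>;
         \<mu> = b_mu B'; \<mu>' = b_frob B' \<mu>; \<nu> = b_mu B; \<nu>' = b_frob B \<nu> in
      M\<lparr>frb := (\<lambda>\<xi>. THE \<upsilon>. \<upsilon> \<in> carrier (loc M \<nu>') \<and>
        loc_map id \<nu>' N \<mu>' id \<upsilon> = frb N (loc_map id \<nu> N \<mu> id \<xi>))\<rparr>)"

definition invariants ::
  "('r::comm_ring_1, 'g) wach_base \<Rightarrow> ('r, 'g) wach_base \<Rightarrow> 'g set \<Rightarrow>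
    (('r, 'b, 'g) wach_ob, ('r, 'b, 'g) wach_ar, ('r, 'b, 'g) wach_ob, ('r, 'b, 'g) wach_ar) func" where
  "invariants B B' H =
    (let G = invariants_ob B B' H in
    \<lparr>fob = G, far = (\<lambda>(X, f, Y). (G X, restrict f (carrier (G X)), G Y))\<rparr>)"


section \<open>Witt vectors, cyclotomic power series rings\<close>

text \<open>\<open>\<pi>\<close> exhibits the type \<open>'a\<close> as the ring of Witt vectors of the perfect field \<open>'k\<close>, i.e. as the
  strict \<open>p\<close>-ring with residue field \<open>'k\<close>, which is unique up to unique isomorphism. \<open>\<sigma>\<close> is its Frobenius, the only ring
  endomorphism lifting the \<open>p\<close>-th power map of \<open>'k\<close>.\<close>

definition unital_hom :: "('a::comm_ring_1 \<Rightarrow> 'b::comm_ring_1) \<Rightarrow> bool" where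
  "unital_hom f \<longleftrightarrow> f 1 = 1 \<and> (\<forall>x y. f (x + y) = f x + f y) \<and> (\<forall>x y. f (x * y) = f x * f y)"

definition witt_ring :: "nat \<Rightarrow> ('a::idom \<Rightarrow> 'k::field) \<Rightarrow> bool" where
  "witt_ring p \<pi> \<longleftrightarrow>
    unital_hom \<pi> \<and> surj \<pi> \<and> (\<forall>x. \<pi> x = 0 \<longleftrightarrow> of_nat p dvd x) \<and>
    (\<forall>x::'a. of_nat p * x = 0 \<longrightarrow> x = 0) \<and>
    (\<forall>x::'a. (\<forall>n. of_nat p ^ n dvd x) \<longrightarrow> x = 0) \<and>
    (\<forall>s::nat \<Rightarrow> 'a. (\<forall>n. of_nat p ^ n dvd s (Suc n) - s n) \<longrightarrow>
      (\<exists>x. \<forall>n. of_nat p ^ n dvd x - s n))"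

definition witt_frobenius ::
  "nat \<Rightarrow> ('a::idom \<Rightarrow> 'k::field) \<Rightarrow> ('a \<Rightarrow> 'a) \<Rightarrow> bool" where
  "witt_frobenius p \<pi> \<sigma> \<longleftrightarrow> unital_hom \<sigma> \<and> (\<forall>x. \<pi> (\<sigma> x) = \<pi> x ^ p)"

text \<open>The \<open>p\<close>-adic integers, as the closure of the natural numbers in the Witt vectors.\<close>

definition Zp :: "nat \<Rightarrow> 'a::comm_ring_1 set" where
  "Zp p = {x. \<forall>n. \<exists>k::nat. of_nat p ^ n dvd x - of_nat k}"

definition Zp_units :: "nat \<Rightarrow> 'a::comm_ring_1 monoid" where
  "Zp_units p = \<lparr>carrier = {x \<in> Zp p. \<exists>y\<in>Zp p. x * y = 1}, mult = (*), one = 1\<rparr>"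

definition teich :: "nat \<Rightarrow> nat \<Rightarrow> 'a::comm_ring_1" where
  "teich p a = (THE x. x \<in> Zp p \<and> x ^ p = x \<and> of_nat p dvd x - of_nat a)"

text \<open>\<open>q\<^sup>x = (1 + \<mu>)\<^sup>x\<close> for a \<open>p\<close>-adic integer \<open>x\<close>, given by its
  binomial coefficients.\<close>

definition qpow :: "'a::idom \<Rightarrow> 'a fps" where
  "qpow x = Abs_fps (\<lambda>n. THE c. of_nat (fact n) * c = (\<Prod>i<n. x - of_nat i))"

definition A_frob :: "nat \<Rightarrow> ('a::idom \<Rightarrow> 'a) \<Rightarrow> 'a fps \<Rightarrow> 'a fps" where
  "A_frob p \<sigma> f = Abs_fps (\<lambda>n. \<sigma> (fps_nth f n)) oo ((1 + fps_X) ^ p - 1)"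

definition A_act :: "('g \<Rightarrow> 'a::idom) \<Rightarrow> 'g \<Rightarrow> 'a fps \<Rightarrow> 'a fps" where
  "A_act \<chi> g f = f oo (qpow (\<chi> g) - 1)"

definition q_p :: "nat \<Rightarrow> 'a::idom fps" where
  "q_p p = (\<Sum>i<p. (1 + fps_X) ^ i)"

definition mu0 :: "nat \<Rightarrow> 'a::idom fps" where
  "mu0 p = (\<Sum>a\<in>{1..<p}. qpow (teich p a) - 1)"

definition S_ring :: "nat \<Rightarrow> 'a::idom fps set" where
  "S_ring p = range (\<lambda>f. f oo mu0 p)"

definition Gamma_top ::
  "nat \<Rightarrow> 'g monoid \<Rightarrow> ('g \<Rightarrow> 'a::idom) \<Rightarrow> 'g topology" where
  "Gamma_top p \<Gamma> \<chi> = topology_generated_by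
     {{h \<in> carrier \<Gamma>. of_nat p ^ n dvd \<chi> h - \<chi> g} | g n. g \<in> carrier \<Gamma>}"

definition Gamma_0 :: "nat \<Rightarrow> 'g monoid \<Rightarrow> ('g \<Rightarrow> 'a::idom) \<Rightarrow> 'g set" where
  "Gamma_0 p \<Gamma> \<chi> = {g \<in> carrier \<Gamma>. \<exists>z\<in>Zp p. \<chi> g = 1 + of_nat p * z}"

definition Gamma_tor :: "nat \<Rightarrow> 'g monoid \<Rightarrow> ('g \<Rightarrow> 'a::idom) \<Rightarrow> 'g set" where
  "Gamma_tor p \<Gamma> \<chi> = {g \<in> carrier \<Gamma>. \<exists>a\<in>{1..<p}. \<chi> g = teich p a}"

text \<open>The projection of \<open>\<Gamma> = \<Gamma>\<^sub>0 \<times> \<Gamma>\<^sub>t\<^sub>o\<^sub>r\<close> to its first factor.\<close>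

definition Gamma_pr ::
  "nat \<Rightarrow> 'g monoid \<Rightarrow> ('g \<Rightarrow> 'a::idom) \<Rightarrow> 'g \<Rightarrow> 'g" where
  "Gamma_pr p \<Gamma> \<chi> g = (THE h. h \<in> Gamma_0 p \<Gamma> \<chi> \<and> (\<exists>t\<in>Gamma_tor p \<Gamma> \<chi>. g = h \<otimes>\<^bsub>\<Gamma>\<^esub> t))"

definition wach_base_A ::
  "nat \<Rightarrow> ('a::idom \<Rightarrow> 'a) \<Rightarrow> 'g monoid \<Rightarrow> ('g \<Rightarrow> 'a) \<Rightarrow> ('a fps, 'g) wach_base" where
  "wach_base_A p \<sigma> \<Gamma> \<chi> =
    \<lparr>b_prime = p, b_scal = UNIV, b_frob = A_frob p \<sigma>, b_grp = \<Gamma>, b_top = Gamma_top p \<Gamma> \<chi>,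
     b_act = A_act \<chi>, b_mu = fps_X, b_xi = q_p p\<rparr>"

definition wach_base_S ::
  "nat \<Rightarrow> ('a::idom \<Rightarrow> 'a) \<Rightarrow> 'g monoid \<Rightarrow> ('g \<Rightarrow> 'a) \<Rightarrow> ('a fps, 'g) wach_base" where
  "wach_base_S p \<sigma> \<Gamma> \<chi> =
    \<lparr>b_prime = p, b_scal = S_ring p, b_frob = A_frob p \<sigma>, b_grp = \<Gamma>\<lparr>carrier := Gamma_0 p \<Gamma> \<chi>\<rparr>,
     b_top = subtopology (Gamma_top p \<Gamma> \<chi>) (Gamma_0 p \<Gamma> \<chi>),
     b_act = A_act \<chi>, b_mu = mu0 p, b_xi = mu0 p + of_nat p\<rparr>"

end

theory Submission
  imports Defs
begin

text \<open>Put \<open>w = \<phi>(\<mu>)/\<mu>\<close>. The Frobenius of a Wach module \<open>N\<close> is \<open>w\<^sup>-\<^sup>k\<Phi>\<close> for a semilinear endomorphism \<open>\<Phi>\<close> of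
  \<open>N\<close> itself, so that every condition on modules and morphisms can be tested on generators.
  Averaging over \<open>\<Gamma>\<^sub>t\<^sub>o\<^sub>r\<close>, whose order \<open>p - 1\<close> is invertible, moves the elements of a basis of \<open>N\<close> only modulo \<open>\<mu>\<close>, because
  \<open>\<Gamma>\<close> acts trivially on \<open>N/\<mu>N\<close>; since power series are complete, the averages are again a
  basis. So \<open>N\<close> has a basis of invariants, the invariants are free over \<open>S\<close>, and \<open>a \<otimes> x \<mapsto> ax\<close> is an isomorphism
  from the base change of the invariants to \<open>N\<close>. The conditions on Frobenius correspond because \<open>\<mu>\<^sub>0\<close> is \<open>\<mu>\<^sup>p\<^sup>-\<^sup>1\<close>
  times a unit and \<open>\<mu>\<^sub>0 + p\<close> is \<open>[p]\<^sub>q\<close> times a unit. Base change is exact because extensions of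
  free modules split, and taking invariants is exact by averaging.\<close>

text \<open>The two unit statements rest on leading terms. If an invariant series starts with c
  mu^m, a root of unity x in Z_p multiplies c by x^m, so p - 1 divides m; and the coefficient of
  mu^(p-1) in mu_0 is 1 modulo p. Hence mu_0 = mu^(p-1) u, an invariant multiple of mu is a multiple
  of mu_0, and the invariants are exactly S. For the other unit, [a] - a is divisible by p, so q^[a]
  and q^a agree modulo mu [p]_q. The quotients phi(mu_0)/mu_0 and (phi(mu)/mu)^(p-1) differ by a
  unit v. So a Frobenius exponent k over S corresponds to (p-1)k over A_F^+, units v^k appear in
  every passage, and exponents over A_F^+ are first raised to multiples of p - 1. Continuity does
  not descend formally: the (p, mu_0)-adic filtration of S has to be compared with the (p, mu)-adic
  one. This is done by reading the mu_0-expansion off the coefficients in degrees (p-1)j. Most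
  structural isomorphisms are recognised by matching bases, and equal morphisms by their values on
  generating pure tensors.\<close>

abbreviation (input) elt (infix ":>" 50) where "x :> M \<equiv> x \<in> carrier M"
abbreviation (input) smult_in ("_ *[_] _" [70, 0, 71] 70) where "c *[M] x \<equiv> smult M c x"
abbreviation (input) add_in ("_ +[_] _" [65, 0, 66] 65) where "x +[M] y \<equiv> add M x y"
abbreviation (input) minus_in ("_ -[_] _" [65, 0, 66] 65) where "x -[M] y \<equiv> a_minus M x y"
abbreviation (input) zero_in ("0[_]") where "0[M] \<equiv> zero M"
abbreviation (input) comp_in ("_ \<bullet>[_] _" [56, 0, 55] 55) where "g \<bullet>[C] f \<equiv> Cmp C g f"

type_synonym ('a, 'b, 'g) fob = "('a fps, 'b, 'g) wach_ob"
type_synonym ('a, 'b, 'g) far = "('a fps, 'b, 'g) wach_ar"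
type_synonym ('a, 'b, 'g) fcat = "(('a, 'b, 'g) fob, ('a, 'b, 'g) far) tcat"
type_synonym ('a, 'b, 'g) ftfunc = "(('a, 'b, 'g) fob, ('a, 'b, 'g) far, ('a, 'b, 'g) fob, ('a, 'b, 'g) far) tfunc"
type_synonym ('a, 'b, 'g) ffunc = "(('a, 'b, 'g) fob, ('a, 'b, 'g) far, ('a, 'b, 'g) fob, ('a, 'b, 'g) far) func"

section \<open>Modules over subrings\<close>

text \<open>S and A_F^+ live in the same type of power series, so base rings are subsets and scalars
  of S act on A_F^+-modules without an embedding. Only closure properties are recorded, because the
  ring laws are those of the type.\<close>

locale sring =
  fixes R :: "'r::comm_ring_1 set"
  assumes one_R [simp, intro]: "1 \<in> R"
    and add_R [simp, intro]: "[|a \<in> R; b \<in> R|] ==> a + b \<in> R"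
    and mult_R [simp, intro]: "[|a \<in> R; b \<in> R|] ==> a * b \<in> R"
    and uminus_R [simp, intro]: "a \<in> R ==> - a \<in> R"
begin

lemma zero_R [simp, intro]: "0 \<in> R" using add_R[OF one_R uminus_R[OF one_R]] by simp

lemma diff_R [simp, intro]: "[|a \<in> R; b \<in> R|] ==> a - b \<in> R" using add_R[of a "- b"] by simp

lemma power_R [simp, intro]: "a \<in> R ==> a ^ n \<in> R" by (induction n) auto

lemma sum_R: "(!!i. i \<in> I ==> f i \<in> R) ==> sum f I \<in> R" by (induction I rule: infinite_finite_induct) auto

lemma of_nat_R [simp, intro]: "of_nat n \<in> R" by (induction n) auto

lemma cring_ring_on: "cring (ring_on R)" by (rule cringI; (intro abelian_groupI comm_monoidI)?)
    (auto simp: ring_on_def algebra_simps intro: bexI[where x = "- x" for x])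

end

lemma sring_UNIV: "sring UNIV" by unfold_locales auto

text \<open>The module predicate only knows \<open>cring (ring_on R)\<close>, whose inverse is an
  abstract operation on \<open>R\<close>. Uniqueness of negatives identifies it with the minus of
  the type.\<close>

lemma sring_of_cring: assumes "cring (ring_on R)" shows "sring R"
proof -
  interpret cring "ring_on R" by fact
  show ?thesis
  proof
    show "- a \<in> R" if a: "a \<in> R" for a
    proof -
      obtain y where "y \<in> R" "y + a = 0" using a a_inv_closed[of a] l_neg[of a] unfolding ring_on_def by auto
      moreover from this have "- a = y" by (simp add: add_eq_0_iff)
      ultimately show ?thesis by simp
    qed
  qed (use one_closed a_closed m_closed in \<open>auto simp: ring_on_def\<close>)
qed

locale rmod =
  fixes R :: "'r::comm_ring_1 set" and M :: "('r, 'u, 'x) module_scheme" (structure)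
  assumes is_module: "Module.module (ring_on R) M"
begin

lemma is_sring: "sring R" using is_module by (auto intro: sring_of_cring simp: Module.module_def)

sublocale sring R by (rule is_sring)

lemma is_abgroup: "abelian_group M" using is_module by (auto simp: Module.module_def)

sublocale abelian_group M by (rule is_abgroup)

lemma smult_closed [simp, intro]: "[|c \<in> R; x \<in> carrier M|] ==> c \<odot> x :> M"
  using module.smult_closed[OF is_module] by (simp add: ring_on_def)

lemma smult_l_distr: "[|a \<in> R; b \<in> R; x \<in> carrier M|] ==> (a + b) \<odot> x = a \<odot> x \<oplus> b \<odot> x"
  using module.smult_l_distr[OF is_module] by (simp add: ring_on_def)

lemma smult_r_distr: "[|a \<in> R; x :> M; y \<in> carrier M|] ==> a \<odot> (x \<oplus> y) = a \<odot> x \<oplus> a \<odot> y"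
  using module.smult_r_distr[OF is_module] by (simp add: ring_on_def)

lemma smult_smult: "[|a \<in> R; b \<in> R; x \<in> carrier M|] ==> a \<odot> (b \<odot> x) = (a * b) \<odot> x"
  using module.smult_assoc1[OF is_module] by (simp add: ring_on_def)

lemma smult_one [simp]: "x :> M ==> 1 \<odot> x = x" using module.smult_one[OF is_module] by (simp add: ring_on_def)

lemma smult_l_null [simp]: "x :> M ==> 0 \<odot> x = \<zero>"
  using module.smult_l_null[OF is_module] by (simp add: ring_on_def)

lemma smult_r_null [simp]: "c \<in> R ==> c \<odot> \<zero> = \<zero>"
  using module.smult_r_null[OF is_module] by (simp add: ring_on_def)

lemma smult_l_minus: "[|c \<in> R; x \<in> carrier M|] ==> (- c) \<odot> x = \<ominus> (c \<odot> x)"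
  by (rule minus_equality[symmetric]) (auto simp: smult_l_distr[symmetric])

lemma smult_r_minus: "[|c \<in> R; x \<in> carrier M|] ==> c \<odot> (\<ominus> x) = \<ominus> (c \<odot> x)"
  by (rule minus_equality[symmetric]) (auto simp: smult_r_distr[symmetric] l_neg)

lemma minus_eq_smult: "x :> M ==> \<ominus> x = (- 1) \<odot> x" by (simp add: smult_l_minus)

lemma smult_diff: "[|c \<in> R; x :> M; y \<in> carrier M|] ==> c \<odot> (x \<ominus> y) = c \<odot> x \<ominus> c \<odot> y"
  by (simp add: minus_eq smult_r_distr smult_r_minus)

lemma diff_smult: "[|a \<in> R; b \<in> R; x \<in> carrier M|] ==> (a - b) \<odot> x = a \<odot> x \<ominus> b \<odot> x"
  using smult_l_distr[of a "- b" x] by (simp add: minus_eq smult_l_minus)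

lemma diff_closed [simp, intro]: "[|x :> M; y \<in> carrier M|] ==> x \<ominus> y :> M" by (simp add: minus_eq)

lemma diff_add_cancel: "[|x :> M; y \<in> carrier M|] ==> (x \<ominus> y) \<oplus> y = x"
  by (simp add: minus_eq a_assoc l_neg)

lemma diff_zero_iff: "[|x :> M; y \<in> carrier M|] ==> x \<ominus> y = \<zero> \<longleftrightarrow> x = y"
  using diff_add_cancel[of x y] by (auto simp: minus_eq r_neg)

lemma add_diff_cancel: "[|x :> M; y \<in> carrier M|] ==> y \<oplus> (x \<ominus> y) = x"
  using diff_add_cancel[of x y] by (simp add: a_comm)

lemma diff_trans: "[|x :> M; y :> M; z \<in> carrier M|] ==> (x \<ominus> y) \<oplus> (y \<ominus> z) = x \<ominus> z"
  by (metis a_assoc diff_add_cancel diff_closed minus_eq a_inv_closed)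

lemma diff_add_add:
  "[|x :> M; y :> M; x' :> M; y' \<in> carrier M|] ==>
    (x \<oplus> y) \<ominus> (x' \<oplus> y') = (x \<ominus> x') \<oplus> (y \<ominus> y')"
  by (simp add: minus_eq minus_add a_ac)

lemma smult_finsum: assumes "c \<in> R" "f \<in> I \<rightarrow> carrier M"
  shows "c \<odot> finsum M f I = finsum M (%i. c \<odot> f i) I" using assms(2)
proof (induction I rule: infinite_finite_induct)
  case (insert i I)
  then have "f i :> M" "f \<in> I \<rightarrow> carrier M" by auto
  with insert assms show ?case by (auto simp: smult_r_distr Pi_def)
qed (use assms in auto)

lemma sum_smult: assumes "x :> M" "!!i. i \<in> I ==> f i \<in> R"
  shows "sum f I \<odot> x = finsum M (%i. f i \<odot> x) I" using assms(2)
proof (induction I rule: infinite_finite_induct)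
  case (insert i I)
  then show ?case using assms(1) by (auto simp: smult_l_distr sum_R Pi_def)
qed (use assms in auto)

text \<open>Wach modules, tensor products, base changes and invariants are records with different
  extra fields; the module axioms depend on these four only.\<close>

lemma cong_fields:
  assumes "carrier N = carrier M" "add N = add M" "zero N = zero M" "smult N = smult M"
  shows "rmod R N"
proof (intro rmod.intro moduleI cring_ring_on)
  show "abelian_group N" by (rule abelian_groupI) (auto simp: assms a_ac intro!: bexI[where x = "\<ominus> x" for x] l_neg)
qed (auto simp: assms ring_on_def smult_l_distr smult_r_distr smult_smult)

end

lemma rmodI: assumes "sring R" "abelian_group M"
    and "!!c x. [|c \<in> R; x \<in> carrier M|] ==> c *[M] x :> M"
    and "!!a b x. [|a \<in> R; b \<in> R; x \<in> carrier M|] ==> (a + b) *[M] x = a *[M] x +[M] b *[M] x"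
    and "!!a x y. [|a \<in> R; x :> M; y \<in> carrier M|] ==> a *[M] (x +[M] y) = a *[M] x +[M] a *[M] y"
    and "!!a b x. [|a \<in> R; b \<in> R; x \<in> carrier M|] ==> a *[M] (b *[M] x) = (a * b) *[M] x"
    and "!!x. x :> M ==> 1 *[M] x = x" shows "rmod R M"
  by (intro rmod.intro moduleI sring.cring_ring_on assms(1,2)) (auto simp: ring_on_def assms(3-))

text \<open>Group actions and Frobenius are semilinear along different ring maps. Their common
  additive part is isolated here, and the behaviour on scalars is stated separately each time, so
  one set of lemmas on zero, differences and sums serves all of them.\<close>

definition addhom where
  "addhom X Y f \<longleftrightarrow> f \<in> carrier X \<rightarrow> carrier Y \<and>
    (\<forall>x\<in>carrier X. \<forall>y\<in>carrier X. f (x +[X] y) = f x +[Y] f y)"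

lemma addhomI: assumes "!!x. x :> X ==> f x :> Y"
    and "!!x y. [|x :> X; y \<in> carrier X|] ==> f (x +[X] y) = f x +[Y] f y" shows "addhom X Y f"
  using assms by (auto simp: addhom_def)

lemma addhom_closed: "addhom X Y f ==> x :> X ==> f x :> Y" by (auto simp: addhom_def)

lemma addhom_add:
  "addhom X Y f ==> x :> X ==> y :> X ==> f (x +[X] y) = f x +[Y] f y" by (auto simp: addhom_def)

lemma addhom_zero: assumes "abelian_group X" "abelian_group Y" "addhom X Y f" shows "f 0[X] = 0[Y]"
proof -
  interpret X: abelian_group X by fact
  interpret Y: abelian_group Y by fact
  have "f 0[X] +[Y] f 0[X] = f 0[X]" using addhom_add[OF assms(3), of "0[X]" "0[X]"] by simp
  then show ?thesis using addhom_closed[OF assms(3), of "0[X]"] by (simp add: Y.add.r_cancel_one)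
qed

lemma addhom_uminus: assumes "abelian_group X" "abelian_group Y" "addhom X Y f" "x :> X"
  shows "f (\<ominus>\<^bsub>X\<^esub> x) = \<ominus>\<^bsub>Y\<^esub> (f x)"
proof -
  interpret X: abelian_group X by fact
  interpret Y: abelian_group Y by fact
  have "f (\<ominus>\<^bsub>X\<^esub> x) +[Y] f x = 0[Y]"
    using addhom_add[OF assms(3), of "\<ominus>\<^bsub>X\<^esub> x" x] assms addhom_zero[OF assms(1-3)]
    by (simp add: X.l_neg)
  then show ?thesis using addhom_closed[OF assms(3)] assms(4) by (metis X.a_inv_closed Y.minus_equality)
qed

lemma addhom_diff: assumes "abelian_group X" "abelian_group Y" "addhom X Y f" "x :> X" "y :> X"
  shows "f (x -[X] y) = f x -[Y] f y"
proof -
  interpret X: abelian_group X by fact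
  interpret Y: abelian_group Y by fact
  show ?thesis using assms addhom_add[OF assms(3), of x "\<ominus>\<^bsub>X\<^esub> y"] addhom_uminus[OF assms(1-3), of y]
    by (simp add: X.minus_eq Y.minus_eq)
qed

lemma addhom_finsum:
  assumes "abelian_group X" "abelian_group Y" "addhom X Y f" "h \<in> I \<rightarrow> carrier X" "finite I"
  shows "f (finsum X h I) = finsum Y (%i. f (h i)) I"
proof -
  interpret X: abelian_group X by fact
  interpret Y: abelian_group Y by fact
  show ?thesis using assms(5,4)
  proof (induction I)
    case empty
    then show ?case using addhom_zero[OF assms(1-3)] by simp
  next
    case (insert i I)
    then have "h \<in> I \<rightarrow> carrier X" "h i :> X" by auto
    with insert show ?case using addhom_add[OF assms(3), of "h i" "finsum X h I"] addhom_closed[OF assms(3)]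
      by (subst X.finsum_insert Y.finsum_insert; auto simp: Pi_def)+
  qed
qed

lemma addhom_restrict: 
  "abelian_group X ==> addhom X Y (restrict f (carrier X)) \<longleftrightarrow> addhom X Y f"
  using abelian_groupE(1)[of X] by (auto simp: addhom_def Pi_def)

lemma span_on_incl: "x \<in> X ==> x \<in> span_on R M X" by (auto simp: span_on_def)

context rmod
begin

lemma submoduleI':
  assumes "H \<subseteq> carrier M" "\<zero> \<in> H" "!!a b. [|a \<in> H; b \<in> H|] ==> a \<oplus> b \<in> H"
    and "!!c x. [|c \<in> R; x \<in> H|] ==> c \<odot> x \<in> H" shows "submodule H (ring_on R) M"
proof (rule module.submoduleI[OF is_module])
  show "\<ominus> a \<in> H" if "a \<in> H" for a using assms(4)[of "-1" a] that assms(1) by (auto simp: minus_eq_smult)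
qed (use assms in \<open>auto simp: ring_on_def\<close>)

lemma submodule_closed: assumes "submodule H (ring_on R) M"
  shows "H \<subseteq> carrier M" "\<zero> \<in> H" "[|a \<in> H; b \<in> H|] ==> a \<oplus> b \<in> H" "[|c \<in> R; a \<in> H|] ==> c \<odot> a \<in> H"
proof -
  interpret H: submodule H "ring_on R" M by fact
  show "H \<subseteq> carrier M" "\<zero> \<in> H" "[|a \<in> H; b \<in> H|] ==> a \<oplus> b \<in> H" "[|c \<in> R; a \<in> H|] ==> c \<odot> a \<in> H"
    using H.subset H.one_closed H.m_closed H.smult_closed by (auto simp: ring_on_def)
qed

lemma span_submodule: assumes "X \<subseteq> carrier M"
  shows "submodule (span_on R M X) (ring_on R) M"
proof (rule submoduleI')
  show "span_on R M X \<subseteq> carrier M"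
    using module.carrier_is_submodule[OF is_module] assms by (auto simp: span_on_def)
qed (auto simp: span_on_def submodule_closed)

lemmas span_closed = submodule_closed[OF span_submodule]

lemma span_induct [consumes 2, case_names base zero add smult]:
  assumes x: "x \<in> span_on R M X" and X: "X \<subseteq> carrier M"
    and "!!x. x \<in> X ==> Q x" "Q \<zero>"
    and "!!x y. [|x \<in> span_on R M X; y \<in> span_on R M X; Q x; Q y|] ==> Q (x \<oplus> y)"
    and "!!c x. [|c \<in> R; x \<in> span_on R M X; Q x|] ==> Q (c \<odot> x)" shows "Q x"
proof -
  have "submodule {x \<in> span_on R M X. Q x} (ring_on R) M" using span_closed[OF X] assms(3-) by (intro submoduleI') auto
  then have "span_on R M X \<subseteq> {x \<in> span_on R M X. Q x}"
    using assms(3) span_on_incl[of _ X R M] by (subst span_on_def) blast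
  with x show ?thesis by auto
qed

end

section \<open>Torsion-freeness and bases with coordinate functionals\<close>

definition tfree where
  "tfree R M \<longleftrightarrow> (\<forall>c\<in>R. \<forall>x\<in>carrier M. c \<noteq> 0 \<longrightarrow> c *[M] x = 0[M] \<longrightarrow> x = 0[M])"

lemma (in rmod) tfree_cancel: assumes "tfree R M" "c \<in> R" "c \<noteq> 0" "x :> M" "y :> M"
  shows "c \<odot> x = c \<odot> y \<longleftrightarrow> x = y"
proof
  assume "c \<odot> x = c \<odot> y"
  then have "c \<odot> (x \<ominus> y) = \<zero>" using assms by (simp add: smult_diff diff_zero_iff)
  then have "x \<ominus> y = \<zero>" using assms by (auto simp: tfree_def)
  then show "x = y" using assms by (simp add: diff_zero_iff)
qed auto

text \<open>A finite basis together with its dual basis \<open>k\<close>. Carrying the coordinate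
  functionals makes passage to tensor products and invariants a matter of formulas rather than of
  unique existence, and an indexed family allows product index sets.\<close>

definition dbasis where
  "dbasis R M I e k \<longleftrightarrow> finite I \<and> (\<forall>i\<in>I. e i :> M) \<and>
    (\<forall>i\<in>I. \<forall>x\<in>carrier M. k i x \<in> R) \<and>
    (\<forall>i\<in>I. \<forall>x\<in>carrier M. \<forall>y\<in>carrier M. k i (x +[M] y) = k i x + k i y) \<and>
    (\<forall>i\<in>I. \<forall>c\<in>R. \<forall>x\<in>carrier M. k i (c *[M] x) = c * k i x) \<and>
    (\<forall>i\<in>I. \<forall>j\<in>I. k i (e j) = (if i = j then 1 else 0)) \<and>
    (\<forall>x\<in>carrier M. x = finsum M (%i. k i x *[M] e i) I)"

lemma dbasisD: assumes "dbasis R M I e k" shows "finite I" "i \<in> I ==> e i :> M"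
    and "[|i \<in> I; x \<in> carrier M|] ==> k i x \<in> R"
    and "[|i \<in> I; x :> M; y \<in> carrier M|] ==> k i (x +[M] y) = k i x + k i y"
    and "[|i \<in> I; c \<in> R; x \<in> carrier M|] ==> k i (c *[M] x) = c * k i x"
    and "[|i \<in> I; j \<in> I|] ==> k i (e j) = (if i = j then 1 else 0)"
    and "x :> M ==> finsum M (%i. k i x *[M] e i) I = x" using assms by (auto simp: dbasis_def)

lemma dbasis_cong:
  assumes "dbasis R M I e k" "carrier N = carrier M" "add N = add M" "zero N = zero M" "smult N = smult M"
  shows "dbasis R N I e k"
proof -
  have "finsum N = (finsum M :: ('d => _) => _)" by (simp add: finsum_def finprod_def fun_eq_iff assms)
  with assms show ?thesis by (simp add: dbasis_def)
qed

context rmod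
begin

lemma coord_zero: assumes "dbasis R M I e k" "i \<in> I" shows "k i \<zero> = 0"
  using dbasisD(4)[OF assms, of \<zero> \<zero>] by simp

lemma coord_finsum:
  assumes "dbasis R M I e k" "i \<in> I" "h \<in> J \<rightarrow> carrier M" "finite J"
  shows "k i (finsum M h J) = (\<Sum>j\<in>J. k i (h j))" using assms(4,3)
proof (induction J)
  case (insert j J)
  then show ?case using dbasisD(4)[OF assms(1,2), of "h j" "finsum M h J"] by (auto simp: Pi_def)
qed (use coord_zero assms in auto)

lemma coord_comb: assumes "dbasis R M I e k" "i \<in> I" "!!i. i \<in> I ==> c i \<in> R"
  shows "k i (finsum M (%i. c i \<odot> e i) I) = c i"
proof -
  have "k i (finsum M (%i. c i \<odot> e i) I) = (\<Sum>j\<in>I. k i (c j \<odot> e j))"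
    using dbasisD[OF assms(1)] assms(2,3) by (intro coord_finsum[OF assms(1)]) auto
  also have "... = (\<Sum>j\<in>I. if j = i then c j else 0)"
    using dbasisD(2,5,6)[OF assms(1)] assms(2,3) by (intro sum.cong) auto
  finally show ?thesis using assms(2) dbasisD(1)[OF assms(1)] by simp
qed

lemma coord_eqI: assumes "dbasis R M I e k" "x :> M" "y :> M" "!!i. i \<in> I ==> k i x = k i y"
  shows "x = y"
proof -
  have "finsum M (%i. k i x \<odot> e i) I = finsum M (%i. k i y \<odot> e i) I"
    using assms dbasisD[OF assms(1)] by (intro finsum_cong') auto
  with dbasisD(7)[OF assms(1)] assms(2,3) show ?thesis by simp
qed

text \<open>\<open>finite_free\<close> wants a set of vectors, not a family. As
  \<open>1 \<noteq> 0\<close>, coordinate \<open>i\<close> separates \<open>e i\<close> from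
  \<open>e j\<close>, so \<open>e\<close> is injective and sums over \<open>I\<close> can be
  reindexed as sums over its image.\<close>

lemma finite_free_of_dbasis: assumes db: "dbasis R M I e k" and "(1::'r) \<noteq> 0"
  shows "finite_free R M"
proof -
  note D = dbasisD[OF db]
  have inj: "inj_on e I"
  proof (rule inj_onI)
    fix i j assume "i \<in> I" "j \<in> I" "e i = e j"
    with D(6)[of i i] D(6)[of i j] assms(2) show "i = j" by (auto split: if_splits)
  qed
  have *: "finsum M (%y. c y \<odot> y) (e ` I) = finsum M (%i. c (e i) \<odot> e i) I" if "c \<in> e ` I \<rightarrow> R" for c
    using that D inj by (intro finsum_reindex) auto
  have "\<exists>!c. c \<in> e ` I \<rightarrow>\<^sub>E R \<and> x = finsum M (%y. c y \<odot> y) (e ` I)" if x: "x :> M" for x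
  proof (rule ex1I)
    let ?c = "\<lambda>y\<in>e ` I. k (the_inv_into I e y) x"
    have c: "?c \<in> e ` I \<rightarrow> R" using D x inj by (auto simp: the_inv_into_f_f)
    have "finsum M (%i. ?c (e i) \<odot> e i) I = finsum M (%i. k i x \<odot> e i) I"
      using D x inj by (intro finsum_cong') (auto simp: the_inv_into_f_f)
    then have "x = finsum M (%y. ?c y \<odot> y) (e ` I)" unfolding *[OF c] using D(7)[OF x] by simp
    moreover have "?c \<in> e ` I \<rightarrow>\<^sub>E R"
      by (rule PiE_I) (use c in \<open>auto simp: restrict_def dest: Pi_mem\<close>)
    ultimately show "?c \<in> e ` I \<rightarrow>\<^sub>E R \<and> x = finsum M (%y. ?c y \<odot> y) (e ` I)" by blast
    fix c assume a: "c \<in> e ` I \<rightarrow>\<^sub>E R \<and> x = finsum M (%y. c y \<odot> y) (e ` I)"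
    have "k i x = c (e i)" if "i \<in> I" for i
    proof -
      have "c \<in> e ` I \<rightarrow> R" using a by (simp add: PiE_def)
      with a *[of c] coord_comb[OF db that, of "%i. c (e i)"] show ?thesis by (simp add: Pi_def)
    qed
    with a inj show "c = ?c"  by (intro ext) (auto simp: the_inv_into_f_f PiE_def extensional_def)
  qed
  then show ?thesis unfolding finite_free_def using is_module D(1,2) by (intro conjI exI[of _ "e ` I"]) auto
qed

text \<open>The coordinate of \<open>f x\<close> at \<open>t i\<close> is that of \<open>x\<close>
  at \<open>i\<close>, which gives injectivity and surjectivity at once. This criterion yields the
  bijectivity of most structural isomorphisms below without an inverse being constructed.\<close>

lemma bij_of_dbasis: assumes X: "dbasis R M I e k" and Y: "dbasis R N J e' k'" "rmod R N"
    and f: "addhom M N f" "!!c x. [|c \<in> R; x \<in> carrier M|] ==> f (c \<odot> x) = c *[N] f x"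
    and t: "bij_betw t I J" "!!i. i \<in> I ==> f (e i) = e' (t i)"
  shows "bij_betw f (carrier M) (carrier N)"
proof -
  interpret N: rmod R N by fact
  note D = dbasisD[OF X] and D' = dbasisD[OF Y(1)]
  have tJ: "t i \<in> J" if "i \<in> I" for i using t(1) that by (auto simp: bij_betw_def)
  have f_comb: "f (finsum M (%i. c i \<odot> e i) I) = finsum N (%i. c i *[N] e' (t i)) I"
    if "!!i. i \<in> I ==> c i \<in> R" for c
    using that D f(2) t tJ D' addhom_finsum[OF is_abgroup N.is_abgroup f(1), of "%i. c i \<odot> e i" I]
    by (auto intro!: N.finsum_cong' )
  have ri: "finsum N (%i. c (t i) *[N] e' (t i)) I = finsum N (%j. c j *[N] e' j) J"
    if "!!j. j \<in> J ==> c j \<in> R" for c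
    using N.finsum_reindex[of "%j. c j *[N] e' j" t I] t(1) that D' by (auto simp: bij_betw_def)
  have coord: "k' (t i) (f x) = k i x" if "x :> M" "i \<in> I" for x i
  proof -
    \<comment> \<open>The coordinates of \<open>x\<close>, moved from \<open>I\<close> to
      \<open>J\<close> along the inverse of \<open>t\<close>, so that \<open>coord_comb\<close>
      applies to the basis of \<open>N\<close>.\<close>
    define c where "c j = k (the_inv_into I t j) x" for j
    have c: "c j \<in> R" if "j \<in> J" for j
      using t(1) that \<open>x \<in> _\<close> D(3) unfolding c_def bij_betw_def by (metis the_inv_into_into subset_refl)
    have ct: "c (t i) = k i x" if "i \<in> I" for i using t(1) that by (simp add: c_def bij_betw_def the_inv_into_f_f)
    have "f x = finsum N (%i. k i x *[N] e' (t i)) I" using f_comb[of "%i. k i x"] D that by auto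
    also have "... = finsum N (%i. c (t i) *[N] e' (t i)) I" using ct c tJ D'(2) D(3) that(1) by (intro N.finsum_cong') auto
    also have "... = finsum N (%j. c j *[N] e' j) J" using ri c by blast
    finally show ?thesis using N.coord_comb[OF Y(1), of "t i" c] c tJ that ct by simp
  qed
  show ?thesis
  proof (rule bij_betwI')
    show "f x = f y \<longleftrightarrow> x = y" if "x :> M" "y :> M" for x y using coord_eqI[OF X that] coord that by metis
    show "\<exists>x\<in>carrier M. y = f x" if y: "y :> N" for y
    proof
      show "finsum M (%i. k' (t i) y \<odot> e i) I :> M" using D D' tJ y by (intro finsum_closed) auto
      show "y = f (finsum M (%i. k' (t i) y \<odot> e i) I)"
        using f_comb[of "%i. k' (t i) y"] ri[of "%j. k' j y"] D' tJ y by auto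
    qed
  qed (use f(1) in \<open>auto simp: addhom_def\<close>)
qed

lemma tfree_of_dbasis:
  assumes "dbasis R M I e k" "!!a b. [|a \<in> R; b \<in> R; a * b = 0|] ==> a = 0 \<or> b = 0"
  shows "tfree R M" unfolding tfree_def
proof (intro ballI impI)
  fix c x assume c: "c \<in> R" "x :> M" "c \<noteq> 0" "c \<odot> x = \<zero>"
  show "x = \<zero>"
  proof (rule coord_eqI[OF assms(1)])
    fix i assume "i \<in> I"
    then show "k i x = k i \<zero>"
      using dbasisD(3,5)[OF assms(1), of i] coord_zero[OF assms(1), of i] c assms(2)[of c "k i x"] by metis
  qed (use c in auto)
qed

text \<open>The coordinates are those singled out by unique existence. They are additive and
  homogeneous because sums and multiples of coordinate vectors are coordinate vectors again, hence
  the unique ones.\<close>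

lemma dbasis_of_finite_free: assumes "finite_free R M" shows "\<exists>I k. dbasis R M I (%x. x) k"
proof -
  from assms obtain E where E: "finite E" "E \<subseteq> carrier M"
    and ex0: "\<forall>x\<in>carrier M. \<exists>!c. c \<in> E \<rightarrow>\<^sub>E R \<and> x = finsum M (%e. c e \<odot> e) E"
    unfolding finite_free_def by (elim conjE exE)
  have ex: "\<exists>!c. c \<in> E \<rightarrow>\<^sub>E R \<and> x = finsum M (%e. c e \<odot> e) E" if "x :> M" for x
    using ex0 that by (rule bspec)
  define c where "c x = (THE c. c \<in> E \<rightarrow>\<^sub>E R \<and> x = finsum M (%e. c e \<odot> e) E)" for x
  have c: "c x \<in> E \<rightarrow>\<^sub>E R" "finsum M (%e. c x e \<odot> e) E = x" if "x :> M" for x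
    using theI'[OF ex[OF that]] by (auto simp: c_def)
  have uniq: "c x e = d e" if "x :> M" "!!e. e \<in> E ==> d e \<in> R" "finsum M (%e. d e \<odot> e) E = x" "e \<in> E"
    for x d e
  proof -
    have "finsum M (%e. restrict d E e \<odot> e) E = x"
      unfolding that(3)[symmetric] using that(2) E by (intro finsum_cong') auto
    then have "c x = restrict d E" unfolding c_def using that by (intro the1_equality ex) auto
    with that show ?thesis by simp
  qed
  have "dbasis R M E (%x. x) (%e x. c x e)" unfolding dbasis_def
  proof (intro conjI ballI)
    fix e x assume e: "e \<in> E" and x: "x :> M"
    show "c x e \<in> R" using c x e by (auto simp: PiE_def)
    {
      fix y assume y: "y :> M"
      have cR: "c x e \<in> R" "c y e \<in> R" if "e \<in> E" for e using c x y that by (auto simp: PiE_def)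
      show "c (x \<oplus> y) e = c x e + c y e"
      proof (rule uniq)
        have "finsum M (%e. (c x e + c y e) \<odot> e) E = finsum M (%e. c x e \<odot> e \<oplus> c y e \<odot> e) E"
          using cR E by (intro finsum_cong') (auto simp: smult_l_distr subset_eq)
        also have "... = x \<oplus> y" using cR E c(2) x y by (subst finsum_addf) auto
        finally show "finsum M (%e. (c x e + c y e) \<odot> e) E = x \<oplus> y" .
      qed (use x y e cR in auto)
    }
    {
      fix a assume a: "a \<in> R"
      have cR: "c x e \<in> R" if "e \<in> E" for e using c x that by (auto simp: PiE_def)
      show "c (a \<odot> x) e = a * c x e"
      proof (rule uniq)
        have "finsum M (%e. (a * c x e) \<odot> e) E = finsum M (%e. a \<odot> (c x e \<odot> e)) E"
          using cR E a by (intro finsum_cong') (auto simp: smult_smult subset_eq)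
        also have "... = a \<odot> x" using cR E c(2) x a by (subst smult_finsum[symmetric]) auto
        finally show "finsum M (%e. (a * c x e) \<odot> e) E = a \<odot> x" .
      qed (use x a e cR in auto)
    }
  next
    fix i j assume "i \<in> E" "j \<in> E"
    show "c j i = (if i = j then 1 else 0)"
    proof (rule uniq)
      have "finsum M (%i. (if i = j then 1 else 0) \<odot> i) E = finsum M (%i. if j = i then i else \<zero>) E"
        using E by (intro finsum_cong') auto
      also have "... = j" using E \<open>j \<in> E\<close> by (intro add.finprod_singleton) auto
      finally show "finsum M (%i. (if i = j then 1 else 0) \<odot> i) E = j" .
    qed (use E \<open>i \<in> E\<close> \<open>j \<in> E\<close> in auto)
  qed (use E c in auto)
  then show ?thesis by blast
qed

end

section \<open>Localization of torsion-free modules\<close>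

text \<open>Localization is only needed for free modules over a domain. Torsion-freeness removes the
  extra power \<open>s ^ k\<close> from \<open>loc_rel\<close>: equality of fractions becomes
  cross-multiplication, and \<open>M\<close> embeds in \<open>M[1/s]\<close>.\<close>

locale lmod = rmod R M for R :: "'r::idom set" and M :: "('r, 'u, 'x) module_scheme" (structure) +
  fixes s :: 'r
  assumes tf: "tfree R M" and s_R [simp]: "s \<in> R" and s_nz [simp]: "s \<noteq> 0"
begin

lemma cancel: "[|c \<in> R; c \<noteq> 0; x :> M; y \<in> carrier M|] ==> c \<odot> x = c \<odot> y \<longleftrightarrow> x = y"
  by (rule tfree_cancel[OF tf])

lemma lfrac_mem: "x :> M ==> (y, n) \<in> lfrac M s x m \<longleftrightarrow> y :> M \<and> s ^ n \<odot> x = s ^ m \<odot> y"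
proof -
  assume x: "x :> M"
  have "s ^ (k + n) \<odot> x = s ^ (k + m) \<odot> y \<longleftrightarrow> s ^ n \<odot> x = s ^ m \<odot> y" if "y :> M" for k
    using cancel[of "s ^ k" "s ^ n \<odot> x" "s ^ m \<odot> y"] x that by (simp add: smult_smult power_add)
  with x show ?thesis by (auto simp: lfrac_def loc_rel_def)
qed

lemma lfrac_self: "x :> M ==> (x, m) \<in> lfrac M s x m" by (simp add: lfrac_mem)

lemma lfrac_eq: assumes "x :> M" "y :> M"
  shows "lfrac M s x m = lfrac M s y n \<longleftrightarrow> s ^ n \<odot> x = s ^ m \<odot> y"
proof
  assume "lfrac M s x m = lfrac M s y n"
  then show "s ^ n \<odot> x = s ^ m \<odot> y" using lfrac_self[OF assms(2), of n] lfrac_mem[OF assms(1), of y n m] by simp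
next
  assume a: "s ^ n \<odot> x = s ^ m \<odot> y"
  have "s ^ l \<odot> x = s ^ m \<odot> z \<longleftrightarrow> s ^ l \<odot> y = s ^ n \<odot> z" if z: "z :> M" for l z
  proof -
    have "s ^ l \<odot> x = s ^ m \<odot> z \<longleftrightarrow> s ^ n \<odot> (s ^ l \<odot> x) = s ^ n \<odot> (s ^ m \<odot> z)"
      using assms z by (subst cancel) auto
    also have "s ^ n \<odot> (s ^ l \<odot> x) = s ^ l \<odot> (s ^ n \<odot> x)" using assms by (simp add: smult_smult mult.commute)
    also have "... = s ^ m \<odot> (s ^ l \<odot> y)" using assms a by (simp add: smult_smult mult.commute)
    also have "s ^ n \<odot> (s ^ m \<odot> z) = s ^ m \<odot> (s ^ n \<odot> z)" using z by (simp add: smult_smult mult.commute)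
    also have "s ^ m \<odot> (s ^ l \<odot> y) = s ^ m \<odot> (s ^ n \<odot> z) \<longleftrightarrow> s ^ l \<odot> y = s ^ n \<odot> z"
      using assms z by (subst cancel) auto
    finally show ?thesis .
  qed
  then show "lfrac M s x m = lfrac M s y n" using assms by (auto simp: lfrac_mem)
qed

lemma loc_carrier: "carrier (loc M s) = {lfrac M s x m | x m. x :> M}" by (auto simp: loc_def quotient_def lfrac_def)

lemma lfrac_closed [simp, intro]: "x :> M ==> lfrac M s x m :> loc M s" by (auto simp: loc_carrier)

lemma locE: assumes "\<xi> :> loc M s"
  obtains x m where "x :> M" "\<xi> = lfrac M s x m" using assms by (auto simp: loc_carrier)

lemma loc_zero: "0[loc M s] = lfrac M s \<zero> 0" by (simp add: loc_def)

lemma loc_smult: assumes "c \<in> R" "x :> M"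
  shows "c *[loc M s] lfrac M s x m = lfrac M s (c \<odot> x) m"
proof -
  have "lfrac M s (c \<odot> y) n = lfrac M s (c \<odot> x) m" if "(y, n) \<in> lfrac M s x m" for y n
  proof -
    from that assms have y: "y :> M" "s ^ n \<odot> x = s ^ m \<odot> y" by (auto simp: lfrac_mem)
    have "s ^ m \<odot> (c \<odot> y) = c \<odot> (s ^ m \<odot> y)" using assms y by (simp add: smult_smult mult.commute)
    also have "... = s ^ n \<odot> (c \<odot> x)" using assms y(2)[symmetric] by (simp add: smult_smult mult.commute)
    finally show ?thesis using assms y by (subst lfrac_eq) auto
  qed
  then have "(\<Union>(y, n)\<in>lfrac M s x m. lfrac M s (c \<odot> y) n) = (\<Union>(y, n)\<in>lfrac M s x m. lfrac M s (c \<odot> x) m)"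
    by (intro SUP_cong) auto
  then show ?thesis using lfrac_self[OF assms(2), of m] by (auto simp: loc_def)
qed

lemma loc_add: assumes "x :> M" "y :> M"
  shows "lfrac M s x m +[loc M s] lfrac M s y n = lfrac M s (s ^ n \<odot> x \<oplus> s ^ m \<odot> y) (m + n)"
proof -
  have "lfrac M s (s ^ n' \<odot> x' \<oplus> s ^ m' \<odot> y') (m' + n') = lfrac M s (s ^ n \<odot> x \<oplus> s ^ m \<odot> y) (m + n)"
    if "(x', m') \<in> lfrac M s x m" "(y', n') \<in> lfrac M s y n" for x' m' y' n'
  proof -
    from that assms have x: "x' :> M" "s ^ m' \<odot> x = s ^ m \<odot> x'"
      and y: "y' :> M" "s ^ n' \<odot> y = s ^ n \<odot> y'" by (auto simp: lfrac_mem)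
    have "s ^ (m + n) \<odot> (s ^ n' \<odot> x') = s ^ (n + n') \<odot> (s ^ m \<odot> x')"
      using x by (simp add: smult_smult power_add mult_ac)
    also have "... = s ^ (m' + n') \<odot> (s ^ n \<odot> x)"
      using x(1) assms x(2)[symmetric] by (simp add: smult_smult power_add mult_ac)
    finally have 1: "s ^ (m + n) \<odot> (s ^ n' \<odot> x') = s ^ (m' + n') \<odot> (s ^ n \<odot> x)" .
    have "s ^ (m + n) \<odot> (s ^ m' \<odot> y') = s ^ (m + m') \<odot> (s ^ n \<odot> y')"
      using y by (simp add: smult_smult power_add mult_ac)
    also have "... = s ^ (m' + n') \<odot> (s ^ m \<odot> y)"
      using y(1) assms y(2)[symmetric] by (simp add: smult_smult power_add mult_ac)
    finally have 2: "s ^ (m + n) \<odot> (s ^ m' \<odot> y') = s ^ (m' + n') \<odot> (s ^ m \<odot> y)" .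
    show ?thesis using x y assms 1 2 by (subst lfrac_eq) (auto simp: smult_r_distr)
  qed
  then have "(\<Union>(x', m')\<in>lfrac M s x m. \<Union>(y', n')\<in>lfrac M s y n. lfrac M s (s ^ n' \<odot> x' \<oplus> s ^ m' \<odot> y') (m' + n'))
    = (\<Union>(x', m')\<in>lfrac M s x m. \<Union>(y', n')\<in>lfrac M s y n. lfrac M s (s ^ n \<odot> x \<oplus> s ^ m \<odot> y) (m + n))"
    by (intro SUP_cong) auto
  also have "... = lfrac M s (s ^ n \<odot> x \<oplus> s ^ m \<odot> y) (m + n)"
    using lfrac_self[OF assms(1), of m] lfrac_self[OF assms(2), of n] by auto
  finally show ?thesis by (simp add: loc_def)
qed

lemma loc_add_same: assumes "x :> M" "y :> M"
  shows "lfrac M s x m +[loc M s] lfrac M s y m = lfrac M s (x \<oplus> y) m"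
  using assms by (simp add: loc_add lfrac_eq smult_r_distr smult_smult power_add)

lemma common_denom: assumes "x :> M" shows "lfrac M s x m = lfrac M s (s ^ n \<odot> x) (m + n)"
  using assms by (simp add: lfrac_eq smult_smult power_add)

lemma locE2: assumes "\<xi> :> loc M s" "ups :> loc M s"
  obtains x y m where "x :> M" "y :> M" "\<xi> = lfrac M s x m" "ups = lfrac M s y m"
proof -
  from assms obtain x m y n where *: "x :> M" "\<xi> = lfrac M s x m" "y :> M" "ups = lfrac M s y n" by (metis locE)
  show thesis by (rule that[of "s ^ n \<odot> x" "s ^ m \<odot> y" "m + n"])
      (use * common_denom[of x m n] common_denom[of y n m] in \<open>auto simp: add.commute\<close>)
qed

lemma locE3: assumes "\<xi> :> loc M s" "ups :> loc M s" "\<zeta> :> loc M s"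
  obtains x y z m where "x :> M" "y :> M" "z :> M"
    "\<xi> = lfrac M s x m" "ups = lfrac M s y m" "\<zeta> = lfrac M s z m"
proof -
  from assms obtain x y m z n where *: "x :> M" "\<xi> = lfrac M s x m" "y :> M" "ups = lfrac M s y m"
    "z :> M" "\<zeta> = lfrac M s z n" by (metis locE locE2)
  show thesis by (rule that[of "s ^ n \<odot> x" "s ^ n \<odot> y" "s ^ m \<odot> z" "m + n"])
      (use * common_denom[of x m n] common_denom[of y m n] common_denom[of z n m] in \<open>auto simp: add.commute\<close>)
qed

lemma abelian_group_loc: "abelian_group (loc M s)"
proof (rule abelian_groupI)
  fix x y z assume xyz: "x :> loc M s" "y :> loc M s" "z :> loc M s"
  show "x +[loc M s] y +[loc M s] z = x +[loc M s] (y +[loc M s] z)" by (rule locE3[OF xyz]) (simp add: loc_add_same a_assoc)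
next
  fix x y assume xy: "x :> loc M s" "y :> loc M s"
  show "x +[loc M s] y = y +[loc M s] x" by (rule locE2[OF xy]) (simp add: loc_add_same a_comm)
  show "x +[loc M s] y :> loc M s" by (rule locE2[OF xy]) (simp add: loc_add_same)
next
  fix x assume "x :> loc M s"
  then obtain a m where a: "a :> M" "x = lfrac M s a m" by (rule locE)
  then show "0[loc M s] +[loc M s] x = x" by (simp add: loc_zero loc_add)
  have "lfrac M s \<zero> m = lfrac M s \<zero> 0" by (simp add: lfrac_eq)
  with a show "\<exists>y\<in>carrier (loc M s). y +[loc M s] x = 0[loc M s]"
    by (intro bexI[of _ "lfrac M s (\<ominus> a) m"]) (auto simp: loc_add_same loc_zero l_neg)
qed (simp add: loc_zero)

lemma rmod_loc: "rmod R (loc M s)"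
proof (rule rmodI[OF is_sring abelian_group_loc])
  fix c x y assume c: "c \<in> R" and xy: "x :> loc M s" "y :> loc M s"
  show "c *[loc M s] (x +[loc M s] y) = c *[loc M s] x +[loc M s] c *[loc M s] y"
    by (rule locE2[OF xy]) (simp add: loc_add_same loc_smult smult_r_distr c)
qed (auto simp: loc_add_same loc_smult smult_l_distr smult_smult elim!: locE)

lemma tfree_loc: "tfree R (loc M s)" unfolding tfree_def
proof (intro ballI impI)
  fix c x assume c: "c \<in> R" "c \<noteq> 0" and x: "x :> loc M s" and 0: "c *[loc M s] x = 0[loc M s]"
  from x obtain a m where a: "a :> M" "x = lfrac M s a m" by (rule locE)
  with 0 c have "c \<odot> a = \<zero>" by (simp add: loc_smult loc_zero lfrac_eq)
  with c a tf have "a = \<zero>" by (auto simp: tfree_def)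
  with a show "x = 0[loc M s]" by (simp add: loc_zero lfrac_eq)
qed

lemma smult_lfrac_cancel: "x :> M ==> s ^ m *[loc M s] lfrac M s x (m + n) = lfrac M s x n"
  by (simp add: loc_smult lfrac_eq smult_smult power_add mult.commute)

text \<open>\<open>loc_ext\<close> asks for a value compatible with all representatives of a
  fraction. Powers of \<open>alp s\<close> cancel in \<open>Q\<close>, so compatibility with one
  representative forces all others as well as uniqueness; a proposed value is checked only
  once.\<close>

lemma loc_ext_eval: assumes Q: "rmod R' Q" "tfree R' Q" and s': "alp s \<in> R'" "alp s \<noteq> 0"
    and F: "!!x. x :> M ==> F x :> Q"
      "!!x n. x :> M ==> F (s ^ n \<odot> x) = alp s ^ n *[Q] F x"
    and ups: "ups :> Q" "alp s ^ j *[Q] ups = F x" and x: "x :> M"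
  shows "loc_ext alp s Q F (lfrac M s x j) = ups" unfolding loc_ext_def
proof (rule the_equality)
  interpret Q: rmod R' Q by fact
  let ?t = "alp s"
  have "?t ^ n *[Q] ups = F y" if "(y, n) \<in> lfrac M s x j" for y n
  proof -
    from that x have y: "y :> M" "s ^ n \<odot> x = s ^ j \<odot> y" by (auto simp: lfrac_mem)
    have "?t ^ j *[Q] (?t ^ n *[Q] ups) = ?t ^ n *[Q] F x"
      using s' ups by (simp add: Q.smult_smult mult.commute flip: ups(2))
    also have "... = ?t ^ j *[Q] F y" using F(2)[OF x, of n] F(2)[OF y(1), of j] y by simp
    finally show ?thesis using Q.tfree_cancel[OF Q(2), of "?t ^ j" "?t ^ n *[Q] ups" "F y"] s' ups F(1)[OF y(1)] by simp
  qed
  with ups show "ups :> Q \<and> (\<forall>(x, n)\<in>lfrac M s x j. ?t ^ n *[Q] ups = F x)" by auto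
  fix ups' assume "ups' :> Q \<and> (\<forall>(x, n)\<in>lfrac M s x j. ?t ^ n *[Q] ups' = F x)"
  then have "ups' :> Q" "?t ^ j *[Q] ups' = ?t ^ j *[Q] ups" using lfrac_self[OF x, of j] ups by auto
  then show "ups' = ups" using Q.tfree_cancel[OF Q(2), of "?t ^ j" ups' ups] s' ups by simp
qed

end

lemma lfrac_cong: "carrier N = carrier M ==> smult N = smult M ==> lfrac N s = lfrac M s"
  by (simp add: lfrac_def loc_rel_def fun_eq_iff)

lemma loc_cong: 
  "carrier N = carrier M ==> smult N = smult M ==> add N = add M ==> zero N = zero M ==> loc N s = loc M s"
  using lfrac_cong[of N M s] by (simp add: loc_def loc_rel_def)

section \<open>Tensor products\<close>

text \<open>Generation by sums alone, without scalars, phrased as an induction principle. Pure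
  tensors generate in this sense, and the maps to be compared on them are often merely
  additive.\<close>

definition addgen where
  "addgen M Z \<longleftrightarrow> Z \<subseteq> carrier M \<and>
    (\<forall>Q. Q 0[M] \<longrightarrow> (\<forall>z\<in>Z. Q z) \<longrightarrow> (\<forall>x\<in>carrier M. \<forall>y\<in>carrier M. Q x \<longrightarrow> Q y \<longrightarrow> Q (x +[M] y)) \<longrightarrow>
      (\<forall>x\<in>carrier M. Q x))"

lemma addgenD: "addgen M Z ==> z \<in> Z ==> z :> M" by (auto simp: addgen_def)

lemma addgen_induct [consumes 2, case_names zero gen add]:
  assumes "addgen M Z" "x :> M" "Q 0[M]" "!!z. z \<in> Z ==> Q z"
    and "!!x y. [|x :> M; y :> M; Q x; Q y|] ==> Q (x +[M] y)" shows "Q x"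
proof -
  have "\<forall>x\<in>carrier M. Q x" by (rule assms(1)[unfolded addgen_def, THEN conjunct2, rule_format, THEN ballI])
      (use assms(3-5) in blast)+
  with assms(2) show ?thesis by blast
qed

lemma addgen_carrier: "addgen M (carrier M)" by (auto simp: addgen_def)

lemma addhom_eqI:
  assumes "addgen X Z" "addhom X Y f" "addhom X Y g" "abelian_group X" "abelian_group Y"
    and "!!z. z \<in> Z ==> f z = g z" and "x :> X" shows "f x = g x" using assms(1,7) by (induction x rule: addgen_induct)
    (use assms(6) in \<open>auto simp: addhom_add[OF assms(2)] addhom_add[OF assms(3)]
       addhom_zero[OF assms(4,5,2)] addhom_zero[OF assms(4,5,3)]\<close>)

declare in_listsD [rule del] in_listsI [rule del]

definition balanced where
  "balanced R L M P beta \<longleftrightarrow>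
    (\<forall>x\<in>carrier L. \<forall>y\<in>carrier M. beta x y :> P) \<and>
    (\<forall>x\<in>carrier L. \<forall>x'\<in>carrier L. \<forall>y\<in>carrier M. beta (x +[L] x') y = beta x y +[P] beta x' y) \<and>
    (\<forall>x\<in>carrier L. \<forall>y\<in>carrier M. \<forall>y'\<in>carrier M. beta x (y +[M] y') = beta x y +[P] beta x y') \<and>
    (\<forall>r\<in>R. \<forall>x\<in>carrier L. \<forall>y\<in>carrier M. beta (r *[L] x) y = beta x (r *[M] y))"

lemma balancedI: assumes "!!x y. [|x :> L; y \<in> carrier M|] ==> beta x y :> P"
    and "!!x x' y. [|x :> L; x' :> L; y \<in> carrier M|] ==> beta (x +[L] x') y = beta x y +[P] beta x' y"
    and "!!x y y'. [|x :> L; y :> M; y' \<in> carrier M|] ==> beta x (y +[M] y') = beta x y +[P] beta x y'"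
    and "!!r x y. [|r \<in> R; x :> L; y \<in> carrier M|] ==> beta (r *[L] x) y = beta x (r *[M] y)"
  shows "balanced R L M P beta" using assms by (auto simp: balanced_def)

lemma balancedD: assumes "balanced R L M P beta"
  shows "[|x :> L; y \<in> carrier M|] ==> beta x y :> P"
    and "[|x :> L; x' :> L; y \<in> carrier M|] ==> beta (x +[L] x') y = beta x y +[P] beta x' y"
    and "[|x :> L; y :> M; y' \<in> carrier M|] ==> beta x (y +[M] y') = beta x y +[P] beta x y'"
    and "[|r \<in> R; x :> L; y \<in> carrier M|] ==> beta (r *[L] x) y = beta x (r *[M] y)"
  using assms by (auto simp: balanced_def)

lemma (in abelian_monoid) finsum_Times:
  assumes "finite I" "finite J" "!!i j. i \<in> I ==> j \<in> J ==> f i j :> G"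
  shows "finsum G (%(i, j). f i j) (I \<times> J) = finsum G (%i. finsum G (f i) J) I" using assms(1,3)
proof (induction I)
  case (insert i I)
  have "insert i I \<times> J = Pair i ` J \<union> I \<times> J" by auto
  then have "finsum G (%(i, j). f i j) (insert i I \<times> J) =
      finsum G (%(i, j). f i j) (Pair i ` J) \<oplus> finsum G (%(i, j). f i j) (I \<times> J)"
    using insert assms(2) by (simp only:) (rule finsum_Un_disjoint, auto)
  also have "finsum G (%(i, j). f i j) (Pair i ` J) = finsum G (f i) J"
    using insert assms(2) by (subst finsum_reindex) (auto simp: inj_on_def)
  finally show ?case using insert assms(2) by (subst finsum_insert) (auto intro!: finsum_closed)
qed simp

definition reg :: "('r::comm_ring_1, 'r) module" where
  "reg = \<lparr>carrier = UNIV, mult = (*), one = 1, zero = 0, add = (+), smult = (*)\<rparr>"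

lemma reg_simps [simp]:
  "carrier reg = UNIV" "zero reg = 0" "add reg = (+)" "smult reg = (*)" by (simp_all add: reg_def)

lemma rmod_reg: "rmod UNIV reg" by (rule rmodI[OF sring_UNIV]; (rule abelian_groupI)?)
    (auto simp: algebra_simps intro: exI[where x = "- x" for x])

text \<open>Allowing \<open>L\<close> to be a module over a larger ring \<open>R'\<close> covers
  both the tensor product of two Wach modules, where \<open>R' = R\<close>, and base change, where
  \<open>L\<close> is A_F^+ and \<open>R\<close> is S.\<close>

locale tpair = L: rmod R' L + M: rmod R M
  for R' R :: "'r::comm_ring_1 set"
    and L :: "('r, ('r, 'b) univ, 'x) module_scheme" and M :: "('r, ('r, 'b) univ, 'y) module_scheme" +
  assumes sub: "R \<subseteq> R'"
begin

abbreviation (input) "T \<equiv> tens R L M"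
abbreviation (input) "pt \<equiv> ptens R L M"
abbreviation (input) "LS \<equiv> lists (carrier L \<times> carrier M)"

lemma R_R' [simp, intro]: "r \<in> R ==> r \<in> R'" using sub by auto

lemma teq_lists: "teq R L M l l' ==> l \<in> LS \<and> l' \<in> LS" by (induction rule: teq.induct) auto

text \<open>Equivalent lists have the same predicate \<open>teq R L M l\<close>, and the choice
  operator in \<open>tcls\<close> depends on that predicate only.\<close>

lemma tcls_eq: "teq R L M l l' ==> tcls R L M l = tcls R L M l'"
proof -
  assume "teq R L M l l'"
  then have "teq R L M l = teq R L M l'" by (auto intro: teq_trans teq_sym simp: fun_eq_iff)
  then show ?thesis by (simp add: tcls_def)
qed

lemma teq_the_list: "l \<in> LS ==> teq R L M l (the_list (tcls R L M l))"
  unfolding tcls_def univ.sel using someI[of "teq R L M l" l] teq_refl by blast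

lemma T_carrier: "carrier T = tcls R L M ` LS" by (simp add: tens_def)

lemma tcls_closed [intro]: "l \<in> LS ==> tcls R L M l :> T" by (auto simp: T_carrier)

lemma T_the_list: "u :> T ==> the_list u \<in> LS \<and> tcls R L M (the_list u) = u"
proof -
  assume "u :> T"
  then obtain l where l: "l \<in> LS" "u = tcls R L M l" unfolding T_carrier by (rule imageE)
  show ?thesis
    using teq_lists[OF teq_the_list[OF l(1)]] tcls_eq[OF teq_the_list[OF l(1)]] unfolding l(2) by (intro conjI) simp_all
qed

lemma T_add: "l \<in> LS ==> k \<in> LS ==> tcls R L M l +[T] tcls R L M k = tcls R L M (l @ k)"
  by (simp add: tens_def) (rule tcls_eq[symmetric], intro teq_append teq_the_list)

lemma T_zero: "0[T] = tcls R L M []" by (simp add: tens_def)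

text \<open>Checked relation by relation. The balancing relation is where commutativity enters,
  since \<open>c\<close> has to pass \<open>r\<close>.\<close>

lemma teq_map_smult: assumes "c \<in> R'"
  shows "teq R L M l l' ==> teq R L M (map (%(x, y). (c *[L] x, y)) l) (map (%(x, y). (c *[L] x, y)) l')"
proof (induction rule: teq.induct)
  case (teq_smult r x y)
  have "c *[L] (r *[L] x) = r *[L] (c *[L] x)" using teq_smult assms by (simp add: L.smult_smult mult.commute)
  then show ?case using teq_smult assms teq.teq_smult[of r R "c *[L] x" L y M] by simp
next
  case (teq_refl l)
  then have "map (%(x, y). (c *[L] x, y)) l \<in> LS" using assms by (auto simp: in_lists_conv_set)
  then show ?case by (rule teq.teq_refl)
next
  case (teq_swap l k)
  then have "map (%(x, y). (c *[L] x, y)) l \<in> LS" "map (%(x, y). (c *[L] x, y)) k \<in> LS"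
    using assms by (auto simp: in_lists_conv_set)
  then show ?case using teq.teq_swap by auto
qed (use assms in \<open>auto intro: teq_sym teq_trans teq_append teq_zero teq_add_left teq_add_right simp: L.smult_r_distr\<close>)

lemma T_smult:
  "c \<in> R' ==> l \<in> LS ==> c *[T] tcls R L M l = tcls R L M (map (%(x, y). (c *[L] x, y)) l)"
  by (simp add: tens_def) (rule tcls_eq[symmetric], intro teq_map_smult teq_the_list)

lemma pt_closed [simp, intro]: "x :> L ==> y :> M ==> pt x y :> T" by (auto simp: ptens_def)

lemma tcls_Cons: "x :> L ==> y :> M ==> l \<in> LS ==> tcls R L M ((x, y) # l) = pt x y +[T] tcls R L M l"
  by (simp add: ptens_def T_add)

lemma abelian_monoid_T: "abelian_monoid T"
proof (rule abelian_monoidI)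
  fix u v w assume "u :> T" "v :> T" "w :> T"
  then show "u +[T] v +[T] w = u +[T] (v +[T] w)" by (auto simp: T_carrier T_add)
next
  fix u v assume "u :> T" "v :> T"
  then show "u +[T] v = v +[T] u" by (auto simp: T_carrier T_add intro!: tcls_eq[OF teq_swap])
  show "u +[T] v :> T"
    using \<open>u \<in> carrier T\<close> \<open>v \<in> carrier T\<close> unfolding T_carrier by (auto simp: T_add intro!: imageI)
qed (auto simp: T_carrier T_add T_zero)

lemma T_induct [consumes 1, case_names zero pure add]:
  assumes "u :> T" "Q 0[T]" "!!x y. [|x :> L; y \<in> carrier M|] ==> Q (pt x y)"
    and "!!u v. [|u :> T; v :> T; Q u; Q v|] ==> Q (u +[T] v)" shows "Q u"
proof -
  have "Q (tcls R L M l)" if "l \<in> LS" for l using that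
  proof (induction l)
    case (Cons p l)
    then show ?case using assms by (cases p) (auto simp: tcls_Cons tcls_closed)
  qed (use assms in \<open>simp add: T_zero\<close>)
  with assms(1) show ?thesis by (auto simp: T_carrier)
qed

lemma addgen_T: "addgen T {pt x y | x y. x :> L \<and> y :> M}" unfolding addgen_def by (auto intro: T_induct)

lemma pt_add_left: "[|x :> L; x' :> L; y \<in> carrier M|] ==> pt (x +[L] x') y = pt x y +[T] pt x' y"
  by (simp add: ptens_def T_add tcls_eq[OF teq_add_left])

lemma pt_add_right: "[|x :> L; y :> M; y' \<in> carrier M|] ==> pt x (y +[M] y') = pt x y +[T] pt x y'"
  by (simp add: ptens_def T_add tcls_eq[OF teq_add_right])

lemma pt_balance: "[|r \<in> R; x :> L; y \<in> carrier M|] ==> pt (r *[L] x) y = pt x (r *[M] y)"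
  by (simp add: ptens_def tcls_eq[OF teq_smult])

lemma smult_pt: "[|c \<in> R'; x :> L; y \<in> carrier M|] ==> c *[T] pt x y = pt (c *[L] x) y"
  by (simp add: ptens_def T_smult)

lemma pt_zero_left: "y :> M ==> pt 0[L] y = 0[T]" by (simp add: ptens_def T_zero tcls_eq[OF teq_zero])

text \<open>The monoid laws are list manipulations; only negatives need an argument, and negating
  the left entry negates a pure tensor.\<close>

lemma abelian_group_T: "abelian_group T"
proof -
  interpret T: abelian_monoid T by (rule abelian_monoid_T)
  have "\<exists>v\<in>carrier T. v +[T] u = 0[T]" if "u :> T" for u using that
  proof (induction u rule: T_induct)
    case (pure x y)
    then have "pt (\<ominus>\<^bsub>L\<^esub> x) y +[T] pt x y = 0[T]"
      by (simp add: pt_add_left[symmetric] L.l_neg pt_zero_left)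
    with pure show ?case by (intro bexI[of _ "pt (\<ominus>\<^bsub>L\<^esub> x) y"]) auto
  next
    case (add u v)
    then obtain u' v' where uv: "u' :> T" "v' :> T" "u' +[T] u = 0[T]" "v' +[T] v = 0[T]" by blast
    from uv(1,2) have "(u' +[T] v') +[T] (u +[T] v) = (u' +[T] u) +[T] (v' +[T] v)" using add(1,2) by (simp add: T.a_ac)
    with uv add show ?case by (intro bexI[of _ "u' +[T] v'"]) auto
  qed (auto intro: bexI[of _ "0[T]"])
  then show ?thesis by (intro abelian_groupI) (auto simp: T.a_ac)
qed

lemma smult_T_closed: "[|c \<in> R'; u \<in> carrier T|] ==> c *[T] u :> T"
  by (fastforce simp: T_carrier T_smult in_lists_conv_set intro!: imageI)

lemma smult_T_add: assumes "c \<in> R'" "u :> T" "v :> T"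
  shows "c *[T] (u +[T] v) = c *[T] u +[T] c *[T] v"
proof -
  obtain l k where lk: "l \<in> LS" "k \<in> LS" "u = tcls R L M l" "v = tcls R L M k" using assms by (auto simp: T_carrier)
  moreover have "map (%(x, y). (c *[L] x, y)) l \<in> LS" "map (%(x, y). (c *[L] x, y)) k \<in> LS"
    using assms(1) lk by (auto simp: in_lists_conv_set)
  ultimately show ?thesis using assms(1) by (simp add: T_add T_smult)
qed

lemma rmod_T: "rmod R' T"
proof -
  interpret T: abelian_group T by (rule abelian_group_T)
  have z: "c *[T] 0[T] = 0[T]" if "c \<in> R'" for c using that by (simp add: T_zero T_smult)
  show ?thesis
  proof (rule rmodI[OF L.is_sring abelian_group_T])
    fix a b u assume a: "a \<in> R'" "b \<in> R'" and u: "u :> T"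
    from u show "(a + b) *[T] u = a *[T] u +[T] b *[T] u"
    proof (induction u rule: T_induct)
      case (add u v)
      then show ?case using a by (simp add: smult_T_add smult_T_closed T.a_ac)
    qed (use a z in \<open>auto simp: smult_pt L.smult_l_distr pt_add_left\<close>)
    from u show "a *[T] (b *[T] u) = (a * b) *[T] u"
      by (induction u rule: T_induct) (use a z in \<open>auto simp: smult_pt L.smult_smult smult_T_add smult_T_closed\<close>)
  next
    fix u assume "u :> T"
    then show "1 *[T] u = u" by (induction u rule: T_induct) (auto simp: smult_pt smult_T_add z)
  qed (auto simp: smult_T_closed smult_T_add)
qed

lemma addhom_pt_left: "y :> M ==> addhom L T (%x. pt x y)" by (auto intro!: addhomI simp: pt_add_left)

lemma addhom_pt_right: "x :> L ==> addhom M T (%y. pt x y)" by (auto intro!: addhomI simp: pt_add_right)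

lemma pt_zero_right: "x :> L ==> pt x 0[M] = 0[T]" using addhom_zero[OF M.is_abgroup abelian_group_T addhom_pt_right] .

lemma pt_diff_left: "[|x :> L; x' :> L; y \<in> carrier M|] ==> pt (x -[L] x') y = pt x y -[T] pt x' y"
  using addhom_diff[OF L.is_abgroup abelian_group_T addhom_pt_left] .

lemma pt_diff_right: "[|x :> L; y :> M; y' \<in> carrier M|] ==> pt x (y -[M] y') = pt x y -[T] pt x y'"
  using addhom_diff[OF M.is_abgroup abelian_group_T addhom_pt_right] .

lemma smult_pt_right: "[|c \<in> R; x :> L; y \<in> carrier M|] ==> c *[T] pt x y = pt x (c *[M] y)"
  by (simp add: smult_pt pt_balance)

section \<open>Universal property of the tensor product\<close>

context
  fixes P :: "('r, 'p, 'z) module_scheme" and beta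
  assumes P: "abelian_group P" and beta: "balanced R L M P beta"
begin

interpretation P: abelian_group P by (rule P)

private abbreviation (input) "ev l \<equiv> foldr (%(x, y) z. beta x y +[P] z) l 0[P]"

lemma ev_closed: "l \<in> LS ==> ev l :> P" by (induction l) (auto intro!: P.a_closed simp: balancedD(1)[OF beta])

lemma ev_append: "l \<in> LS ==> k \<in> LS ==> ev (l @ k) = ev l +[P] ev k"
proof (induction l)
  case (Cons p l)
  then show ?case using ev_closed[of l] ev_closed[of k] by (cases p) (auto simp: P.a_assoc balancedD(1)[OF beta])
qed (use ev_closed in auto)

text \<open>Each generating relation of \<open>teq\<close> is one that a balanced biadditive map
  respects, so folding a list into \<open>P\<close> depends on its class only.\<close>

lemma ev_teq: "teq R L M l l' ==> ev l = ev l'"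
proof (induction rule: teq.induct)
  case (teq_append l l' k k')
  then show ?case using teq_lists ev_append by metis
next
  case (teq_swap l k)
  then show ?case by (simp only: ev_append P.a_comm ev_closed)
next
  case (teq_zero y)
  have "addhom L P (%x. beta x y)" using balancedD[OF beta] teq_zero by (intro addhomI) auto
  from addhom_zero[OF L.is_abgroup P this] show ?case by simp
qed (use balancedD[OF beta] in auto)

lemma tlift_tcls: "l \<in> LS ==> tlift P beta (tcls R L M l) = ev l" using ev_teq[OF teq_the_list] by (simp add: tlift_def)

lemma tlift_pt: "x :> L ==> y :> M ==> tlift P beta (pt x y) = beta x y"
  using tlift_tcls[of "[(x, y)]"] balancedD(1)[OF beta] by (simp add: ptens_def)

lemma addhom_tlift: "addhom T P (tlift P beta)"
  by (rule addhomI) (auto simp: T_carrier T_add tlift_tcls ev_append simp del: foldr_append intro: ev_closed)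

text \<open>Multiplication by \<open>c\<close> on the target is represented by an arbitrary additive
  \<open>h\<close>, so nothing is demanded of the scalars of \<open>P\<close>. The proof compares
  both sides on pure tensors.\<close>

lemma tlift_smult: assumes "!!x y. x :> L ==> y :> M ==> beta (c *[L] x) y = h (beta x y)"
    and "addhom P P h" "c \<in> R'" "u :> T" shows "tlift P beta (c *[T] u) = h (tlift P beta u)" using assms(4)
proof (induction u rule: T_induct)
  case zero
  have "c *[T] 0[T] = 0[T]" using rmod.smult_r_null[OF rmod_T assms(3)] .
  moreover have "tlift P beta 0[T] = 0[P]" using addhom_zero[OF abelian_group_T P addhom_tlift] .
  ultimately show ?case using addhom_zero[OF P P assms(2)] by simp
next
  case (pure x y)
  then show ?case using assms(1,3) by (simp add: smult_pt tlift_pt)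
next
  case (add u v)
  then show ?case using assms(2,3) addhom_closed[OF addhom_tlift]
    by (simp add: smult_T_add smult_T_closed addhom_add[OF addhom_tlift] addhom_add[OF assms(2)])
qed

end

lemma tmap_tlift: assumes T': "tpair R'' R L' M'" and u: "u :> T"
    and f: "!!x. x :> L ==> f x :> L'" and g: "!!y. y :> M ==> g y :> M'"
  shows "tmap R L' M' f g u = tlift (tens R L' M') (%x y. ptens R L' M' (f x) (g y)) u"
proof -
  interpret T': tpair R'' R L' M' by fact
  have "tcls R L' M' (map (map_prod f g) l) =
      foldr (%(x, y) z. ptens R L' M' (f x) (g y) +[tens R L' M'] z) l 0[tens R L' M']"
    if "l \<in> LS" for l using that
  proof (induction l)
    case (Cons p l)
    then have "map (map_prod f g) l \<in> lists (carrier L' \<times> carrier M')" using f g by (auto simp: in_lists_conv_set)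
    with Cons show ?case using f g by (cases p) (auto simp: T'.tcls_Cons)
  qed (simp add: T'.T_zero)
  with T_the_list[OF u] show ?thesis by (simp add: tmap_def tlift_def)
qed

text \<open>Semilinear along a common map \<^term>\<open>rho\<close> of scalars is what makes \<^term>\<open>tmap\<close> well defined.\<close>

lemma assumes T': "tpair R'' R L' M'" and f: "addhom L L' f" and g: "addhom M M' g"
    and rho: "!!r. r \<in> R ==> rho r \<in> R"
      "!!r x. r \<in> R ==> x :> L ==> f (r *[L] x) = rho r *[L'] f x"
      "!!r y. r \<in> R ==> y :> M ==> g (r *[M] y) = rho r *[M'] g y"
  shows tmap_pt: "x :> L ==> y :> M ==> tmap R L' M' f g (pt x y) = ptens R L' M' (f x) (g y)"
    and addhom_tmap: "addhom T (tens R L' M') (tmap R L' M' f g)"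
proof -
  interpret T': tpair R'' R L' M' by fact
  note c = addhom_closed[OF f] addhom_closed[OF g]
  have b: "balanced R L M (tens R L' M') (%x y. ptens R L' M' (f x) (g y))" by (rule balancedI)
      (auto simp: c rho addhom_add[OF f] addhom_add[OF g] T'.pt_add_left T'.pt_add_right T'.pt_balance)
  show "x :> L ==> y :> M ==> tmap R L' M' f g (pt x y) = ptens R L' M' (f x) (g y)"
    using tmap_tlift[OF T', of "pt x y" f g] c tlift_pt[OF T'.abelian_group_T b] by simp
  show "addhom T (tens R L' M') (tmap R L' M' f g)"
    using addhom_tlift[OF T'.abelian_group_T b] tmap_tlift[OF T', of _ f g] c abelian_groupE(1)[OF abelian_group_T]
    by (auto simp: addhom_def Pi_def)
qed

text \<open>The coordinate at \<open>(i, j)\<close> of a pure tensor is the product of the two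
  coordinates, which is balanced and hence extends to all tensors. Its target is \<open>reg\<close>,
  the whole type as a module; that the values lie in \<open>R'\<close> is a separate
  induction.\<close>

lemma dbasis_T: assumes e: "dbasis R' L I e k" and f: "dbasis R M J f m"
  shows "dbasis R' T (I \<times> J) (%(i, j). pt (e i) (f j)) (%(i, j). tlift reg (%x y. k i x * m j y))"
proof -
  interpret T: rmod R' T by (rule rmod_T)
  note D = dbasisD[OF e] and D' = dbasisD[OF f]
  note reg = rmod.is_abgroup[OF rmod_reg]
  let ?kap = "%(i, j). tlift reg (%x y. k i x * m j y)" and ?b = "%(i, j). pt (e i) (f j)"
  have b: "balanced R L M reg (%x y. k i x * m j y)" if "i \<in> I" "j \<in> J" for i j
    by (rule balancedI) (use that D(4,5) D'(4,5) in \<open>auto simp: algebra_simps\<close>)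
  note kap_pt = tlift_pt[OF reg b] and kap_add = addhom_add[OF addhom_tlift[OF reg b]]
  have kap_zero: "tlift reg (%x y. k i x * m j y) 0[T] = 0" if "i \<in> I" "j \<in> J" for i j
    using addhom_zero[OF abelian_group_T reg addhom_tlift[OF reg b[OF that]]] by simp
  have kap_R [simp]: "tlift reg (%x y. k i x * m j y) u \<in> R'" if "i \<in> I" "j \<in> J" "u :> T" for i j u
    using that(3) by (induction u rule: T_induct)
      (use that(1,2) kap_zero kap_add D(3) D'(3) in \<open>auto simp: kap_pt\<close>)
  have expand: "u = finsum T (%q. ?kap q u *[T] ?b q) (I \<times> J)" if "u :> T" for u using that
  proof (induction u rule: T_induct)
    case zero
    have "finsum T (%q. ?kap q 0[T] *[T] ?b q) (I \<times> J) = finsum T (%q. 0[T]) (I \<times> J)"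
      using D(2) D'(2) kap_zero by (intro T.finsum_cong') auto
    then show ?case by simp
  next
    case (pure x y)
    have 1: "pt (e i) y = finsum T (%j. m j y *[T] pt (e i) (f j)) J" if "i \<in> I" for i
    proof -
      have "pt (e i) y = pt (e i) (finsum M (%j. m j y *[M] f j) J)" using D'(7) pure by simp
      also have "... = finsum T (%j. pt (e i) (m j y *[M] f j)) J"
        using D' pure by (intro addhom_finsum[OF M.is_abgroup abelian_group_T addhom_pt_right[OF D(2)[OF that]]]) auto
      also have "... = finsum T (%j. m j y *[T] pt (e i) (f j)) J"
        using D D' pure that by (intro T.finsum_cong') (auto simp: smult_pt_right)
      finally show ?thesis .
    qed
    have "pt x y = pt (finsum L (%i. k i x *[L] e i) I) y" using D(7) pure by simp
    also have "... = finsum T (%i. pt (k i x *[L] e i) y) I"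
      using D pure by (intro addhom_finsum[OF L.is_abgroup abelian_group_T addhom_pt_left[OF pure(2)]]) auto
    also have "... = finsum T (%i. finsum T (%j. (k i x * m j y) *[T] pt (e i) (f j)) J) I"
    proof (intro T.finsum_cong')
      fix i assume i: "i \<in> I"
      have "pt (k i x *[L] e i) y = k i x *[T] pt (e i) y" using D pure i by (simp add: smult_pt)
      also have "... = finsum T (%j. k i x *[T] (m j y *[T] pt (e i) (f j))) J"
        unfolding 1[OF i] using D D' pure i by (intro T.smult_finsum) auto
      also have "... = finsum T (%j. (k i x * m j y) *[T] pt (e i) (f j)) J"
        using D D' pure i by (intro T.finsum_cong') (auto simp: T.smult_smult)
      finally show "pt (k i x *[L] e i) y = finsum T (%j. (k i x * m j y) *[T] pt (e i) (f j)) J" .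
    qed (use D D' pure in \<open>auto intro!: T.finsum_closed\<close>)
    also have "... = finsum T (%(i, j). (k i x * m j y) *[T] pt (e i) (f j)) (I \<times> J)"
      using D D' pure by (intro T.finsum_Times[symmetric]) auto
    also have "... = finsum T (%q. ?kap q (pt x y) *[T] ?b q) (I \<times> J)"
      using D D' pure by (intro T.finsum_cong') (auto simp: kap_pt)
    finally show ?case .
  next
    case (add u v)
    have "finsum T (%q. ?kap q (u +[T] v) *[T] ?b q) (I \<times> J) =
        finsum T (%q. ?kap q u *[T] ?b q +[T] ?kap q v *[T] ?b q) (I \<times> J)"
      using add(1,2) kap_add D(2) D'(2) by (intro T.finsum_cong') (auto simp: T.smult_l_distr)
    also have "... = u +[T] v" using add(1,2) D(2) D'(2) by (subst T.finsum_addf) (auto simp: add(3,4)[symmetric])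
    finally show ?case by simp
  qed
  show ?thesis unfolding dbasis_def
  proof (intro conjI ballI)
    show "finite (I \<times> J)" using D D' by auto
    fix q assume q: "q \<in> I \<times> J"
    show "?b q :> T" using q D D' by auto
    {
      fix q' assume "q' \<in> I \<times> J"
      with q show "?kap q (?b q') = (if q = q' then 1 else 0)" using D(2,6) D'(2,6) by (auto simp: kap_pt split: if_splits)
    }
    fix u assume u: "u :> T"
    show "?kap q u \<in> R'" using q kap_R u by auto
    {
      fix v assume "v :> T"
      with q u show "?kap q (u +[T] v) = ?kap q u + ?kap q v" by (auto simp: kap_add)
    }
    {
      fix c assume c: "c \<in> R'"
      obtain i j where ij: "q = (i, j)" "i \<in> I" "j \<in> J" using q by auto
      have "addhom reg reg ((*) c)" by (auto intro!: addhomI simp: algebra_simps)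
      then show "?kap q (c *[T] u) = c * ?kap q u"
        using tlift_smult[OF reg b[OF ij(2,3)], of c "(*) c" u] D(5) c u ij by (simp add: mult.assoc)
    }
  qed (use expand in auto)
qed

end

text \<open>Representatives of either factor change by powers of \<open>s\<close>, and such powers
  move freely across the tensor sign, so the union in \<open>loc_pure\<close> runs over a constant
  family.\<close>

lemma loc_pure_lfrac:
  fixes R R' :: "'r::idom set" and L :: "('r, ('r, 'b) univ, 'x) module_scheme"
    and M :: "('r, ('r, 'b) univ, 'y) module_scheme"
  defines "T \<equiv> tens R L M" and "pt \<equiv> ptens R L M"
  assumes tp: "tpair R' R L M" and "lmod R' L s" "lmod R M s" "lmod R' T s" and xy: "x :> L" "y :> M"
  shows "loc_pure R L M s (lfrac L s x m) (lfrac M s y n) = lfrac T s (pt x y) (m + n)"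
proof -
  interpret tpair R' R L M by fact
  note defs = T_def pt_def
  interpret LL: lmod R' L s by fact
  interpret MM: lmod R M s by fact
  interpret TT: lmod R' T s by fact
  have "lfrac T s (pt x' y') (m' + n') = lfrac T s (pt x y) (m + n)"
    if "(x', m') \<in> lfrac L s x m" "(y', n') \<in> lfrac M s y n" for x' m' y' n'
  proof -
    from that xy have x: "x' :> L" "s ^ m' *[L] x = s ^ m *[L] x'"
      and y: "y' :> M" "s ^ n' *[M] y = s ^ n *[M] y'" by (auto simp: LL.lfrac_mem MM.lfrac_mem)
    have *: "s ^ (a + b) *[T] pt z z' = pt (s ^ a *[L] z) (s ^ b *[M] z')"
      if "z :> L" "z' :> M" for a b z z'
      using that by (simp add: defs power_add pt_balance[symmetric] smult_pt L.smult_smult mult.commute)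
    have [simp]: "pt a b :> T" if "a :> L" "b :> M" for a b using that by (auto simp: defs)
    show ?thesis using x y xy by (subst TT.lfrac_eq) (auto simp: *)
  qed
  then have "loc_pure R L M s (lfrac L s x m) (lfrac M s y n) =
      (\<Union>(x', m')\<in>lfrac L s x m. \<Union>(y', n')\<in>lfrac M s y n. lfrac T s (pt x y) (m + n))"
    unfolding loc_pure_def defs by (intro SUP_cong) auto
  then show ?thesis using LL.lfrac_self[OF xy(1), of m] MM.lfrac_self[OF xy(2), of n] by auto
qed

section \<open>Wach modules over a base\<close>

text \<open>The scalar map \<open>rho\<close> lets the same lemma serve linear maps and the
  semilinear group action.\<close>

lemma span_map: assumes "rmod R X" "rmod R' Y" "addhom X Y f"
    and "!!c x. [|c \<in> R; x \<in> carrier X|] ==> f (c *[X] x) = rho c *[Y] f x" "!!c. c \<in> R ==> rho c \<in> R'"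
    and "Z \<subseteq> carrier X" "Z' \<subseteq> carrier Y" "!!z. z \<in> Z ==> f z \<in> span_on R' Y Z'"
    and "x \<in> span_on R X Z" shows "f x \<in> span_on R' Y Z'"
proof -
  interpret X: rmod R X by fact
  interpret Y: rmod R' Y by fact
  note Xc = X.span_closed[OF assms(6)] and Yc = Y.span_closed[OF assms(7)]
  show ?thesis using assms(9,6)
  proof (induction x rule: X.span_induct)
    case zero
    then show ?case using Yc(2) addhom_zero[OF X.is_abgroup Y.is_abgroup assms(3)] by simp
  next
    case (add x y)
    then have "x :> X" "y :> X" using Xc(1) by auto
    with add show ?case using addhom_add[OF assms(3)] Yc(3) by simp
  next
    case (smult c x)
    then have "x :> X" using Xc(1) by auto
    with smult show ?case using assms(4,5) Yc(4) by simp
  qed (use assms(8) in auto)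
qed

abbreviation regon :: "'r::comm_ring_1 set => ('r, 'r) module" where
  "regon R \<equiv> reg\<lparr>carrier := R\<rparr>"

lemma (in sring) rmod_regon: "rmod R (regon R)" by (rule rmodI[OF sring_axioms]; (rule abelian_groupI)?)
    (auto simp: algebra_simps intro: bexI[where x = "- x" for x])

text \<open>\<^term>\<open>w\<close> is \<^term>\<open>b_frob B (b_mu B) / b_mu B\<close>, and \<^term>\<open>U\<close> is a fundamental system of
  neighbourhoods of the identity.\<close>

locale wbase =
  fixes B :: "('r::idom, 'g) wach_base" and w :: 'r and U :: "nat => 'g set"
  assumes sring_B: "sring (b_scal B)"
    and frob_R [simp]: "c \<in> b_scal B ==> b_frob B c \<in> b_scal B"
    and frob_1 [simp]: "b_frob B 1 = 1"
    and frob_add: "[|c \<in> b_scal B; d \<in> b_scal B|] ==> b_frob B (c + d) = b_frob B c + b_frob B d"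
    and frob_mult: "[|c \<in> b_scal B; d \<in> b_scal B|] ==> b_frob B (c * d) = b_frob B c * b_frob B d"
    and grp: "group (b_grp B)"
    and act_R [simp]: "[|g :> b_grp B; c \<in> b_scal B|] ==> b_act B g c \<in> b_scal B"
    and act_1 [simp]: "g :> b_grp B ==> b_act B g 1 = 1"
    and act_add: "[|g :> b_grp B; c \<in> b_scal B; d \<in> b_scal B|] ==>
      b_act B g (c + d) = b_act B g c + b_act B g d"
    and act_mult: "[|g :> b_grp B; c \<in> b_scal B; d \<in> b_scal B|] ==>
      b_act B g (c * d) = b_act B g c * b_act B g d"
    and act_one [simp]: "c \<in> b_scal B ==> b_act B \<one>\<^bsub>b_grp B\<^esub> c = c"
    and act_comp: "[|g :> b_grp B; h :> b_grp B; c \<in> b_scal B|] ==>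
      b_act B (g \<otimes>\<^bsub>b_grp B\<^esub> h) c = b_act B g (b_act B h c)"
    and act_frob: "[|g :> b_grp B; c \<in> b_scal B|] ==>
      b_act B g (b_frob B c) = b_frob B (b_act B g c)"
    and mu_R [simp]: "b_mu B \<in> b_scal B" and mu_nz [simp]: "b_mu B \<noteq> 0"
    and w_R [simp]: "w \<in> b_scal B" and w_nz [simp]: "w \<noteq> 0" and frob_mu: "b_frob B (b_mu B) = b_mu B * w"
    and xi_R [simp]: "b_xi B \<in> b_scal B"
    and xi_dvd_w: "\<exists>c\<in>b_scal B. w = b_xi B * c" and w_dvd_xi: "\<exists>c\<in>b_scal B. \<exists>n. w * c = b_xi B ^ n"
    and act_mod: "[|g :> b_grp B; c \<in> b_scal B|] ==> \<exists>d\<in>b_scal B. b_act B g c - c = b_mu B * d"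
    and topspace_B: "topspace (b_top B) = carrier (b_grp B)"
    and open_nbhd: "[|openin (b_top B) W; g \<in> W|] ==> \<exists>m. \<forall>h\<in>U m. g \<otimes>\<^bsub>b_grp B\<^esub> h \<in> W"
    and nbhd_open: "g :> b_grp B ==> openin (b_top B) ((\<otimes>\<^bsub>b_grp B\<^esub>) g ` U m)"
    and U_sub: "U m \<subseteq> carrier (b_grp B)" and one_U: "\<one>\<^bsub>b_grp B\<^esub> \<in> U m" and U_mono: "m \<le> n ==> U n \<subseteq> U m"
    and act_cont: "c \<in> b_scal B ==> \<exists>m. \<forall>g\<in>U m. b_act B g c - c \<in> adic_power B (regon (b_scal B)) n"
begin

abbreviation (input) "R \<equiv> b_scal B"
abbreviation (input) "phi \<equiv> b_frob B"
abbreviation (input) "act \<equiv> b_act B"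
abbreviation (input) "G \<equiv> b_grp B"
abbreviation (input) "mu \<equiv> b_mu B"

sublocale sring R by (rule sring_B)

sublocale G: group G by (rule grp)

lemma U_carrier [simp]: "g \<in> U m ==> g :> G" using U_sub by auto

lemma frob_power: "c \<in> R ==> phi (c ^ n) = phi c ^ n" by (induction n) (auto simp: frob_mult)

lemma act_power: "g :> G ==> c \<in> R ==> act g (c ^ n) = act g c ^ n" by (induction n) (auto simp: act_mult)

lemma act_0 [simp]: "g :> G ==> act g 0 = 0" using act_add[of g 0 0] add_cancel_right_right by (metis add_0 zero_R)

lemma frob_0 [simp]: "phi 0 = 0" using frob_add[of 0 0] add_cancel_right_right by (metis add_0 zero_R)

lemma act_of_nat [simp]: "g :> G ==> act g (of_nat n) = of_nat n" by (induction n) (auto simp: act_add)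

lemma act_inv [simp]: "g :> G ==> c \<in> R ==> act g (act (inv\<^bsub>G\<^esub> g) c) = c"
  by (simp add: act_comp[symmetric])

lemma frob_mu_R [simp]: "phi mu \<in> R" and frob_mu_nz [simp]: "phi mu \<noteq> 0" by (simp_all add: frob_mu)

text \<open>Triviality modulo \<open>mu\<close>, applied to \<open>g\<close>, makes
  \<open>act g mu\<close> a multiple \<open>v * mu\<close>; applied to the inverse of
  \<open>g\<close> it supplies \<open>v'\<close>, so \<open>v\<close> is a unit. Since the action
  commutes with Frobenius, \<open>w\<close> transforms by the factor \<open>phi v / v\<close>; the
  equivariance computations use it in this form.\<close>

lemma act_mu: assumes g: "g :> G"
  obtains v v' where "v \<in> R" "v' \<in> R" "v * v' = 1" "act g mu = v * mu" "act g (phi mu) = phi v * phi mu"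
    "phi v * phi v' = 1" "act g w * v = phi v * w" "v \<noteq> 0" "phi v \<noteq> 0" "act g w \<noteq> 0"
proof -
  obtain c where c: "c \<in> R" "act g mu - mu = mu * c" using act_mod[OF g mu_R] by blast
  obtain d where d: "d \<in> R" "act (inv\<^bsub>G\<^esub> g) mu - mu = mu * d" using act_mod[of "inv\<^bsub>G\<^esub> g" mu] g by auto
  define v v' where "v = 1 + c" and "v' = act g (1 + d)"
  have v: "v \<in> R" "v' \<in> R" "act g mu = v * mu" using c d g by (auto simp: v_def v'_def algebra_simps)
  have "mu = act g ((1 + d) * mu)" using act_inv[OF g mu_R] d by (simp add: algebra_simps)
  also have "... = v' * (v * mu)" using d g v by (simp add: act_mult v'_def)
  finally have vv: "v * v' = 1" by (metis mult.assoc mult.commute mult_cancel_right1 mu_nz)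
  have fv: "act g (phi mu) = phi v * phi mu" using g v by (simp add: act_frob frob_mult)
  have fvv: "phi v * phi v' = 1" using v vv frob_mult[of v v'] by simp
  have "v * mu * act g w = phi v * (mu * w)" using fv g v by (simp add: frob_mu act_mult)
  then have vw: "act g w * v = phi v * w" by (simp add: mult_ac)
  have nz: "v \<noteq> 0" "phi v \<noteq> 0" using vv fvv by auto
  then have "act g w \<noteq> 0" using vw by auto
  with v vv fv fvv vw nz that show thesis by blast
qed

section \<open>The (p, mu)-adic filtration and continuity of the action\<close>

definition adic_gens where
  "adic_gens N n = {(of_nat (b_prime B) ^ i * mu ^ (n - i)) *[N] x | i x. i \<le> n \<and> x :> N}"

lemma adic_power_eq: "adic_power B N n = span_on R N (adic_gens N n)" by (simp add: adic_power_def adic_gens_def)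

lemma adic_gens_carrier: "rmod R N ==> adic_gens N n \<subseteq> carrier N"
  by (auto simp: adic_gens_def intro!: rmod.smult_closed)

lemma adic_closed: assumes "rmod R N"
  shows "a \<in> adic_power B N n ==> a :> N" "0[N] \<in> adic_power B N n"
    "[|a \<in> adic_power B N n; b \<in> adic_power B N n|] ==> a +[N] b \<in> adic_power B N n"
    "[|c \<in> R; a \<in> adic_power B N n|] ==> c *[N] a \<in> adic_power B N n"
  using rmod.span_closed[OF assms adic_gens_carrier[OF assms]] by (auto simp: adic_power_eq)

lemma adic_genI: "i \<le> n ==> x :> N ==> (of_nat (b_prime B) ^ i * mu ^ (n - i)) *[N] x \<in> adic_power B N n"
  unfolding adic_power_eq adic_gens_def by (rule span_on_incl) blast


lemma adic_map: assumes "rmod R X" "rmod R Y" "addhom X Y f"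
    and "!!c x. [|c \<in> R; x \<in> carrier X|] ==> f (c *[X] x) = rho c *[Y] f x" "!!c. c \<in> R ==> rho c \<in> R"
    and "!!i z. i \<le> n ==> z :> X ==>
      f ((of_nat (b_prime B) ^ i * mu ^ (n - i)) *[X] z) \<in> adic_power B Y m"
    and "x \<in> adic_power B X n" shows "f x \<in> adic_power B Y m" unfolding adic_power_eq
  by (rule span_map[OF assms(1-5) adic_gens_carrier[OF assms(1)] adic_gens_carrier[OF assms(2)] _
        assms(7)[unfolded adic_power_eq]])
    (use assms(6) in \<open>auto simp: adic_gens_def adic_power_eq\<close>)

lemma adic_lin_map: assumes "rmod R X" "rmod R Y" "addhom X Y f"
    and "!!c x. [|c \<in> R; x \<in> carrier X|] ==> f (c *[X] x) = c *[Y] f x"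
    and "x \<in> adic_power B X n" shows "f x \<in> adic_power B Y n" by (rule adic_map[OF assms(1-3), of "%c. c"])
    (use assms in \<open>auto intro!: adic_genI simp: addhom_closed[OF assms(3)]\<close>)

text \<open>From a monomial of degree \<open>n + 1\<close> in \<open>p\<close> and \<open>mu\<close>
  one factor is moved to the vector: a \<open>mu\<close> if there is one, otherwise a
  \<open>p\<close>.\<close>

lemma adic_antimono: "m \<le> n ==> rmod R N ==> adic_power B N n \<subseteq> adic_power B N m"
proof (induction n rule: dec_induct)
  case (step n)
  interpret N: rmod R N by fact
  let ?p = "of_nat (b_prime B) :: 'r"
  have "x \<in> adic_power B N n" if "x \<in> adic_power B N (Suc n)" for x
  proof (rule adic_map[of N N "%x. x" "%c. c", OF _ _ _ _ _ _ that])
    fix i x assume i: "i \<le> Suc n" and x: "x :> N"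
    show "(?p ^ i * mu ^ (Suc n - i)) *[N] x \<in> adic_power B N n"
    proof (cases "i \<le> n")
      case True
      then have "(?p ^ i * mu ^ (Suc n - i)) *[N] x = (?p ^ i * mu ^ (n - i)) *[N] (mu *[N] x)"
        using x by (simp add: N.smult_smult Suc_diff_le mult_ac)
      with True x show ?thesis using adic_genI[of i n "mu *[N] x" N] by simp
    next
      case False
      with i have "i = Suc n" by simp
      then have "(?p ^ i * mu ^ (Suc n - i)) *[N] x = (?p ^ n * mu ^ (n - n)) *[N] (?p *[N] x)"
        using x by (simp add: N.smult_smult mult_ac)
      with x show ?thesis using adic_genI[of n n "?p *[N] x" N] by simp
    qed
  qed (auto intro!: addhomI step.prems)
  with step show ?case by blast
qed simp

lemma adic_scalar: assumes "rmod R N" "c \<in> adic_power B (regon R) n" "x :> N"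
  shows "c *[N] x \<in> adic_power B N n"
proof -
  interpret N: rmod R N by fact
  show ?thesis by (rule adic_map[OF rmod_regon assms(1), of "%c. c *[N] x" "%c. c"])
      (use assms N.smult_smult[symmetric] adic_genI[of _ _ _ N] in \<open>auto intro!: addhomI simp: N.smult_l_distr\<close>)
qed

lemma actionD: assumes "semilinear_action B N" shows "g :> G ==> addhom N N (gact N g)"
    and "x :> N ==> gact N \<one>\<^bsub>G\<^esub> x = x"
    and "[|g :> G; h :> G; x \<in> carrier N|] ==> gact N (g \<otimes>\<^bsub>G\<^esub> h) x = gact N g (gact N h x)"
    and "[|g :> G; c \<in> R; x \<in> carrier N|] ==> gact N g (c *[N] x) = act g c *[N] gact N g x"
  using assms by (auto simp: semilinear_action_def addhom_def)

text \<open>\<open>g\<close> fixes \<open>p\<close> and multiplies \<open>mu\<close> by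
  \<open>v\<close>, and the power of \<open>v\<close> is absorbed into the vector.\<close>

lemma gact_adic: assumes "rmod R N" "semilinear_action B N" "g :> G" "x \<in> adic_power B N n"
  shows "gact N g x \<in> adic_power B N n"
proof -
  interpret N: rmod R N by fact
  note A = actionD[OF assms(2)]
  obtain v where v: "v \<in> R" "act g mu = v * mu" using act_mu[OF assms(3)] by metis
  show ?thesis
  proof (rule adic_map[OF assms(1,1) A(1)[OF assms(3)] A(4)[OF assms(3)] _ _ assms(4)])
    fix i z assume i: "i \<le> n" and z: "z :> N"
    have gz: "gact N g z :> N" using addhom_closed[OF A(1)] assms(3) z by blast
    let ?p = "of_nat (b_prime B) :: 'r"
    have "gact N g ((?p ^ i * mu ^ (n - i)) *[N] z) = (?p ^ i * mu ^ (n - i)) *[N] (v ^ (n - i) *[N] gact N g z)"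
      using z gz assms(3) A(4) v by (simp add: act_mult act_power N.smult_smult power_mult_distrib mult_ac)
    then show "gact N g ((?p ^ i * mu ^ (n - i)) *[N] z) \<in> adic_power B N n"
      using adic_genI[OF i, of "v ^ (n - i) *[N] gact N g z" N] gz v by simp
  qed (use assms(3) in auto)
qed

text \<open>By definition the cosets of the filtration are only a subbasis; as the filtration
  decreases, they form a basis.\<close>

lemma openin_adic_iff: assumes "rmod R N" shows "openin (adic_topology B N) W \<longleftrightarrow>
    W \<subseteq> carrier N \<and> (\<forall>x\<in>W. \<exists>n. (\<oplus>\<^bsub>N\<^esub>) x ` adic_power B N n \<subseteq> W)"
proof
  interpret N: rmod R N by fact
  note c = adic_closed[OF assms]
  let ?S = "{(\<oplus>\<^bsub>N\<^esub>) x ` adic_power B N n | x n. x :> N}"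
  assume "openin (adic_topology B N) W"
  then have "generate_topology_on ?S W" by (simp add: adic_topology_def openin_topology_generated_by_iff)
  then show "W \<subseteq> carrier N \<and> (\<forall>x\<in>W. \<exists>n. (\<oplus>\<^bsub>N\<^esub>) x ` adic_power B N n \<subseteq> W)"
  proof induction
    case (Int a b)
    show ?case
    proof (intro conjI ballI)
      fix x assume "x \<in> a \<inter> b"
      then obtain m n where "(\<oplus>\<^bsub>N\<^esub>) x ` adic_power B N m \<subseteq> a" "(\<oplus>\<^bsub>N\<^esub>) x ` adic_power B N n \<subseteq> b"
        using Int by blast
      then have "(\<oplus>\<^bsub>N\<^esub>) x ` adic_power B N (max m n) \<subseteq> a \<inter> b"
        using adic_antimono[OF _ assms, of m "max m n"] adic_antimono[OF _ assms, of n "max m n"] by force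
      then show "\<exists>n. (\<oplus>\<^bsub>N\<^esub>) x ` adic_power B N n \<subseteq> a \<inter> b" by blast
    qed (use Int in auto)
  next
    case (UN K)
    show ?case
    proof (intro conjI ballI)
      fix x assume "x \<in> \<Union> K"
      then obtain k where k: "k \<in> K" "x \<in> k" by blast
      then obtain n where "(\<oplus>\<^bsub>N\<^esub>) x ` adic_power B N n \<subseteq> k" using UN by blast
      with k show "\<exists>n. (\<oplus>\<^bsub>N\<^esub>) x ` adic_power B N n \<subseteq> \<Union> K" by blast
    qed (use UN in blast)
  next
    case (Basis s)
    then obtain x n where s: "s = (\<oplus>\<^bsub>N\<^esub>) x ` adic_power B N n" "x :> N" by blast
    have "(\<oplus>\<^bsub>N\<^esub>) y ` adic_power B N n \<subseteq> s" if "y \<in> s" for y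
    proof -
      from that s obtain a where a: "y = x +[N] a" "a \<in> adic_power B N n" by blast
      have "y +[N] b \<in> s" if b: "b \<in> adic_power B N n" for b
      proof -
        have "y +[N] b = x +[N] (a +[N] b)" using a b s by (simp add: N.a_assoc c(1))
        then show ?thesis using s c(3)[OF a(2) b] by blast
      qed
      then show ?thesis by blast
    qed
    moreover have "s \<subseteq> carrier N" using s c(1) by auto
    ultimately show ?case by blast
  qed auto
next
  interpret N: rmod R N by fact
  note c = adic_closed[OF assms]
  assume W: "W \<subseteq> carrier N \<and> (\<forall>x\<in>W. \<exists>n. (\<oplus>\<^bsub>N\<^esub>) x ` adic_power B N n \<subseteq> W)"
  then obtain k where k: "!!x. x \<in> W ==> (\<oplus>\<^bsub>N\<^esub>) x ` adic_power B N (k x) \<subseteq> W" by metis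
  have "W = \<Union> ((%x. (\<oplus>\<^bsub>N\<^esub>) x ` adic_power B N (k x)) ` W)"
  proof
    show "W \<subseteq> \<Union> ((%x. (\<oplus>\<^bsub>N\<^esub>) x ` adic_power B N (k x)) ` W)"
    proof
      fix x assume "x \<in> W"
      moreover have "x = x +[N] 0[N]" using W \<open>x \<in> W\<close> by auto
      ultimately show "x \<in> \<Union> ((%x. (\<oplus>\<^bsub>N\<^esub>) x ` adic_power B N (k x)) ` W)" using c(2) by blast
    qed
  qed (use k in blast)
  moreover have "openin (adic_topology B N) (\<Union> ((%x. (\<oplus>\<^bsub>N\<^esub>) x ` adic_power B N (k x)) ` W))"
    using W by (intro openin_Union) (auto simp: adic_topology_def intro!: topology_generated_by_Basis)
  ultimately show "openin (adic_topology B N) W" by simp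
qed

lemma topspace_adic: "rmod R N ==> topspace (adic_topology B N) = carrier N"
proof -
  assume N: "rmod R N"
  interpret N: rmod R N by fact
  have "(\<oplus>\<^bsub>N\<^esub>) x ` adic_power B N n \<subseteq> carrier N" if "x :> N" for x n
    using adic_closed(1)[OF N] that by auto
  then have "openin (adic_topology B N) (carrier N)" by (subst openin_adic_iff[OF N]) auto
  moreover have "topspace (adic_topology B N) \<subseteq> carrier N"
    using openin_adic_iff[OF N, of "topspace (adic_topology B N)"] by auto
  ultimately show ?thesis using openin_subset by blast
qed

text \<open>All group elements preserve the filtration, step by step, so joint continuity on the
  product reduces to continuity at the identity for each fixed vector. In this form it can be tested
  on generators and moved between the two bases.\<close>

lemma continuous_action_iff: assumes N: "rmod R N" and act: "semilinear_action B N"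
  shows "continuous_map (prod_topology (b_top B) (adic_topology B N)) (adic_topology B N) (%(g, x). gact N g x)
    \<longleftrightarrow> (\<forall>x\<in>carrier N. \<forall>n. \<exists>m. \<forall>g\<in>U m. gact N g x -[N] x \<in> adic_power B N n)"
proof
  interpret N: rmod R N by fact
  note A = actionD[OF act] and c = adic_closed[OF N]
  let ?A = "adic_topology B N" and ?f = "%(g, x). gact N g x"
  assume cont: "continuous_map (prod_topology (b_top B) ?A) ?A ?f"
  show "\<forall>x\<in>carrier N. \<forall>n. \<exists>m. \<forall>g\<in>U m. gact N g x -[N] x \<in> adic_power B N n"
  proof (intro ballI allI)
    fix x n assume x: "x :> N"
    let ?V = "(\<oplus>\<^bsub>N\<^esub>) x ` adic_power B N n"
    have "openin ?A ?V" using x by (auto simp: adic_topology_def intro!: topology_generated_by_Basis)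
    with cont have "openin (prod_topology (b_top B) ?A)
        {q \<in> topspace (prod_topology (b_top B) ?A). ?f q \<in> ?V}" by (rule openin_continuous_map_preimage)
    moreover have "x +[N] 0[N] = x" using x by simp
    then have "x \<in> ?V" using c(2)[of n] by (metis imageI)
    then have "(\<one>\<^bsub>G\<^esub>, x) \<in> {q \<in> topspace (prod_topology (b_top B) ?A). ?f q \<in> ?V}"
      using x A(2)[OF x] by (simp add: topspace_B topspace_adic[OF N])
    ultimately obtain W W' where W: "openin (b_top B) W" "\<one>\<^bsub>G\<^esub> \<in> W" "x \<in> W'"
      "W \<times> W' \<subseteq> {q \<in> topspace (prod_topology (b_top B) ?A). ?f q \<in> ?V}"
      unfolding openin_prod_topology_alt by meson
    obtain m where m: "!!h. h \<in> U m ==> \<one>\<^bsub>G\<^esub> \<otimes>\<^bsub>G\<^esub> h \<in> W" using open_nbhd[OF W(1,2)] by blast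
    have "gact N g x -[N] x \<in> adic_power B N n" if g: "g \<in> U m" for g
    proof -
      have "g \<in> W" using m[OF g] g by simp
      then have "gact N g x \<in> ?V" using W by auto
      then obtain a where a: "gact N g x = x +[N] a" "a \<in> adic_power B N n" by blast
      then have "gact N g x -[N] x = a" using x c(1)[of a n] by (simp add: N.minus_eq N.a_comm[of x a] N.a_assoc N.r_neg)
      with a show ?thesis by simp
    qed
    then show "\<exists>m. \<forall>g\<in>U m. gact N g x -[N] x \<in> adic_power B N n" by blast
  qed
next
  interpret N: rmod R N by fact
  note A = actionD[OF act] and c = adic_closed[OF N]
  note [simp] = addhom_closed[OF A(1)]
  let ?A = "adic_topology B N" and ?f = "%(g, x). gact N g x"
  assume cont: "\<forall>x\<in>carrier N. \<forall>n. \<exists>m. \<forall>g\<in>U m. gact N g x -[N] x \<in> adic_power B N n"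
  show "continuous_map (prod_topology (b_top B) ?A) ?A ?f" unfolding continuous_map_def
  proof (intro conjI allI impI)
    show "?f \<in> topspace (prod_topology (b_top B) ?A) \<rightarrow> topspace ?A"
      by (auto simp: topspace_B topspace_adic[OF N])
    fix V assume V: "openin ?A V"
    show "openin (prod_topology (b_top B) ?A) {q \<in> topspace (prod_topology (b_top B) ?A). ?f q \<in> V}"
      unfolding openin_prod_topology_alt
    proof (intro allI impI)
      fix g x assume "(g, x) \<in> {q \<in> topspace (prod_topology (b_top B) ?A). ?f q \<in> V}"
      then have gx: "g :> G" "x :> N" "gact N g x \<in> V" by (auto simp: topspace_B topspace_adic[OF N])
      obtain n where n: "(\<oplus>\<^bsub>N\<^esub>) (gact N g x) ` adic_power B N n \<subseteq> V"
        using V gx by (auto simp: openin_adic_iff[OF N])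
      obtain m where m: "!!h. h \<in> U m ==> gact N h x -[N] x \<in> adic_power B N n" using cont gx by blast
      let ?W = "(\<otimes>\<^bsub>G\<^esub>) g ` U m" and ?W' = "(\<oplus>\<^bsub>N\<^esub>) x ` adic_power B N n"
      \<comment> \<open>Expanded as \<open>g x\<close> plus the errors \<open>g (h x - x)\<close>
        and \<open>(g h) a\<close>. Both errors stay in step \<open>n\<close> of the
        filtration.\<close>
      have "gact N (g \<otimes>\<^bsub>G\<^esub> h) (x +[N] a) \<in> V" if h: "h \<in> U m" and a: "a \<in> adic_power B N n" for h a
      proof -
        have hc: "h :> G" and ac: "a :> N" using h a c(1) by auto
        have "gact N h x = x +[N] (gact N h x -[N] x)" using gx hc by (simp add: N.add_diff_cancel)
        then have "gact N g (gact N h x) = gact N g x +[N] gact N g (gact N h x -[N] x)"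
          using gx hc addhom_add[OF A(1)[OF gx(1)], of x "gact N h x -[N] x"] by simp
        moreover have "gact N (g \<otimes>\<^bsub>G\<^esub> h) (x +[N] a) = gact N g (gact N h x) +[N] gact N (g \<otimes>\<^bsub>G\<^esub> h) a"
          using gx hc ac A(3) addhom_add[OF A(1)] by simp
        ultimately have "gact N (g \<otimes>\<^bsub>G\<^esub> h) (x +[N] a) =
            gact N g x +[N] (gact N g (gact N h x -[N] x) +[N] gact N (g \<otimes>\<^bsub>G\<^esub> h) a)"
          using gx hc ac by (simp add: N.a_assoc)
        moreover have "gact N g (gact N h x -[N] x) +[N] gact N (g \<otimes>\<^bsub>G\<^esub> h) a \<in> adic_power B N n"
          by (intro c(3) gact_adic[OF N act]) (use gx hc m[OF h] a in auto)
        ultimately show ?thesis using n by auto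
      qed
      moreover have "g \<in> ?W" using one_U[of m] gx by force
      moreover have "x +[N] 0[N] = x" using gx by simp
      then have "x \<in> ?W'" using c(2)[of n] by (metis imageI)
      moreover have "openin ?A ?W'" using gx by (auto simp: adic_topology_def intro!: topology_generated_by_Basis)
      moreover have "?W \<times> ?W' \<subseteq> topspace (prod_topology (b_top B) ?A)"
        using gx c(1) by (auto simp: topspace_B topspace_adic[OF N])
      ultimately show "\<exists>W W'. openin (b_top B) W \<and> openin ?A W' \<and> g \<in> W \<and> x \<in> W' \<and>
          W \<times> W' \<subseteq> {q \<in> topspace (prod_topology (b_top B) ?A). ?f q \<in> V}"
        using nbhd_open[OF gx(1), of m] by (intro exI[of _ ?W] exI[of _ ?W']) fast
    qed
  qed
qed

lemma cont_gen: assumes N: "rmod R N" and act: "semilinear_action B N" and gen: "addgen N Z"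
    and Z: "!!z n. z \<in> Z ==> \<exists>m. \<forall>g\<in>U m. gact N g z -[N] z \<in> adic_power B N n"
    and x: "x :> N" shows "\<exists>m. \<forall>g\<in>U m. gact N g x -[N] x \<in> adic_power B N n" using gen x
proof (induction x rule: addgen_induct)
  case zero
  interpret N: rmod R N by fact
  have "gact N g 0[N] = 0[N]" if "g :> G" for g using addhom_zero[OF N.is_abgroup N.is_abgroup actionD(1)[OF act that]] .
  then show ?case using adic_closed(2)[OF N, of n] N.diff_zero_iff[of "0[N]" "0[N]"] by auto
next
  case (add x y)
  interpret N: rmod R N by fact
  note A = actionD[OF act]
  note [simp] = addhom_closed[OF A(1)] addhom_add[OF A(1)]
  from add obtain m m' where m: "!!g. g \<in> U m ==> gact N g x -[N] x \<in> adic_power B N n"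
    "!!g. g \<in> U m' ==> gact N g y -[N] y \<in> adic_power B N n" by blast
  have "gact N g (x +[N] y) -[N] (x +[N] y) \<in> adic_power B N n" if g: "g \<in> U (max m m')" for g
  proof -
    have "g \<in> U m" "g \<in> U m'" using g U_mono[of m "max m m'"] U_mono[of m' "max m m'"] by auto
    then have "(gact N g x -[N] x) +[N] (gact N g y -[N] y) \<in> adic_power B N n" using m adic_closed(3)[OF N] by blast
    then show ?thesis using add(1,2) g by (simp add: N.diff_add_add)
  qed
  then show ?case by blast
qed (use Z in auto)

end

lemma finite_free_rmod: "finite_free R N ==> rmod R N" by (simp add: finite_free_def rmod.intro)

lemma finite_free_tfree: "finite_free R N ==> tfree (R :: 'r::idom set) N"
  using rmod.dbasis_of_finite_free[OF finite_free_rmod] rmod.tfree_of_dbasis[OF finite_free_rmod] by (metis mult_eq_0_iff)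

lemma (in lmod) loc_map_eval: assumes N: "lmod R' N t" and a: "alp s \<in> R'" "alp s \<noteq> 0"
    and f: "addhom M N f" "!!n x. x :> M ==> f (s ^ n \<odot> x) = alp s ^ n *[N] f x"
    and x: "x :> M" "y :> N" "alp s ^ j *[N] y = t ^ n *[N] f x"
  shows "loc_map alp s N t f (lfrac M s x j) = lfrac N t y n"
proof -
  interpret N: lmod R' N t by fact
  note [simp] = addhom_closed[OF f(1)]
  show ?thesis unfolding loc_map_def
    by (rule loc_ext_eval[where alp = alp, OF N.rmod_loc N.tfree_loc a]) (use a f x in \<open>auto simp: N.loc_smult N.lfrac_eq\<close>)
qed

lemma (in lmod) loc_map_linear:
  assumes "lmod R N s" "addhom M N f" "!!c x. [|c \<in> R; x \<in> carrier M|] ==> f (c \<odot> x) = c *[N] f x" "x :> M"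
  shows "loc_map id s N s f (lfrac M s x j) = lfrac N s (f x) j"
  by (rule loc_map_eval[OF assms(1) _ _ assms(2)]) (use assms addhom_closed[OF assms(2)] in auto)

section \<open>Frobenius with cleared denominators\<close>

context wbase
begin

text \<open>As \<open>phi mu = mu * w\<close>, the fraction in the third clause is
  \<open>Phi x\<close> over \<open>w ^ k * phi mu ^ j\<close>. Equivariance is written with the
  powers of \<open>w\<close> cleared. The last clause bounds the cokernel by a power of
  \<open>w\<close> instead of \<open>b_xi B\<close>; this is equivalent because each divides a power
  of the other.\<close>

definition frob_pres where
  "frob_pres N Phi k \<longleftrightarrow> addhom N N Phi \<and>
    (\<forall>c\<in>R. \<forall>x\<in>carrier N. Phi (c *[N] x) = phi c *[N] Phi x) \<and>
    (\<forall>x\<in>carrier N. \<forall>j. frb N (lfrac N mu x j) = lfrac N (phi mu) (mu ^ k *[N] Phi x) (k + j)) \<and>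
    (\<forall>g\<in>carrier G. \<forall>x\<in>carrier N. act g w ^ k *[N] Phi (gact N g x) = w ^ k *[N] gact N g (Phi x)) \<and>
    (\<exists>l. \<forall>x\<in>carrier N. w ^ l *[N] x \<in> span_on R N (Phi ` carrier N))"

text \<open>The Frobenius of a Wach module \<^term>\<open>N\<close> is \<^term>\<open>Phi\<close> divided by \<^term>\<open>w ^ k\<close>, with \<^term>\<open>Phi\<close>
  a semilinear endomorphism of \<^term>\<open>N\<close> itself.\<close>

definition wm where
  "wm N Phi k \<longleftrightarrow> wach_module B N \<and> frob_pres N Phi k"

lemma wach_moduleD: assumes "wach_module B N"
  shows "finite_free R N" "rmod R N" "tfree R N" "lmod R N mu" "lmod R N (phi mu)" "semilinear_action B N"
    "[|g :> G; x \<in> carrier N|] ==> \<exists>y\<in>carrier N. gact N g x -[N] x = mu *[N] y"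
    "x :> N ==> \<exists>m. \<forall>g\<in>U m. gact N g x -[N] x \<in> adic_power B N n"
proof -
  show *: "finite_free R N" "semilinear_action B N" and
    "[|g :> G; x \<in> carrier N|] ==> \<exists>y\<in>carrier N. gact N g x -[N] x = mu *[N] y"
    using assms unfolding wach_module_def by blast+
  show "rmod R N" "tfree R N" using * finite_free_rmod finite_free_tfree by auto
  then show "lmod R N mu" "lmod R N (phi mu)" by (auto intro!: lmod.intro lmod_axioms.intro)
  show "x :> N ==> \<exists>m. \<forall>g\<in>U m. gact N g x -[N] x \<in> adic_power B N n"
    using continuous_action_iff[OF finite_free_rmod[OF *(1)] *(2)] assms unfolding wach_module_def by blast
qed

text \<open>The denominator \<open>s ^ j\<close> becomes \<open>(v * s) ^ j\<close>, and the unit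
  part is moved to the numerator as \<open>v' ^ j\<close>.\<close>

lemma loc_map_act:
  assumes N: "lmod R N s" "semilinear_action B N" "g :> G" "v \<in> R" "v' \<in> R" "v * v' = 1"
    and s: "act g s = v * s" and x: "x :> N"
  shows "loc_map (act g) s N s (gact N g) (lfrac N s x j) = lfrac N s (v' ^ j *[N] gact N g x) j"
proof -
  interpret N: lmod R N s by fact
  note A = actionD[OF N(2)]
  have gx: "gact N g x :> N" using addhom_closed[OF A(1)] assms by blast
  have "(v * s) ^ j * v' ^ j = s ^ j * (v * v') ^ j" by (simp add: power_mult_distrib mult_ac)
  then have 1: "(v * s) ^ j * v' ^ j = s ^ j" using assms by simp
  have "v \<noteq> 0" using assms by auto
  show ?thesis by (rule N.loc_map_eval[OF N(1) _ _ A(1)])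
      (use assms gx A(4) \<open>v \<noteq> 0\<close> 1 in \<open>auto simp: N.smult_smult act_power\<close>)
qed

lemma twist_nat: assumes "lmod R N s"
  shows "twist N s mu (int k) = {lfrac N s (mu ^ k *[N] x) 0 | x. x :> N}"
proof -
  interpret N: lmod R N s by fact
  interpret L: rmod R "loc N s" by (rule N.rmod_loc)
  show ?thesis by (auto simp: twist_def)
qed

lemma frob_commutes_iff:
  assumes N: "lmod R N mu" "lmod R N (phi mu)" "semilinear_action B N" "g :> G" "x :> N"
    and Phi: "addhom N N Phi" "!!c x. [|c \<in> R; x \<in> carrier N|] ==> Phi (c *[N] x) = phi c *[N] Phi x"
    and frb: "!!x j. x :> N ==> frb N (lfrac N mu x j) = lfrac N (phi mu) (mu ^ k *[N] Phi x) (k + j)"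
  shows "frb N (loc_map (act g) mu N mu (gact N g) (lfrac N mu x j)) =
      loc_map (act g) (phi mu) N (phi mu) (gact N g) (frb N (lfrac N mu x j)) \<longleftrightarrow>
    act g w ^ k *[N] Phi (gact N g x) = w ^ k *[N] gact N g (Phi x)"
proof -
  interpret N: lmod R N mu by fact
  interpret N': lmod R N "phi mu" by fact
  note A = actionD[OF N(3)]
  obtain v v' where v: "v \<in> R" "v' \<in> R" "v * v' = 1" "act g mu = v * mu" "act g (phi mu) = phi v * phi mu"
    "phi v * phi v' = 1" "act g w * v = phi v * w" "v \<noteq> 0" "phi v \<noteq> 0" "act g w \<noteq> 0"
    using act_mu[OF N(4)] by metis
  have c [simp]: "gact N g x :> N" "Phi x :> N" "gact N g (Phi x) :> N"
    "Phi (gact N g x) :> N" using addhom_closed[OF A(1)] addhom_closed[OF Phi(1)] N(4,5) by blast+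
  have "frb N (loc_map (act g) mu N mu (gact N g) (lfrac N mu x j)) =
      lfrac N (phi mu) (mu ^ k *[N] (phi v' ^ j *[N] Phi (gact N g x))) (k + j)"
    using v N(5) Phi(2) by (simp add: loc_map_act[OF N(1,3,4) v(1-4) N(5)] frb frob_power)
  moreover have "loc_map (act g) (phi mu) N (phi mu) (gact N g) (frb N (lfrac N mu x j)) =
      lfrac N (phi mu) (phi v' ^ (k + j) *[N] ((v ^ k * mu ^ k) *[N] gact N g (Phi x))) (k + j)"
    using v N(4,5) A(4) by (simp add: frb loc_map_act[OF N(2,3,4) _ _ v(6,5)] act_power power_mult_distrib N.smult_smult)
  ultimately have "frb N (loc_map (act g) mu N mu (gact N g) (lfrac N mu x j)) =
      loc_map (act g) (phi mu) N (phi mu) (gact N g) (frb N (lfrac N mu x j)) \<longleftrightarrow>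
    (phi mu ^ (k + j) * mu ^ k * phi v' ^ j) *[N] Phi (gact N g x) =
      (phi mu ^ (k + j) * phi v' ^ (k + j) * (v ^ k * mu ^ k)) *[N] gact N g (Phi x)"
    using v by (simp add: N'.lfrac_eq N.smult_smult mult_ac)
  \<comment> \<open>This factor cancels all \<open>phi v'\<close> and, by
    \<open>act g w * v = phi v * w\<close>, turns both sides into the same multiple of the two sides
    of the desired equation; torsion-freeness then removes the multiple.\<close>
  also have "... \<longleftrightarrow> (phi v ^ (k + j) * w ^ k) *[N] ((phi mu ^ (k + j) * mu ^ k * phi v' ^ j) *[N] Phi (gact N g x)) =
      (phi v ^ (k + j) * w ^ k) *[N] ((phi mu ^ (k + j) * phi v' ^ (k + j) * (v ^ k * mu ^ k)) *[N] gact N g (Phi x))"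
    using v by (subst N.cancel) auto
  also have "... \<longleftrightarrow> (phi mu ^ (k + j) * mu ^ k * v ^ k) *[N] (act g w ^ k *[N] Phi (gact N g x)) =
      (phi mu ^ (k + j) * mu ^ k * v ^ k) *[N] (w ^ k *[N] gact N g (Phi x))"
  proof -
    have "(phi v ^ (k + j) * w ^ k) * (phi mu ^ (k + j) * mu ^ k * phi v' ^ j) =
        (phi mu ^ (k + j) * mu ^ k) * (phi v * w) ^ k * (phi v * phi v') ^ j"
      by (simp add: power_mult_distrib power_add mult_ac)
    also have "... = (phi mu ^ (k + j) * mu ^ k * v ^ k) * act g w ^ k"
      unfolding v(6) v(7)[symmetric] by (simp add: power_mult_distrib mult_ac)
    finally have 1: "(phi v ^ (k + j) * w ^ k) * (phi mu ^ (k + j) * mu ^ k * phi v' ^ j) =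
      (phi mu ^ (k + j) * mu ^ k * v ^ k) * act g w ^ k" .
    have "(phi v ^ (k + j) * w ^ k) * (phi mu ^ (k + j) * phi v' ^ (k + j) * (v ^ k * mu ^ k)) =
        (phi mu ^ (k + j) * mu ^ k * v ^ k) * w ^ k * (phi v * phi v') ^ (k + j)" by (simp add: power_mult_distrib mult_ac)
    then have 2: "(phi v ^ (k + j) * w ^ k) * (phi mu ^ (k + j) * phi v' ^ (k + j) * (v ^ k * mu ^ k)) =
        (phi mu ^ (k + j) * mu ^ k * v ^ k) * w ^ k" unfolding v(6) by simp
    have m: "a *[N] (b *[N] y) = (a * b) *[N] y" if "a \<in> R" "b \<in> R" "y :> N" for a b y
      using that by (rule N.smult_smult)
    have "(phi v ^ (k + j) * w ^ k) *[N] ((phi mu ^ (k + j) * mu ^ k * phi v' ^ j) *[N] Phi (gact N g x)) =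
        (phi mu ^ (k + j) * mu ^ k * v ^ k) *[N] (act g w ^ k *[N] Phi (gact N g x))"
      using v N(4) by (subst m m; auto simp: 1)+
    moreover have "(phi v ^ (k + j) * w ^ k) *[N] ((phi mu ^ (k + j) * phi v' ^ (k + j) * (v ^ k * mu ^ k)) *[N] gact N g (Phi x)) =
        (phi mu ^ (k + j) * mu ^ k * v ^ k) *[N] (w ^ k *[N] gact N g (Phi x))" using v N(4) by (subst m m; auto simp: 2)+
    ultimately show ?thesis by simp
  qed
  also have "... \<longleftrightarrow> act g w ^ k *[N] Phi (gact N g x) = w ^ k *[N] gact N g (Phi x)"
    using v N(4) by (subst N.cancel) auto
  finally show ?thesis .
qed

text \<open>All Wach Wach-type conditions other than the formula for Frobenius are stable under sums
  once the maps are additive, so they are checked on a generating set such as the pure tensors. The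
  heights are read off from \<open>k\<close> and \<open>l\<close>.\<close>

lemma wmI: assumes ff: "finite_free R N" and gen: "addgen N Z"
    and act: "!!g. g :> G ==> addhom N N (gact N g)"
      "!!z. z \<in> Z ==> gact N \<one>\<^bsub>G\<^esub> z = z"
      "!!g h z. [|g :> G; h :> G; z \<in> Z|] ==> gact N (g \<otimes>\<^bsub>G\<^esub> h) z = gact N g (gact N h z)"
      "!!g c z. [|g :> G; c \<in> R; z \<in> Z|] ==> gact N g (c *[N] z) = act g c *[N] gact N g z"
      "!!g z. [|g :> G; z \<in> Z|] ==> \<exists>y\<in>carrier N. gact N g z -[N] z = mu *[N] y"
      "!!z n. z \<in> Z ==> \<exists>m. \<forall>g\<in>U m. gact N g z -[N] z \<in> adic_power B N n"
    and Phi: "addhom N N Phi" "!!c z. [|c \<in> R; z \<in> Z|] ==> Phi (c *[N] z) = phi c *[N] Phi z"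
      "!!g z. [|g :> G; z \<in> Z|] ==> act g w ^ k *[N] Phi (gact N g z) = w ^ k *[N] gact N g (Phi z)"
      "!!z. z \<in> Z ==> w ^ l *[N] z \<in> span_on R N (Phi ` carrier N)"
    and frb: "!!x j. x :> N ==> frb N (lfrac N mu x j) = lfrac N (phi mu) (mu ^ k *[N] Phi x) (k + j)"
  shows "wm N Phi k"
proof -
  have N: "rmod R N" and tf: "tfree R N" using ff finite_free_rmod finite_free_tfree by auto
  interpret N: lmod R N mu by (intro lmod.intro lmod_axioms.intro N tf) auto
  interpret N': lmod R N "phi mu" by (intro lmod.intro lmod_axioms.intro N tf) auto
  note [simp] = addhom_closed[OF act(1)] addhom_add[OF act(1)] addhom_closed[OF Phi(1)] addhom_add[OF Phi(1)]
  have z0 [simp]: "gact N g 0[N] = 0[N]" if "g :> G" for g using addhom_zero[OF N.is_abgroup N.is_abgroup act(1)[OF that]] .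
  have Phi0 [simp]: "Phi 0[N] = 0[N]" using addhom_zero[OF N.is_abgroup N.is_abgroup Phi(1)] .
  note Zc [simp] = addgenD[OF gen]
  have 2: "gact N \<one>\<^bsub>G\<^esub> x = x" if "x :> N" for x
    using gen that by (induction x rule: addgen_induct) (auto simp: act)
  have 3: "gact N (g \<otimes>\<^bsub>G\<^esub> h) x = gact N g (gact N h x)" if "g :> G" "h :> G" "x :> N" for g h x
    using gen that(3) by (induction x rule: addgen_induct) (auto simp: act that)
  have 4: "gact N g (c *[N] x) = act g c *[N] gact N g x" if "g :> G" "c \<in> R" "x :> N" for g c x
    using gen that(3) by (induction x rule: addgen_induct) (auto simp: act that N.smult_r_distr)
  have sa: "semilinear_action B N" unfolding semilinear_action_def using 2 3 4 by auto
  have 5: "\<exists>y\<in>carrier N. gact N g x -[N] x = mu *[N] y" if "g :> G" "x :> N" for g x using gen that(2)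
  proof (induction x rule: addgen_induct)
    case zero
    then show ?case using that(1) N.diff_zero_iff[of "0[N]" "0[N]"] by (intro bexI[of _ "0[N]"]) auto
  next
    case (add x y)
    then obtain x' y' where *: "x' :> N" "y' :> N" "gact N g x -[N] x = mu *[N] x'"
      "gact N g y -[N] y = mu *[N] y'" by blast
    have "gact N g (x +[N] y) -[N] (x +[N] y) = mu *[N] (x' +[N] y')"
      using * add(1,2) that(1) by (simp add: N.diff_add_add N.smult_r_distr)
    then show ?case using * by blast
  qed (use act(5) that in auto)
  have cont: "continuous_map (prod_topology (b_top B) (adic_topology B N)) (adic_topology B N) (%(g, x). gact N g x)"
    unfolding continuous_action_iff[OF N sa] using cont_gen[OF N sa gen act(6)] by blast
  have Phi2: "Phi (c *[N] x) = phi c *[N] Phi x" if "c \<in> R" "x :> N" for c x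
    using gen that(2) by (induction x rule: addgen_induct) (auto simp: Phi(2) that N.smult_r_distr)
  have Phi3: "act g w ^ k *[N] Phi (gact N g x) = w ^ k *[N] gact N g (Phi x)" if "g :> G" "x :> N" for g x
    using gen that(2) by (induction x rule: addgen_induct) (auto simp: Phi(3) that N.smult_r_distr)
  have sub: "Phi ` carrier N \<subseteq> carrier N" by auto
  have Phi4: "w ^ l *[N] x \<in> span_on R N (Phi ` carrier N)" if "x :> N" for x
    using gen that by (induction x rule: addgen_induct)
      (auto simp: Phi(4) N.smult_r_distr intro: N.span_closed[OF sub])
  have sf: "semilinear_frobenius B N" unfolding semilinear_frobenius_def Let_def
  proof (intro conjI ballI)
    fix \<xi> assume "\<xi> :> loc N mu"
    then obtain x j where x: "x :> N" "\<xi> = lfrac N mu x j" by (rule N.locE)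
    show "frb N \<xi> :> loc N (phi mu)" using x by (simp add: frb)
    show "frb N (c *[loc N mu] \<xi>) = phi c *[loc N (phi mu)] frb N \<xi>" if "c \<in> R" for c
    proof -
      have "mu ^ k *[N] (phi c *[N] Phi x) = phi c *[N] (mu ^ k *[N] Phi x)"
        using x that by (simp add: N.smult_smult mult.commute)
      then show ?thesis using x that by (simp add: N.loc_smult N'.loc_smult frb Phi2)
    qed
    show "frb N (loc_map (act g) mu N mu (gact N g) \<xi>) =
        loc_map (act g) (phi mu) N (phi mu) (gact N g) (frb N \<xi>)" if "g :> G" for g unfolding x(2)
      by (subst frob_commutes_iff[OF N.lmod_axioms N'.lmod_axioms sa that x(1) Phi(1) Phi2 frb])
        (use Phi3 x that in auto)
  next
    fix \<xi> ups assume xy: "\<xi> :> loc N mu" "ups :> loc N mu"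
    show "frb N (\<xi> +[loc N mu] ups) = frb N \<xi> +[loc N (phi mu)] frb N ups"
      by (rule N.locE2[OF xy]) (simp add: N.loc_add_same frb N'.loc_add_same N.smult_r_distr)
  qed
  \<comment> \<open>The hypothesis bounds the cokernel by \<open>w ^ l\<close>. Since
    \<open>w\<close> divides \<open>b_xi B ^ n\<close>, this costs \<open>n * l\<close> powers of
    \<open>b_xi B\<close>, so \<open>b = k\<close> and \<open>a = k - n * l\<close> are admissible
    heights.\<close>
  obtain c n where c: "c \<in> R" "w * c = b_xi B ^ n" using w_dvd_xi by blast
  define e where "e = n * l"
  have e: "b_xi B ^ e = c ^ l * w ^ l"
    unfolding e_def power_mult c(2)[symmetric] by (simp add: power_mult_distrib mult.commute)
  \<comment> \<open>On mu^k N the denominator of Frobenius disappears, because phi(mu)^k cancels it.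
    This is why the twist \<open>b = k\<close> works.\<close>
  have frk: "frb N (lfrac N mu (mu ^ k *[N] x) 0) = lfrac N (phi mu) (mu ^ k *[N] Phi x) 0" if "x :> N" for x
  proof -
    have "phi mu ^ 0 *[N] (mu ^ k *[N] (phi mu ^ k *[N] Phi x)) = phi mu ^ (k + 0) *[N] (mu ^ k *[N] Phi x)"
      using that by (simp add: N.smult_smult mult.commute)
    then show ?thesis using that by (simp add: frb Phi2 frob_power N'.lfrac_eq)
  qed
  have height: "frobenius_height B N (int k - int e) (int k)"
    unfolding frobenius_height_def Let_def twist_nat[OF N.lmod_axioms] twist_nat[OF N'.lmod_axioms]
  proof (intro conjI ballI)
    show "frb N ` {lfrac N mu (mu ^ k *[N] x) 0 |x. x :> N} \<subseteq> {lfrac N (phi mu) (mu ^ k *[N] x) 0 |x. x :> N}"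
      by (auto simp: frk)
    interpret L: rmod R "loc N (phi mu)" by (rule N'.rmod_loc)
    let ?Z = "frb N ` {lfrac N mu (mu ^ k *[N] x) 0 |x. x :> N}"
    have Z: "?Z \<subseteq> carrier (loc N (phi mu))" by (auto simp: frk)
    have sp: "lfrac N (phi mu) (mu ^ k *[N] z) 0 \<in> span_on R (loc N (phi mu)) ?Z" if "z \<in> span_on R N (Phi ` carrier N)" for z
    proof (rule span_map[OF N N'.rmod_loc _ _ _ sub Z _ that, where rho = "%c. c"])
      show "addhom N (loc N (phi mu)) (%z. lfrac N (phi mu) (mu ^ k *[N] z) 0)"
        by (rule addhomI) (auto simp: N'.loc_add_same N.smult_r_distr)
      show "lfrac N (phi mu) (mu ^ k *[N] (c *[N] x)) 0 = c *[loc N (phi mu)] lfrac N (phi mu) (mu ^ k *[N] x) 0"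
        if "c \<in> R" "x :> N" for c x using that by (simp add: N'.loc_smult N.smult_smult mult.commute)
      show "lfrac N (phi mu) (mu ^ k *[N] z) 0 \<in> span_on R (loc N (phi mu)) ?Z" if "z \<in> Phi ` carrier N" for z
        using that by (intro span_on_incl) (auto simp: frk[symmetric])
    qed auto
    fix ups assume "ups \<in> {lfrac N (phi mu) (mu ^ k *[N] x) 0 |x. x :> N}"
    then obtain x where x: "x :> N" "ups = lfrac N (phi mu) (mu ^ k *[N] x) 0" by blast
    have "b_xi B ^ e *[loc N (phi mu)] ups = lfrac N (phi mu) (mu ^ k *[N] (c ^ l *[N] (w ^ l *[N] x))) 0"
      using x c by (simp add: N'.loc_smult e N.smult_smult mult_ac)
    also have "... \<in> span_on R (loc N (phi mu)) ?Z"
      using x c Phi4 by (intro sp) (auto intro!: N.span_closed(4)[OF sub, of "c ^ l"])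
    finally show "b_xi B ^ nat (int k - (int k - int e)) *[loc N (phi mu)] ups \<in> span_on R (loc N (phi mu)) ?Z" by simp
  qed
  have "\<exists>a b. a \<le> b \<and> frobenius_height B N a b"
    using height by (intro exI[of _ "int k - int e"] exI[of _ "int k"]) simp
  then have "wach_module B N" unfolding wach_module_def using ff sa cont 5 sf by simp
  moreover have "frob_pres N Phi k" unfolding frob_pres_def using Phi(1) Phi2 Phi3 Phi4 frb by (auto intro!: exI[of _ l])
  ultimately show ?thesis by (simp add: wm_def)
qed

text \<open>Stability of mu^b N under Frobenius bounds the denominators of Frobenius on
  \<open>N\<close> by a power of \<open>w\<close>; multiplying by that power gives
  \<open>Phi\<close>. Its additivity, semilinearity and equivariance are pulled back along the
  embedding of \<open>N\<close> in the localization.\<close>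

lemma wm_exists: assumes W: "wach_module B N" shows "\<exists>Phi k. wm N Phi k"
proof -
  note D = wach_moduleD[OF W]
  interpret N: lmod R N mu by (rule D)
  interpret N': lmod R N "phi mu" by (rule D)
  interpret L: rmod R "loc N mu" by (rule N.rmod_loc)
  interpret L': rmod R "loc N (phi mu)" by (rule N'.rmod_loc)
  note tf' = N'.tfree_loc
  let ?L = "loc N mu" and ?L' = "loc N (phi mu)"
  have sf: "!!\<xi>. \<xi> :> ?L ==> frb N \<xi> :> ?L'"
    "!!\<xi> ups. [|\<xi> :> ?L; ups \<in> carrier ?L|] ==> frb N (\<xi> +[?L] ups) = frb N \<xi> +[?L'] frb N ups"
    "!!c \<xi>. [|c \<in> R; \<xi> \<in> carrier ?L|] ==> frb N (c *[?L] \<xi>) = phi c *[?L'] frb N \<xi>"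
    "!!g \<xi>. [|g :> G; \<xi> \<in> carrier ?L|] ==>
      frb N (loc_map (act g) mu N mu (gact N g) \<xi>) = loc_map (act g) (phi mu) N (phi mu) (gact N g) (frb N \<xi>)"
  proof -
    have "semilinear_frobenius B N" using W by (simp add: wach_module_def)
    then show "!!\<xi>. \<xi> :> ?L ==> frb N \<xi> :> ?L'"
      "!!\<xi> ups. [|\<xi> :> ?L; ups \<in> carrier ?L|] ==> frb N (\<xi> +[?L] ups) = frb N \<xi> +[?L'] frb N ups"
      "!!c \<xi>. [|c \<in> R; \<xi> \<in> carrier ?L|] ==> frb N (c *[?L] \<xi>) = phi c *[?L'] frb N \<xi>"
      "!!g \<xi>. [|g :> G; \<xi> \<in> carrier ?L|] ==>
        frb N (loc_map (act g) mu N mu (gact N g) \<xi>) = loc_map (act g) (phi mu) N (phi mu) (gact N g) (frb N \<xi>)"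
      unfolding semilinear_frobenius_def Let_def by simp_all
  qed
  from W have "\<exists>a b. frobenius_height B N a b" unfolding wach_module_def by blast
  then obtain a b where h: "frobenius_height B N a b" by blast
  have ab: "frb N ` twist N mu mu b \<subseteq> twist N (phi mu) mu b"
    "!!ups. ups \<in> twist N (phi mu) mu b ==> b_xi B ^ nat (b - a) *[?L'] ups \<in> span_on R ?L' (frb N ` twist N mu mu b)"
    using h unfolding frobenius_height_def Let_def by simp_all
  \<comment> \<open>Positive and negative part of \<open>b\<close>, so that mu^b = mu^k / mu^c with
    natural exponents. If Frobenius sends mu^b x to mu^b y, then w^k times the Frobenius of x is w^c
    y, which lies in \<open>N\<close>.\<close>
  define k c where "k = nat b" and "c = nat (- b)"
  let ?i = "%x. lfrac N mu x 0" and ?i' = "%x. lfrac N (phi mu) x 0"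
  have i'_smult: "d *[?L'] ?i' x = ?i' (d *[N] x)" if "d \<in> R" "x :> N" for d x using that by (simp add: N'.loc_smult)
  have i'_inj: "?i' x = ?i' y \<longleftrightarrow> x = y" if "x :> N" "y :> N" for x y using that by (simp add: N'.lfrac_eq)
  have can: "d *[?L'] ups = d *[?L'] ups' \<longleftrightarrow> ups = ups'" if "d \<in> R" "d \<noteq> 0" "ups :> ?L'" "ups' :> ?L'" for d ups ups'
    using that by (intro L'.tfree_cancel[OF tf'])
  have "phi mu ^ n = mu ^ n * w ^ n" for n by (simp add: frob_mu power_mult_distrib)
  note pw = this
  have "\<exists>y\<in>carrier N. w ^ k *[?L'] frb N (?i x) = ?i' y" if x: "x :> N" for x
  proof -
    let ?\<xi> = "lfrac N mu (mu ^ k *[N] x) c"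
    have mc: "mu ^ c *[?L] ?\<xi> = mu ^ k *[?L] ?i x"
      using x N.smult_lfrac_cancel[of "mu ^ k *[N] x" c 0] by (simp add: N.loc_smult)
    then have "?\<xi> \<in> twist N mu mu b" using x by (auto simp: twist_def c_def[symmetric] k_def[symmetric] N.loc_smult)
    then have "frb N ?\<xi> \<in> twist N (phi mu) mu b" using ab(1) by blast
    then obtain y where y: "y :> N" "mu ^ c *[?L'] frb N ?\<xi> = ?i' (mu ^ k *[N] y)" by (auto simp: twist_def c_def k_def)
    have f: "frb N ?\<xi> :> ?L'" "frb N (?i x) :> ?L'" using sf(1) x by auto
    have "mu ^ k *[?L'] (w ^ k *[?L'] frb N (?i x)) = frb N (mu ^ k *[?L] ?i x)"
      using x f sf(3) by (simp add: frob_power pw L'.smult_smult)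
    also have "... = w ^ c *[?L'] (mu ^ c *[?L'] frb N ?\<xi>)"
      unfolding mc[symmetric] using x f sf(3) by (simp add: frob_power pw L'.smult_smult mult.commute)
    also have "... = mu ^ k *[?L'] ?i' (w ^ c *[N] y)"
      unfolding y(2) using y by (simp add: i'_smult N.smult_smult mult.commute)
    finally have "w ^ k *[?L'] frb N (?i x) = ?i' (w ^ c *[N] y)" using f y by (subst (asm) can) auto
    then show ?thesis using y by (intro bexI[of _ "w ^ c *[N] y"]) auto
  qed
  then obtain Phi where Phi: "!!x. x :> N ==> Phi x :> N"
    "!!x. x :> N ==> w ^ k *[?L'] frb N (?i x) = ?i' (Phi x)" by metis
  have ic: "?i x :> ?L" "frb N (?i x) :> ?L'" if "x :> N" for x using sf(1) that by auto
  have ah: "addhom N N Phi"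
  proof (rule addhomI)
    fix x y assume xy: "x :> N" "y :> N"
    then have "?i' (Phi (x +[N] y)) = w ^ k *[?L'] frb N (?i x +[?L] ?i y)"
      using Phi(2)[of "x +[N] y"] by (simp add: N.loc_add_same)
    also have "... = ?i' (Phi x) +[?L'] ?i' (Phi y)" using xy ic sf(2) by (simp add: L'.smult_r_distr Phi(2)[symmetric])
    also have "... = ?i' (Phi x +[N] Phi y)" using xy Phi(1) by (simp add: N'.loc_add_same)
    finally show "Phi (x +[N] y) = Phi x +[N] Phi y" using xy Phi(1) by (simp add: i'_inj)
  qed (rule Phi(1))
  have sl: "Phi (d *[N] x) = phi d *[N] Phi x" if d: "d \<in> R" and x: "x :> N" for d x
  proof -
    have "?i' (Phi (d *[N] x)) = w ^ k *[?L'] frb N (d *[?L] ?i x)"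
      using Phi(2)[of "d *[N] x"] d x by (simp add: N.loc_smult)
    also have "... = phi d *[?L'] (w ^ k *[?L'] frb N (?i x))" using d x ic sf(3) by (simp add: L'.smult_smult mult.commute)
    also have "... = ?i' (phi d *[N] Phi x)" using d x Phi by (simp add: i'_smult)
    finally show ?thesis using d x Phi(1) by (simp add: i'_inj)
  qed
  have frb: "frb N (lfrac N mu x j) = lfrac N (phi mu) (mu ^ k *[N] Phi x) (k + j)" if x: "x :> N" for x j
  proof -
    let ?\<xi> = "lfrac N mu x j"
    have f: "frb N ?\<xi> :> ?L'" using sf(1) x by auto
    have "phi mu ^ j *[?L'] frb N ?\<xi> = frb N (?i x)"
      using sf(3)[of "mu ^ j" ?\<xi>] x N.smult_lfrac_cancel[OF x, of j 0] by (simp add: frob_power)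
    then have "phi mu ^ (k + j) *[?L'] frb N ?\<xi> = phi mu ^ k *[?L'] frb N (?i x)"
      using f ic x by (simp add: power_add L'.smult_smult[symmetric])
    also have "... = mu ^ k *[?L'] ?i' (Phi x)" using f ic x by (simp add: pw Phi(2)[symmetric] L'.smult_smult)
    also have "... = phi mu ^ (k + j) *[?L'] lfrac N (phi mu) (mu ^ k *[N] Phi x) (k + j)"
      using N'.smult_lfrac_cancel[of "mu ^ k *[N] Phi x" "k + j" 0] x Phi(1) by (simp add: i'_smult)
    finally show ?thesis using f x Phi(1) by (subst (asm) can) auto
  qed
  have comm: "act g w ^ k *[N] Phi (gact N g x) = w ^ k *[N] gact N g (Phi x)" if "g :> G" "x :> N" for g x
    using frob_commutes_iff[OF D(4,5,6) that ah sl frb, of 0] sf(4)[OF that(1), of "?i x"] that by auto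
  have sub: "Phi ` carrier N \<subseteq> carrier N" using Phi(1) by auto
  note spN = N.span_closed[OF sub]
  obtain d where d: "d \<in> R" "w = b_xi B * d" using xi_dvd_w by blast
  define e where "e = nat (b - a)"
  have "w ^ (e + c) *[N] x \<in> span_on R N (Phi ` carrier N)" if x: "x :> N" for x
  proof -
    \<comment> \<open>This is mu^b x, written with a denominator that is a power of
      \<open>phi mu\<close>; the factor \<open>w ^ c\<close> comes from phi(mu)^c = mu^c
      w^c.\<close>
    let ?ups = "lfrac N (phi mu) (mu ^ k *[N] (w ^ c *[N] x)) c"
    have "phi mu ^ 0 *[N] (mu ^ c *[N] (mu ^ k *[N] (w ^ c *[N] x))) = phi mu ^ c *[N] (mu ^ k *[N] x)"
      using x by (simp add: N.smult_smult pw mult_ac)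
    then have "mu ^ c *[?L'] ?ups = ?i' (mu ^ k *[N] x)" using x by (simp add: N'.loc_smult N'.lfrac_eq)
    then have "?ups \<in> twist N (phi mu) mu b" using x by (auto simp: twist_def c_def[symmetric] k_def[symmetric])
    then have "b_xi B ^ e *[?L'] ?ups \<in> span_on R ?L' (frb N ` twist N mu mu b)" unfolding e_def by (rule ab(2))
    moreover have Zc: "frb N ` twist N mu mu b \<subseteq> carrier ?L'" using sf(1) by (auto simp: twist_def)
    ultimately have "\<exists>z\<in>span_on R N (Phi ` carrier N). phi mu ^ c *[?L'] (b_xi B ^ e *[?L'] ?ups) = ?i' (mu ^ k *[N] z)"
    proof (induction rule: L'.span_induct)
      case (base ups)
      then obtain \<eta> where \<eta>: "\<eta> \<in> twist N mu mu b" "ups = frb N \<eta>" by blast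
      then obtain y where y: "y :> N" "mu ^ c *[?L] \<eta> = ?i (mu ^ k *[N] y)" "\<eta> :> ?L"
        by (auto simp: twist_def c_def k_def)
      have "phi mu ^ c *[?L'] frb N \<eta> = frb N (mu ^ c *[?L] \<eta>)" using y(3) sf(3)[of "mu ^ c" \<eta>] by (simp add: frob_power)
      also have "... = frb N (mu ^ k *[?L] ?i y)" using y by (simp add: N.loc_smult)
      also have "... = mu ^ k *[?L'] (w ^ k *[?L'] frb N (?i y))" using y sf(1,3) by (simp add: frob_power pw L'.smult_smult)
      also have "... = ?i' (mu ^ k *[N] Phi y)" using y Phi by (simp add: i'_smult)
      finally show ?case using \<eta> y by (intro bexI[of _ "Phi y"] span_on_incl) auto
    next
      case zero
      then show ?case using spN(2) by (intro bexI[of _ "0[N]"]) (auto simp: N'.loc_zero N'.loc_smult)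
    next
      case (add ups ups')
      then obtain z z' where z: "z \<in> span_on R N (Phi ` carrier N)" "z' \<in> span_on R N (Phi ` carrier N)"
        "phi mu ^ c *[?L'] ups = ?i' (mu ^ k *[N] z)" "phi mu ^ c *[?L'] ups' = ?i' (mu ^ k *[N] z')" by blast
      moreover have "ups :> ?L'" "ups' :> ?L'" "z :> N" "z' :> N" using add(1,2) L'.span_closed(1)[OF Zc] z spN(1) by auto
      ultimately show ?case using spN(3)[of z z']
        by (intro bexI[of _ "z +[N] z'"]) (auto simp: L'.smult_r_distr N.smult_r_distr N'.loc_add_same)
    next
      case (smult q ups)
      then obtain z where z: "z \<in> span_on R N (Phi ` carrier N)" "phi mu ^ c *[?L'] ups = ?i' (mu ^ k *[N] z)" by blast
      have c: "ups :> ?L'" "z :> N" using smult(2) L'.span_closed(1)[OF Zc] z spN(1) by auto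
      have "phi mu ^ c *[?L'] (q *[?L'] ups) = q *[?L'] (phi mu ^ c *[?L'] ups)"
        using c smult(1) by (simp add: L'.smult_smult mult.commute)
      also have "... = ?i' (mu ^ k *[N] (q *[N] z))" using c smult(1) z by (simp add: i'_smult N.smult_smult mult.commute)
      finally show ?case using spN(4)[OF smult(1) z(1)] by blast
    qed
    then obtain z where z: "z \<in> span_on R N (Phi ` carrier N)"
      "phi mu ^ c *[?L'] (b_xi B ^ e *[?L'] ?ups) = ?i' (mu ^ k *[N] z)" by blast
    have zc: "z :> N" using z spN(1) by auto
    have "phi mu ^ c *[?L'] (b_xi B ^ e *[?L'] ?ups) =
        phi mu ^ c *[?L'] lfrac N (phi mu) (b_xi B ^ e *[N] (mu ^ k *[N] (w ^ c *[N] x))) (c + 0)"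
      using x by (simp add: N'.loc_smult)
    also have "... = ?i' (b_xi B ^ e *[N] (mu ^ k *[N] (w ^ c *[N] x)))" using x by (subst N'.smult_lfrac_cancel) auto
    also have "... = ?i' (mu ^ k *[N] ((b_xi B ^ e * w ^ c) *[N] x))" using x by (simp add: N.smult_smult mult_ac)
    finally have "(b_xi B ^ e * w ^ c) *[N] x = z" unfolding z(2) using x zc by (simp add: i'_inj N.cancel)
    moreover have "w ^ (e + c) *[N] x = d ^ e *[N] ((b_xi B ^ e * w ^ c) *[N] x)"
    proof -
      have "w ^ (e + c) = d ^ e * (b_xi B ^ e * w ^ c)"
        by (subst power_add, subst d(2)) (simp add: power_mult_distrib mult_ac)
      then show ?thesis using x d(1) by (simp add: N.smult_smult)
    qed
    ultimately show ?thesis using spN(4)[of "d ^ e" z] z(1) d(1) by simp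
  qed
  then have "\<exists>l. \<forall>x\<in>carrier N. w ^ l *[N] x \<in> span_on R N (Phi ` carrier N)" by blast
  then have "wm N Phi k" unfolding wm_def frob_pres_def using W ah sl frb comm by simp
  then show ?thesis by blast
qed

lemma wmD: assumes "wm N Phi k"
  shows "wach_module B N" "finite_free R N" "rmod R N" "tfree R N" "lmod R N mu" "lmod R N (phi mu)"
    "semilinear_action B N" "addhom N N Phi"
    "[|c \<in> R; x \<in> carrier N|] ==> Phi (c *[N] x) = phi c *[N] Phi x"
    "x :> N ==> frb N (lfrac N mu x j) = lfrac N (phi mu) (mu ^ k *[N] Phi x) (k + j)"
    "[|g :> G; x \<in> carrier N|] ==> act g w ^ k *[N] Phi (gact N g x) = w ^ k *[N] gact N g (Phi x)"
    "\<exists>l. \<forall>x\<in>carrier N. w ^ l *[N] x \<in> span_on R N (Phi ` carrier N)"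
proof -
  from assms have W: "wach_module B N" and P: "frob_pres N Phi k" by (auto simp: wm_def)
  show "wach_module B N" "finite_free R N" "rmod R N" "tfree R N" "lmod R N mu" "lmod R N (phi mu)" "semilinear_action B N"
    using W wach_moduleD[OF W] by auto
  show "addhom N N Phi"
    "[|c \<in> R; x \<in> carrier N|] ==> Phi (c *[N] x) = phi c *[N] Phi x"
    "x :> N ==> frb N (lfrac N mu x j) = lfrac N (phi mu) (mu ^ k *[N] Phi x) (k + j)"
    "[|g :> G; x \<in> carrier N|] ==> act g w ^ k *[N] Phi (gact N g x) = w ^ k *[N] gact N g (Phi x)"
    "\<exists>l. \<forall>x\<in>carrier N. w ^ l *[N] x \<in> span_on R N (Phi ` carrier N)"
    using P unfolding frob_pres_def by simp_all
qed

text \<open>Frobenius is \<open>Phi\<close> over \<open>w ^ k\<close> on the source and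
  \<open>Psi\<close> over \<open>w ^ m\<close> on the target. Multiplying the compatibility by
  \<open>w ^ (k + m)\<close> makes it independent of the denominator of the fraction, so one
  identity on \<open>X\<close> remains.\<close>

lemma wach_hom_iff: assumes X: "wm X Phi k" and Y: "wm Y Psi m"
  shows "f \<in> wach_hom B X Y \<longleftrightarrow> f \<in> extensional (carrier X) \<and> addhom X Y f \<and>
    (\<forall>c\<in>R. \<forall>x\<in>carrier X. f (c *[X] x) = c *[Y] f x) \<and>
    (\<forall>g\<in>carrier G. \<forall>x\<in>carrier X. f (gact X g x) = gact Y g (f x)) \<and>
    (\<forall>x\<in>carrier X. w ^ m *[Y] f (Phi x) = w ^ k *[Y] Psi (f x))"
    (is "_ \<longleftrightarrow> ?E \<and> ?A \<and> ?L \<and> ?G \<and> ?F")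
proof -
  note DX = wmD[OF X] and DY = wmD[OF Y]
  interpret X: lmod R X mu by (rule DX)
  interpret X': lmod R X "phi mu" by (rule DX)
  interpret Y: lmod R Y mu by (rule DY)
  interpret Y': lmod R Y "phi mu" by (rule DY)
  have "(\<forall>\<xi>\<in>carrier (loc X mu). loc_map id (phi mu) Y (phi mu) f (frb X \<xi>) = frb Y (loc_map id mu Y mu f \<xi>)) \<longleftrightarrow> ?F"
    if A: ?A and L: ?L
  proof -
    have c: "Phi x :> X" "f x :> Y" "f (Phi x) :> Y" "Psi (f x) :> Y" if "x :> X" for x
      using that addhom_closed[OF A] addhom_closed[OF DX(8)] addhom_closed[OF DY(8)] by auto
    have "loc_map id (phi mu) Y (phi mu) f (frb X (lfrac X mu x j)) = frb Y (loc_map id mu Y mu f (lfrac X mu x j)) \<longleftrightarrow>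
        w ^ m *[Y] f (Phi x) = w ^ k *[Y] Psi (f x)" if x: "x :> X" for x j
    proof -
      have "loc_map id mu Y mu f (lfrac X mu x j) = lfrac Y mu (f x) j"
        using L x by (intro X.loc_map_linear[OF DY(5) A]) auto
      moreover have "loc_map id (phi mu) Y (phi mu) f (lfrac X (phi mu) (mu ^ k *[X] Phi x) (k + j)) =
          lfrac Y (phi mu) (f (mu ^ k *[X] Phi x)) (k + j)" using L x c by (intro X'.loc_map_linear[OF DY(6) A]) auto
      ultimately have "loc_map id (phi mu) Y (phi mu) f (frb X (lfrac X mu x j)) = frb Y (loc_map id mu Y mu f (lfrac X mu x j)) \<longleftrightarrow>
        (phi mu ^ (m + j) * mu ^ k) *[Y] f (Phi x) = (phi mu ^ (k + j) * mu ^ m) *[Y] Psi (f x)"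
        using x c L by (simp add: DX(10) DY(10) Y'.lfrac_eq Y.smult_smult)
      also have "... \<longleftrightarrow> (mu ^ (m + k + j) * w ^ j) *[Y] (w ^ m *[Y] f (Phi x)) = (mu ^ (m + k + j) * w ^ j) *[Y] (w ^ k *[Y] Psi (f x))"
        using x c by (simp add: Y.smult_smult frob_mu power_mult_distrib power_add mult_ac)
      also have "... \<longleftrightarrow> w ^ m *[Y] f (Phi x) = w ^ k *[Y] Psi (f x)" using x c by (subst Y.cancel) auto
      finally show ?thesis .
    qed
    then show ?thesis by (fastforce simp: X.loc_carrier)
  qed
  then show ?thesis unfolding wach_hom_def addhom_def PiE_def by auto
qed

lemma wach_homI:
  assumes X: "wm X Phi k" and Y: "wm Y Psi m" and gen: "addgen X Z" and f: "addhom X Y f" "f \<in> extensional (carrier X)"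
    and "!!c z. [|c \<in> R; z \<in> Z|] ==> f (c *[X] z) = c *[Y] f z"
    and "!!g z. [|g :> G; z \<in> Z|] ==> f (gact X g z) = gact Y g (f z)"
    and "!!z. z \<in> Z ==> w ^ m *[Y] f (Phi z) = w ^ k *[Y] Psi (f z)"
  shows "f \<in> wach_hom B X Y"
proof -
  note DX = wmD[OF X] and DY = wmD[OF Y]
  interpret X: rmod R X by (rule DX)
  interpret Y: rmod R Y by (rule DY)
  note aX = actionD(1)[OF DX(7)] and aY = actionD(1)[OF DY(7)]
  note cl [simp] = addhom_closed[OF f(1)] addhom_closed[OF DX(8)] addhom_closed[OF DY(8)] addhom_closed[OF aX] addhom_closed[OF aY]
  note ad [simp] = addhom_add[OF f(1)] addhom_add[OF DX(8)] addhom_add[OF DY(8)] addhom_add[OF aX] addhom_add[OF aY]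
  note ze [simp] = addhom_zero[OF X.is_abgroup Y.is_abgroup f(1)] addhom_zero[OF X.is_abgroup X.is_abgroup DX(8)]
    addhom_zero[OF Y.is_abgroup Y.is_abgroup DY(8)] addhom_zero[OF X.is_abgroup X.is_abgroup aX]
    addhom_zero[OF Y.is_abgroup Y.is_abgroup aY]
  note Z [simp] = addgenD[OF gen]
  have 1: "f (c *[X] x) = c *[Y] f x" if "c \<in> R" "x :> X" for c x
    using gen that(2) by (induction x rule: addgen_induct) (use that assms(6) in \<open>auto simp: X.smult_r_distr Y.smult_r_distr\<close>)
  have 2: "f (gact X g x) = gact Y g (f x)" if "g :> G" "x :> X" for g x
    using gen that(2) by (induction x rule: addgen_induct) (use that assms(7) in auto)
  have 3: "w ^ m *[Y] f (Phi x) = w ^ k *[Y] Psi (f x)" if "x :> X" for x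
    using gen that by (induction x rule: addgen_induct) (use that assms(8) in \<open>auto simp: Y.smult_r_distr\<close>)
  show ?thesis unfolding wach_hom_iff[OF X Y] using f 1 2 3 by auto
qed

end

section \<open>Unit and tensor product of Wach modules\<close>

text \<open>Records of different types cannot be equated, so agreement of their module parts is a
  relation of its own. It reduces statements about a Wach module to its bare module.\<close>

definition same_mod where
  "same_mod N M \<longleftrightarrow> carrier N = carrier M \<and> add N = add M \<and> zero N = zero M \<and> smult N = smult M"

lemma same_modD: assumes "same_mod N M"
  shows "carrier N = carrier M" "add N = add M" "zero N = zero M" "smult N = smult M"
    "lfrac N s = lfrac M s" "loc N s = loc M s" "addhom N P f = addhom M P f" "addhom Q N g = addhom Q M g"
    "a_minus N = a_minus M" "span_on R N = span_on R M" "addgen N = addgen M" "adic_power B N n = adic_power B M n"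
proof -
  show *: "carrier N = carrier M" "add N = add M" "zero N = zero M" "smult N = smult M"
    using assms by (auto simp: same_mod_def)
  show "lfrac N s = lfrac M s" "loc N s = loc M s" by (auto simp: * intro!: lfrac_cong loc_cong)
  show "addhom N P f = addhom M P f" "addhom Q N g = addhom Q M g" by (auto simp: addhom_def *)
  show "a_minus N = a_minus M" by (intro ext) (simp add: a_minus_def a_inv_def m_inv_def *)
  show sp: "span_on R N = span_on R M" for R
    by (intro ext) (simp add: span_on_def submodule_def subgroup_def submodule_axioms_def m_inv_def *)
  show "addgen N = addgen M" by (intro ext) (simp add: addgen_def *)
  show "adic_power B N n = adic_power B M n" by (simp add: adic_power_def sp *)
qed

lemma scalar_module_simps [simp]:
  "carrier (scalar_module R) = Scalar ` R" "zero (scalar_module R) = Scalar 0"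
  "add (scalar_module R) = (%x y. Scalar (the_scalar x + the_scalar y))"
  "smult (scalar_module R) = (%c x. Scalar (c * the_scalar x))" by (simp_all add: scalar_module_def)

lemma (in sring) rmod_scalar: "rmod R (scalar_module R :: ('r, ('r, 'b) univ) module)"
  by (rule rmodI[OF sring_axioms]; (rule abelian_groupI)?)
    (auto simp: algebra_simps intro!: imageI intro: bexI[where x = "- x" for x])

lemma (in sring) dbasis_scalar: "dbasis R (scalar_module R) {()} (%_. Scalar 1) (%_. the_scalar)"
proof -
  interpret S: rmod R "scalar_module R" by (rule rmod_scalar)
  have "finsum (scalar_module R) f {()} = f ()" if "f () \<in> Scalar ` R" for f using that by (subst S.finsum_insert) auto
  then show ?thesis by (auto simp: dbasis_def)
qed

context wbase
begin

lemma unit_simps: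
  "same_mod (wach_unit B) (scalar_module R)"
  "gact (wach_unit B) = (%g x. Scalar (act g (the_scalar x)))"
  "frb (wach_unit B) = loc_map phi mu (scalar_module R) (phi mu) (%x. Scalar (phi (the_scalar x)))"
  by (simp_all add: same_mod_def wach_unit_def Let_def module.defs wach.defs scalar_module_def)

lemma tens_simps:
  "same_mod (wach_tens B X Y) (tens R X Y)"
  "gact (wach_tens B X Y) = (%g. tmap R X Y (gact X g) (gact Y g))"
  "frb (wach_tens B X Y) = loc_ext phi mu (loc (tens R X Y) (phi mu))
    (tlift (loc (tens R X Y) (phi mu)) (%x y. loc_pure R X Y (phi mu) (frb X (lfrac X mu x 0)) (frb Y (lfrac Y mu y 0))))"
  by (simp_all add: same_mod_def wach_tens_def Let_def module.defs wach.defs)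

lemmas unit_mod [simp] = same_modD[OF unit_simps(1)]
lemmas tens_mod [simp] = same_modD[OF tens_simps(1)]

text \<open>Frobenius of tensor products and base changes is defined through \<open>loc_ext\<close>;
  a formula on integral vectors determines it on all fractions.\<close>

lemma frb_loc_ext:
  assumes "lmod R N mu" "lmod R N (phi mu)" "addhom N N Phi" "!!c x. [|c \<in> R; x \<in> carrier N|] ==> Phi (c *[N] x) = phi c *[N] Phi x"
    and F: "!!x. x :> N ==> F x = lfrac N (phi mu) (mu ^ k *[N] Phi x) k" and x: "x :> N"
  shows "loc_ext phi mu (loc N (phi mu)) F (lfrac N mu x j) = lfrac N (phi mu) (mu ^ k *[N] Phi x) (k + j)"
proof -
  interpret N: lmod R N mu by fact
  interpret N': lmod R N "phi mu" by fact
  note [simp] = addhom_closed[OF assms(3)]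
  show ?thesis
  proof (rule N.loc_ext_eval[where alp = phi, OF N'.rmod_loc N'.tfree_loc _ _ _ _ _ _ x])
    show "F (mu ^ n *[N] x) = phi mu ^ n *[loc N (phi mu)] F x" if "x :> N" for x n
      using that by (simp add: F assms(4) frob_power N'.loc_smult N.smult_smult mult.commute)
    show "phi mu ^ j *[loc N (phi mu)] lfrac N (phi mu) (mu ^ k *[N] Phi x) (k + j) = F x"
      using x N'.smult_lfrac_cancel[of "mu ^ k *[N] Phi x" j k] by (simp add: F add.commute)
  qed (use x F in auto)
qed

abbreviation (input) "uPhi \<equiv> %x. Scalar (phi (the_scalar x))"

lemma wm_unit: "wm (wach_unit B) uPhi 0"
proof -
  let ?N = "wach_unit B" and ?S = "scalar_module R"
  have rS: "rmod R ?S" by (rule rmod_scalar)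
  interpret S: rmod R ?S by (rule rS)
  interpret N: rmod R ?N by (rule S.cong_fields) simp_all
  have db: "dbasis R ?N {()} (%_. Scalar 1) (%_. the_scalar)" by (rule dbasis_cong[OF dbasis_scalar]) simp_all
  have tf: "tfree R ?S" by (auto simp: tfree_def)
  interpret L: lmod R ?S mu by (intro lmod.intro lmod_axioms.intro rS tf) auto
  interpret L': lmod R ?S "phi mu" by (intro lmod.intro lmod_axioms.intro rS tf) auto
  have diff: "x -[?N] y = Scalar (the_scalar x - the_scalar y)" if "x :> ?N" "y :> ?N" for x y
  proof -
    have "\<ominus>\<^bsub>?N\<^esub> y = Scalar (- the_scalar y)" using that by (intro N.minus_equality) auto
    then show ?thesis by (simp add: N.minus_eq del: tens_mod(9) unit_mod(9))
  qed
  show ?thesis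
  proof (rule wmI[OF N.finite_free_of_dbasis[OF db] addgen_carrier])
    fix g assume g: "g :> G"
    show "addhom ?N ?N (gact ?N g)" using g by (auto intro!: addhomI simp: unit_simps(2) act_add)
    fix h z assume "h :> G" "z :> ?N"
    then show "gact ?N (g \<otimes>\<^bsub>G\<^esub> h) z = gact ?N g (gact ?N h z)" using g by (auto simp: unit_simps(2) act_comp)
  next
    fix g z assume g: "g :> G" and z: "z :> ?N"
    then obtain c where c: "c \<in> R" "z = Scalar c" by auto
    obtain d where d: "d \<in> R" "act g c - c = mu * d" using act_mod[OF g c(1)] by blast
    show "\<exists>y\<in>carrier ?N. gact ?N g z -[?N] z = mu *[?N] y"
      using c g d by (intro bexI[of _ "Scalar d"]) (auto simp: unit_simps(2) diff simp del: unit_mod(9))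
    show "act g w ^ 0 *[?N] uPhi (gact ?N g z) = w ^ 0 *[?N] gact ?N g (uPhi z)"
      using c g by (auto simp: unit_simps(2) act_frob)
  next
    fix z n assume "z :> ?N"
    then obtain c where c: "c \<in> R" "z = Scalar c" by auto
    obtain m where m: "!!g. g \<in> U m ==> act g c - c \<in> adic_power B (regon R) n" using act_cont[OF c(1)] by blast
    have "gact ?N g z -[?N] z \<in> adic_power B ?N n" if g: "g \<in> U m" for g
    proof -
      have "(act g c - c) *[?S] Scalar 1 \<in> adic_power B ?S n" using m[OF g] by (intro adic_scalar[OF rS]) auto
      then show ?thesis using c g by (simp add: unit_simps(2) diff del: unit_mod(9))
    qed
    then show "\<exists>m. \<forall>g\<in>U m. gact ?N g z -[?N] z \<in> adic_power B ?N n" by blast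
  next
    fix z assume "z :> ?N"
    then obtain c where c: "c \<in> R" "z = Scalar c" by auto
    have "c *[?N] Scalar 1 \<in> span_on R ?N (uPhi ` carrier ?N)"
      by (intro N.span_closed(4) span_on_incl c(1)) (auto simp: image_iff intro: bexI[of _ 1])
    then show "w ^ 0 *[?N] z \<in> span_on R ?N (uPhi ` carrier ?N)" using c by simp
  next
    fix x j assume x: "x :> ?N"
    have ah: "addhom ?S ?S uPhi" by (auto intro!: addhomI simp: frob_add)
    have "frb ?N (lfrac ?S mu x j) = lfrac ?S (phi mu) (uPhi x) j" unfolding unit_simps(3)
      by (rule L.loc_map_eval[OF L'.lmod_axioms _ _ ah]) (use x in \<open>auto simp: frob_mult frob_power\<close>)
    then show "frb ?N (lfrac ?N mu x j) = lfrac ?N (phi mu) (mu ^ 0 *[?N] uPhi x) (0 + j)" using x by auto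
  qed (auto intro!: addhomI simp: unit_simps(2) frob_add act_mult frob_mult)
qed

lemma tpair_RR: "rmod R X ==> rmod R Y ==> tpair R R X Y" by (simp add: tpair_def tpair_axioms_def)

text \<open>Denominators multiply, so exponents add. For the cokernel, \<open>w ^ (l1 + l2)\<close>
  is distributed over the two factors of a pure tensor, and bilinearity carries the two spans into
  the span of the image.\<close>

lemma wm_tens: assumes X: "wm X Phi k" and Y: "wm Y Psi m"
  shows "wm (wach_tens B X Y) (tmap R X Y Phi Psi) (k + m)"
proof -
  note DX = wmD[OF X] and DY = wmD[OF Y]
  note aX = actionD[OF DX(7)] and aY = actionD[OF DY(7)]
  note cX [simp] = addhom_closed[OF aX(1)] addhom_closed[OF DX(8)]
    and cY [simp] = addhom_closed[OF aY(1)] addhom_closed[OF DY(8)]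
  note tp = tpair_RR[OF DX(3) DY(3)]
  interpret XY: tpair R R X Y by (rule tp)
  let ?T = "tens R X Y" and ?N = "wach_tens B X Y" and ?p = "ptens R X Y" and ?Phi = "tmap R X Y Phi Psi"
  interpret T: rmod R ?T by (rule XY.rmod_T)
  obtain I k1 J k2 where db: "dbasis R X I (%x. x) k1" "dbasis R Y J (%x. x) k2"
    using XY.L.dbasis_of_finite_free[OF DX(2)] XY.M.dbasis_of_finite_free[OF DY(2)] by blast
  note dbT = XY.dbasis_T[OF db]
  have ffT: "finite_free R ?T" by (rule T.finite_free_of_dbasis[OF dbT]) simp
  have ff: "finite_free R ?N" by (rule rmod.finite_free_of_dbasis[OF T.cong_fields dbasis_cong[OF dbT]]) simp_all
  note tf = finite_free_tfree[OF ffT]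
  have l: "lmod R ?T mu" "lmod R ?T (phi mu)" by (intro lmod.intro lmod_axioms.intro XY.rmod_T tf; simp)+
  interpret L': lmod R ?T "phi mu" by (rule l)
  have g_pt: "gact ?N g (?p x y) = ?p (gact X g x) (gact Y g y)" and g_ah: "addhom ?T ?T (gact ?N g)"
    if "g :> G" "x :> X" "y :> Y" for g x y using XY.tmap_pt[OF tp aX(1)[OF that(1)] aY(1)[OF that(1)], of "act g"]
      XY.addhom_tmap[OF tp aX(1)[OF that(1)] aY(1)[OF that(1)], of "act g"] that aX(4) aY(4) by (auto simp: tens_simps(2))
  have g_ah: "addhom ?T ?T (gact ?N g)" if "g :> G" for g using g_ah[OF that, of "0[X]" "0[Y]"] by simp
  have Phi_pt: "?Phi (?p x y) = ?p (Phi x) (Psi y)" if "x :> X" "y :> Y" for x y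
    using XY.tmap_pt[OF tp DX(8) DY(8), of phi] DX(9) DY(9) that by auto
  have Phi_ah: "addhom ?T ?T ?Phi" using XY.addhom_tmap[OF tp DX(8) DY(8), of phi] DX(9) DY(9) by auto
  \<comment> \<open>An increment of a pure tensor is split into one increment per factor; triviality
    modulo \<open>mu\<close> and continuity both pass to the tensor product in this way.\<close>
  have diff: "?p x' y' -[?T] ?p x y = ?p x' (y' -[Y] y) +[?T] ?p (x' -[X] x) y"
    if "x :> X" "y :> Y" "x' :> X" "y' :> Y" for x y x' y'
    using that by (simp add: XY.pt_diff_left XY.pt_diff_right T.diff_trans)
  have sm: "(a * b) *[?T] ?p x y = ?p (a *[X] x) (b *[Y] y)"
    if "a \<in> R" "b \<in> R" "x :> X" "y :> Y" for a b x y
    using that by (simp add: XY.smult_pt XY.pt_balance[symmetric] XY.L.smult_smult mult.commute)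
  obtain l1 where l1: "!!x. x :> X ==> w ^ l1 *[X] x \<in> span_on R X (Phi ` carrier X)" using DX(12) by blast
  obtain l2 where l2: "!!x. x :> Y ==> w ^ l2 *[Y] x \<in> span_on R Y (Psi ` carrier Y)" using DY(12) by blast
  have subs: "Phi ` carrier X \<subseteq> carrier X" "Psi ` carrier Y \<subseteq> carrier Y" "?Phi ` carrier ?T \<subseteq> carrier ?T"
    using addhom_closed[OF Phi_ah] by auto
  have sp: "?p a b \<in> span_on R ?T (?Phi ` carrier ?T)" if "a \<in> span_on R X (Phi ` carrier X)" "b \<in> span_on R Y (Psi ` carrier Y)" for a b
  proof (rule span_map[OF DY(3) XY.rmod_T XY.addhom_pt_right _ _ subs(2,3) _ that(2), where rho = "%c. c"])
    show ac: "a :> X" using that XY.L.span_closed(1)[OF subs(1)] by auto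
    fix b assume "b \<in> Psi ` carrier Y"
    then obtain y where y: "y :> Y" "b = Psi y" by blast
    show "?p a b \<in> span_on R ?T (?Phi ` carrier ?T)"
    proof (rule span_map[OF DX(3) XY.rmod_T XY.addhom_pt_left _ _ subs(1,3) _ that(1), where rho = "%c. c"])
      fix a assume "a \<in> Phi ` carrier X"
      then obtain x where x: "x :> X" "a = Phi x" by blast
      then have "?p a b = ?Phi (?p x y)" using y by (simp add: Phi_pt)
      then show "?p a b \<in> span_on R ?T (?Phi ` carrier ?T)" using x y by (intro span_on_incl) auto
    qed (use y in \<open>auto simp: XY.smult_pt\<close>)
  qed (use that XY.L.span_closed(1)[OF subs(1)] in \<open>auto simp: XY.smult_pt_right\<close>)
  show ?thesis
  proof (rule wmI[OF ff, where l = "l1 + l2", unfolded tens_mod, OF XY.addgen_T])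
    fix g assume g: "g :> G"
    show "addhom ?T ?T (gact ?N g)" by (rule g_ah[OF g])
    fix h z assume h: "h :> G" and "z \<in> {?p x y |x y. x :> X \<and> y :> Y}"
    then obtain x y where z: "x :> X" "y :> Y" "z = ?p x y" by blast
    then show "gact ?N (g \<otimes>\<^bsub>G\<^esub> h) z = gact ?N g (gact ?N h z)" using g h aX(3) aY(3) by (simp add: g_pt)
  next
    fix g z assume g: "g :> G" and "z \<in> {?p x y |x y. x :> X \<and> y :> Y}"
    then obtain x y where z: "x :> X" "y :> Y" "z = ?p x y" by blast
    show "gact ?N g (c *[?T] z) = act g c *[?T] gact ?N g z" if "c \<in> R" for c
      using z g that aX(4) by (simp add: XY.smult_pt g_pt)
    obtain x' y' where xy': "x' :> X" "gact X g x -[X] x = mu *[X] x'" "y' :> Y" "gact Y g y -[Y] y = mu *[Y] y'"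
      using wach_moduleD(7)[OF DX(1) g z(1)] wach_moduleD(7)[OF DY(1) g z(2)] by blast
    have "gact ?N g z -[?T] z = mu *[?T] (?p (gact X g x) y' +[?T] ?p x' y)"
      using z g xy' by (simp add: g_pt diff T.smult_r_distr XY.smult_pt XY.pt_balance)
    then show "\<exists>y\<in>carrier ?T. gact ?N g z -[?T] z = mu *[?T] y"
      using z g xy' by (intro bexI[of _ "?p (gact X g x) y' +[?T] ?p x' y"]) auto
    have "(act g w ^ k * act g w ^ m) *[?T] ?Phi (gact ?N g z) = (w ^ k * w ^ m) *[?T] gact ?N g (?Phi z)"
      using z g DX(11) DY(11) by (simp add: g_pt Phi_pt sm)
    then show "act g w ^ (k + m) *[?T] ?Phi (gact ?N g z) = w ^ (k + m) *[?T] gact ?N g (?Phi z)" by (simp add: power_add)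
  next
    fix z n assume "z \<in> {?p x y |x y. x :> X \<and> y :> Y}"
    then obtain x y where z: "x :> X" "y :> Y" "z = ?p x y" by blast
    obtain m1 m2 where m: "!!g. g \<in> U m1 ==> gact X g x -[X] x \<in> adic_power B X n"
      "!!g. g \<in> U m2 ==> gact Y g y -[Y] y \<in> adic_power B Y n"
      using wach_moduleD(8)[OF DX(1) z(1)] wach_moduleD(8)[OF DY(1) z(2)] by meson
    have "gact ?N g z -[?T] z \<in> adic_power B ?T n" if g: "g \<in> U (max m1 m2)" for g
    proof -
      have gm: "g \<in> U m1" "g \<in> U m2" using g U_mono[of m1 "max m1 m2"] U_mono[of m2 "max m1 m2"] by auto
      have "?p (gact X g x) (gact Y g y -[Y] y) \<in> adic_power B ?T n" using z gm m(2)[OF gm(2)]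
        by (intro adic_lin_map[OF DY(3) XY.rmod_T XY.addhom_pt_right]) (auto simp: XY.smult_pt_right)
      moreover have "?p (gact X g x -[X] x) y \<in> adic_power B ?T n" using m(1)[OF gm(1)]
        by (rule adic_lin_map[OF DX(3) XY.rmod_T XY.addhom_pt_left, rotated 2]) (use z in \<open>auto simp: XY.smult_pt\<close>)
      ultimately have "?p (gact X g x) (gact Y g y -[Y] y) +[?T] ?p (gact X g x -[X] x) y \<in> adic_power B ?T n"
        by (rule adic_closed(3)[OF XY.rmod_T])
      then show ?thesis using z gm by (simp add: g_pt diff)
    qed
    then show "\<exists>m. \<forall>g\<in>U m. gact ?N g z -[?T] z \<in> adic_power B ?T n" by blast
  next
    show "addhom ?T ?T ?Phi" by (rule Phi_ah)
    fix z assume "z \<in> {?p x y |x y. x :> X \<and> y :> Y}"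
    then obtain x y where z: "x :> X" "y :> Y" "z = ?p x y" by blast
    show "?Phi (c *[?T] z) = phi c *[?T] ?Phi z" if "c \<in> R" for c using z that DX(9) by (simp add: XY.smult_pt Phi_pt)
    show "w ^ (l1 + l2) *[?T] z \<in> span_on R ?T (?Phi ` carrier ?T)" using z l1 l2 sp by (simp add: power_add sm)
    show "gact ?N \<one>\<^bsub>G\<^esub> z = z" using z by (simp add: g_pt aX(2) aY(2))
  next
    fix x j assume x: "x :> ?T"
    let ?beta = "%x y. loc_pure R X Y (phi mu) (frb X (lfrac X mu x 0)) (frb Y (lfrac Y mu y 0))"
    let ?F = "%u. lfrac ?T (phi mu) (mu ^ (k + m) *[?T] ?Phi u) (k + m)"
    have sl: "?Phi (c *[?T] u) = phi c *[?T] ?Phi u" if "c \<in> R" "u :> ?T" for c u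
      using that(2) by (induction u rule: XY.T_induct)
        (use that(1) DX(9) addhom_closed[OF Phi_ah] addhom_zero[OF T.is_abgroup T.is_abgroup Phi_ah] in
          \<open>auto simp: XY.smult_pt Phi_pt T.smult_r_distr addhom_add[OF Phi_ah]\<close>)
    have Fa: "addhom ?T (loc ?T (phi mu)) ?F" using addhom_closed[OF Phi_ah]
      by (intro addhomI) (auto simp: addhom_add[OF Phi_ah] T.smult_r_distr L'.loc_add_same)
    \<comment> \<open>On pure tensors the product of the two Frobenius values is the additive map
      \<open>?F\<close>, and balancedness of \<open>?beta\<close> is inherited from it.\<close>
    have beta: "?beta x y = ?F (?p x y)" if "x :> X" "y :> Y" for x y
      using that by (simp add: DX(10) DY(10) loc_pure_lfrac[OF tp DX(6) DY(6) l(2)] Phi_pt power_add sm)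
    have bal: "balanced R X Y (loc ?T (phi mu)) ?beta"
    proof (rule balancedI)
      fix x x' y assume a: "x :> X" "x' :> X" "y :> Y"
      show "?beta (x +[X] x') y = ?beta x y +[loc ?T (phi mu)] ?beta x' y"
        using a addhom_add[OF Fa] by (simp add: beta XY.pt_add_left)
    next
      fix x y y' assume a: "x :> X" "y :> Y" "y' :> Y"
      show "?beta x (y +[Y] y') = ?beta x y +[loc ?T (phi mu)] ?beta x y'"
        using a addhom_add[OF Fa] by (simp add: beta XY.pt_add_right)
    qed (use addhom_closed[OF Fa] in \<open>auto simp: beta XY.pt_balance\<close>)
    have "tlift (loc ?T (phi mu)) ?beta u = ?F u" if "u :> ?T" for u
      by (rule addhom_eqI[OF XY.addgen_T XY.addhom_tlift[OF L'.abelian_group_loc bal] Fa XY.abelian_group_T L'.abelian_group_loc _ that])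
        (auto simp: XY.tlift_pt[OF L'.abelian_group_loc bal] beta)
    then show "frb ?N (lfrac ?T mu x j) = lfrac ?T (phi mu) (mu ^ (k + m) *[?T] ?Phi x) (k + m + j)"
      unfolding tens_simps(3) using x by (intro frb_loc_ext[OF l Phi_ah sl])
  qed
qed

end

section \<open>The tensor category of Wach modules\<close>

context wbase
begin

abbreviation (input) "TT \<equiv> wach_tens B"

lemma wach_wm: "wach_module B X ==> (!!Phi k. wm X Phi k ==> thesis) ==> thesis" using wm_exists by blast

lemma wach_TT [simp, intro]: "wach_module B X ==> wach_module B Y ==> wach_module B (TT X Y)"
  by (meson wach_wm wm_tens wmD(1))

lemma wach_unit' [simp, intro]: "wach_module B (wach_unit B)" using wmD(1)[OF wm_unit] .

lemmas wach_rmod = wach_moduleD(2)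

lemma wach_tpair: "wach_module B X ==> wach_module B Y ==> tpair R R X Y" by (intro tpair_RR wach_rmod)

lemma pt_mem [simp, intro]:
  "[|wach_module B X; wach_module B Y; x :> X; y \<in> carrier Y|] ==> ptens R X Y x y :> tens R X Y"
  using tpair.pt_closed[OF wach_tpair] .

lemma wach_homD: assumes "f \<in> wach_hom B X Y"
  shows "addhom X Y f" "[|c \<in> R; x \<in> carrier X|] ==> f (c *[X] x) = c *[Y] f x"
    "[|g :> G; x \<in> carrier X|] ==> f (gact X g x) = gact Y g (f x)" "f \<in> extensional (carrier X)"
    "x :> X ==> f x :> Y" using assms by (auto simp: wach_hom_def addhom_def PiE_def)

lemma hom_Phi: assumes "wm X Phi k" "wm Y Psi m" "f \<in> wach_hom B X Y" "x :> X"
  shows "w ^ m *[Y] f (Phi x) = w ^ k *[Y] Psi (f x)" using assms wach_hom_iff[OF assms(1,2)] by blast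

lemma hom_eqI:
  assumes "f \<in> wach_hom B X P" "g \<in> wach_hom B X P" "wach_module B X" "wach_module B P" "addgen X Z"
    "!!z. z \<in> Z ==> f z = g z" shows "f = g"
proof (rule extensionalityI[OF wach_homD(4)[OF assms(1)] wach_homD(4)[OF assms(2)]])
  fix x assume "x :> X"
  with assms(6) show "f x = g x" by (rule addhom_eqI[OF assms(5) wach_homD(1)[OF assms(1)] wach_homD(1)[OF assms(2)]
          rmod.is_abgroup[OF wach_rmod[OF assms(3)]] rmod.is_abgroup[OF wach_rmod[OF assms(4)]]])
qed

lemma hom_id: "wach_module B X ==> restrict id (carrier X) \<in> wach_hom B X X"
proof -
  assume X: "wach_module B X"
  then obtain Phi k where w: "wm X Phi k" using wach_wm by blast
  interpret X: rmod R X by (rule wach_rmod[OF X])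
  note D = wmD[OF w] and a = addhom_closed[OF actionD(1)[OF wmD(7)[OF w]]]
  show ?thesis unfolding wach_hom_iff[OF w w] using addhom_closed[OF D(8)] a by (auto intro!: addhomI)
qed

lemma hom_comp:
  assumes "wach_module B X" "wach_module B Y" "wach_module B Z" "f \<in> wach_hom B X Y" "g \<in> wach_hom B Y Z"
  shows "compose (carrier X) g f \<in> wach_hom B X Z"
proof -
  obtain Phi k Psi m Om q where w: "wm X Phi k" "wm Y Psi m" "wm Z Om q" using assms(1-3) wach_wm by metis
  note DX = wmD[OF w(1)] and DY = wmD[OF w(2)] and DZ = wmD[OF w(3)]
  interpret X: rmod R X by (rule DX)
  interpret Y: rmod R Y by (rule DY)
  interpret Z: lmod R Z mu by (rule DZ)
  note f = wach_homD[OF assms(4)] and g = wach_homD[OF assms(5)]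
  note [simp] = f(5) g(5) addhom_closed[OF DX(8)] addhom_closed[OF DY(8)] addhom_closed[OF DZ(8)]
    addhom_closed[OF actionD(1)[OF DX(7)]]
  have "w ^ q *[Z] g (f (Phi x)) = w ^ k *[Z] Om (g (f x))" if x: "x :> X" for x
  proof -
    \<comment> \<open>The factor \<open>w ^ m\<close>, with \<open>m\<close> the exponent of the
      middle module, lets the compatibility of \<open>f\<close> be used inside \<open>g\<close>; it
      cancels at the end by torsion-freeness.\<close>
    have "w ^ m *[Z] (w ^ q *[Z] g (f (Phi x))) = w ^ q *[Z] g (w ^ m *[Y] f (Phi x))"
      using x by (simp add: g(2) Z.smult_smult mult.commute)
    also have "... = w ^ q *[Z] g (w ^ k *[Y] Psi (f x))" using hom_Phi[OF w(1,2) assms(4) x] by simp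
    also have "... = w ^ k *[Z] (w ^ q *[Z] g (Psi (f x)))" using x by (simp add: g(2) Z.smult_smult mult.commute)
    also have "... = w ^ m *[Z] (w ^ k *[Z] Om (g (f x)))"
      using x hom_Phi[OF w(2,3) assms(5), of "f x"] by (simp add: Z.smult_smult mult.commute)
    finally show ?thesis using x by (subst (asm) Z.cancel) auto
  qed
  then show ?thesis unfolding wach_hom_iff[OF w(1,3)]
    by (auto intro!: addhomI simp: compose_eq addhom_add[OF f(1)] addhom_add[OF g(1)] f g(2,3))
qed

lemma hom_inverse:
  assumes XY: "wach_module B X" "wach_module B Y" and f: "f \<in> wach_hom B X Y" and bij: "bij_betw f (carrier X) (carrier Y)"
  defines "g \<equiv> restrict (the_inv_into (carrier X) f) (carrier Y)"
  shows "g \<in> wach_hom B Y X" "compose (carrier X) g f = restrict id (carrier X)"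
    "compose (carrier Y) f g = restrict id (carrier Y)"
proof -
  obtain Phi k Psi m where w: "wm X Phi k" "wm Y Psi m" using XY wach_wm by metis
  note DX = wmD[OF w(1)] and DY = wmD[OF w(2)] and fD = wach_homD[OF f]
  interpret X: lmod R X mu by (rule DX)
  interpret Y: lmod R Y mu by (rule DY)
  have inj: "f x = f x' \<longleftrightarrow> x = x'" if "x :> X" "x' :> X" for x x'
    using bij that by (auto simp: bij_betw_def inj_on_def)
  have gf: "g (f x) = x" if "x :> X" for x using bij that fD(5) by (simp add: g_def bij_betw_def the_inv_into_f_f)
  have fg: "f (g y) = y" if "y :> Y" for y using bij that by (simp add: g_def bij_betw_def f_the_inv_into_f)
  have gc: "g y :> X" if "y :> Y" for y using bij that unfolding bij_betw_def by (metis gf imageE)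
  note [simp] = fg gf gc fD(5) addhom_closed[OF DX(8)] addhom_closed[OF DY(8)]
    addhom_closed[OF actionD(1)[OF DX(7)]] addhom_closed[OF actionD(1)[OF DY(7)]]
  have geq: "g y = x" if "y :> Y" "x :> X" "y = f x" for x y using that by simp
  show "g \<in> wach_hom B Y X" unfolding wach_hom_iff[OF w(2,1)]
  proof (intro conjI ballI addhomI)
    show "g \<in> extensional (carrier Y)" by (simp add: g_def)
    fix y assume y: "y :> Y"
    then show "g y :> X" by simp
    show "g (y +[Y] y') = g y +[X] g y'" if "y' :> Y" for y' using y that by (intro geq) (auto simp: addhom_add[OF fD(1)])
    show "g (c *[Y] y) = c *[X] g y" if "c \<in> R" for c using y that by (intro geq) (auto simp: fD(2))
    show "g (gact Y h y) = gact X h (g y)" if "h :> G" for h using y that by (intro geq) (auto simp: fD(3))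
    have "f (w ^ k *[X] g (Psi y)) = f (w ^ m *[X] Phi (g y))" using y hom_Phi[OF w f, of "g y"] by (simp add: fD(2))
    then show "w ^ k *[X] g (Psi y) = w ^ m *[X] Phi (g y)" using y by (subst (asm) inj) auto
  qed
  show "compose (carrier X) g f = restrict id (carrier X)" "compose (carrier Y) f g = restrict id (carrier Y)"
    by (auto simp: compose_def restrict_def fun_eq_iff)
qed

lemma addgen_TT: assumes "wach_module B X" "wach_module B Y" "addgen X Z" "addgen Y Z'"
  shows "addgen (TT X Y) {ptens R X Y a b | a b. a \<in> Z \<and> b \<in> Z'}"
proof -
  interpret XY: tpair R R X Y by (rule wach_tpair[OF assms(1,2)])
  show ?thesis unfolding addgen_def tens_mod
  proof (intro conjI allI impI ballI)
    show "{ptens R X Y a b |a b. a \<in> Z \<and> b \<in> Z'} \<subseteq> carrier (tens R X Y)"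
      using addgenD[OF assms(3)] addgenD[OF assms(4)] by auto
    fix Q u
    assume Q: "Q 0[tens R X Y]" "\<forall>z\<in>{ptens R X Y a b |a b. a \<in> Z \<and> b \<in> Z'}. Q z"
      "\<forall>x\<in>carrier (tens R X Y). \<forall>y\<in>carrier (tens R X Y). Q x \<longrightarrow> Q y \<longrightarrow> Q (x +[tens R X Y] y)"
    assume "u :> tens R X Y"
    then show "Q u"
    proof (induction u rule: XY.T_induct)
      case (pure x y)
      show ?case using assms(3) pure(1)
      proof (induction x rule: addgen_induct)
        case (gen a)
        note a = addgenD[OF assms(3) gen]
        show ?case using assms(4) pure(2)
          by (induction y rule: addgen_induct) (use gen a Q in \<open>auto simp: XY.pt_zero_right XY.pt_add_right\<close>)
      qed (use pure Q in \<open>auto simp: XY.pt_zero_left XY.pt_add_left\<close>)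
    qed (use Q in auto)
  qed
qed

text \<open>The universal property inside the category of Wach modules: each condition on
  \<open>beta\<close> is a condition on a morphism, evaluated on pure tensors. On the source the
  exponents of the two factors add.\<close>

lemma hom_tensI:
  assumes X: "wm X Phi k" and Y: "wm Y Psi m" and P: "wm P Om q" and beta: "balanced R X Y P beta"
    and lin: "!!c x y. [|c \<in> R; x :> X; y \<in> carrier Y|] ==> beta (c *[X] x) y = c *[P] beta x y"
    and eq: "!!g x y. [|g :> G; x :> X; y \<in> carrier Y|] ==> beta (gact X g x) (gact Y g y) = gact P g (beta x y)"
    and fr: "!!x y. [|x :> X; y \<in> carrier Y|] ==> w ^ q *[P] beta (Phi x) (Psi y) = w ^ (k + m) *[P] Om (beta x y)"
  shows "restrict (tlift P beta) (carrier (TT X Y)) \<in> wach_hom B (TT X Y) P" (is "?f \<in> _")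
    and "[|x :> X; y \<in> carrier Y|] ==> restrict (tlift P beta) (carrier (TT X Y)) (ptens R X Y x y) = beta x y"
proof -
  note DX = wmD[OF X] and DY = wmD[OF Y] and DP = wmD[OF P]
  note aX = actionD[OF DX(7)] and aY = actionD[OF DY(7)]
  note [simp] = addhom_closed[OF aX(1)] addhom_closed[OF DX(8)] addhom_closed[OF aY(1)] addhom_closed[OF DY(8)]
  note tp = tpair_RR[OF DX(3) DY(3)]
  interpret XY: tpair R R X Y by (rule tp)
  interpret P: rmod R P by (rule DP)
  note lp = XY.tlift_pt[OF P.is_abgroup beta]
  have ev: "?f (ptens R X Y x y) = beta x y" if "x :> X" "y :> Y" for x y using that by (simp add: lp)
  then show "[|x :> X; y \<in> carrier Y|] ==> ?f (ptens R X Y x y) = beta x y" .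
  show "?f \<in> wach_hom B (TT X Y) P" unfolding tens_mod(1)
  proof (rule wach_homI[OF wm_tens[OF X Y] P, unfolded tens_mod, OF XY.addgen_T])
    show "addhom (tens R X Y) P (restrict (tlift P beta) (carrier (tens R X Y)))"
      using XY.addhom_tlift[OF P.is_abgroup beta] addhom_restrict[OF XY.abelian_group_T] by blast
    fix z assume "z \<in> {ptens R X Y x y |x y. x :> X \<and> y :> Y}"
    then obtain x y where z: "x :> X" "y :> Y" "z = ptens R X Y x y" by blast
    note ev = ev[unfolded tens_mod]
    show "restrict (tlift P beta) (carrier (tens R X Y)) (c *[tens R X Y] z) =
        c *[P] restrict (tlift P beta) (carrier (tens R X Y)) z" if "c \<in> R" for c
      using z that by (simp only: XY.smult_pt ev lin XY.L.smult_closed)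
    have "gact (TT X Y) g z = ptens R X Y (gact X g x) (gact Y g y)" if g: "g :> G" for g
      using XY.tmap_pt[OF tp aX(1)[OF g] aY(1)[OF g], of "act g" x y] z g aX(4) aY(4) by (simp add: tens_simps(2))
    then show "restrict (tlift P beta) (carrier (tens R X Y)) (gact (TT X Y) g z) =
        gact P g (restrict (tlift P beta) (carrier (tens R X Y)) z)" if "g :> G" for g using z that eq ev by simp
    have "tmap R X Y Phi Psi z = ptens R X Y (Phi x) (Psi y)"
      using XY.tmap_pt[OF tp DX(8) DY(8), of phi x y] z DX(9) DY(9) by simp
    then show "w ^ q *[P] restrict (tlift P beta) (carrier (tens R X Y)) (tmap R X Y Phi Psi z) =
        w ^ (k + m) *[P] Om (restrict (tlift P beta) (carrier (tens R X Y)) z)" using z fr ev by simp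
  qed simp
qed

lemma TT_pure_eval: assumes X: "wm X Phi k" and Y: "wm Y Psi m" and xy: "x :> X" "y :> Y"
  shows "g :> G ==> gact (TT X Y) g (ptens R X Y x y) = ptens R X Y (gact X g x) (gact Y g y)"
    and "tmap R X Y Phi Psi (ptens R X Y x y) = ptens R X Y (Phi x) (Psi y)"
    and "[|a \<in> R; b \<in> R|] ==> (a * b) *[tens R X Y] ptens R X Y x y = ptens R X Y (a *[X] x) (b *[Y] y)"
proof -
  note DX = wmD[OF X] and DY = wmD[OF Y]
  note aX = actionD[OF DX(7)] and aY = actionD[OF DY(7)]
  note tp = tpair_RR[OF DX(3) DY(3)]
  interpret XY: tpair R R X Y by (rule tp)
  show "gact (TT X Y) g (ptens R X Y x y) = ptens R X Y (gact X g x) (gact Y g y)" if g: "g :> G"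
    using XY.tmap_pt[OF tp aX(1)[OF g] aY(1)[OF g], of "act g" x y] xy g aX(4) aY(4) by (simp add: tens_simps(2))
  show "tmap R X Y Phi Psi (ptens R X Y x y) = ptens R X Y (Phi x) (Psi y)"
    using XY.tmap_pt[OF tp DX(8) DY(8), of phi x y] xy DX(9) DY(9) by simp
  show "(a * b) *[tens R X Y] ptens R X Y x y = ptens R X Y (a *[X] x) (b *[Y] y)" if "a \<in> R" "b \<in> R"
    using that xy by (simp add: XY.smult_pt XY.pt_balance[symmetric] XY.L.smult_smult mult.commute)
qed

lemma tlift_same: "same_mod N M ==> tlift N beta u = tlift M beta u" by (simp add: tlift_def same_mod_def)

text \<open>The underlying functions of the tensor product of arrows and of the constraints in
  \<open>wach_cat\<close>. They are named so that record projections fold into them; afterwards only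
  their values on pure tensors matter.\<close>

definition "ftar X Y X' Y' f g = restrict (tmap R X' Y' f g) (carrier (TT X Y))"
definition "fasc X Y Z = restrict (tlift (TT X (TT Y Z)) (%u z. tlift (TT X (TT Y Z))
  (%x y. ptens R X (TT Y Z) x (ptens R Y Z y z)) u)) (carrier (TT (TT X Y) Z))"
definition "flun X = restrict (tlift X (%c x. the_scalar c *[X] x)) (carrier (TT (wach_unit B) X))"
definition "frun X = restrict (tlift X (%x c. the_scalar c *[X] x)) (carrier (TT X (wach_unit B)))"
definition "fbrd X Y = restrict (tlift (TT Y X) (%x y. ptens R Y X y x)) (carrier (TT X Y))"

lemma ftar: assumes "wach_module B X" "wach_module B Y" "wach_module B X'" "wach_module B Y'"
    and f: "f \<in> wach_hom B X X'" and g: "g \<in> wach_hom B Y Y'"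
  shows "ftar X Y X' Y' f g \<in> wach_hom B (TT X Y) (TT X' Y')"
    and "[|x :> X; y \<in> carrier Y|] ==> ftar X Y X' Y' f g (ptens R X Y x y) = ptens R X' Y' (f x) (g y)"
proof -
  obtain Phi k Psi m where w: "wm X Phi k" "wm Y Psi m" using assms wach_wm by metis
  obtain Phi' k' Psi' m' where w': "wm X' Phi' k'" "wm Y' Psi' m'" using assms wach_wm by metis
  note fD = wach_homD[OF f] and gD = wach_homD[OF g]
  interpret XY: tpair R R X Y by (rule wach_tpair[OF assms(1,2)])
  interpret XY': tpair R R X' Y' by (rule wach_tpair[OF assms(3,4)])
  note [simp] = fD(5) gD(5) addhom_closed[OF wmD(8)[OF w(1)]] addhom_closed[OF wmD(8)[OF w(2)]]
     addhom_closed[OF wmD(8)[OF w'(1)]] addhom_closed[OF wmD(8)[OF w'(2)]]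
  let ?beta = "%x y. ptens R X' Y' (f x) (g y)"
  have bal: "balanced R X Y (TT X' Y') ?beta"
    by (rule balancedI) (auto simp: addhom_add[OF fD(1)] addhom_add[OF gD(1)] XY'.pt_add_left XY'.pt_add_right
        XY'.pt_balance fD(2) gD(2))
  have fr: "w ^ (k' + m') *[TT X' Y'] ?beta (Phi x) (Psi y) = w ^ (k + m) *[TT X' Y'] tmap R X' Y' Phi' Psi' (?beta x y)"
    if "x :> X" "y :> Y" for x y using that hom_Phi[OF w(1) w'(1) f that(1)] hom_Phi[OF w(2) w'(2) g that(2)]
    by (simp add: power_add TT_pure_eval[OF w'])
  have eq: "ftar X Y X' Y' f g = restrict (tlift (TT X' Y') ?beta) (carrier (TT X Y))" unfolding ftar_def
    by (intro restrict_ext) (simp add: XY.tmap_tlift[OF XY'.tpair_axioms] tlift_same[OF tens_simps(1)])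
  note H = hom_tensI[OF w wm_tens[OF w'] bal _ _ fr, folded eq]
  show "ftar X Y X' Y' f g \<in> wach_hom B (TT X Y) (TT X' Y')"
    by (rule H) (auto simp: XY'.smult_pt fD(2,3) gD(3) TT_pure_eval[OF w'])
  show "[|x :> X; y \<in> carrier Y|] ==> ftar X Y X' Y' f g (ptens R X Y x y) = ptens R X' Y' (f x) (g y)"
    by (rule H) (auto simp: XY'.smult_pt fD(2,3) gD(3) TT_pure_eval[OF w'])
qed

lemma flun: assumes X: "wach_module B X" shows "flun X \<in> wach_hom B (TT (wach_unit B) X) X"
    and "[|c \<in> R; x \<in> carrier X|] ==> flun X (ptens R (wach_unit B) X (Scalar c) x) = c *[X] x"
proof -
  obtain Phi k where w: "wm X Phi k" using X wach_wm by metis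
  note D = wmD[OF w]
  interpret X: rmod R X by (rule D)
  note [simp] = addhom_closed[OF D(8)] addhom_closed[OF actionD(1)[OF D(7)]]
  have bal: "balanced R (wach_unit B) X X (%c x. the_scalar c *[X] x)"
    by (rule balancedI) (auto simp: X.smult_l_distr X.smult_r_distr X.smult_smult mult.commute)
  note H = hom_tensI[OF wm_unit w w bal, folded flun_def]
  show "flun X \<in> wach_hom B (TT (wach_unit B) X) X"
    by (rule H) (auto simp: X.smult_smult unit_simps(2) D(9) actionD(4)[OF D(7)])
  show "[|c \<in> R; x \<in> carrier X|] ==> flun X (ptens R (wach_unit B) X (Scalar c) x) = c *[X] x"
    by (subst H) (auto simp: X.smult_smult unit_simps(2) D(9) actionD(4)[OF D(7)])
qed

lemma frun: assumes X: "wach_module B X" shows "frun X \<in> wach_hom B (TT X (wach_unit B)) X"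
    and "[|c \<in> R; x \<in> carrier X|] ==> frun X (ptens R X (wach_unit B) x (Scalar c)) = c *[X] x"
proof -
  obtain Phi k where w: "wm X Phi k" using X wach_wm by metis
  note D = wmD[OF w]
  interpret X: rmod R X by (rule D)
  note [simp] = addhom_closed[OF D(8)] addhom_closed[OF actionD(1)[OF D(7)]]
  have bal: "balanced R X (wach_unit B) X (%x c. the_scalar c *[X] x)"
    by (rule balancedI) (auto simp: X.smult_l_distr X.smult_r_distr X.smult_smult mult.commute)
  note H = hom_tensI[OF w wm_unit w bal, folded frun_def]
  show "frun X \<in> wach_hom B (TT X (wach_unit B)) X"
    by (rule H) (auto simp: X.smult_smult unit_simps(2) D(9) actionD(4)[OF D(7)] mult.commute)
  show "[|c \<in> R; x \<in> carrier X|] ==> frun X (ptens R X (wach_unit B) x (Scalar c)) = c *[X] x"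
    by (subst H) (auto simp: X.smult_smult unit_simps(2) D(9) actionD(4)[OF D(7)] mult.commute)
qed

lemma fbrd: assumes "wach_module B X" "wach_module B Y"
  shows "fbrd X Y \<in> wach_hom B (TT X Y) (TT Y X)"
    and "[|x :> X; y \<in> carrier Y|] ==> fbrd X Y (ptens R X Y x y) = ptens R Y X y x"
proof -
  obtain Phi k Psi m where w: "wm X Phi k" "wm Y Psi m" using assms wach_wm by metis
  interpret XY: tpair R R Y X by (rule wach_tpair[OF assms(2,1)])
  have bal: "balanced R X Y (TT Y X) (%x y. ptens R Y X y x)"
    by (rule balancedI) (auto simp: XY.pt_add_left XY.pt_add_right XY.pt_balance)
  have fr: "w ^ (m + k) *[TT Y X] ptens R Y X (Psi y) (Phi x) = w ^ (k + m) *[TT Y X] tmap R Y X Psi Phi (ptens R Y X y x)"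
    if "x :> X" "y :> Y" for x y using that by (simp add: TT_pure_eval[OF w(2,1)] add.commute)
  note H = hom_tensI[OF w wm_tens[OF w(2,1)] bal _ _ fr, folded fbrd_def]
  show "fbrd X Y \<in> wach_hom B (TT X Y) (TT Y X)"
    by (rule H) (auto simp: XY.smult_pt XY.pt_balance TT_pure_eval[OF w(2,1)])
  show "[|x :> X; y \<in> carrier Y|] ==> fbrd X Y (ptens R X Y x y) = ptens R Y X y x"
    by (rule H) (auto simp: XY.smult_pt XY.pt_balance TT_pure_eval[OF w(2,1)])
qed

text \<open>The defining map is an iterated \<open>tlift\<close>. For fixed \<open>z\<close> the
  inner one is additive in \<open>u\<close> by construction; its dependence on \<open>z\<close>, its
  equivariance and its compatibility with Frobenius are proved by induction on the tensor
  \<open>u\<close>.\<close>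

lemma fasc: assumes "wach_module B X" "wach_module B Y" "wach_module B Z"
  shows "fasc X Y Z \<in> wach_hom B (TT (TT X Y) Z) (TT X (TT Y Z))"
    and "[|x :> X; y :> Y; z \<in> carrier Z|] ==>
      fasc X Y Z (ptens R (TT X Y) Z (ptens R X Y x y) z) = ptens R X (TT Y Z) x (ptens R Y Z y z)"
proof -
  obtain Phi k Psi m Om q where w: "wm X Phi k" "wm Y Psi m" "wm Z Om q" using assms wach_wm by metis
  let ?P = "TT X (TT Y Z)"
  note wP = wm_tens[OF w(1) wm_tens[OF w(2,3)]]
  note DX = wmD[OF w(1)] and DY = wmD[OF w(2)] and DZ = wmD[OF w(3)] and DP = wmD[OF wP] and DXY = wmD[OF wm_tens[OF w(1,2)]]
  interpret XY: tpair R R X Y by (rule wach_tpair[OF assms(1,2)])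
  interpret YZ: tpair R R Y Z by (rule wach_tpair[OF assms(2,3)])
  interpret XYZ: tpair R R X "TT Y Z" by (rule wach_tpair[OF assms(1) wach_TT[OF assms(2,3)]])
  interpret P: rmod R ?P by (rule DP)
  interpret XYm: rmod R "TT X Y" by (rule DXY)
  let ?\<gamma> = "%z x y. ptens R X (TT Y Z) x (ptens R Y Z y z)"
  note cl = addhom_closed[OF DX(8)] addhom_closed[OF DY(8)] addhom_closed[OF DZ(8)] addhom_closed[OF DP(8)]
    addhom_closed[OF actionD(1)[OF DX(7)]] addhom_closed[OF actionD(1)[OF DY(7)]]
    addhom_closed[OF actionD(1)[OF DZ(7)]] addhom_closed[OF actionD(1)[OF DP(7)]]
  note [simp] = cl[unfolded tens_mod]
  have pin: "ptens R X (TT Y Z) x (ptens R Y Z y z) :> tens R X (TT Y Z)"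
    if "x :> X" "y :> Y" "z :> Z" for x y z using that by (intro XYZ.pt_closed) auto
  have gbal: "balanced R X Y ?P (?\<gamma> z)" if "z :> Z" for z by (rule balancedI)
      (use that in \<open>auto simp: pin XYZ.pt_add_left YZ.pt_add_left XYZ.pt_balance[symmetric] YZ.smult_pt[symmetric]
        XYZ.pt_add_right[unfolded tens_mod] XYZ.pt_balance[unfolded tens_mod]\<close>)
  note lp = XY.tlift_pt[OF P.is_abgroup gbal] and la = XY.addhom_tlift[OF P.is_abgroup gbal]
  note lc [simp] = addhom_closed[OF la, unfolded tens_mod] and ladd = addhom_add[OF la, unfolded tens_mod]
    and l0 = addhom_zero[OF XY.abelian_group_T P.is_abgroup la, unfolded tens_mod]
  let ?beta = "%u z. tlift ?P (?\<gamma> z) u"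
  have lsm: "tlift ?P (?\<gamma> z) (c *[tens R X Y] u) = c *[?P] tlift ?P (?\<gamma> z) u"
    if "c \<in> R" "z :> Z" "u :> tens R X Y" for c z u
  proof (rule XY.tlift_smult[OF P.is_abgroup gbal[OF that(2)] _ _ that(1,3)])
    show "addhom ?P ?P ((\<odot>\<^bsub>?P\<^esub>) c)" using that P.smult_r_distr P.smult_closed by (intro addhomI) auto
  qed (use that in \<open>auto simp: XYZ.smult_pt\<close>)
  have bal: "balanced R (TT X Y) Z ?P ?beta"
  proof (rule balancedI)
    fix u z z' assume "u :> TT X Y" and z: "z :> Z" "z' :> Z"
    then have u: "u :> tens R X Y" by simp
    note z' = YZ.M.a_closed[OF z]
    show "?beta u (z +[Z] z') = ?beta u z +[?P] ?beta u z'" using u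
    proof (induction u rule: XY.T_induct)
      case zero
      then show ?case using z z' P.l_zero[OF P.zero_closed] by (simp add: l0)
    next
      case (pure x y)
      then show ?case
        using z z' XYZ.pt_add_right[of x "ptens R Y Z y z" "ptens R Y Z y z'"] by (simp add: lp YZ.pt_add_right)
    next
      case (add u v)
      then have "?beta u z :> ?P" "?beta v z :> ?P" "?beta u z' :> ?P" "?beta v z' :> ?P" using z by auto
      then have "(?beta u z +[?P] ?beta u z') +[?P] (?beta v z +[?P] ?beta v z') = (?beta u z +[?P] ?beta v z) +[?P] (?beta u z' +[?P] ?beta v z')"
        by (simp only: P.a_ac P.a_closed)
      with add z z' show ?case by (simp add: ladd)
    qed
  next
    fix r u z assume r: "r \<in> R" and "u :> TT X Y" and z: "z :> Z"
    then have u: "u :> tens R X Y" by simp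
    have rz: "r *[Z] z :> Z" using r z by simp
    have "?beta u (r *[Z] z) = r *[?P] ?beta u z" using u
    proof (induction u rule: XY.T_induct)
      case zero
      then show ?case using z rz r P.smult_r_null[OF r] by (simp add: l0)
    next
      case (pure x y)
      then show ?case using z rz r XYZ.smult_pt_right[of r x "ptens R Y Z y z"] by (simp add: lp YZ.smult_pt_right)
    next
      case (add u v)
      then show ?case using z rz r P.smult_r_distr[of r "?beta u z" "?beta v z"] by (simp add: ladd)
    qed
    then show "?beta (r *[TT X Y] u) z = ?beta u (r *[Z] z)" using lsm[OF r z u] by simp
  qed (use ladd in auto)
  note eX = TT_pure_eval[OF w(1,2)] and eY = TT_pure_eval[OF w(2,3)] and eP = TT_pure_eval[OF w(1) wm_tens[OF w(2,3)], unfolded tens_mod]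
  have geq: "?beta (gact (TT X Y) g u) (gact Z g z) = gact ?P g (?beta u z)" 
    if g: "g :> G" and "u :> TT X Y" and z: "z :> Z" for g u z
  proof -
    note aP = actionD(1)[OF DP(7) g] and aXY = actionD(1)[OF DXY(7) g]
    note zs = addhom_zero[OF P.is_abgroup P.is_abgroup aP] addhom_zero[OF XYm.is_abgroup XYm.is_abgroup aXY]
      and as = addhom_add[OF aP] addhom_add[OF aXY] and cs = addhom_closed[OF aP] addhom_closed[OF aXY]
    from that have "u :> tens R X Y" by simp
    then show ?thesis
    proof (induction u rule: XY.T_induct)
      case (pure x y)
      then show ?case using g z by (simp add: eX(1) eY(1) eP(1) lp)
    qed (use g z zs as cs in \<open>auto simp: l0 ladd\<close>)
  qed
  have fr: "w ^ (k + (m + q)) *[?P] ?beta (tmap R X Y Phi Psi u) (Om z) = w ^ (k + m + q) *[?P] tmap R X (TT Y Z) Phi (tmap R Y Z Psi Om) (?beta u z)"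
    if "u :> TT X Y" and z: "z :> Z" for u z
  proof -
    let ?PhiP = "tmap R X (TT Y Z) Phi (tmap R Y Z Psi Om)" and ?PhiT = "tmap R X Y Phi Psi"
    note zs = addhom_zero[OF P.is_abgroup P.is_abgroup DP(8)] addhom_zero[OF XYm.is_abgroup XYm.is_abgroup DXY(8)]
      and as = addhom_add[OF DP(8)] addhom_add[OF DXY(8)] and cs = addhom_closed[OF DP(8)] addhom_closed[OF DXY(8)]
    from that have "u :> tens R X Y" by simp
    then have "?beta (?PhiT u) (Om z) = ?PhiP (?beta u z)"
    proof (induction u rule: XY.T_induct)
      case (pure x y)
      then show ?case using z by (simp add: eX(2) eY(2) eP(2) lp)
    qed (use z zs as cs in \<open>auto simp: l0 ladd\<close>)
    then show ?thesis by (simp add: add.assoc)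
  qed
  have lin: "?beta (c *[TT X Y] u) z = c *[?P] ?beta u z" if "c \<in> R" "u :> TT X Y" "z :> Z" for c u z
    using lsm that by simp
  show "fasc X Y Z \<in> wach_hom B (TT (TT X Y) Z) ?P"
    unfolding fasc_def by (rule hom_tensI(1)[OF wm_tens[OF w(1,2)] w(3) wP bal]; (rule lin geq fr; assumption))
  have H2: "fasc X Y Z (ptens R (TT X Y) Z u z) = ?beta u z" if "u :> TT X Y" "z :> Z" for u z unfolding fasc_def
    by (rule hom_tensI(2)[OF wm_tens[OF w(1,2)] w(3) wP bal _ _ _ that]; (rule lin geq fr; assumption))
  show "fasc X Y Z (ptens R (TT X Y) Z (ptens R X Y x y) z) = ptens R X (TT Y Z) x (ptens R Y Z y z)"
    if "x :> X" "y :> Y" "z :> Z" using H2[of "ptens R X Y x y" z] that by (simp add: lp)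
qed

end

section \<open>The symmetric monoidal category of Wach modules\<close>

context wbase
begin

lemma wach_cat_simps:
  "Obj (wach_cat B) = {X. wach_module B X}"
  "Arr (wach_cat B) = {(X, f, Y). wach_module B X \<and> wach_module B Y \<and> f \<in> wach_hom B X Y}"
  "Dom (wach_cat B) (X, f, Y) = X" "Cod (wach_cat B) (X, f, Y) = Y"
  "Idn (wach_cat B) X = (X, restrict id (carrier X), X)"
  "Cmp (wach_cat B) (Y, g, Z) (X, f, Y') = (X, compose (carrier X) g f, Z)"
  "tob (wach_cat B) = TT"
  "tar (wach_cat B) (X, f, X') (Y, g, Y') = (TT X Y, ftar X Y X' Y' f g, TT X' Y')"
  "tun (wach_cat B) = wach_unit B"
  "asc (wach_cat B) X Y Z = (TT (TT X Y) Z, fasc X Y Z, TT X (TT Y Z))"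
  "lun (wach_cat B) X = (TT (wach_unit B) X, flun X, X)"
  "run (wach_cat B) X = (TT X (wach_unit B), frun X, X)"
  "brd (wach_cat B) X Y = (TT X Y, fbrd X Y, TT Y X)"
  by (simp_all only: wach_cat_def Let_def cat.simps tcat.simps case_prod_conv
      ftar_def fasc_def flun_def frun_def fbrd_def)

lemma in_hom_wach:
  "in_hom (wach_cat B) F X Y \<longleftrightarrow> (\<exists>f. F = (X, f, Y) \<and> wach_module B X \<and> wach_module B Y \<and> f \<in> wach_hom B X Y)"
  by (auto simp: in_hom_def wach_cat_simps)

lemma ArrE: assumes "F \<in> Arr (wach_cat B)"
  obtains X f Y where "F = (X, f, Y)" "wach_module B X" "wach_module B Y" "f \<in> wach_hom B X Y"
  using assms by (auto simp: wach_cat_simps)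

lemma iso_of_bij:
  assumes "wach_module B X" "wach_module B Y" "f \<in> wach_hom B X Y" "bij_betw f (carrier X) (carrier Y)"
  shows "iso_arr (wach_cat B) (X, f, Y) X Y" unfolding iso_arr_def in_hom_wach
proof (intro conjI exI)
  let ?g = "restrict (the_inv_into (carrier X) f) (carrier Y)"
  note H = hom_inverse[OF assms]
  show "(Y, ?g, X) = (Y, ?g, X)" "?g \<in> wach_hom B Y X" using H by auto
  show "(Y, ?g, X) \<bullet>[wach_cat B] (X, f, Y) = Idn (wach_cat B) X" "(X, f, Y) \<bullet>[wach_cat B] (Y, ?g, X) = Idn (wach_cat B) Y"
    using H by (auto simp: wach_cat_simps)
qed (use assms in auto)

lemma comp_id: "f \<in> wach_hom B X Y ==> compose (carrier X) f (restrict id (carrier X)) = f"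
  "f \<in> wach_hom B X Y ==> compose (carrier X) (restrict id (carrier Y)) f = f" using wach_homD(4,5)[of f X Y]
  by (auto simp: compose_def restrict_def fun_eq_iff extensional_def)

lemma TT_dbasis: assumes "wach_module B X" "wach_module B Y" "dbasis R X I e k" "dbasis R Y J f m"
  shows "\<exists>kap. dbasis R (TT X Y) (I \<times> J) (%(i, j). ptens R X Y (e i) (f j)) kap"
  using dbasis_cong[OF tpair.dbasis_T[OF wach_tpair[OF assms(1,2)] assms(3,4)], of "TT X Y"] by auto

lemma unit_dbasis: "dbasis R (wach_unit B) {()} (%_. Scalar 1) (%_. the_scalar)"
  by (rule dbasis_cong[OF dbasis_scalar]) simp_all

lemma wach_dbasis: "wach_module B X ==> \<exists>I k. dbasis R X I (%x. x) k"
  using rmod.dbasis_of_finite_free wach_moduleD(1,2) by blast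

lemma bij_hom:
  assumes "wach_module B X" "wach_module B Y" "f \<in> wach_hom B X Y" "dbasis R X I e k" "dbasis R Y J e' k'"
    "bij_betw t I J" "!!i. i \<in> I ==> f (e i) = e' (t i)"
  shows "bij_betw f (carrier X) (carrier Y)"
  using rmod.bij_of_dbasis[OF wach_rmod[OF assms(1)] assms(4,5) wach_rmod[OF assms(2)] wach_homD(1)[OF assms(3)]]
    wach_homD(2)[OF assms(3)] assms(6,7) by blast

text \<open>Tensors of basis vectors form bases on both sides and the associator rebrackets them, so
  only the index sets have to be matched.\<close>

lemma asc_iso: assumes X: "wach_module B X" "wach_module B Y" "wach_module B Z"
  shows "bij_betw (fasc X Y Z) (carrier (TT (TT X Y) Z)) (carrier (TT X (TT Y Z)))"
proof -
  obtain I k J m K n where db: "dbasis R X I (%x. x) k" "dbasis R Y J (%x. x) m" "dbasis R Z K (%x. x) n"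
    using wach_dbasis X by metis
  obtain kap1 where d1: "dbasis R (TT X Y) (I \<times> J) (%(i, j). ptens R X Y i j) kap1"
    using TT_dbasis[OF X(1,2) db(1,2)] by auto
  obtain kap2 where d2: "dbasis R (TT Y Z) (J \<times> K) (%(i, j). ptens R Y Z i j) kap2"
    using TT_dbasis[OF X(2,3) db(2,3)] by auto
  obtain kap3 where d3: "dbasis R (TT (TT X Y) Z) ((I \<times> J) \<times> K) (%(q, j). ptens R (TT X Y) Z (case q of (i, j) => ptens R X Y i j) j) kap3"
    using TT_dbasis[OF wach_TT[OF X(1,2)] X(3) d1 db(3)] by auto
  obtain kap4 where d4: "dbasis R (TT X (TT Y Z)) (I \<times> (J \<times> K)) (%(i, q). ptens R X (TT Y Z) i (case q of (i, j) => ptens R Y Z i j)) kap4"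
    using TT_dbasis[OF X(1) wach_TT[OF X(2,3)] db(1) d2] by auto
  have b: "bij_betw (%((i, j), k). (i, (j, k))) ((I \<times> J) \<times> K) (I \<times> (J \<times> K))"
    by (rule bij_betw_byWitness[where f' = "%(i, (j, k)). ((i, j), k)"]) auto
  show ?thesis by (rule bij_hom[OF _ _ fasc(1)[OF X] d3 d4 b])
      (use X dbasisD(2)[OF db(1)] dbasisD(2)[OF db(2)] dbasisD(2)[OF db(3)] in \<open>auto simp: fasc(2)\<close>)
qed

lemma lun_iso: assumes X: "wach_module B X"
  shows "bij_betw (flun X) (carrier (TT (wach_unit B) X)) (carrier X)"
proof -
  obtain I k where db: "dbasis R X I (%x. x) k" using wach_dbasis X by metis
  obtain kap where d: "dbasis R (TT (wach_unit B) X) ({()} \<times> I) (%(i, j). ptens R (wach_unit B) X (Scalar 1) j) kap"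
    using TT_dbasis[OF wach_unit' X unit_dbasis db] by auto
  interpret X: rmod R X by (rule wach_rmod[OF X])
  have "bij_betw snd ({()} \<times> I) I" by (rule bij_betw_byWitness[where f' = "Pair ()"]) auto
  from bij_hom[OF _ X flun(1)[OF X] d db this] show ?thesis using X dbasisD(2)[OF db] by (auto simp: flun(2))
qed

lemma run_iso: assumes X: "wach_module B X"
  shows "bij_betw (frun X) (carrier (TT X (wach_unit B))) (carrier X)"
proof -
  obtain I k where db: "dbasis R X I (%x. x) k" using wach_dbasis X by metis
  obtain kap where d: "dbasis R (TT X (wach_unit B)) (I \<times> {()}) (%(i, j). ptens R X (wach_unit B) i (Scalar 1)) kap"
    using TT_dbasis[OF X wach_unit' db unit_dbasis] by auto
  interpret X: rmod R X by (rule wach_rmod[OF X])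
  have "bij_betw fst (I \<times> {()}) I" by (rule bij_betw_byWitness[where f' = "%i. (i, ())"]) auto
  from bij_hom[OF _ X frun(1)[OF X] d db this] show ?thesis using X dbasisD(2)[OF db] by (auto simp: frun(2))
qed

lemmas gen2 = addgen_TT[OF _ _ addgen_carrier addgen_carrier]

lemma gen3: assumes "wach_module B X" "wach_module B Y" "wach_module B Z"
  shows "addgen (TT (TT X Y) Z) {ptens R (TT X Y) Z (ptens R X Y x y) z | x y z. x :> X \<and> y :> Y \<and> z :> Z}"
  using addgen_TT[OF wach_TT[OF assms(1,2)] assms(3) gen2[OF assms(1,2)] addgen_carrier]
  by (rule back_subst[of "addgen _"]) blast

lemma gen4: assumes "wach_module B W" "wach_module B X" "wach_module B Y" "wach_module B Z"
  shows "addgen (TT (TT (TT W X) Y) Z) {ptens R (TT (TT W X) Y) Z (ptens R (TT W X) Y (ptens R W X v x) y) z |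
    v x y z. v :> W \<and> x :> X \<and> y :> Y \<and> z :> Z}"
  using addgen_TT[OF wach_TT[OF wach_TT[OF assms(1,2)] assms(3)] assms(4) gen3[OF assms(1-3)] addgen_carrier]
  by (rule back_subst[of "addgen _"]) blast

lemma unit_carrier: "c :> wach_unit B \<longleftrightarrow> (\<exists>a\<in>R. c = Scalar a)" by auto

lemmas ev = ftar(2) fasc(2) flun(2) frun(2) fbrd(2) compose_eq wach_homD(5)

text \<open>Each coherence axiom is an equation between Wach homomorphisms out of an iterated tensor
  product. Such maps are determined by pure tensors, on which both sides take the same
  value.\<close>

theorem tensor_category_wach: "tensor_category (wach_cat B :: (('r, 'b, 'g) wach_ob, ('r, 'b, 'g) wach_ar) tcat)"
proof -
  let ?C = "wach_cat B :: (('r, 'b, 'g) wach_ob, ('r, 'b, 'g) wach_ar) tcat"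
  note cs = wach_cat_simps
  have category: "category ?C" unfolding category_def
  proof (intro conjI ballI impI)
    fix F assume F: "F \<in> Arr ?C"
    then show "Dom ?C F \<in> Obj ?C" "Cod ?C F \<in> Obj ?C" "F \<bullet>[?C] Idn ?C (Dom ?C F) = F" "Idn ?C (Cod ?C F) \<bullet>[?C] F = F"
      by (auto elim!: ArrE simp: cs comp_id simp del: restrict_apply)
    fix F' assume F': "F' \<in> Arr ?C"
    {
      assume "Dom ?C F' = Cod ?C F"
      with F F' show "in_hom ?C (F' \<bullet>[?C] F) (Dom ?C F) (Cod ?C F')"
        by (auto elim!: ArrE simp: cs in_hom_wach intro: hom_comp)
    }
    fix F'' assume F'': "F'' \<in> Arr ?C" and "Dom ?C F' = Cod ?C F \<and> Dom ?C F'' = Cod ?C F'"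
    with F F' show "F'' \<bullet>[?C] (F' \<bullet>[?C] F) = (F'' \<bullet>[?C] F') \<bullet>[?C] F"
      by (auto elim!: ArrE simp: cs compose_def restrict_def fun_eq_iff dest: wach_homD(5))
  next
    fix X assume "X \<in> Obj ?C"
    then show "in_hom ?C (Idn ?C X) X X" by (auto simp: cs in_hom_wach hom_id)
  qed
  have tar_hom: "in_hom ?C (tar ?C F F') (tob ?C (Dom ?C F) (Dom ?C F')) (tob ?C (Cod ?C F) (Cod ?C F'))"
    if "F \<in> Arr ?C" "F' \<in> Arr ?C" for F F' using that by (auto elim!: ArrE simp: cs in_hom_wach intro: ftar(1))
  have tar_id: "tar ?C (Idn ?C X) (Idn ?C Y) = Idn ?C (tob ?C X Y)" if "X \<in> Obj ?C" "Y \<in> Obj ?C" for X Y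
  proof -
    have w: "wach_module B X" "wach_module B Y" using that by (auto simp: cs)
    have "ftar X Y X Y (restrict id (carrier X)) (restrict id (carrier Y)) = restrict id (carrier (TT X Y))"
      by (rule hom_eqI[OF ftar(1) hom_id _ _ gen2]) (use w in \<open>auto simp: ftar(2) hom_id\<close>)
    then show ?thesis by (simp add: cs)
  qed
  have tar_comp: "tar ?C (F' \<bullet>[?C] F) (H' \<bullet>[?C] H) = tar ?C F' H' \<bullet>[?C] tar ?C F H"
    if FH: "F \<in> Arr ?C" "H \<in> Arr ?C" "F' \<in> Arr ?C" "H' \<in> Arr ?C" "Dom ?C F' = Cod ?C F" "Dom ?C H' = Cod ?C H" for F F' H H'
  proof -
    obtain X f Y where F: "F = (X, f, Y)" "wach_module B X" "wach_module B Y" "f \<in> wach_hom B X Y" using FH(1) by (rule ArrE)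
    obtain f' Z where F': "F' = (Y, f', Z)" "wach_module B Z" "f' \<in> wach_hom B Y Z"
      using ArrE[OF FH(3)] FH(5) F(1) cs(3,4) by metis
    obtain X1 h Y1 where H: "H = (X1, h, Y1)" "wach_module B X1" "wach_module B Y1" "h \<in> wach_hom B X1 Y1" using FH(2) by (rule ArrE)
    obtain h' Z1 where H': "H' = (Y1, h', Z1)" "wach_module B Z1" "h' \<in> wach_hom B Y1 Z1"
      using ArrE[OF FH(4)] FH(6) H(1) cs(3,4) by metis
    have "ftar X X1 Z Z1 (compose (carrier X) f' f) (compose (carrier X1) h' h) =
        compose (carrier (TT X X1)) (ftar Y Y1 Z Z1 f' h') (ftar X X1 Y Y1 f h)"
      by (rule hom_eqI[OF ftar(1) hom_comp[OF _ _ _ ftar(1) ftar(1)] _ _ gen2])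
        (use F F' H H' in \<open>auto simp: ftar(2) hom_comp compose_eq wach_homD(5)\<close>)
    then show ?thesis using F F' H H' by (simp add: cs)
  qed
  have asc: "iso_arr ?C (asc ?C X Y Z) (tob ?C (tob ?C X Y) Z) (tob ?C X (tob ?C Y Z))"
    if "X \<in> Obj ?C" "Y \<in> Obj ?C" "Z \<in> Obj ?C" for X Y Z
    using that unfolding cs by (intro iso_of_bij fasc(1) asc_iso) auto
  have asc_nat: "asc ?C (Cod ?C F) (Cod ?C H) (Cod ?C K) \<bullet>[?C] tar ?C (tar ?C F H) K =
      tar ?C F (tar ?C H K) \<bullet>[?C] asc ?C (Dom ?C F) (Dom ?C H) (Dom ?C K)"
    if a: "F \<in> Arr ?C" "H \<in> Arr ?C" "K \<in> Arr ?C" for F H K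
  proof -
    obtain X f X' where F: "F = (X, f, X')" "wach_module B X" "wach_module B X'" "f \<in> wach_hom B X X'" using a(1) by (rule ArrE)
    obtain Y h Y' where H: "H = (Y, h, Y')" "wach_module B Y" "wach_module B Y'" "h \<in> wach_hom B Y Y'" using a(2) by (rule ArrE)
    obtain Z k Z' where K: "K = (Z, k, Z')" "wach_module B Z" "wach_module B Z'" "k \<in> wach_hom B Z Z'" using a(3) by (rule ArrE)
    have "compose (carrier (TT (TT X Y) Z)) (fasc X' Y' Z') (ftar (TT X Y) Z (TT X' Y') Z' (ftar X Y X' Y' f h) k) =
        compose (carrier (TT (TT X Y) Z)) (ftar X (TT Y Z) X' (TT Y' Z') f (ftar Y Z Y' Z' h k)) (fasc X Y Z)"
      by (rule hom_eqI[OF hom_comp[OF _ _ _ ftar(1) fasc(1)] hom_comp[OF _ _ _ fasc(1) ftar(1)] _ _ gen3])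
        (use F H K in \<open>auto simp: ftar fasc compose_eq wach_homD(5)\<close>)
    then show ?thesis using F H K by (simp add: cs)
  qed
  have lr: "iso_arr ?C (lun ?C X) (tob ?C (tun ?C) X) X" "iso_arr ?C (run ?C X) (tob ?C X (tun ?C)) X" if "X \<in> Obj ?C" for X
    using that unfolding cs by (intro iso_of_bij flun(1) frun(1) lun_iso run_iso; auto)+
  have lr_nat: "lun ?C (Cod ?C F) \<bullet>[?C] tar ?C (Idn ?C (tun ?C)) F = F \<bullet>[?C] lun ?C (Dom ?C F)"
    "run ?C (Cod ?C F) \<bullet>[?C] tar ?C F (Idn ?C (tun ?C)) = F \<bullet>[?C] run ?C (Dom ?C F)" if a: "F \<in> Arr ?C" for F
  proof -
    obtain X f Y where F: "F = (X, f, Y)" "wach_module B X" "wach_module B Y" "f \<in> wach_hom B X Y" using a by (rule ArrE)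
    let ?U = "wach_unit B"
    interpret X: rmod R X by (rule wach_rmod[OF F(2)])
    have "compose (carrier (TT ?U X)) (flun Y) (ftar ?U X ?U Y (restrict id (carrier ?U)) f) =
        compose (carrier (TT ?U X)) f (flun X)"
      by (rule hom_eqI[OF hom_comp[OF _ _ _ ftar(1) flun(1)] hom_comp[OF _ _ _ flun(1) F(4)] _ _ gen2])
        (use F in \<open>auto simp: ftar(2) flun(2) hom_id compose_eq wach_homD(2,5) simp del: unit_mod(1), auto simp: unit_carrier flun(2) wach_homD(2,5)[OF F(4)] simp del: unit_mod(1)\<close>)
    then show "lun ?C (Cod ?C F) \<bullet>[?C] tar ?C (Idn ?C (tun ?C)) F = F \<bullet>[?C] lun ?C (Dom ?C F)" using F by (simp add: cs)
    have "compose (carrier (TT X ?U)) (frun Y) (ftar X ?U Y ?U f (restrict id (carrier ?U))) =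
        compose (carrier (TT X ?U)) f (frun X)"
      by (rule hom_eqI[OF hom_comp[OF _ _ _ ftar(1) frun(1)] hom_comp[OF _ _ _ frun(1) F(4)] _ _ gen2])
        (use F in \<open>auto simp: ftar(2) frun(2) hom_id compose_eq wach_homD(2,5) simp del: unit_mod(1), auto simp: unit_carrier frun(2) wach_homD(2,5)[OF F(4)] simp del: unit_mod(1)\<close>)
    then show "run ?C (Cod ?C F) \<bullet>[?C] tar ?C F (Idn ?C (tun ?C)) = F \<bullet>[?C] run ?C (Dom ?C F)" using F by (simp add: cs)
  qed
  have brd_brd: "brd ?C Y X \<bullet>[?C] brd ?C X Y = Idn ?C (tob ?C X Y)" if "X \<in> Obj ?C" "Y \<in> Obj ?C" for X Y
  proof -
    have w: "wach_module B X" "wach_module B Y" using that by (auto simp: cs)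
    have "compose (carrier (TT X Y)) (fbrd Y X) (fbrd X Y) = restrict id (carrier (TT X Y))"
      by (rule hom_eqI[OF hom_comp[OF _ _ _ fbrd(1) fbrd(1)] hom_id _ _ gen2]) (use w in \<open>auto simp: fbrd(2) compose_eq\<close>)
    then show ?thesis by (simp add: cs)
  qed
  have brd: "iso_arr ?C (brd ?C X Y) (tob ?C X Y) (tob ?C Y X)" if "X \<in> Obj ?C" "Y \<in> Obj ?C" for X Y
    unfolding iso_arr_def
  proof (intro conjI exI)
    show "in_hom ?C (brd ?C X Y) (tob ?C X Y) (tob ?C Y X)" "in_hom ?C (brd ?C Y X) (tob ?C Y X) (tob ?C X Y)"
      using that by (auto simp: cs in_hom_wach fbrd)
  qed (use brd_brd that in auto)
  have brd_nat: "brd ?C (Cod ?C F) (Cod ?C H) \<bullet>[?C] tar ?C F H = tar ?C H F \<bullet>[?C] brd ?C (Dom ?C F) (Dom ?C H)"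
    if a: "F \<in> Arr ?C" "H \<in> Arr ?C" for F H
  proof -
    obtain X f X' where F: "F = (X, f, X')" "wach_module B X" "wach_module B X'" "f \<in> wach_hom B X X'" using a(1) by (rule ArrE)
    obtain Y h Y' where H: "H = (Y, h, Y')" "wach_module B Y" "wach_module B Y'" "h \<in> wach_hom B Y Y'" using a(2) by (rule ArrE)
    have "compose (carrier (TT X Y)) (fbrd X' Y') (ftar X Y X' Y' f h) = compose (carrier (TT X Y)) (ftar Y X Y' X' h f) (fbrd X Y)"
      by (rule hom_eqI[OF hom_comp[OF _ _ _ ftar(1) fbrd(1)] hom_comp[OF _ _ _ fbrd(1) ftar(1)] _ _ gen2])
        (use F H in \<open>auto simp: ftar(2) fbrd(2) compose_eq wach_homD(5)\<close>)
    then show ?thesis using F H by (simp add: cs)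
  qed
  have pentagon: "asc ?C W X (tob ?C Y Z) \<bullet>[?C] asc ?C (tob ?C W X) Y Z =
      tar ?C (Idn ?C W) (asc ?C X Y Z) \<bullet>[?C] asc ?C W (tob ?C X Y) Z \<bullet>[?C] tar ?C (asc ?C W X Y) (Idn ?C Z)"
    if "W \<in> Obj ?C" "X \<in> Obj ?C" "Y \<in> Obj ?C" "Z \<in> Obj ?C" for W X Y Z
  proof -
    have w: "wach_module B W" "wach_module B X" "wach_module B Y" "wach_module B Z" using that by (auto simp: cs)
    let ?D = "TT (TT (TT W X) Y) Z" and ?iW = "restrict id (carrier W)" and ?iZ = "restrict id (carrier Z)"
    have "compose (carrier ?D) (fasc W X (TT Y Z)) (fasc (TT W X) Y Z) =
        compose (carrier ?D) (ftar W (TT (TT X Y) Z) W (TT X (TT Y Z)) ?iW (fasc X Y Z))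
          (compose (carrier ?D) (fasc W (TT X Y) Z) (ftar (TT (TT W X) Y) Z (TT W (TT X Y)) Z (fasc W X Y) ?iZ))"
      by (rule hom_eqI[OF hom_comp[OF _ _ _ fasc(1) fasc(1)] hom_comp[OF _ _ _ hom_comp[OF _ _ _ ftar(1) fasc(1)] ftar(1)] _ _ gen4])
        (use w in \<open>auto simp: fasc ftar hom_id compose_eq\<close>)
    then show ?thesis by (simp add: cs)
  qed
  have triangle: "tar ?C (Idn ?C X) (lun ?C Y) \<bullet>[?C] asc ?C X (tun ?C) Y = tar ?C (run ?C X) (Idn ?C Y)"
    if "X \<in> Obj ?C" "Y \<in> Obj ?C" for X Y
  proof -
    have w: "wach_module B X" "wach_module B Y" using that by (auto simp: cs)
    let ?U = "wach_unit B"
    interpret XY: tpair R R X Y by (rule wach_tpair[OF w])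
    \<comment> \<open>The middle scalar is absorbed into \<open>y\<close> on one side and into
      \<open>x\<close> on the other; balancing identifies the two results.\<close>
    have e: "compose (carrier (TT (TT X ?U) Y)) (ftar X (TT ?U Y) X Y (restrict id (carrier X)) (flun Y)) (fasc X ?U Y)
          (ptens R (TT X ?U) Y (ptens R X ?U x (Scalar c)) y) =
        ftar (TT X ?U) Y X Y (frun X) (restrict id (carrier Y)) (ptens R (TT X ?U) Y (ptens R X ?U x (Scalar c)) y)"
      if "x :> X" "c \<in> R" "y :> Y" for x c y
    proof -
      have 1: "ptens R X ?U x (Scalar c) :> tens R X ?U" "ptens R ?U Y (Scalar c) y :> tens R ?U Y" using that w by auto
      have 2: "ptens R (TT X ?U) Y (ptens R X ?U x (Scalar c)) y :> tens R (TT X ?U) Y" using 1 that w by (intro pt_mem) auto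
      show ?thesis using that w 1 2 by (simp add: compose_eq fasc(2) ftar(2) flun frun hom_id XY.pt_balance)
    qed
    have "compose (carrier (TT (TT X ?U) Y)) (ftar X (TT ?U Y) X Y (restrict id (carrier X)) (flun Y)) (fasc X ?U Y) =
        ftar (TT X ?U) Y X Y (frun X) (restrict id (carrier Y))"
      by (rule hom_eqI[OF hom_comp[OF _ _ _ fasc(1) ftar(1)] ftar(1) _ _ gen3])
        (use w e in \<open>auto simp: frun(1) flun(1) hom_id\<close>)
    then show ?thesis by (simp add: cs)
  qed
  have hexagon: "tar ?C (Idn ?C Y) (brd ?C X Z) \<bullet>[?C] asc ?C Y X Z \<bullet>[?C] tar ?C (brd ?C X Y) (Idn ?C Z) =
      asc ?C Y Z X \<bullet>[?C] brd ?C X (tob ?C Y Z) \<bullet>[?C] asc ?C X Y Z"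
    if "X \<in> Obj ?C" "Y \<in> Obj ?C" "Z \<in> Obj ?C" for X Y Z
  proof -
    have w: "wach_module B X" "wach_module B Y" "wach_module B Z" using that by (auto simp: cs)
    let ?D = "TT (TT X Y) Z" and ?iY = "restrict id (carrier Y)" and ?iZ = "restrict id (carrier Z)"
    have "compose (carrier ?D) (ftar Y (TT X Z) Y (TT Z X) ?iY (fbrd X Z))
          (compose (carrier ?D) (fasc Y X Z) (ftar (TT X Y) Z (TT Y X) Z (fbrd X Y) ?iZ)) =
        compose (carrier ?D) (fasc Y Z X) (compose (carrier ?D) (fbrd X (TT Y Z)) (fasc X Y Z))"
      by (rule hom_eqI[OF hom_comp[OF _ _ _ hom_comp[OF _ _ _ ftar(1) fasc(1)] ftar(1)]
            hom_comp[OF _ _ _ hom_comp[OF _ _ _ fasc(1) fbrd(1)] fasc(1)] _ _ gen3])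
        (use w in \<open>auto simp: fasc ftar fbrd hom_id compose_eq\<close>)
    then show ?thesis by (simp add: cs)
  qed
  show ?thesis unfolding tensor_category_def
  proof (intro conjI ballI impI)
    show "tun ?C \<in> Obj ?C" by (simp add: cs)
    show "tob ?C X Y \<in> Obj ?C" if "X \<in> Obj ?C" "Y \<in> Obj ?C" for X Y using that by (simp add: cs)
  qed (rule category tar_hom tar_id tar_comp asc asc_nat lr lr_nat brd brd_nat pentagon triangle hexagon brd_brd;
       (elim conjE)?; assumption)+
qed

end

section \<open>Base change and invariants of Wach modules\<close>

unbundle fps_syntax

text \<open>Fixed-point iteration. The factor \<open>fps_X\<close> makes coefficient
  \<open>m\<close> of an iterate depend only on lower coefficients of the previous one, so it is
  stable from step \<open>m\<close> on, and the diagonal of the iterates solves the system.\<close>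

lemma fps_system_solution:
  fixes a :: "'i => 'i => 'a::comm_ring_1 fps" and x :: "'i => 'a fps"
  assumes "finite I"
  shows "\<exists>y. \<forall>i\<in>I. x i = y i + fps_X * (\<Sum>j\<in>I. a i j * y j)"
proof -
  define s where "s = rec_nat x (%n s i. x i - fps_X * (\<Sum>j\<in>I. a i j * s j))"
  have s0: "s 0 = x" and sS: "s (Suc n) i = x i - fps_X * (\<Sum>j\<in>I. a i j * s n j)" for n i by (simp_all add: s_def)
  have cong: "(\<Sum>j\<in>I. a i j * y j) $ m = (\<Sum>j\<in>I. a i j * z j) $ m"
    if "!!j l. l \<le> m ==> fps_nth (y j) l = fps_nth (z j) l" for y z i and m :: nat
    using that by (simp add: fps_sum_nth fps_mult_nth)
  have st: "fps_nth (s n i) m = fps_nth (s m i) m" if "m \<le> n" for n m i using that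
  proof (induction m arbitrary: n i rule: less_induct)
    case (less m)
    show ?case
    proof (cases m)
      case 0
      then show ?thesis by (cases n) (simp_all add: sS s0)
    next
      case (Suc m')
      with less.prems obtain n' where n': "n = Suc n'" "m' \<le> n'" by (cases n) auto
      have "(\<Sum>j\<in>I. a i j * s n' j) $ m' = (\<Sum>j\<in>I. a i j * s m' j) $ m'"
      proof (rule cong)
        fix j l assume l: "l \<le> m'"
        then have "fps_nth (s n' j) l = fps_nth (s l j) l" using n' Suc by (intro less.IH) auto
        moreover have "fps_nth (s m' j) l = fps_nth (s l j) l" using l Suc by (intro less.IH) auto
        ultimately show "fps_nth (s n' j) l = fps_nth (s m' j) l" by simp
      qed
      then show ?thesis using Suc n' by (simp add: sS)
    qed
  qed
  define y where "y i = Abs_fps (%n. s n i $ n)" for i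
  have "x i = y i + fps_X * (\<Sum>j\<in>I. a i j * y j)" for i
  proof (rule fps_ext)
    fix m
    show "x i $ m = (y i + fps_X * (\<Sum>j\<in>I. a i j * y j)) $ m"
    proof (cases m)
      case 0
      then show ?thesis by (simp add: y_def s0)
    next
      case (Suc m')
      have "(\<Sum>j\<in>I. a i j * y j) $ m' = (\<Sum>j\<in>I. a i j * s m' j) $ m'"
      proof (rule cong)
        show "y j $ l = s m' j $ l" if "l \<le> m'" for j l using st[OF that, of j] by (simp add: y_def)
      qed
      then show ?thesis using Suc by (simp add: y_def sS)
    qed
  qed
  then show ?thesis by blast
qed

text \<open>Because of the factor \<open>fps_X\<close>, coefficient \<open>n\<close> of a solution
  is expressed through coefficients below \<open>n\<close>, all of which vanish by
  induction.\<close>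

lemma fps_system_unique:
  fixes a :: "'i => 'i => 'a::comm_ring_1 fps" and y :: "'i => 'a fps"
  assumes "!!i. i \<in> I ==> y i + fps_X * (\<Sum>j\<in>I. a i j * y j) = 0" "i \<in> I"
  shows "y i = 0"
proof (rule fps_ext)
  fix n
  show "y i $ n = 0 $ n" using assms(2)
  proof (induction n arbitrary: i rule: less_induct)
    case (less n)
    have "y i = - (fps_X * (\<Sum>j\<in>I. a i j * y j))" using assms(1)[OF less.prems] by (simp only: eq_neg_iff_add_eq_0)
    then have e: "y i $ n = (- (fps_X * (\<Sum>j\<in>I. a i j * y j))) $ n" by (rule arg_cong)
    show ?case
    proof (cases n)
      case 0
      then show ?thesis using e by simp
    next
      case (Suc m)
      have "(\<Sum>j\<in>I. a i j * y j) $ m = 0" using less.IH Suc by (simp add: fps_sum_nth fps_mult_nth)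
      then show ?thesis using e Suc by simp
    qed
  qed
qed

text \<open>The base change matrix is congruent to the identity modulo \<^term>\<open>fps_X\<close>, hence invertible.\<close>

lemma dbasis_perturb:
  fixes N :: "('a::comm_ring_1 fps, 'u, 'x) module_scheme"
  assumes N: "rmod UNIV N" and db: "dbasis UNIV N I e k"
    and n: "!!i. i \<in> I ==> n i :> N" "!!i. i \<in> I ==> e' i :> N" "!!i. i \<in> I ==> e' i -[N] e i = fps_X *[N] n i"
  shows "\<exists>k'. dbasis UNIV N I e' k'"
proof -
  interpret N: rmod UNIV N by fact
  note D = dbasisD[OF db]
  \<comment> \<open>\<open>y\<close> is the candidate for the coordinate vector of \<open>x\<close>
    in the basis \<open>e'\<close>: the base change matrix is \<open>1 + X a\<close>, where
    \<open>a\<close> has the entries \<open>k i (n j)\<close>.\<close>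
  define P where "P x y \<longleftrightarrow> (\<forall>i\<in>I. k i x = y i + fps_X * (\<Sum>j\<in>I. k i (n j) * y j))" for x y
  have "\<exists>y. P x y" for x unfolding P_def by (rule fps_system_solution[OF D(1)])
  then obtain f where f: "!!x. P x (f x)" by metis
  have uniq: "f x i = y i" if "P x y" "i \<in> I" for x y i
  proof -
    have "f x i - y i = 0"
    proof (rule fps_system_unique[where I = I and a = "%i j. k i (n j)" and y = "%i. f x i - y i"])
      fix i assume i: "i \<in> I"
      have "f x i + fps_X * (\<Sum>j\<in>I. k i (n j) * f x j) = y i + fps_X * (\<Sum>j\<in>I. k i (n j) * y j)"
        using f[of x] that(1) i by (simp add: P_def)
      then show "f x i - y i + fps_X * (\<Sum>j\<in>I. k i (n j) * (f x j - y j)) = 0"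
        by (simp add: right_diff_distrib sum_subtractf algebra_simps)
    qed (rule that(2))
    then show ?thesis by simp
  qed
  have ki: "k i (c *[N] e' j) = (if i = j then c else 0) + fps_X * (k i (n j) * c)" if "i \<in> I" "j \<in> I" for i j c
  proof -
    have "e' j = e j +[N] fps_X *[N] n j" using n[OF that(2)] N.add_diff_cancel[of "e' j" "e j"] D(2) that by simp
    then have "k i (c *[N] e' j) = c * (k i (e j) + fps_X * k i (n j))" using D(2,4,5) n that by simp
    then show ?thesis using D(6)[OF that] by (simp add: algebra_simps)
  qed
  have comb: "P (finsum N (%i. y i *[N] e' i) I) y" for y unfolding P_def
  proof
    fix i assume i: "i \<in> I"
    have "k i (finsum N (%i. y i *[N] e' i) I) = (\<Sum>j\<in>I. k i (y j *[N] e' j))"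
      using n D(1) by (intro N.coord_finsum[OF db i]) auto
    also have "... = (\<Sum>j\<in>I. (if i = j then y j else 0) + fps_X * (k i (n j) * y j))"
      using ki i by (intro sum.cong) auto
    also have "... = y i + fps_X * (\<Sum>j\<in>I. k i (n j) * y j)" using D(1) i by (simp add: sum.distrib sum_distrib_left)
    finally show "k i (finsum N (%i. y i *[N] e' i) I) = y i + fps_X * (\<Sum>j\<in>I. k i (n j) * y j)" .
  qed
  have "dbasis UNIV N I e' (%i x. f x i)" unfolding dbasis_def
  proof (intro conjI ballI)
    fix x assume x: "x :> N"
    show "x = finsum N (%i. f x i *[N] e' i) I"
    proof (rule N.coord_eqI[OF db x])
      show "finsum N (%i. f x i *[N] e' i) I :> N" using n by (intro N.finsum_closed) auto
      show "k i x = k i (finsum N (%i. f x i *[N] e' i) I)" if "i \<in> I" for i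
        using comb[of "f x"] f[of x] that by (simp add: P_def)
    qed
    fix i assume i: "i \<in> I"
    show "f (x +[N] y) i = f x i + f y i" if y: "y :> N" for y
    proof (rule uniq[OF _ i])
      show "P (x +[N] y) (%i. f x i + f y i)"
        using f[of x] f[of y] D(4) x y unfolding P_def by (auto simp: algebra_simps sum.distrib)
    qed
    show "f (c *[N] x) i = c * f x i" for c
    proof (rule uniq[OF _ i])
      show "P (c *[N] x) (%i. c * f x i)" using f[of x] D(5) x unfolding P_def by (auto simp: algebra_simps sum_distrib_left)
    qed
  next
    fix i j assume ij: "i \<in> I" "j \<in> I"
    have "finsum N (%i. (if i = j then 1 else 0) *[N] e' i) I = finsum N (%i. if j = i then e' i else 0[N]) I"
      using n ij by (intro N.finsum_cong') auto
    also have "... = e' j" using D(1) ij n by (intro N.add.finprod_singleton) auto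
    finally show "f (e' j) i = (if i = j then 1 else 0)" using uniq[OF comb[of "%i. if i = j then 1 else 0"] ij(1)] by simp
  qed (use D n in auto)
  then show ?thesis by blast
qed

text \<open>The presentation of Frobenius as \<open>Phi\<close> over \<open>w ^ k\<close> is not
  unique: numerator and denominator may be multiplied by a power of \<open>w\<close>. This makes it
  possible to reach exponents divisible by \<open>d\<close>.\<close>

lemma (in wbase) wm_raise: assumes "wm N Phi k" shows "wm N (%x. w ^ j *[N] Phi x) (k + j)"
proof -
  note D = wmD[OF assms]
  interpret N: lmod R N mu by (rule D)
  interpret N': lmod R N "phi mu" by (rule D)
  note [simp] = addhom_closed[OF D(8)] addhom_closed[OF actionD(1)[OF D(7)]]
  note sa = actionD(4)[OF D(7)]
  obtain l where l: "!!x. x :> N ==> w ^ l *[N] x \<in> span_on R N (Phi ` carrier N)" using D(12) by blast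
  have "frob_pres N (%x. w ^ j *[N] Phi x) (k + j)" unfolding frob_pres_def
  proof (intro conjI ballI allI)
    show "addhom N N (%x. w ^ j *[N] Phi x)" by (rule addhomI) (auto simp: addhom_add[OF D(8)] N.smult_r_distr)
    fix x assume x: "x :> N"
    show "w ^ j *[N] Phi (c *[N] x) = phi c *[N] (w ^ j *[N] Phi x)" if "c \<in> R" for c
      using x that by (simp add: D(9) N.smult_smult mult.commute)
    show "frb N (lfrac N mu x i) = lfrac N (phi mu) (mu ^ (k + j) *[N] (w ^ j *[N] Phi x)) (k + j + i)" for i
    proof -
      have "phi mu ^ (k + j + i) *[N] (mu ^ k *[N] Phi x) = phi mu ^ (k + i) *[N] (mu ^ (k + j) *[N] (w ^ j *[N] Phi x))"
        using x by (simp add: N.smult_smult power_add frob_mu power_mult_distrib mult_ac)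
      then show ?thesis using x by (simp add: D(10) N'.lfrac_eq)
    qed
    show "act g w ^ (k + j) *[N] (w ^ j *[N] Phi (gact N g x)) = w ^ (k + j) *[N] gact N g (w ^ j *[N] Phi x)"
      if g: "g :> G" for g
    proof -
      have "act g w ^ (k + j) *[N] (w ^ j *[N] Phi (gact N g x)) = (w ^ j * act g w ^ j) *[N] (act g w ^ k *[N] Phi (gact N g x))"
        using x g by (simp add: N.smult_smult power_add mult_ac)
      also have "... = (w ^ j * act g w ^ j) *[N] (w ^ k *[N] gact N g (Phi x))" using D(11)[OF g x] by simp
      also have "... = w ^ (k + j) *[N] gact N g (w ^ j *[N] Phi x)"
        using x g by (simp add: sa N.smult_smult power_add act_power mult_ac)
      finally show ?thesis .
    qed
  next
    have sub: "Phi ` carrier N \<subseteq> carrier N" "(%x. w ^ j *[N] Phi x) ` carrier N \<subseteq> carrier N" by auto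
    have "w ^ j *[N] y \<in> span_on R N ((%x. w ^ j *[N] Phi x) ` carrier N)" if "y \<in> span_on R N (Phi ` carrier N)" for y
      by (rule span_map[OF D(3) D(3) _ _ _ sub _ that, where rho = "%c. c"])
        (auto intro!: addhomI span_on_incl simp: N.smult_r_distr N.smult_smult mult.commute)
    then have "w ^ (l + j) *[N] x \<in> span_on R N ((%x. w ^ j *[N] Phi x) ` carrier N)" if "x :> N" for x
      using l[OF that] that by (simp add: power_add N.smult_smult mult.commute[of "w ^ l"] flip: N.smult_smult)
    then show "\<exists>l. \<forall>x\<in>carrier N. w ^ l *[N] x \<in> span_on R N ((%x. w ^ j *[N] Phi x) ` carrier N)" by blast
  qed
  then show ?thesis using D(1) by (simp add: wm_def)
qed

text \<open>\<open>B\<close> stands for S and \<open>B'\<close> for A_F^+, with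
  \<open>d = p - 1\<close>, \<open>H\<close> the torsion subgroup and \<open>u\<close> the unit in
  mu_0 = mu^(p-1) u. The equivalence is proved from these axioms. Two of them carry real arithmetic:
  \<open>nu_dvd\<close> recovers divisibility by mu_0 from divisibility by mu, and
  \<open>adic_comp\<close> compares the adic filtrations on S.\<close>

locale wpair = S: wbase B w U + A: wbase B' w' U'
  for B B' :: "('a::idom fps, 'g) wach_base" and w w' U U' +
  fixes pr :: "'g => 'g" and H :: "'g set" and d :: nat and u ui ci :: "'a fps"
  assumes scal': "b_scal B' = UNIV" and mu': "b_mu B' = fps_X"
    and prime_eq [simp]: "b_prime B = b_prime B'" and frob_eq [simp]: "b_frob B = b_frob B'"
    and act_eq [simp]: "b_act B = b_act B'"
    and mult_eq [simp]: "mult (b_grp B) = mult (b_grp B')" and one_eq [simp]: "one (b_grp B) = one (b_grp B')"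
    and G_sub: "carrier (b_grp B) \<subseteq> carrier (b_grp B')"
    and nu: "b_mu B = b_mu B' ^ d * u" and u_unit: "u * ui = 1" and d_pos: "d > 0"
    and fixed: "b_scal B = {c. \<forall>h\<in>H. b_act B' h c = c}"
    and H_sub: "subgroup H (b_grp B')" and H_fin: "finite H" and ci: "of_nat (card H) * ci = 1"
    and H_comm: "[|g :> b_grp B'; h \<in> H|] ==> g \<otimes>\<^bsub>b_grp B'\<^esub> h = h \<otimes>\<^bsub>b_grp B'\<^esub> g"
    and pr_G [simp]: "g :> b_grp B' ==> pr g :> b_grp B"
    and pr_split: "g :> b_grp B' ==> \<exists>t\<in>H. g = pr g \<otimes>\<^bsub>b_grp B'\<^esub> t"
    and pr_mult: "[|g :> b_grp B'; h \<in> carrier (b_grp B')|] ==> pr (g \<otimes>\<^bsub>b_grp B'\<^esub> h) = pr g \<otimes>\<^bsub>b_grp B'\<^esub> pr h"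
    and pr_id [simp]: "g :> b_grp B ==> pr g = g"
    and pr_H [simp]: "h \<in> H ==> pr h = \<one>\<^bsub>b_grp B'\<^esub>"
    and nu_dvd: "[|c \<in> b_scal B; c = b_mu B' * e|] ==> \<exists>c'\<in>b_scal B. c = b_mu B * c'"
    and U_U': "\<exists>m'. U' m' \<subseteq> U m" and U'_U: "\<exists>m'. U m' \<subseteq> U' m"
    and adic_comp: "\<exists>k. \<forall>c\<in>b_scal B. c \<in> adic_power B' (regon UNIV) k \<longrightarrow> c \<in> adic_power B (regon (b_scal B)) n"
begin

abbreviation (input) "R \<equiv> b_scal B"
abbreviation (input) "R' \<equiv> b_scal B'"
abbreviation (input) "phi \<equiv> b_frob B'"
abbreviation (input) "act \<equiv> b_act B'"
abbreviation (input) "G \<equiv> b_grp B'"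
abbreviation (input) "G0 \<equiv> b_grp B"
abbreviation (input) "mu \<equiv> b_mu B'"
abbreviation (input) "nu \<equiv> b_mu B"

lemma mem_R' [simp, intro]: "c \<in> R'" by (simp add: scal')

lemma G0_G [simp]: "g :> G0 ==> g :> G" using G_sub by auto

lemma H_G [simp]: "h \<in> H ==> h :> G" using subgroup.subset[OF H_sub] by auto

lemma act_fix: "h \<in> H ==> c \<in> R ==> act h c = c" by (simp add: fixed)

text \<open>\<open>g\<close> and \<open>pr g\<close> differ by an element of \<open>H\<close>, which
  fixes \<open>R\<close>.\<close>

lemma act_pr: "g :> G ==> c \<in> R ==> act (pr g) c = act g c"
  using pr_split[of g] A.act_comp[of "pr g" _ c] by (metis G0_G H_G act_fix mem_R' pr_G)

text \<open>The unit phi(u)/u. It measures the failure of phi(nu)/nu to be the \<open>d\<close>-th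
  power of phi(mu)/mu and enters whenever Frobenius passes from one base to the other.\<close>

definition "v = phi u * ui"
definition "vi = phi ui * u"

lemma vvi: "v * vi = 1"
proof -
  have "phi u * phi ui = 1" using A.frob_mult[of u ui] u_unit by simp
  then show ?thesis using u_unit by (simp add: v_def vi_def) (metis mult.assoc mult.commute mult_1)
qed

lemma v_power: "v ^ k * vi ^ k = 1" "vi ^ k * v ^ k = 1"
  using vvi by (metis power_mult_distrib power_one, metis power_mult_distrib power_one mult.commute)

lemma frob_nu: "phi nu = phi mu ^ d * phi u" by (simp add: nu A.frob_mult A.frob_power)

lemma phi_u: "phi u * phi ui = 1" "phi u ^ k * phi ui ^ k = 1" "u ^ k * ui ^ k = 1"
proof -
  show *: "phi u * phi ui = 1" using A.frob_mult[of u ui] u_unit by simp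
  then show "phi u ^ k * phi ui ^ k = 1" "u ^ k * ui ^ k = 1" using u_unit by (metis power_mult_distrib power_one)+
qed

lemma w_eq: "w = w' ^ d * v"
proof -
  have "nu * w = phi mu ^ d * phi u" using S.frob_mu frob_nu by simp
  also have "... = mu ^ d * w' ^ d * phi u * (u * ui)" using u_unit by (simp add: A.frob_mu power_mult_distrib)
  also have "... = nu * (w' ^ d * v)" by (simp add: nu v_def mult_ac)
  finally have "nu * w = nu * (w' ^ d * v)" .
  then show ?thesis using S.mu_nz by simp
qed

lemma w'_pow: "w' ^ d = w * vi" using vvi by (simp add: w_eq mult.assoc)

lemma nz: "u \<noteq> 0" "ui \<noteq> 0" "v \<noteq> 0" "vi \<noteq> 0" "phi u \<noteq> 0" "phi ui \<noteq> 0"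
  using u_unit vvi phi_u(1) by auto

end

section \<open>Base change of a Wach module\<close>

context wpair
begin

abbreviation (input) AA :: "('a fps, ('a fps, 'b) univ) module" where "AA \<equiv> scalar_module R'"
abbreviation (input) "FF \<equiv> base_change_ob B B' pr"
abbreviation (input) "sphi \<equiv> %a. Scalar (phi (the_scalar a))"
abbreviation (input) "bt X \<equiv> tens R AA X"
abbreviation (input) "bp X \<equiv> ptens R AA X"

lemma bc_simps:
  "same_mod (FF X) (bt X)"
  "gact (FF X) = (%g. tmap R AA X (%a. Scalar (act g (the_scalar a))) (gact X (pr g)))"
  "frb (FF X) = loc_ext phi mu (loc (bt X) (phi mu)) (tlift (loc (bt X) (phi mu)) (%a x. phi (the_scalar a) *[loc (bt X) (phi mu)]
      loc_map id (phi nu) (bt X) (phi mu) (bp X (Scalar 1)) (frb X (lfrac X nu x 0))))"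
  by (simp_all add: same_mod_def base_change_ob_def Let_def module.defs wach.defs)

lemmas bc_mod [simp] = same_modD[OF bc_simps(1)]

lemma tpair_bc: "rmod R X ==> tpair R' R AA X" unfolding tpair_def tpair_axioms_def using A.rmod_scalar by auto

text \<open>Over \<open>B\<close> the denominator is \<open>w ^ k\<close>, which equals
  \<open>w' ^ (d * k) * v ^ k\<close>. The power of \<open>w'\<close> stays as denominator over
  \<open>B'\<close>, with exponent \<open>d * k\<close>; the unit is moved to the numerator as
  \<open>vi ^ k\<close>.\<close>

definition "FPhi X Phi k = (%t. vi ^ k *[bt X] tmap R AA X sphi Phi t)"

lemma bc_eval: assumes X: "S.wm X Phi k" and x: "x :> X"
  shows "g :> G ==> gact (FF X) g (bp X (Scalar a) x) = bp X (Scalar (act g a)) (gact X (pr g) x)"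
    and "g :> G ==> addhom (bt X) (bt X) (gact (FF X) g)"
    and "tmap R AA X sphi Phi (bp X (Scalar a) x) = bp X (Scalar (phi a)) (Phi x)"
    and "addhom (bt X) (bt X) (tmap R AA X sphi Phi)"
    and "c *[bt X] bp X (Scalar a) x = bp X (Scalar (c * a)) x"
    and "FPhi X Phi k (bp X (Scalar a) x) = bp X (Scalar (vi ^ k * phi a)) (Phi x)"
    and "addhom (bt X) (bt X) (FPhi X Phi k)"
proof -
  note D = S.wmD[OF X]
  note tp = tpair_bc[OF D(3)]
  interpret T: tpair R' R AA X by (rule tp)
  interpret Tm: rmod R' "bt X" by (rule T.rmod_T)
  have ag: "addhom AA AA (%a. Scalar (act g (the_scalar a)))" if "g :> G" for g
    using that by (intro addhomI) (auto simp: A.act_add)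
  have aphi: "addhom AA AA sphi" by (intro addhomI) (auto simp: A.frob_add)
  have gg: "tmap R AA X (%a. Scalar (act g (the_scalar a))) (gact X (pr g)) (bp X (Scalar a) x) = bp X (Scalar (act g a)) (gact X (pr g) x)"
    "addhom (bt X) (bt X) (tmap R AA X (%a. Scalar (act g (the_scalar a))) (gact X (pr g)))" if g: "g :> G" for g
    using T.tmap_pt[OF tp ag[OF g] S.actionD(1)[OF D(7), of "pr g"], of "act g" "Scalar a" x]
      T.addhom_tmap[OF tp ag[OF g] S.actionD(1)[OF D(7), of "pr g"], of "act g"]
      g x S.actionD(4)[OF D(7), of "pr g"] S.act_R[of "pr g"] by (auto simp: A.act_mult act_pr)
  then show "g :> G ==> gact (FF X) g (bp X (Scalar a) x) = bp X (Scalar (act g a)) (gact X (pr g) x)"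
    "g :> G ==> addhom (bt X) (bt X) (gact (FF X) g)" unfolding bc_simps(2) by blast+
  have phiR: "phi r \<in> R" if "r \<in> R" for r using S.frob_R[OF that] by simp
  show p: "tmap R AA X sphi Phi (bp X (Scalar a) x) = bp X (Scalar (phi a)) (Phi x)"
    and ah: "addhom (bt X) (bt X) (tmap R AA X sphi Phi)"
    using T.tmap_pt[OF tp aphi D(8), of phi "Scalar a" x] T.addhom_tmap[OF tp aphi D(8), of phi] D(9) x phiR
    by (auto simp: A.frob_mult)
  show s: "c *[bt X] bp X (Scalar a) x = bp X (Scalar (c * a)) x" for c a using T.smult_pt[of c "Scalar a" x] x by simp
  show "FPhi X Phi k (bp X (Scalar a) x) = bp X (Scalar (vi ^ k * phi a)) (Phi x)"
    using addhom_closed[OF D(8) x] T.smult_pt[of "vi ^ k" "Scalar (phi a)" "Phi x"] by (simp add: FPhi_def p)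
  show "addhom (bt X) (bt X) (FPhi X Phi k)"
    unfolding FPhi_def using addhom_closed[OF ah] addhom_add[OF ah] by (intro addhomI) (auto simp: Tm.smult_r_distr)
qed

lemma bc_dbasis: assumes "rmod R X" "dbasis R X I e k"
  shows "\<exists>kap. dbasis R' (FF X) ({()} \<times> I) (%(i, j). bp X (Scalar 1) (e j)) kap"
  using dbasis_cong[OF tpair.dbasis_T[OF tpair_bc[OF assms(1)] A.dbasis_scalar assms(2)], of "FF X"] by auto

lemma finite_free_bc: assumes "finite_free R X" shows "finite_free R' (FF X)" "finite_free R' (bt X)"
proof -
  interpret X: rmod R X by (rule finite_free_rmod[OF assms])
  interpret T: tpair R' R AA X by (rule tpair_bc[OF X.rmod_axioms])
  interpret Tm: rmod R' "bt X" by (rule T.rmod_T)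
  obtain I k where db: "dbasis R X I (%x. x) k" using X.dbasis_of_finite_free[OF assms] by blast
  note dbT = T.dbasis_T[OF A.dbasis_scalar db]
  show "finite_free R' (bt X)" by (rule Tm.finite_free_of_dbasis[OF dbT]) simp
  show "finite_free R' (FF X)" by (rule rmod.finite_free_of_dbasis[OF Tm.cong_fields dbasis_cong[OF dbT]]) simp_all
qed

lemma nu_mu: "nu = mu * (mu ^ (d - 1) * u)" using d_pos by (cases d) (simp_all add: nu mult_ac)

text \<open>\<open>nu\<close> is a multiple of \<open>mu\<close>, so a monomial in \<open>p\<close>
  and \<open>nu\<close> is a multiple of the same monomial in \<open>p\<close> and
  \<open>mu\<close>.\<close>

lemma adic_bc: assumes X: "rmod R X" and y: "y \<in> adic_power B X n"
  shows "bp X (Scalar a) y \<in> adic_power B' (bt X) n"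
proof -
  interpret T: tpair R' R AA X by (rule tpair_bc[OF X])
  interpret Tm: rmod R' "bt X" by (rule T.rmod_T)
  show ?thesis unfolding A.adic_power_eq
  proof (rule span_map[OF X T.rmod_T T.addhom_pt_right _ _ S.adic_gens_carrier[OF X] A.adic_gens_carrier[OF T.rmod_T] _ y[unfolded S.adic_power_eq], where rho = "%c. c"])
    fix z assume "z \<in> S.adic_gens X n"
    then obtain i x where z: "z = (of_nat (b_prime B') ^ i * nu ^ (n - i)) *[X] x" "i \<le> n" "x :> X"
      by (auto simp: S.adic_gens_def)
    have "bp X (Scalar a) z = (of_nat (b_prime B') ^ i * nu ^ (n - i)) *[bt X] bp X (Scalar a) x"
      using z by (subst T.smult_pt_right) auto
    also have "... = (of_nat (b_prime B') ^ i * mu ^ (n - i)) *[bt X] ((mu ^ (d - 1) * u) ^ (n - i) *[bt X] bp X (Scalar a) x)"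
      using z by (subst nu_mu) (simp add: Tm.smult_smult power_mult_distrib mult_ac)
    also have "... \<in> adic_power B' (bt X) n" using z by (intro A.adic_genI) auto
    finally show "bp X (Scalar a) z \<in> span_on R' (bt X) (A.adic_gens (bt X) n)" by (simp add: A.adic_power_eq)
  qed (use y in \<open>auto simp: T.smult_pt_right\<close>)
qed

lemma wm_F:
  fixes X :: "('a, 'b, 'g) fob"
  assumes X: "S.wm X Phi k" shows "A.wm (FF X) (FPhi X Phi k) (d * k)"
proof -
  note D = S.wmD[OF X] and E = bc_eval[OF X]
  interpret X: rmod R X by (rule D)
  interpret X': lmod R X "phi nu" using D(6) by simp
  note tp = tpair_bc[OF D(3)]
  interpret T: tpair R' R AA X by (rule tp)
  interpret Tm: rmod R' "bt X" by (rule T.rmod_T)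
  note ff = finite_free_bc[OF D(2)]
  note tf = finite_free_tfree[OF ff(2)]
  have l: "lmod R' (bt X) mu" "lmod R' (bt X) (phi mu)" by (intro lmod.intro lmod_axioms.intro T.rmod_T tf; simp)+
  interpret L': lmod R' "bt X" "phi mu" by (rule l)
  note cX [simp] = addhom_closed[OF D(8)] addhom_closed[OF S.actionD(1)[OF D(7)]]
  note aX = S.actionD[OF D(7)]
  have gen: "addgen (bt X) {bp X (Scalar a) x | a x. x :> X}" using T.addgen_T by (rule back_subst[of "addgen _"]) auto
  have pin [simp]: "bp X (Scalar a) x :> bt X" if "x :> X" for a x using that by auto
  have rsm: "bp X (Scalar (r * a)) x = bp X (Scalar a) (r *[X] x)" if "r \<in> R" "x :> X" for r a x
    using T.pt_balance[of r "Scalar a" x] that by simp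
  note x0 = X.zero_closed
  have ah: "addhom (bt X) (bt X) (FPhi X Phi k)" by (rule E(7)[OF x0])
  have sl: "FPhi X Phi k (c *[bt X] t) = phi c *[bt X] FPhi X Phi k t" if "t :> bt X" for c t using gen that
  proof (induction t rule: addgen_induct)
    case zero
    show ?case using addhom_zero[OF Tm.is_abgroup Tm.is_abgroup ah] by simp
  next
    case (gen z)
    then obtain a x where z: "x :> X" "z = bp X (Scalar a) x" by blast
    then show ?case by (simp add: E A.frob_mult mult_ac)
  next
    case (add s t)
    then show ?case using addhom_closed[OF ah] by (simp add: Tm.smult_r_distr addhom_add[OF ah])
  qed
  obtain l1 where l1: "!!x. x :> X ==> w ^ l1 *[X] x \<in> span_on R X (Phi ` carrier X)" using D(12) by blast
  have subs: "Phi ` carrier X \<subseteq> carrier X" "FPhi X Phi k ` carrier (bt X) \<subseteq> carrier (bt X)" using addhom_closed[OF ah] by auto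
  have sp: "bp X (Scalar a) y \<in> span_on R' (bt X) (FPhi X Phi k ` carrier (bt X))" if "y \<in> span_on R X (Phi ` carrier X)" for a y
  proof (rule span_map[OF D(3) T.rmod_T T.addhom_pt_right _ _ subs _ that, where rho = "%c. c"])
    fix y assume "y \<in> Phi ` carrier X"
    then obtain x where x: "x :> X" "y = Phi x" by blast
    \<comment> \<open>The factor \<open>v ^ k\<close> undoes the \<open>vi ^ k\<close> built into
      \<open>FPhi\<close>, so the tensor of \<open>a\<close> with \<open>Phi x\<close> is a multiple
      of a value of \<open>FPhi\<close>.\<close>
    have a: "a * v ^ k * (vi ^ k * phi 1) = a" using v_power by (simp add: mult.assoc)
    have "(a * v ^ k) *[bt X] FPhi X Phi k (bp X (Scalar 1) x) = bp X (Scalar (a * v ^ k * (vi ^ k * phi 1))) (Phi x)"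
      using x by (subst E(6)) (auto intro!: E(5))
    then have "bp X (Scalar a) y = (a * v ^ k) *[bt X] FPhi X Phi k (bp X (Scalar 1) x)" unfolding a x(2) by (rule sym)
    also have "... \<in> span_on R' (bt X) (FPhi X Phi k ` carrier (bt X))"
      using x by (intro Tm.span_closed(4)[OF subs(2)] span_on_incl imageI) auto
    finally show "bp X (Scalar a) y \<in> span_on R' (bt X) (FPhi X Phi k ` carrier (bt X))" .
  qed (auto simp: T.smult_pt_right)
  have diff: "bp X (Scalar a') x' -[bt X] bp X (Scalar a) x =
      bp X (Scalar a') (x' -[X] x) +[bt X] bp X (Scalar (a' - a)) x" if "x :> X" "x' :> X" for a a' x x'
  proof -
    have "(a' - a) *[bt X] bp X (Scalar 1) x = bp X (Scalar a') x -[bt X] bp X (Scalar a) x"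
      using that Tm.diff_smult[of a' a "bp X (Scalar 1) x"] E(5)[of x a' 1] E(5)[of x a 1] by simp
    then have "bp X (Scalar (a' - a)) x = bp X (Scalar a') x -[bt X] bp X (Scalar a) x"
      using that E(5)[of x "a' - a" 1] by simp
    then show ?thesis using that by (simp add: T.pt_diff_right Tm.diff_trans)
  qed
  show ?thesis
  proof (rule A.wmI[OF ff(1), where l = "d * l1", unfolded bc_mod, OF gen])
    fix g assume g: "g :> G"
    show "addhom (bt X) (bt X) (gact (FF X) g)" by (rule E(2)[OF x0 g])
    fix z assume "z \<in> {bp X (Scalar a) x |a x. x :> X}"
    then obtain a x where z: "x :> X" "z = bp X (Scalar a) x" by blast
    show "gact (FF X) (g \<otimes>\<^bsub>G\<^esub> h) z = gact (FF X) g (gact (FF X) h z)" if h: "h :> G" for h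
    proof -
      have "gact X (pr g \<otimes>\<^bsub>G\<^esub> pr h) x = gact X (pr g) (gact X (pr h) x)" using aX(3)[of "pr g" "pr h" x] g h z by simp
      then show ?thesis using z g h by (simp add: E A.act_comp pr_mult)
    qed
    show "gact (FF X) g (c *[bt X] z) = act g c *[bt X] gact (FF X) g z" if "c \<in> R'" for c
      using z g by (simp add: E A.act_mult)
    obtain x' where x': "x' :> X" "gact X (pr g) x -[X] x = nu *[X] x'"
      using S.wach_moduleD(7)[OF D(1) _ z(1), of "pr g"] g by auto
    obtain b where b: "act g a - a = mu * b" using A.act_mod[OF g, of a] by auto
    have "gact (FF X) g z -[bt X] z =
        mu *[bt X] (bp X (Scalar (mu ^ (d - 1) * u * act g a)) x' +[bt X] bp X (Scalar b) x)"
    proof -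
      have "bp X (Scalar (act g a)) (nu *[X] x') = bp X (Scalar (nu * act g a)) x'" using rsm x' by simp
      also have "nu * act g a = mu * (mu ^ (d - 1) * u * act g a)" by (subst nu_mu) (simp add: mult_ac)
      finally show ?thesis using z g x' b by (simp add: E diff Tm.smult_r_distr)
    qed
    then show "\<exists>y\<in>carrier (bt X). gact (FF X) g z -[bt X] z = mu *[bt X] y" using x' z by (intro bexI) auto
    have "w' ^ (d * k) * (act g vi ^ k * act g (phi a)) = vi ^ k * act g vi ^ k * act g (phi a) * w ^ k"
      by (simp add: power_mult w'_pow power_mult_distrib mult_ac)
    then have eq: "w' ^ (d * k) * (act g vi ^ k * act g (phi a)) = w ^ k * (vi ^ k * act g vi ^ k * act g (phi a))"
      by (simp only: mult_ac)
    \<comment> \<open>The power of \<open>w'\<close> contains \<open>w ^ k\<close>, which lies in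
      \<open>R\<close> and so crosses the tensor sign. Inside \<open>X\<close> the equivariance of
      \<open>Phi\<close> turns it into \<open>act g w ^ k\<close>, which crosses back.\<close>
    have "w' ^ (d * k) *[bt X] gact (FF X) g (FPhi X Phi k z) =
        bp X (Scalar (w' ^ (d * k) * (act g vi ^ k * act g (phi a)))) (gact X (pr g) (Phi x))"
      using z g by (simp add: E A.act_mult A.act_power)
    also have "... = bp X (Scalar (vi ^ k * act g vi ^ k * act g (phi a))) (w ^ k *[X] gact X (pr g) (Phi x))"
      unfolding eq using z g by (intro rsm) (auto simp: S.power_R)
    also have "w ^ k *[X] gact X (pr g) (Phi x) = act g w ^ k *[X] Phi (gact X (pr g) x)"
      using D(11)[of "pr g" x] g z act_pr[OF g S.w_R] by simp
    also have "bp X (Scalar (vi ^ k * act g vi ^ k * act g (phi a))) (act g w ^ k *[X] Phi (gact X (pr g) x)) =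
        bp X (Scalar (act g w ^ k * (vi ^ k * act g vi ^ k * act g (phi a)))) (Phi (gact X (pr g) x))"
    proof (rule rsm[symmetric])
      show "act g w ^ k \<in> R" using S.act_R[of "pr g" w] act_pr[OF g S.w_R] g by (simp add: S.power_R)
    qed (use g z in auto)
    also have "act g w ^ k * (vi ^ k * act g vi ^ k * act g (phi a)) = act g w' ^ (d * k) * (vi ^ k * phi (act g a))"
    proof -
      have "act g w ^ k * act g vi ^ k = act g w' ^ (d * k)"
        using g by (simp add: power_mult A.act_power[symmetric] w'_pow A.act_mult power_mult_distrib)
      moreover have "act g w ^ k * (vi ^ k * act g vi ^ k * act g (phi a)) = (act g w ^ k * act g vi ^ k) * (vi ^ k * act g (phi a))"
        by (simp only: mult_ac)
      ultimately have "act g w ^ k * (vi ^ k * act g vi ^ k * act g (phi a)) = act g w' ^ (d * k) * (vi ^ k * act g (phi a))"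
        by (simp only:)
      then show ?thesis using g by (simp add: A.act_frob)
    qed
    finally show "act g w' ^ (d * k) *[bt X] FPhi X Phi k (gact (FF X) g z) = w' ^ (d * k) *[bt X] gact (FF X) g (FPhi X Phi k z)"
      using z g by (simp add: E)
  next
    fix z n assume "z \<in> {bp X (Scalar a) x |a x. x :> X}"
    then obtain a x where z: "x :> X" "z = bp X (Scalar a) x" by blast
    obtain m where m: "!!g. g \<in> U m ==> gact X g x -[X] x \<in> adic_power B X n"
      using S.wach_moduleD(8)[OF D(1) z(1)] by meson
    obtain m1 where m1: "U' m1 \<subseteq> U m" using U_U' by blast
    obtain m2 where m2: "!!g. g \<in> U' m2 ==> act g a - a \<in> adic_power B' (regon R') n" using A.act_cont[of a n] by auto
    have "gact (FF X) g z -[bt X] z \<in> adic_power B' (bt X) n" if g: "g \<in> U' (max m1 m2)" for g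
    proof -
      have gm: "g \<in> U' m1" "g \<in> U' m2" using g A.U_mono[of m1 "max m1 m2"] A.U_mono[of m2 "max m1 m2"] by auto
      have gU: "g \<in> U m" using gm m1 by auto
      \<comment> \<open>Elements near the identity lie in the smaller group, where \<open>pr\<close>
        is the identity. Comparability of the two neighbourhood systems is needed for this.\<close>
      have g0: "g :> G0" using gU by simp
      have "bp X (Scalar (act g a)) (gact X g x -[X] x) \<in> adic_power B' (bt X) n"
        using m[OF gU] by (rule adic_bc[OF D(3)])
      moreover have "(act g a - a) *[bt X] bp X (Scalar 1) x \<in> adic_power B' (bt X) n"
        using m2[OF gm(2)] z by (intro A.adic_scalar[OF T.rmod_T]) auto
      ultimately show ?thesis using z g0 A.adic_closed(3)[OF T.rmod_T] by (simp add: E diff)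
    qed
    then show "\<exists>m. \<forall>g\<in>U' m. gact (FF X) g z -[bt X] z \<in> adic_power B' (bt X) n" by blast
  next
    show "addhom (bt X) (bt X) (FPhi X Phi k)" by (rule ah)
    fix z assume "z \<in> {bp X (Scalar a) x |a x. x :> X}"
    then obtain a x where z: "x :> X" "z = bp X (Scalar a) x" by blast
    show "FPhi X Phi k (c *[bt X] z) = phi c *[bt X] FPhi X Phi k z" for c using sl z by simp
    have one: "\<one>\<^bsub>G\<^esub> :> G0" using S.G.one_closed by simp
    show "gact (FF X) \<one>\<^bsub>G\<^esub> z = z" using z one aX(2)[OF z(1)] by (simp add: E)
    have "w' ^ (d * l1) = w ^ l1 * vi ^ l1" by (simp add: power_mult w'_pow power_mult_distrib)
    then have "w' ^ (d * l1) *[bt X] z = bp X (Scalar (vi ^ l1 * a)) (w ^ l1 *[X] x)"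
      using z rsm[of "w ^ l1" x "vi ^ l1 * a"] by (simp add: E mult_ac)
    then show "w' ^ (d * l1) *[bt X] z \<in> span_on R' (bt X) (FPhi X Phi k ` carrier (bt X))" using sp l1 z by simp
  next
    fix t j assume t: "t :> bt X"
    let ?Q = "loc (bt X) (phi mu)"
    let ?beta = "%a x. phi (the_scalar a) *[?Q] loc_map id (phi nu) (bt X) (phi mu) (bp X (Scalar 1)) (frb X (lfrac X nu x 0))"
    let ?F = "%t. lfrac (bt X) (phi mu) (mu ^ (d * k) *[bt X] FPhi X Phi k t) (d * k)"
    have Fa: "addhom (bt X) ?Q ?F"
      using addhom_closed[OF ah] by (intro addhomI) (auto simp: addhom_add[OF ah] Tm.smult_r_distr L'.loc_add_same)
    have beta: "?beta (Scalar a) x = ?F (bp X (Scalar a) x)" if x: "x :> X" for a x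
    proof -
      \<comment> \<open>The denominator \<open>phi nu ^ k\<close> is rewritten over
        \<open>phi mu\<close>: as \<open>phi nu = phi mu ^ d * phi u\<close>, the inverse unit
        \<open>phi ui ^ k\<close> enters the numerator and the exponent becomes
        \<open>d * k\<close>.\<close>
      let ?y = "bp X (Scalar (phi ui ^ k * nu ^ k)) (Phi x)"
      have nR: "nu ^ k \<in> R" by (simp add: S.power_R)
      have "loc_map id (phi nu) (bt X) (phi mu) (bp X (Scalar 1)) (lfrac X (phi nu) (nu ^ k *[X] Phi x) k) = lfrac (bt X) (phi mu) ?y (d * k)"
      proof (rule X'.loc_map_eval[OF l(2)])
        have "phi nu ^ k * (phi ui ^ k * nu ^ k) = phi mu ^ (d * k) * (phi u ^ k * phi ui ^ k) * nu ^ k"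
          by (simp add: frob_nu power_mult_distrib power_mult mult_ac)
        then have "phi nu ^ k * (phi ui ^ k * nu ^ k) = phi mu ^ (d * k) * nu ^ k" unfolding phi_u(2) by simp
        then have "phi nu ^ k *[bt X] ?y = phi mu ^ (d * k) *[bt X] bp X (Scalar (nu ^ k * 1)) (Phi x)"
          using x by (simp only: E(5) cX mult_1_right)
        then show "id (phi nu) ^ k *[bt X] ?y = phi mu ^ (d * k) *[bt X] bp X (Scalar 1) (nu ^ k *[X] Phi x)"
          using rsm[OF nR cX(1)[OF x], of 1] by (simp only: id_apply)
      qed (use x nR T.addhom_pt_right[of "Scalar 1"] in \<open>auto simp: T.smult_pt_right S.power_R\<close>)
      then have "?beta (Scalar a) x = lfrac (bt X) (phi mu) (bp X (Scalar (phi a * (phi ui ^ k * nu ^ k))) (Phi x)) (d * k)"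
        using x D(10)[OF x, of 0] by (simp add: L'.loc_smult E)
      also have "phi a * (phi ui ^ k * nu ^ k) = mu ^ (d * k) * (vi ^ k * phi a)"
        by (simp add: nu vi_def power_mult_distrib power_mult mult_ac)
      also have "bp X (Scalar (mu ^ (d * k) * (vi ^ k * phi a))) (Phi x) = mu ^ (d * k) *[bt X] FPhi X Phi k (bp X (Scalar a) x)"
        using x by (simp add: E)
      finally show ?thesis .
    qed
    have bal: "balanced R (AA :: ('a fps, ('a fps, 'b) univ) module) X ?Q ?beta"
    proof (rule balancedI)
      fix a a' :: "('a fps, 'b) univ" and x assume "a :> AA" "a' :> AA" and x: "x :> X"
      then obtain b b' where b: "a = Scalar b" "a' = Scalar b'" by auto
      have "bp X (Scalar (b + b')) x = bp X (Scalar b) x +[bt X] bp X (Scalar b') x"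
        using T.pt_add_left[of a a' x] x b by simp
      then show "?beta (a +[AA] a') x = ?beta a x +[?Q] ?beta a' x"
        using beta[OF x, of b] beta[OF x, of b'] beta[OF x, of "b + b'"] addhom_add[OF Fa, of "bp X (Scalar b) x" "bp X (Scalar b') x"] x b by simp
    next
      fix a :: "('a fps, 'b) univ" and x x' assume "a :> AA" and x: "x :> X" "x' :> X"
      then obtain b where b: "a = Scalar b" by auto
      show "?beta a (x +[X] x') = ?beta a x +[?Q] ?beta a x'"
        using beta[OF x(1), of b] beta[OF x(2), of b] beta[of "x +[X] x'" b] T.pt_add_right[of a x x']
          addhom_add[OF Fa, of "bp X (Scalar b) x" "bp X (Scalar b) x'"] x b by simp
    next
      fix r and a :: "('a fps, 'b) univ" and x assume r: "r \<in> R" and "a :> AA" and x: "x :> X"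
      then obtain b where b: "a = Scalar b" by auto
      show "?beta (r *[AA] a) x = ?beta a (r *[X] x)"
        using beta[OF x, of "r * b"] beta[of "r *[X] x" b] rsm[OF r x, of b] x r b by simp
    next
      fix a :: "('a fps, 'b) univ" and x assume "a :> AA" and x: "x :> X"
      then obtain b where b: "a = Scalar b" by auto
      then show "?beta a x :> ?Q" using beta[OF x, of b] addhom_closed[OF Fa, of "bp X (Scalar b) x"] x by simp
    qed
    have "tlift ?Q ?beta t = ?F t" if "t :> bt X" for t
    proof (rule addhom_eqI[OF gen T.addhom_tlift[OF L'.abelian_group_loc bal] Fa T.abelian_group_T L'.abelian_group_loc _ that])
      fix z assume "z \<in> {bp X (Scalar a) x |a x. x :> X}"
      then obtain a x where z: "x :> X" "z = bp X (Scalar a) x" by blast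
      show "tlift ?Q ?beta z = ?F z"
        using T.tlift_pt[OF L'.abelian_group_loc bal, of "Scalar a" x] beta[OF z(1), of a] z by simp
    qed
    then show "frb (FF X) (lfrac (bt X) mu t j) = lfrac (bt X) (phi mu) (mu ^ (d * k) *[bt X] FPhi X Phi k t) (d * k + j)"
      unfolding bc_simps(3) using t sl by (intro A.frb_loc_ext[OF l ah]) auto
  qed
qed

end

section \<open>Invariants of a Wach module\<close>

context wpair
begin

abbreviation (input) "GG \<equiv> invariants_ob B B' H"

definition "inv_mod N = N\<lparr>carrier := {x \<in> carrier N. \<forall>h\<in>H. gact N h x = x}\<rparr>"

lemma inv_simps:
  "same_mod (GG N) (inv_mod N)" "gact (GG N) = gact N"
  "frb (GG N) = (%\<xi>. THE ups. ups :> loc (inv_mod N) (phi nu) \<and>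
      loc_map id (phi nu) N (phi mu) id ups = frb N (loc_map id nu N mu id \<xi>))"
  by (simp_all add: same_mod_def invariants_ob_def inv_mod_def Let_def)

lemma inv_ops: "add (inv_mod N) = add N" "zero (inv_mod N) = zero N" "smult (inv_mod N) = smult N"
  by (simp_all add: inv_mod_def)

lemma inv_carrier: "carrier (inv_mod N) = {x \<in> carrier N. \<forall>h\<in>H. gact N h x = x}" by (simp add: inv_mod_def)

lemma inv_I: "x :> N ==> (!!h. h \<in> H ==> gact N h x = x) ==> x :> inv_mod N" by (simp add: inv_carrier)

lemmas inv_mod [simp] = same_modD[OF inv_simps(1)]

lemma inv_in: "x :> inv_mod N ==> x :> N" by (simp add: inv_carrier)

lemma inv_fix: "x :> inv_mod N ==> h \<in> H ==> gact N h x = x" by (simp add: inv_carrier)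

lemma act_ci: "h :> G ==> act h ci = ci"
proof -
  assume h: "h :> G"
  have "of_nat (card H) * act h ci = of_nat (card H) * ci"
    using A.act_mult[OF h, of "of_nat (card H)" ci] h by (simp add: ci)
  moreover have "of_nat (card H) \<noteq> (0 :: 'a fps)" using ci by auto
  ultimately show ?thesis by simp
qed

lemma H_translate: "h \<in> H ==> bij_betw ((\<otimes>\<^bsub>G\<^esub>) h) H H"
proof (rule bij_betw_byWitness[where f' = "(\<otimes>\<^bsub>G\<^esub>) (inv\<^bsub>G\<^esub> h)"])
  assume h: "h \<in> H"
  then have hi: "inv\<^bsub>G\<^esub> h \<in> H" by (rule subgroup.m_inv_closed[OF H_sub])
  show "\<forall>a\<in>H. inv\<^bsub>G\<^esub> h \<otimes>\<^bsub>G\<^esub> (h \<otimes>\<^bsub>G\<^esub> a) = a" "\<forall>a\<in>H. h \<otimes>\<^bsub>G\<^esub> (inv\<^bsub>G\<^esub> h \<otimes>\<^bsub>G\<^esub> a) = a"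
    using h by (auto simp: A.G.m_assoc[symmetric])
  show "(\<otimes>\<^bsub>G\<^esub>) h ` H \<subseteq> H" "(\<otimes>\<^bsub>G\<^esub>) (inv\<^bsub>G\<^esub> h) ` H \<subseteq> H"
    using h hi subgroup.m_closed[OF H_sub] by auto
qed

definition "avg N x = ci *[N] finsum N (%h. gact N h x) H"

definition "eavg a = ci * (\<Sum>h\<in>H. act h a)"

lemma eavg_R: "eavg a \<in> R"
proof -
  have "act h (eavg a) = eavg a" if h: "h \<in> H" for h
  proof -
    have sum: "act h (\<Sum>g\<in>J. f g) = (\<Sum>g\<in>J. act h (f g))" if "finite J" for J :: "'g set" and f
      using that by (induction J) (use h in \<open>auto simp: A.act_add\<close>)
    have "act h (\<Sum>g\<in>H. act g a) = (\<Sum>g\<in>H. act (h \<otimes>\<^bsub>G\<^esub> g) a)"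
      using h by (simp add: sum[OF H_fin] A.act_comp)
    also have "... = (\<Sum>g\<in>H. act g a)" by (rule sum.reindex_bij_betw[OF H_translate[OF h]])
    finally show ?thesis using h by (simp add: eavg_def A.act_mult act_ci)
  qed
  then show ?thesis by (simp add: fixed)
qed

text \<open>Translating the summation index gives invariance, and \<open>ci\<close> normalises. On
  multiples of an invariant vector only the scalar is averaged. If every element of \<open>H\<close>
  moves \<open>x\<close> by a multiple of \<open>mu\<close>, so does the average; this is what the
  perturbation of a basis requires.\<close>

lemma avg: assumes N: "rmod R' N" "semilinear_action B' N" shows "x :> N ==> avg N x :> inv_mod N"
    and "x :> inv_mod N ==> avg N x = x" and "x :> inv_mod N ==> avg N (a *[N] x) = eavg a *[N] x"
    and "addhom N N (avg N)"
    and "x :> N ==> (!!h. h \<in> H ==> \<exists>y\<in>carrier N. gact N h x -[N] x = mu *[N] y) ==>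
      \<exists>y\<in>carrier N. avg N x -[N] x = mu *[N] y"
proof -
  interpret N: rmod R' N by fact
  note [simp] = inv_in[where N = N]
  note sa = A.actionD[OF N(2)]
  note gc [simp] = addhom_closed[OF sa(1)]
  have ac: "avg N x :> N" if "x :> N" for x using that by (auto simp: avg_def intro!: N.finsum_closed N.smult_closed)
  have card_smult: "(ci * of_nat (card H)) *[N] y = y" if "y :> N" for y using that ci by (simp add: mult.commute)
  have const: "finsum N (%h. y) H = of_nat (card H) *[N] y" if "y :> N" for y
    using N.sum_smult[OF that, of H "%_. 1"] that by simp
  show "avg N x :> inv_mod N" if x: "x :> N" unfolding inv_carrier
  proof (intro CollectI conjI ballI ac[OF x])
    fix h assume h: "h \<in> H"
    have "gact N h (finsum N (%g. gact N g x) H) = finsum N (%g. gact N h (gact N g x)) H"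
      using x h H_fin by (intro addhom_finsum[OF N.is_abgroup N.is_abgroup sa(1)]) auto
    also have "... = finsum N (%g. gact N (h \<otimes>\<^bsub>G\<^esub> g) x) H"
      using x h by (intro N.finsum_cong') (auto simp: sa(3))
    also have "... = finsum N (%g. gact N g x) ((\<otimes>\<^bsub>G\<^esub>) h ` H)"
      using x h H_translate[OF h] by (intro N.finsum_reindex[symmetric]) (auto simp: bij_betw_def)
    also have "(\<otimes>\<^bsub>G\<^esub>) h ` H = H" using H_translate[OF h] by (simp add: bij_betw_def)
    finally show "gact N h (avg N x) = avg N x" using x h by (simp add: avg_def sa(4) act_ci N.finsum_closed)
  qed
  show "avg N x = x" if x: "x :> inv_mod N"
  proof -
    have "finsum N (%h. gact N h x) H = finsum N (%h. x) H" using x by (intro N.finsum_cong') (auto simp: inv_fix)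
    then show ?thesis using x const[of x] card_smult[of x] by (simp add: avg_def N.smult_smult)
  qed
  show "avg N (a *[N] x) = eavg a *[N] x" if x: "x :> inv_mod N"
  proof -
    have "finsum N (%h. gact N h (a *[N] x)) H = finsum N (%h. act h a *[N] x) H"
      using x by (intro N.finsum_cong') (auto simp: inv_fix sa(4))
    also have "... = (\<Sum>h\<in>H. act h a) *[N] x" using x by (intro N.sum_smult[symmetric]) auto
    finally show ?thesis using x by (simp add: avg_def eavg_def N.smult_smult)
  qed
  show "addhom N N (avg N)"
  proof (rule addhomI[OF ac])
    fix x y assume xy: "x :> N" "y :> N"
    have "finsum N (%h. gact N h (x +[N] y)) H = finsum N (%h. gact N h x +[N] gact N h y) H"
      using xy by (intro N.finsum_cong') (auto simp: addhom_add[OF sa(1)])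
    also have "... = finsum N (%h. gact N h x) H +[N] finsum N (%h. gact N h y) H" using xy by (intro N.finsum_addf) auto
    finally show "avg N (x +[N] y) = avg N x +[N] avg N y" using xy by (simp add: avg_def N.smult_r_distr N.finsum_closed)
  qed
  show "\<exists>y\<in>carrier N. avg N x -[N] x = mu *[N] y"
    if x: "x :> N" and "!!h. h \<in> H ==> \<exists>y\<in>carrier N. gact N h x -[N] x = mu *[N] y"
  proof -
    from that(2) obtain y where y: "!!h. h \<in> H ==> y h :> N" "!!h. h \<in> H ==> gact N h x -[N] x = mu *[N] y h"
      by metis
    have fy: "finsum N y H :> N" using y by (intro N.finsum_closed) auto
    have "finsum N (%h. gact N h x) H = finsum N (%h. x +[N] mu *[N] y h) H"
    proof (rule N.finsum_cong')
      fix h assume "h \<in> H"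
      then show "gact N h x = x +[N] mu *[N] y h" using x y N.add_diff_cancel[of "gact N h x" x] by simp
    qed (use x y in auto)
    also have "... = finsum N (%h. x) H +[N] finsum N (%h. mu *[N] y h) H" using x y by (intro N.finsum_addf) auto
    also have "finsum N (%h. mu *[N] y h) H = mu *[N] finsum N y H" using y by (intro N.smult_finsum[symmetric]) auto
    finally have "avg N x = ci *[N] (of_nat (card H) *[N] x) +[N] ci *[N] (mu *[N] finsum N y H)"
      using x y fy const[OF x] by (simp add: avg_def N.smult_r_distr)
    also have "... = x +[N] mu *[N] (ci *[N] finsum N y H)"
      using x fy card_smult[OF x] by (simp add: N.smult_smult mult.commute)
    finally have e: "avg N x = x +[N] mu *[N] (ci *[N] finsum N y H)" .
    have "avg N x -[N] x = mu *[N] (ci *[N] finsum N y H)"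
      unfolding e using x fy by (simp add: N.minus_eq N.a_comm[of x] N.a_assoc N.r_neg)
    then show ?thesis using fy by (intro bexI[of _ "ci *[N] finsum N y H"]) auto
  qed
qed

lemma rmod_inv: assumes N: "rmod R' N" "semilinear_action B' N" shows "rmod R (inv_mod N)"
proof -
  interpret N: rmod R' N by fact
  note [simp] = inv_in[where N = N]
  note sa = A.actionD[OF N(2)]
  have z: "gact N h 0[N] = 0[N]" if "h \<in> H" for h using addhom_zero[OF N.is_abgroup N.is_abgroup sa(1)] that by simp
  have m: "\<ominus>\<^bsub>N\<^esub> x :> inv_mod N" if "x :> inv_mod N" for x
    using that addhom_uminus[OF N.is_abgroup N.is_abgroup sa(1)] inv_fix[OF that] by (intro inv_I) auto
  show ?thesis
  proof (rule rmodI[OF S.sring_B])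
    show "abelian_group (inv_mod N)"
    proof (rule abelian_groupI)
      show "\<exists>y\<in>carrier (inv_mod N). y +[inv_mod N] x = 0[inv_mod N]" if "x :> inv_mod N" for x
        using m[OF that] that by (intro bexI[of _ "\<ominus>\<^bsub>N\<^esub> x"]) (auto simp: inv_ops N.l_neg)
    qed (auto simp: inv_ops z N.a_ac addhom_add[OF sa(1)] inv_fix intro!: inv_I)
  qed (auto simp: inv_ops sa(4) act_fix N.smult_l_distr N.smult_r_distr N.smult_smult inv_fix intro!: inv_I)
qed

lemma inv_minus:
  assumes N: "rmod R' N" "semilinear_action B' N" and "x :> inv_mod N" "y :> inv_mod N"
  shows "x -[inv_mod N] y = x -[N] y"
proof -
  interpret N: rmod R' N by fact
  note [simp] = inv_in[where N = N]
  interpret M: rmod R "inv_mod N" by (rule rmod_inv[OF N])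
  have ah: "addhom (inv_mod N) N (%x. x)" by (rule addhomI) (auto simp: inv_ops)
  show ?thesis using addhom_diff[OF M.is_abgroup N.is_abgroup ah assms(3,4)] .
qed

text \<open>Applying \<open>h\<close> to the expansion of an invariant vector in invariant basis
  vectors changes the coordinates only, so by uniqueness these are fixed by \<open>H\<close>, that
  is, lie in \<open>R\<close>. The same family with the same functionals then serves over
  \<open>R\<close>.\<close>

lemma inv_dbasis:
  assumes N: "rmod R' N" "semilinear_action B' N" and db: "dbasis R' N I e kap" and e0: "\<forall>i\<in>I. e i :> inv_mod N"
  shows "dbasis R (inv_mod N) I e kap"
proof -
  have e: "!!i. i \<in> I ==> e i :> inv_mod N" using e0 by blast
  interpret N: rmod R' N by fact
  note [simp] = inv_in[where N = N]
  interpret M: rmod R "inv_mod N" by (rule rmod_inv[OF N])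
  note sa = A.actionD[OF N(2)] and D = dbasisD[OF db]
  have ah: "addhom (inv_mod N) N (%x. x)" by (rule addhomI) (auto simp: inv_ops)
  have R: "kap i x \<in> R" if i: "i \<in> I" and x: "x :> inv_mod N" for i x
  proof -
    have "act h (kap i x) = kap i x" if h: "h \<in> H" for h
    proof -
      have "x = gact N h (finsum N (%i. kap i x *[N] e i) I)" using inv_fix[OF x h] D(7)[of x] x by simp
      also have "... = finsum N (%i. gact N h (kap i x *[N] e i)) I"
        using h x D(1,2) by (intro addhom_finsum[OF N.is_abgroup N.is_abgroup sa(1)]) auto
      also have "... = finsum N (%i. act h (kap i x) *[N] e i) I"
        using h x D(2) e by (intro N.finsum_cong') (auto simp: sa(4) inv_fix)
      finally show ?thesis using N.coord_comb[OF db i, of "%i. act h (kap i x)"] by simp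
    qed
    then show ?thesis by (simp add: fixed)
  qed
  have "x = finsum (inv_mod N) (%i. kap i x *[N] e i) I" if x: "x :> inv_mod N" for x
  proof -
    have "kap i x *[N] e i :> inv_mod N" if "i \<in> I" for i
      using M.smult_closed[OF R[OF that x] e[OF that]] by (simp add: inv_ops)
    then have "finsum (inv_mod N) (%i. kap i x *[N] e i) I = finsum N (%i. kap i x *[N] e i) I"
      using D(1) by (intro addhom_finsum[OF M.is_abgroup N.is_abgroup ah]) auto
    then show ?thesis using D(7)[of x] x by simp
  qed
  then show ?thesis using D e R by (auto simp: dbasis_def inv_ops)
qed

lemma inv_basis_exists:
  fixes N :: "('a fps, 'u, 'g, 'x) wach_scheme"
  assumes N: "A.wm N Phi k"
  shows "\<exists>I (e :: 'u => 'u) kap. dbasis R' N I e kap \<and> (\<forall>i\<in>I. e i :> inv_mod N)"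
proof -
  note D = A.wmD[OF N]
  interpret N: rmod R' N by (rule D)
  note [simp] = inv_in[where N = N]
  obtain I kap where db: "dbasis R' N I (%x. x) kap" using N.dbasis_of_finite_free[OF D(2)] by blast
  have "\<exists>y\<in>carrier N. avg N i -[N] i = mu *[N] y" if "i \<in> I" for i
    using dbasisD(2)[OF db that] A.wach_moduleD(7)[OF D(1)] by (intro avg(5)[OF D(3,7)]) auto
  then obtain n where n: "!!i. i \<in> I ==> n i :> N" "!!i. i \<in> I ==> avg N i -[N] i = mu *[N] n i" by metis
  have "\<exists>kap'. dbasis UNIV N I (avg N) kap'"
    using dbasis_perturb[OF D(3)[unfolded scal'] db[unfolded scal'], of n "avg N"] n avg(1)[OF D(3,7)] dbasisD(2)[OF db]
    by (simp add: mu')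
  then obtain kap' where "dbasis R' N I (avg N) kap'" unfolding scal' by blast
  moreover have "\<forall>i\<in>I. avg N i :> inv_mod N" using avg(1)[OF D(3,7)] dbasisD(2)[OF db] by blast
  ultimately show ?thesis by (intro exI conjI)
qed

text \<open>Only \<open>w' ^ d\<close>, not \<open>w'\<close>, is comparable with \<open>w\<close>,
  so an exponent over \<open>B'\<close> must be a multiple of \<open>d\<close> before it can
  descend.\<close>

lemma wm_multiple: assumes "wach_module B' N" shows "\<exists>Phi k. A.wm N Phi (d * k)"
proof -
  obtain Phi k where "A.wm N Phi k" using A.wach_wm[OF assms] by blast
  from A.wm_raise[OF this, of "d * k - k"] have "A.wm N (%x. w' ^ (d * k - k) *[N] Phi x) (d * k)" using d_pos by simp
  then show ?thesis by blast
qed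

lemma addgen_inv:
  fixes N :: "('a fps, 'u, 'g, 'x) wach_scheme"
  assumes N: "A.wm N Phi k" shows "addgen N {a *[N] m | a m. m :> inv_mod N}"
proof -
  note D = A.wmD[OF N]
  interpret N: rmod R' N by (rule D)
  note [simp] = inv_in[where N = N]
  obtain I and e :: "'u => 'u" and kap where db: "dbasis R' N I e kap" and e0: "\<forall>i\<in>I. e i :> inv_mod N"
    using inv_basis_exists[OF N] by blast
  have e: "!!i. i \<in> I ==> e i :> inv_mod N" using e0 by blast
  show ?thesis unfolding addgen_def
  proof (intro conjI allI impI ballI)
    show "{a *[N] m |a m. m :> inv_mod N} \<subseteq> carrier N" by auto
    fix Q x
    assume Q: "Q 0[N]" "\<forall>z\<in>{a *[N] m |a m. m :> inv_mod N}. Q z"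
      "\<forall>x\<in>carrier N. \<forall>y\<in>carrier N. Q x \<longrightarrow> Q y \<longrightarrow> Q (x +[N] y)" and x: "x :> N"
    have "Q (finsum N (%i. kap i x *[N] e i) J)" if "finite J" "J \<subseteq> I" for J using that
    proof (induction J)
      case (insert i J)
      have c: "(%i. kap i x *[N] e i) \<in> J \<rightarrow> carrier N" using insert e by auto
      have "kap i x *[N] e i :> N" "Q (kap i x *[N] e i)" using insert e Q(2) by auto
      then show ?case using insert Q(3) c N.finsum_closed[OF c] by (subst N.finsum_insert) auto
    qed (use Q in simp)
    from this[of I] show "Q x" using dbasisD(1,7)[OF db] x by simp
  qed
qed

lemma inv_lmod:
  fixes N :: "('a, 'b, 'g) fob"
  assumes N: "A.wm N Phi k"
  shows "finite_free R (inv_mod N)" "lmod R (inv_mod N) nu" "lmod R (inv_mod N) (phi nu)" "finite_free R (GG N)"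
proof -
  note D = A.wmD[OF N]
  interpret M: rmod R "inv_mod N" by (rule rmod_inv[OF D(3,7)])
  obtain I and e :: "('a fps, 'b) univ => ('a fps, 'b) univ" and kap where db: "dbasis R' N I e kap" and e0: "\<forall>i\<in>I. e i :> inv_mod N"
    using inv_basis_exists[OF N] by blast
  have e: "!!i. i \<in> I ==> e i :> inv_mod N" using e0 by blast
  note dbM = inv_dbasis[OF D(3,7) db e0]
  show ff: "finite_free R (inv_mod N)" by (rule M.finite_free_of_dbasis[OF dbM]) simp
  show "finite_free R (GG N)" by (rule rmod.finite_free_of_dbasis[OF M.cong_fields dbasis_cong[OF dbM]]) simp_all
  show "lmod R (inv_mod N) nu" "lmod R (inv_mod N) (phi nu)"
    using S.frob_mu_R S.frob_mu_nz by (intro lmod.intro lmod_axioms.intro M.rmod_axioms finite_free_tfree[OF ff]; simp)+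
qed

lemma wm_G:
  fixes N :: "('a, 'b, 'g) fob"
  assumes N: "A.wm N Phi (d * k)" shows "S.wm (GG N) (%x. v ^ k *[N] Phi x) k"
proof -
  note D = A.wmD[OF N]
  let ?M = "inv_mod N" and ?Phi = "%x. v ^ k *[N] Phi x"
  interpret N: lmod R' N mu by (rule D)
  note [simp] = inv_in[where N = N]
  interpret N': lmod R' N "phi mu" by (rule D)
  note rM = rmod_inv[OF D(3,7)]
  interpret M: lmod R ?M nu by (rule inv_lmod[OF N])
  interpret M': lmod R ?M "phi nu" by (rule inv_lmod[OF N])
  obtain I and e :: "('a fps, 'b) univ => ('a fps, 'b) univ" and kap where db: "dbasis R' N I e kap" and e0: "\<forall>i\<in>I. e i :> ?M"
    using inv_basis_exists[OF N] by blast
  have e: "!!i. i \<in> I ==> e i :> ?M" using e0 by blast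
  note dbM = inv_dbasis[OF D(3,7) db e0] and Db = dbasisD[OF db]
  note DM = dbasisD[OF dbM]
  note sa = A.actionD[OF D(7)]
  note gc [simp] = addhom_closed[OF sa(1)] addhom_closed[OF D(8)]
  note ms = inv_ops
  have smM [simp]: "c *[N] x :> ?M" if "c \<in> R" "x :> ?M" for c x using M.smult_closed[OF that] by (simp add: ms)
  \<comment> \<open>\<open>H\<close> is central in \<open>G\<close>, so all of \<open>G\<close>
    preserves its invariants.\<close>
  have gM [simp]: "gact N g x :> ?M" if g: "g :> G" and x: "x :> ?M" for g x
  proof -
    have "gact N h (gact N g x) = gact N g x" if h: "h \<in> H" for h
      using sa(3)[of h g x] sa(3)[of g h x] H_comm[OF g h] g h x inv_fix[OF x h] by simp
    then show ?thesis using g x by (intro inv_I) auto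
  qed
  have w'k: "w' ^ (d * k) = w ^ k * vi ^ k" by (simp add: power_mult w'_pow power_mult_distrib)
  have PhiM: "?Phi x :> ?M" if x: "x :> ?M" for x unfolding inv_carrier
  proof (intro CollectI conjI ballI)
    fix h assume h: "h \<in> H"
    \<comment> \<open>\<open>H\<close> fixes \<open>w = w' ^ d * v\<close>, while the two factors
      separately may move. The factor \<open>v ^ k\<close> in \<open>?Phi\<close> compensates the
      action of \<open>H\<close> on \<open>w' ^ (d * k)\<close> in the equivariance of
      \<open>Phi\<close>.\<close>
    have wh: "act h w = w" by (rule act_fix[OF h S.w_R])
    have "act h (w' ^ d) * act h v = act h w" using h by (simp add: w_eq A.act_mult)
    then have awv: "act h w' ^ (d * k) * act h v ^ k = w ^ k"
      using h wh by (simp add: A.act_power power_mult power_mult_distrib[symmetric])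
    have "w' ^ (d * k) *[N] gact N h (?Phi x) = (act h v ^ k) *[N] (w' ^ (d * k) *[N] gact N h (Phi x))"
      using h x by (simp add: sa(4) A.act_power N.smult_smult mult.commute)
    also have "... = (act h v ^ k) *[N] (act h w' ^ (d * k) *[N] Phi x)" using D(11)[of h x] h x inv_fix[OF x h] by simp
    also have "... = w ^ k *[N] Phi x" using h x awv by (simp add: N.smult_smult mult.commute)
    also have "w ^ k = w' ^ (d * k) * v ^ k" by (simp add: w_eq power_mult_distrib power_mult)
    finally have "w' ^ (d * k) *[N] gact N h (?Phi x) = w' ^ (d * k) *[N] ?Phi x" using x by (simp add: N.smult_smult)
    then show "gact N h (?Phi x) = ?Phi x" using x h by (subst (asm) N.cancel) auto
  qed (use x in auto)
  have ah: "addhom ?M ?M ?Phi" by (rule addhomI[OF PhiM]) (auto simp: ms addhom_add[OF D(8)] N.smult_r_distr)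
  have sub: "?Phi ` carrier ?M \<subseteq> carrier ?M" using PhiM by auto
  obtain l where l: "!!x. x :> N ==> w' ^ l *[N] x \<in> span_on R' N (Phi ` carrier N)" using D(12) by blast
  have subN: "Phi ` carrier N \<subseteq> carrier N" by auto
  note av = avg[OF D(3,7)]
  let ?SM = "span_on R ?M (?Phi ` carrier ?M)"
  note spM = M.span_closed[OF sub]
  have av0: "avg N 0[N] = 0[N]" by (rule addhom_zero[OF N.is_abgroup N.is_abgroup av(4)])
  \<comment> \<open>Averaging turns an \<open>R'\<close>-combination of values of \<open>Phi\<close>
    into an \<open>R\<close>-combination of values of \<open>?Phi\<close> on invariants:
    coefficients are averaged, and the vectors \<open>?Phi m\<close> do not move. Thus the bound on
    the cokernel descends.\<close>
  have spPhi: "avg N (c *[N] Phi n) \<in> ?SM" if n: "n :> N" for n c using addgen_inv[OF N] n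
  proof (induction n rule: addgen_induct)
    case zero
    show ?case using addhom_zero[OF N.is_abgroup N.is_abgroup D(8)] av0 spM(2) by (simp add: ms)
  next
    case (gen z)
    then obtain a m where z: "z = a *[N] m" "m :> ?M" by blast
    have "c *[N] Phi z = (c * phi a * vi ^ k) *[N] ?Phi m"
      using z v_power(2)[of k] by (simp add: D(9) N.smult_smult mult.assoc)
    then have "avg N (c *[N] Phi z) = eavg (c * phi a * vi ^ k) *[N] ?Phi m" using av(3)[OF PhiM[OF z(2)]] by simp
    also have "... \<in> ?SM" using z spM(4)[OF eavg_R span_on_incl] by (auto simp: ms)
    finally show ?case .
  next
    case (add x y)
    then show ?case using spM(3) by (simp add: addhom_add[OF D(8)] N.smult_r_distr addhom_add[OF av(4)] ms)
  qed
  have spA: "avg N (c *[N] y) \<in> ?SM" if "y \<in> span_on R' N (Phi ` carrier N)" for y c using that subN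
  proof (induction arbitrary: c rule: N.span_induct)
    case (base y)
    then show ?case using spPhi by auto
  next
    case zero
    show ?case using av0 spM(2) by (simp add: ms)
  next
    case (add x y)
    then have "x :> N" "y :> N" using N.span_closed(1)[OF subN] by auto
    with add show ?case using spM(3) by (simp add: N.smult_r_distr addhom_add[OF av(4)] ms)
  next
    case (smult b x)
    then have "x :> N" using N.span_closed(1)[OF subN] by auto
    with smult show ?case by (simp add: N.smult_smult)
  qed
  show ?thesis
  proof (rule S.wmI[OF inv_lmod(4)[OF N], where l = l, unfolded inv_mod, OF addgen_carrier])
    fix g assume "g :> G0"
    then have g: "g :> G" by simp
    show "addhom ?M ?M (gact (GG N) g)" using g by (intro addhomI) (auto simp: inv_simps(2) ms addhom_add[OF sa(1)])
    fix x assume x: "x :> ?M"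
    show "gact (GG N) (g \<otimes>\<^bsub>G0\<^esub> h) x = gact (GG N) g (gact (GG N) h x)" if "h :> G0" for h
      using g that x by (simp add: inv_simps(2) sa(3))
    show "gact (GG N) g (c *[?M] x) = b_act B g c *[?M] gact (GG N) g x" if "c \<in> R" for c
      using g that x by (simp add: inv_simps(2) ms sa(4))
    show "\<exists>y\<in>carrier ?M. gact (GG N) g x -[?M] x = nu *[?M] y"
    proof -
      obtain y where y: "y :> N" "gact N g x -[N] x = mu *[N] y" using A.wach_moduleD(7)[OF D(1) g inv_in[OF x]] by blast
      let ?z = "gact N g x -[?M] x"
      have z: "?z :> ?M" using g x by (intro M.diff_closed) auto
      have z2: "?z = mu *[N] y" using g x y inv_minus[OF D(3,7), of "gact N g x" x] by auto
      \<comment> \<open>Divisibility is read on coordinates: they lie in \<open>R\<close> because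
        \<open>?z\<close> is invariant, and they are multiples of \<open>mu\<close>, hence of
        \<open>nu\<close>.\<close>
      have "\<exists>c\<in>R. kap i ?z = nu * c" if i: "i \<in> I" for i
        using nu_dvd[of "kap i ?z" "kap i y"] DM(3)[OF i z] Db(5)[OF i _ y(1), of mu] z2 by simp
      then obtain c where c: "!!i. i \<in> I ==> c i \<in> R" "!!i. i \<in> I ==> kap i ?z = nu * c i" by metis
      have cin: "finsum ?M (%i. c i *[?M] e i) I :> ?M" using c e by (intro M.finsum_closed) auto
      have "?z = nu *[?M] finsum ?M (%i. c i *[?M] e i) I"
        by (rule M.coord_eqI[OF dbM z]) (use c cin M.coord_comb[OF dbM _ c(1)] DM(5) in auto)
      then show ?thesis using cin by (auto simp: inv_simps(2))
    qed
    show "b_act B g w ^ k *[?M] ?Phi (gact (GG N) g x) = w ^ k *[?M] gact (GG N) g (?Phi x)"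
    proof -
      have wk: "w ^ k = w' ^ (d * k) * v ^ k" by (simp add: w_eq power_mult_distrib power_mult)
      have awk: "act g w ^ k = act g w' ^ (d * k) * act g v ^ k"
        using g by (simp add: w_eq power_mult_distrib power_mult A.act_mult A.act_power)
      have "act g w ^ k *[N] ?Phi (gact N g x) = (act g v ^ k * v ^ k) *[N] (act g w' ^ (d * k) *[N] Phi (gact N g x))"
        using g x unfolding awk by (simp add: N.smult_smult mult_ac)
      also have "... = (act g v ^ k * v ^ k) *[N] (w' ^ (d * k) *[N] gact N g (Phi x))" using D(11)[of g x] g x by simp
      also have "... = w ^ k *[N] gact N g (?Phi x)"
        using g x unfolding wk by (simp add: sa(4) A.act_power N.smult_smult mult_ac)
      finally show ?thesis by (simp add: inv_simps(2) ms)
    qed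
  next
    fix x n assume x: "x :> ?M"
    \<comment> \<open>Elements of \<open>R\<close> in step \<open>q\<close> over \<open>B'\<close>
      lie in step \<open>n\<close> over \<open>B\<close>. This is applied to the coordinates of
      \<open>g x - x\<close> in an invariant basis.\<close>
    obtain q where q: "!!c. c \<in> R ==> c \<in> adic_power B' (regon UNIV) q ==> c \<in> adic_power B (regon R) n"
      using adic_comp by blast
    obtain m where m: "!!g. g \<in> U' m ==> gact N g x -[N] x \<in> adic_power B' N q"
      using A.wach_moduleD(8)[OF D(1), of x q] x by auto
    obtain m' where m': "U m' \<subseteq> U' m" using U'_U by blast
    have "gact N g x -[?M] x \<in> adic_power B ?M n" if g: "g \<in> U m'" for g
    proof -
      let ?z = "gact N g x -[?M] x"
      have gU: "g \<in> U' m" using g m' by auto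
      then have gG: "g :> G" by simp
      have z: "?z :> ?M" using gG x by (intro M.diff_closed) auto
      have z2: "?z \<in> adic_power B' N q" using gG x m[OF gU] inv_minus[OF D(3,7), of "gact N g x" x] by auto
      have "kap i ?z \<in> adic_power B' (regon R') q" if i: "i \<in> I" for i
        by (rule A.adic_lin_map[OF D(3) A.rmod_regon _ _ z2]) (use Db(4,5)[OF i] in \<open>auto intro!: addhomI\<close>)
      then have k: "kap i ?z \<in> adic_power B (regon R) n" if "i \<in> I" for i
        using q DM(3)[OF that z] that unfolding scal' by blast
      have kz: "kap i ?z *[?M] e i \<in> adic_power B ?M n" if "i \<in> I" for i
        by (rule S.adic_scalar[OF rM k[OF that] e[OF that]])
      have "finsum ?M (%i. kap i ?z *[?M] e i) J \<in> adic_power B ?M n" if "finite J" "J \<subseteq> I" for J using that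
      proof (induction J)
        case (insert i J)
        have c: "(%i. kap i ?z *[?M] e i) \<in> J \<rightarrow> carrier ?M" "kap i ?z *[?M] e i :> ?M"
          using insert kz S.adic_closed(1)[OF rM] by blast+
        show ?case using insert kz[of i] S.adic_closed(3)[OF rM] c by (subst M.finsum_insert) auto
      qed (use S.adic_closed(2)[OF rM] in simp)
      from this[of I] show ?thesis using DM(1,7) z by simp
    qed
    then show "\<exists>m. \<forall>g\<in>U m. gact (GG N) g x -[?M] x \<in> adic_power B ?M n" by (auto simp: inv_simps(2))
  next
    show "addhom ?M ?M ?Phi" by (rule ah)
    fix x assume x: "x :> ?M"
    show "gact (GG N) \<one>\<^bsub>G0\<^esub> x = x" using x by (simp add: inv_simps(2) sa(2))
    show "?Phi (c *[?M] x) = b_frob B c *[?M] ?Phi x" if "c \<in> R" for c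
      using x by (simp add: ms D(9) N.smult_smult mult.commute)
    \<comment> \<open>\<open>w ^ l\<close> contains \<open>w' ^ (d * l)\<close>, which covers the
      required \<open>w' ^ l\<close> because \<open>d > 0\<close>. Averaging afterwards does not
      change the invariant vector.\<close>
    have wl: "w ^ l *[N] x = (v ^ l * w' ^ (d * l - l)) *[N] (w' ^ l *[N] x)"
    proof -
      have "w' ^ (d * l) = w' ^ (d * l - l) * w' ^ l" using d_pos by (subst power_add[symmetric]) simp
      then have "w ^ l = v ^ l * w' ^ (d * l - l) * w' ^ l" by (simp add: w_eq power_mult_distrib power_mult mult_ac)
      then show ?thesis using x by (simp add: N.smult_smult)
    qed
    have "avg N (w ^ l *[N] x) \<in> ?SM" unfolding wl using x by (intro spA l) auto
    moreover have "avg N (w ^ l *[N] x) = w ^ l *[N] x" using x by (intro av(2) smM) (auto simp: S.power_R)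
    ultimately show "w ^ l *[?M] x \<in> ?SM" by (simp add: ms)
  next
    fix x j assume x: "x :> ?M"
    have incl: "addhom ?M N id" by (rule addhomI) (auto simp: ms)
    \<comment> \<open>The denominator \<open>nu ^ i\<close> is rewritten as
      \<open>mu ^ (d * i)\<close>; its unit part \<open>u ^ i\<close> is inverted in the
      numerator.\<close>
    have lm: "loc_map id nu N mu id (lfrac ?M nu y i) = lfrac N mu (ui ^ i *[N] y) (d * i)" if y: "y :> ?M" for y i
    proof (rule M.loc_map_eval[OF D(5) _ _ incl])
      have "nu ^ i * ui ^ i = mu ^ (d * i) * (u ^ i * ui ^ i)" by (simp add: nu power_mult_distrib power_mult mult_ac)
      then show "id nu ^ i *[N] (ui ^ i *[N] y) = mu ^ (d * i) *[N] id y" using y by (simp add: N.smult_smult phi_u(3))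
    qed (use y in \<open>auto simp: ms\<close>)
    have lm': "loc_map id (phi nu) N (phi mu) id (lfrac ?M (phi nu) y i) = lfrac N (phi mu) (phi ui ^ i *[N] y) (d * i)"
      if y: "y :> ?M" for y i
    proof (rule M'.loc_map_eval[OF D(6) _ _ incl])
      have "phi nu ^ i * phi ui ^ i = phi mu ^ (d * i) * (phi u ^ i * phi ui ^ i)" by (simp add: frob_nu power_mult_distrib power_mult mult_ac)
      then show "id (phi nu) ^ i *[N] (phi ui ^ i *[N] y) = phi mu ^ (d * i) *[N] id y"
        using y by (simp add: N.smult_smult phi_u(2))
    qed (use y in \<open>auto simp: ms frob_nu nz\<close>)
    define y' where "y' = nu ^ k *[N] ?Phi x"
    let ?ups = "lfrac ?M (phi nu) y' (k + j)"
    have nuk: "y' :> ?M" unfolding y'_def using PhiM[OF x] by (rule smM[rotated]) (auto simp: S.power_R)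
    have val: "loc_map id (phi nu) N (phi mu) id ?ups = frb N (loc_map id nu N mu id (lfrac ?M nu x j))"
    proof -
      have e: "phi ui ^ (k + j) * (nu ^ k * v ^ k) = mu ^ (d * k) * phi ui ^ j"
      proof -
        have "phi ui ^ (k + j) * (nu ^ k * v ^ k) = mu ^ (d * k) * phi ui ^ j * (vi ^ k * v ^ k)"
          by (simp add: nu vi_def power_mult_distrib power_mult power_add mult_ac)
        then show ?thesis by (simp add: v_power)
      qed
      have "loc_map id (phi nu) N (phi mu) id ?ups = lfrac N (phi mu) (phi ui ^ (k + j) *[N] y') (d * (k + j))"
        using lm'[OF nuk, of "k + j"] .
      also have "phi ui ^ (k + j) *[N] y' = (mu ^ (d * k) * phi ui ^ j) *[N] Phi x"
        using x e by (simp add: y'_def N.smult_smult mult.assoc)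
      also have "lfrac N (phi mu) ((mu ^ (d * k) * phi ui ^ j) *[N] Phi x) (d * (k + j)) =
          frb N (lfrac N mu (ui ^ j *[N] x) (d * j))" using x by (simp add: D(9,10) A.frob_power N.smult_smult distrib_left)
      also have "lfrac N mu (ui ^ j *[N] x) (d * j) = loc_map id nu N mu id (lfrac ?M nu x j)" using lm[OF x] by simp
      finally show ?thesis .
    qed
    have "frb (GG N) (lfrac ?M nu x j) = ?ups" unfolding inv_simps(3)
    proof (rule the_equality)
      show "?ups :> loc ?M (phi nu) \<and> loc_map id (phi nu) N (phi mu) id ?ups = frb N (loc_map id nu N mu id (lfrac ?M nu x j))"
        using val nuk by (auto simp: ms)
      fix ups assume a: "ups :> loc ?M (phi nu) \<and> loc_map id (phi nu) N (phi mu) id ups = frb N (loc_map id nu N mu id (lfrac ?M nu x j))"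
      then obtain y i where y: "y :> ?M" "ups = lfrac ?M (phi nu) y i" using M'.locE by blast
      let ?i' = "k + j"
      \<comment> \<open>Uniqueness for the \<open>THE\<close> in the definition: equal images over
        \<open>phi mu\<close> are cross-multiplied, and powers of the unit \<open>phi u\<close> then
        restore denominators in \<open>phi nu\<close>.\<close>
      have "lfrac N (phi mu) (phi ui ^ i *[N] y) (d * i) = lfrac N (phi mu) (phi ui ^ ?i' *[N] y') (d * ?i')"
        using a val y lm'[OF y(1), of i] lm'[OF nuk, of ?i'] by (simp add: ms)
      then have "phi mu ^ (d * ?i') *[N] (phi ui ^ i *[N] y) = phi mu ^ (d * i) *[N] (phi ui ^ ?i' *[N] y')"
        using y nuk by (subst (asm) N'.lfrac_eq) auto
      then have "(phi u ^ i * phi u ^ ?i') *[N] (phi mu ^ (d * ?i') *[N] (phi ui ^ i *[N] y)) =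
          (phi u ^ i * phi u ^ ?i') *[N] (phi mu ^ (d * i) *[N] (phi ui ^ ?i' *[N] y'))" by (simp only:)
      moreover have "(phi u ^ i * phi u ^ ?i') *[N] (phi mu ^ (d * ?i') *[N] (phi ui ^ i *[N] y)) = phi nu ^ ?i' *[N] y"
      proof -
        have "phi u ^ i * phi u ^ ?i' * (phi mu ^ (d * ?i') * phi ui ^ i) = phi nu ^ ?i' * (phi u ^ i * phi ui ^ i)"
          by (simp add: frob_nu power_mult_distrib power_mult mult_ac)
        then show ?thesis using y by (simp add: N.smult_smult phi_u(2))
      qed
      moreover have "(phi u ^ i * phi u ^ ?i') *[N] (phi mu ^ (d * i) *[N] (phi ui ^ ?i' *[N] y')) = phi nu ^ i *[N] y'"
      proof -
        have "phi u ^ i * phi u ^ ?i' * (phi mu ^ (d * i) * phi ui ^ ?i') = phi nu ^ i * (phi u ^ ?i' * phi ui ^ ?i')"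
          by (simp add: frob_nu power_mult_distrib power_mult mult_ac)
        then show ?thesis using nuk by (simp add: N.smult_smult phi_u(2))
      qed
      ultimately have "phi nu ^ ?i' *[N] y = phi nu ^ i *[N] y'" by simp
      then show "ups = ?ups" using y nuk by (simp add: M'.lfrac_eq ms)
    qed
    then show "frb (GG N) (lfrac ?M nu x j) = lfrac ?M (b_frob B nu) (nu ^ k *[?M] ?Phi x) (k + j)" by (simp add: y'_def ms)
  qed
qed

end

section \<open>The comparison morphisms\<close>

lemma addgen_mono: "addgen X Z ==> Z \<subseteq> Z' ==> Z' \<subseteq> carrier X ==> addgen X Z'"
  unfolding addgen_def by (intro conjI allI impI; (elim conjE)?) (assumption | blast)+

section \<open>Linear generating sets\<close>

context wbase
begin

text \<open>After base change the vectors 1 \<otimes> x generate with scalars but in general not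
  additively. For maps already known to be linear this smaller set is enough.\<close>

definition "lgen X Z \<longleftrightarrow> Z \<subseteq> carrier X \<and> addgen X {c *[X] z | c z. c \<in> R \<and> z \<in> Z}"

lemma hom_eqL:
  assumes "f \<in> wach_hom B X P" "g \<in> wach_hom B X P" "wach_module B X" "wach_module B P" "lgen X Z"
    "!!z. z \<in> Z ==> f z = g z" shows "f = g"
proof (rule hom_eqI[OF assms(1-4)])
  show "addgen X {c *[X] z | c z. c \<in> R \<and> z \<in> Z}" using assms(5) by (simp add: lgen_def)
  fix y assume "y \<in> {c *[X] z | c z. c \<in> R \<and> z \<in> Z}"
  then obtain c z where "y = c *[X] z" "c \<in> R" "z \<in> Z" by blast
  moreover from this have "z :> X" using assms(5) by (auto simp: lgen_def)
  ultimately show "f y = g y" using wach_homD(2)[OF assms(1)] wach_homD(2)[OF assms(2)] assms(6) by simp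
qed

lemma lgen_unit: "lgen (wach_unit B) {Scalar 1}"
proof -
  have e: "{c *[wach_unit B] z |c z. c \<in> R \<and> z \<in> {Scalar 1}} = carrier (wach_unit B)" by auto
  show ?thesis unfolding lgen_def e using addgen_carrier[of "wach_unit B"] by auto
qed

lemma lgen_TT: assumes "wach_module B X" "wach_module B Y" "lgen X Z" "lgen Y Z'"
  shows "lgen (TT X Y) {ptens R X Y a b | a b. a \<in> Z \<and> b \<in> Z'}"
proof -
  interpret XY: tpair R R X Y by (rule wach_tpair[OF assms(1,2)])
  interpret T: rmod R "TT X Y" by (rule wach_rmod[OF wach_TT[OF assms(1,2)]])
  have Z: "Z \<subseteq> carrier X" "Z' \<subseteq> carrier Y" using assms(3,4) by (auto simp: lgen_def)
  have Zc: "{ptens R X Y a b | a b. a \<in> Z \<and> b \<in> Z'} \<subseteq> carrier (TT X Y)" using Z assms(1,2) by auto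
  have "addgen (TT X Y) {c *[TT X Y] z |c z. c \<in> R \<and> z \<in> {ptens R X Y a b | a b. a \<in> Z \<and> b \<in> Z'}}"
  proof (rule addgen_mono[OF addgen_TT[OF assms(1,2), of "{c *[X] z | c z. c \<in> R \<and> z \<in> Z}" "{c *[Y] z | c z. c \<in> R \<and> z \<in> Z'}"]])
    show "{ptens R X Y a b |a b. a \<in> {c *[X] z | c z. c \<in> R \<and> z \<in> Z} \<and> b \<in> {c *[Y] z | c z. c \<in> R \<and> z \<in> Z'}} \<subseteq>
        {c *[TT X Y] z |c z. c \<in> R \<and> z \<in> {ptens R X Y a b | a b. a \<in> Z \<and> b \<in> Z'}}"
    proof
      fix y assume "y \<in> {ptens R X Y a b |a b. a \<in> {c *[X] z | c z. c \<in> R \<and> z \<in> Z} \<and> b \<in> {c *[Y] z | c z. c \<in> R \<and> z \<in> Z'}}"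
      then obtain c z c' z' where y: "y = ptens R X Y (c *[X] z) (c' *[Y] z')" "c \<in> R" "z \<in> Z" "c' \<in> R" "z' \<in> Z'" by blast
      have "y = (c' * c) *[TT X Y] ptens R X Y z z'"
        using y Z by (auto simp: XY.pt_balance[symmetric] XY.smult_pt XY.L.smult_smult subset_eq)
      then show "y \<in> {c *[TT X Y] z |c z. c \<in> R \<and> z \<in> {ptens R X Y a b | a b. a \<in> Z \<and> b \<in> Z'}}" using y by blast
    qed
    show "{c *[TT X Y] z |c z. c \<in> R \<and> z \<in> {ptens R X Y a b | a b. a \<in> Z \<and> b \<in> Z'}} \<subseteq> carrier (TT X Y)"
      using Zc T.smult_closed by blast
  qed (use assms in \<open>auto simp: lgen_def\<close>)
  with Zc show ?thesis by (simp add: lgen_def)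
qed

text \<open>Linearity is assumed on all vectors, so equivariance and compatibility with Frobenius
  extend from \<open>Z\<close> to its multiples by semilinearity, and then to sums.\<close>

lemma wach_homL:
  assumes X: "wm X Phi k" and Y: "wm Y Psi m" and gen: "lgen X Z" and f: "addhom X Y f" "f \<in> extensional (carrier X)"
    and lin: "!!c x. [|c \<in> R; x \<in> carrier X|] ==> f (c *[X] x) = c *[Y] f x"
    and eq: "!!g z. [|g :> G; z \<in> Z|] ==> f (gact X g z) = gact Y g (f z)"
    and fr: "!!z. z \<in> Z ==> w ^ m *[Y] f (Phi z) = w ^ k *[Y] Psi (f z)"
  shows "f \<in> wach_hom B X Y"
proof -
  note DX = wmD[OF X] and DY = wmD[OF Y]
  interpret X: rmod R X by (rule DX)
  interpret Y: rmod R Y by (rule DY)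
  have Z: "z :> X" if "z \<in> Z" for z using gen that by (auto simp: lgen_def)
  note aX = actionD[OF DX(7)] and aY = actionD[OF DY(7)]
  note [simp] = addhom_closed[OF f(1)] addhom_closed[OF DX(8)] addhom_closed[OF DY(8)] addhom_closed[OF aX(1)] addhom_closed[OF aY(1)] Z
  show ?thesis
  proof (rule wach_homI[OF X Y _ f])
    show "addgen X {c *[X] z | c z. c \<in> R \<and> z \<in> Z}" using gen by (simp add: lgen_def)
    fix y assume "y \<in> {c *[X] z | c z. c \<in> R \<and> z \<in> Z}"
    then obtain c z where y: "y = c *[X] z" "c \<in> R" "z \<in> Z" by blast
    show "f (b *[X] y) = b *[Y] f y" if "b \<in> R" for b using y that by (simp add: lin)
    show "f (gact X g y) = gact Y g (f y)" if "g :> G" for g using y that eq by (simp add: aX(4) aY(4) lin)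
    have "w ^ m *[Y] f (Phi y) = phi c *[Y] (w ^ m *[Y] f (Phi z))"
      using y by (simp add: DX(9) lin Y.smult_smult mult.commute)
    also have "... = w ^ k *[Y] Psi (f y)" using y fr by (simp add: lin DY(9) Y.smult_smult mult.commute)
    finally show "w ^ m *[Y] f (Phi y) = w ^ k *[Y] Psi (f y)" .
  qed
qed

end

section \<open>The two functors on morphisms\<close>

context wpair
begin

abbreviation (input) "TS \<equiv> wach_tens B"
abbreviation (input) "TA \<equiv> wach_tens B'"
abbreviation (input) "US \<equiv> wach_unit B"
abbreviation (input) "UA \<equiv> wach_unit B'"

lemma wach_F [simp, intro]: "wach_module B X ==> wach_module B' (FF X)" by (meson S.wach_wm wm_F A.wmD(1))

lemma wach_G [simp, intro]: "wach_module B' N ==> wach_module B (GG N)" by (meson wm_multiple wm_G S.wmD(1))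

text \<open>The canonical map from a module to its base change. Its values generate linearly and are
  invariant under \<open>H\<close>, so maps out of a base change are described by what they do to
  them.\<close>

definition "io X x = bp X (Scalar 1) x"

lemma bc_tp: "wach_module B X ==> tpair R' R AA X" by (rule tpair_bc[OF S.wach_rmod])

lemma io_mem [simp, intro]: "[|wach_module B X; x \<in> carrier X|] ==> io X x :> bt X"
  unfolding io_def using tpair.pt_closed[OF bc_tp, of X "Scalar 1" x] by simp

lemma io_add: "[|wach_module B X; x :> X; y \<in> carrier X|] ==> io X (x +[X] y) = io X x +[bt X] io X y"
  unfolding io_def using tpair.pt_add_right[OF bc_tp, of X "Scalar 1" x y] by simp

lemma io_smult: "[|wach_module B X; c \<in> R; x \<in> carrier X|] ==> io X (c *[X] x) = c *[bt X] io X x"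
  unfolding io_def using tpair.smult_pt_right[OF bc_tp, of X c "Scalar 1" x] by auto

lemma bp_io: "[|wach_module B X; x \<in> carrier X|] ==> bp X (Scalar a) x = a *[bt X] io X x"
  unfolding io_def using tpair.smult_pt[OF bc_tp, of X a "Scalar 1" x] by auto

lemma io_gact: assumes "wach_module B X" "g :> G" "x :> X"
  shows "gact (FF X) g (io X x) = io X (gact X (pr g) x)"
proof -
  obtain Phi k where w: "S.wm X Phi k" using assms S.wach_wm by blast
  show ?thesis using bc_eval(1)[OF w assms(3,2), of 1] assms by (simp add: io_def)
qed

lemma io_Phi:
  fixes X :: "('a, 'b, 'g) fob"
  assumes "S.wm X Phi k" "x :> X" shows "FPhi X Phi k (io X x) = vi ^ k *[bt X] io X (Phi x)"
proof -
  have "FPhi X Phi k (io X x) = bp X (Scalar (vi ^ k * phi 1)) (Phi x)" unfolding io_def by (rule bc_eval(6)[OF assms])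
  also have "... = (vi ^ k * phi 1) *[bt X] io X (Phi x)"
    by (rule bp_io[OF S.wmD(1)[OF assms(1)] addhom_closed[OF S.wmD(8)[OF assms(1)] assms(2)]])
  finally show ?thesis by simp
qed

lemma lgen_F: assumes X: "wach_module B X" and Z: "addgen X Z" shows "A.lgen (FF X) (io X ` Z)"
proof -
  interpret T: tpair R' R AA X by (rule bc_tp[OF X])
  interpret Tm: rmod R' "bt X" by (rule T.rmod_T)
  have c: "io X ` Z \<subseteq> carrier (bt X)" using addgenD[OF Z] X by auto
  have "addgen (bt X) {c *[bt X] z |c z. z \<in> io X ` Z}" unfolding addgen_def
  proof (intro conjI allI impI ballI)
    show "{c *[bt X] z |c z. z \<in> io X ` Z} \<subseteq> carrier (bt X)" using c by auto
    fix Q t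
    assume Q: "Q 0[bt X]" "\<forall>z\<in>{c *[bt X] z |c z. z \<in> io X ` Z}. Q z"
      "\<forall>x\<in>carrier (bt X). \<forall>y\<in>carrier (bt X). Q x \<longrightarrow> Q y \<longrightarrow> Q (x +[bt X] y)" and t: "t :> bt X"
    show "Q t" using t
    proof (induction t rule: T.T_induct)
      case (pure a x)
      obtain b where b: "a = Scalar b" using pure(1) by auto
      show ?case using Z pure(2)
      proof (induction x rule: addgen_induct)
        case zero
        then show ?case using Q pure by (simp add: T.pt_zero_right)
      next
        case (gen z)
        then show ?case using Q(2) addgenD[OF Z gen] X b by (auto simp: bp_io)
      next
        case (add x y)
        then show ?case using Q(3) pure(1) by (simp add: T.pt_add_right)
      qed
    qed (use Q in auto)
  qed
  with c show ?thesis by (simp add: A.lgen_def)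
qed

lemma lgen_F': "wach_module B X ==> A.lgen (FF X) (io X ` carrier X)" by (rule lgen_F[OF _ addgen_carrier])

definition "fF X Y f = restrict (tmap R AA Y id f) (carrier (FF X))"

text \<open>Stated for linear maps rather than Wach homomorphisms, because exactness of base change
  applies it to splittings, which need not respect the action or Frobenius.\<close>

lemma bc_map:
  assumes X: "wach_module B X" "wach_module B Y" and f: "addhom X Y f" "\<forall>c\<in>R. \<forall>x\<in>carrier X. f (c *[X] x) = c *[Y] f x"
  shows "addhom (bt X) (bt Y) (tmap R AA Y id f)"
    and "x :> X ==> tmap R AA Y id f (bp X (Scalar a) x) = bp Y (Scalar a) (f x)"
    and "t :> bt X ==> tmap R AA Y id f (c *[bt X] t) = c *[bt Y] tmap R AA Y id f t"
proof -
  interpret T: tpair R' R AA X by (rule bc_tp[OF X(1)])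
  interpret T': tpair R' R AA Y by (rule bc_tp[OF X(2)])
  interpret Tm: rmod R' "bt X" by (rule T.rmod_T)
  interpret Tm': rmod R' "bt Y" by (rule T'.rmod_T)
  have i: "addhom AA AA id" by (rule addhomI) auto
  show ah: "addhom (bt X) (bt Y) (tmap R AA Y id f)"
    and p: "x :> X ==> tmap R AA Y id f (bp X (Scalar a) x) = bp Y (Scalar a) (f x)" for x a
    using T.addhom_tmap[OF T'.tpair_axioms i f(1), of "%c. c"] T.tmap_pt[OF T'.tpair_axioms i f(1), of "%c. c" "Scalar a" x] f(2) by auto
  define h where "h = tmap R AA Y id f"
  note ah = ah[folded h_def] and p = p[folded h_def]
  have "h (c *[bt X] t) = c *[bt Y] h t" if "t :> bt X" for t using that
  proof (induction t rule: T.T_induct)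
    case zero
    then show ?case using addhom_zero[OF Tm.is_abgroup Tm'.is_abgroup ah] by simp
  next
    case (pure a x)
    obtain b where b: "a = Scalar b" using pure(1) by auto
    have fx: "f x :> Y" using addhom_closed[OF f(1)] pure by blast
    show ?case using p pure(2) fx b T.smult_pt[of c "Scalar b" x] T'.smult_pt[of c "Scalar b" "f x"] by simp
  next
    case (add s t)
    then show ?case using addhom_closed[OF ah] by (simp add: Tm.smult_r_distr Tm'.smult_r_distr addhom_add[OF ah])
  qed
  then show "t :> bt X ==> tmap R AA Y id f (c *[bt X] t) = c *[bt Y] tmap R AA Y id f t" unfolding h_def .
qed

lemma fF: assumes X: "wach_module B X" "wach_module B Y" and f: "f \<in> wach_hom B X Y"
  shows "fF X Y f \<in> wach_hom B' (FF X) (FF Y)" and "x :> X ==> fF X Y f (io X x) = io Y (f x)"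
proof -
  obtain Phi k Psi m where w: "S.wm X Phi k" "S.wm Y Psi m" using X S.wach_wm by metis
  note D = S.wmD[OF w(1)] and fD = S.wach_homD[OF f]
  have fl: "\<forall>c\<in>R. \<forall>x\<in>carrier X. f (c *[X] x) = c *[Y] f x" using fD(2) by blast
  define h where "h = tmap R AA Y id f"
  note M = bc_map[OF X fD(1) fl, folded h_def]
  have fF_h: "fF X Y f = restrict h (carrier (bt X))" by (simp only: fF_def h_def bc_mod)
  interpret T: tpair R' R AA X by (rule bc_tp[OF X(1)])
  interpret T': tpair R' R AA Y by (rule bc_tp[OF X(2)])
  interpret Tm: rmod R' "bt X" by (rule T.rmod_T)
  interpret Tm': rmod R' "bt Y" by (rule T'.rmod_T)
  have e: "fF X Y f (io X x) = io Y (f x)" if "x :> X" for x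
    using M(2)[OF that, of 1] that X by (simp add: fF_h io_def[symmetric])
  then show "x :> X ==> fF X Y f (io X x) = io Y (f x)" .
  have lin: "fF X Y f (c *[bt X] t) = c *[bt Y] fF X Y f t" if "t :> bt X" for c t
    using M(3)[OF that] that by (simp add: fF_h)
  note cl = addhom_closed[OF D(8)] addhom_closed[OF S.actionD(1)[OF D(7)]] addhom_closed[OF S.wmD(8)[OF w(2)]]
  show "fF X Y f \<in> wach_hom B' (FF X) (FF Y)"
  proof (rule A.wach_homL[OF wm_F[OF w(1)] wm_F[OF w(2)] lgen_F'[OF X(1)]])
    show "addhom (FF X) (FF Y) (fF X Y f)" using M(1) by (simp add: fF_h addhom_restrict[OF T.abelian_group_T])
    show "fF X Y f \<in> extensional (carrier (FF X))" by (simp add: fF_h)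
    show "fF X Y f (c *[FF X] t) = c *[FF Y] fF X Y f t" if "t :> FF X" for c t using lin that by simp
  next
    fix g z assume g: "g :> G" and "z \<in> io X ` carrier X"
    then obtain x where z: "z = io X x" "x :> X" by blast
    then show "fF X Y f (gact (FF X) g z) = gact (FF Y) g (fF X Y f z)" using X g cl fD by (simp add: io_gact e)
  next
    fix z assume "z \<in> io X ` carrier X"
    then obtain x where z: "z = io X x" "x :> X" by blast
    \<comment> \<open>Powers of \<open>w'\<close> are turned into powers of \<open>w\<close> times
      units. Powers of \<open>w\<close> lie in \<open>R\<close> and pass through
      \<open>io Y\<close>, so the identity for \<open>f\<close> can be applied inside
      \<open>Y\<close>.\<close>
    have "w' ^ (d * m) *[bt Y] fF X Y f (FPhi X Phi k z) = (w' ^ (d * m) * vi ^ k) *[bt Y] io Y (f (Phi x))"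
      using z X cl fD by (simp add: io_Phi[OF w(1)] lin e Tm'.smult_smult)
    also have "w' ^ (d * m) * vi ^ k = (vi ^ m * vi ^ k) * w ^ m" by (simp add: power_mult w'_pow power_mult_distrib mult_ac)
    also have "((vi ^ m * vi ^ k) * w ^ m) *[bt Y] io Y (f (Phi x)) = (vi ^ m * vi ^ k) *[bt Y] io Y (w ^ m *[Y] f (Phi x))"
      using z X cl fD by (subst io_smult) (auto simp: Tm'.smult_smult S.power_R)
    also have "w ^ m *[Y] f (Phi x) = w ^ k *[Y] Psi (f x)" by (rule S.hom_Phi[OF w f z(2)])
    also have "(vi ^ m * vi ^ k) *[bt Y] io Y (w ^ k *[Y] Psi (f x)) = ((vi ^ m * vi ^ k) * w ^ k) *[bt Y] io Y (Psi (f x))"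
      using z X cl fD by (subst io_smult) (auto simp: Tm'.smult_smult S.power_R)
    also have "(vi ^ m * vi ^ k) * w ^ k = w' ^ (d * k) * vi ^ m" by (simp add: power_mult w'_pow power_mult_distrib mult_ac)
    also have "(w' ^ (d * k) * vi ^ m) *[bt Y] io Y (Psi (f x)) = w' ^ (d * k) *[bt Y] FPhi Y Psi m (fF X Y f z)"
      using z X cl fD by (simp add: io_Phi[OF w(2)] e Tm'.smult_smult)
    finally show "w' ^ (d * m) *[FF Y] fF X Y f (FPhi X Phi k z) = w' ^ (d * k) *[FF Y] FPhi Y Psi m (fF X Y f z)" by simp
  qed
qed

definition "fG N f = restrict f (carrier (GG N))"

lemma fG: assumes N: "wach_module B' N" "wach_module B' N'" and f: "f \<in> wach_hom B' N N'"
  shows "fG N f \<in> wach_hom B (GG N) (GG N')" and "x :> inv_mod N ==> fG N f x = f x"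
    and "x :> inv_mod N ==> f x :> inv_mod N'"
proof -
  obtain Phi k Psi m where w: "A.wm N Phi (d * k)" "A.wm N' Psi (d * m)" using N wm_multiple by metis
  note D = A.wmD[OF w(1)] and D' = A.wmD[OF w(2)] and fD = A.wach_homD[OF f]
  interpret N': rmod R' N' by (rule D')
  note [simp] = inv_in[where N = N]
  show fi: "f x :> inv_mod N'" if "x :> inv_mod N" for x
    using that fD(3,5) inv_fix[OF that] by (intro inv_I) (auto simp: fD(3)[symmetric])
  show "x :> inv_mod N ==> fG N f x = f x" for x by (simp add: fG_def)
  interpret M: rmod R "inv_mod N" by (rule rmod_inv[OF D(3,7)])
  have PhiM: "v ^ k *[N] Phi x :> inv_mod N" "gact N g x :> inv_mod N" if "x :> inv_mod N" "g :> G0" for x g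
    using addhom_closed[OF S.wmD(8)[OF wm_G[OF w(1)]], of x] addhom_closed[OF S.actionD(1)[OF S.wmD(7)[OF wm_G[OF w(1)]]], of g x] that
    by (auto simp: inv_simps(2))
  note [simp] = addhom_closed[OF D(8)] addhom_closed[OF D'(8)]
  show "fG N f \<in> wach_hom B (GG N) (GG N')"
  proof (rule S.wach_homI[OF wm_G[OF w(1)] wm_G[OF w(2)] addgen_carrier])
    have "addhom (inv_mod N) (inv_mod N') f" by (rule addhomI[OF fi]) (auto simp: inv_ops addhom_add[OF fD(1)])
    then show "addhom (GG N) (GG N') (fG N f)" by (simp add: fG_def addhom_restrict[OF M.is_abgroup])
    show "fG N f \<in> extensional (carrier (GG N))" by (simp add: fG_def)
    fix x assume "x :> GG N"
    then have x: "x :> inv_mod N" by simp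
    show "fG N f (c *[GG N] x) = c *[GG N'] fG N f x" if "c \<in> R" for c
      using M.smult_closed[OF that x] x by (simp add: fG_def inv_ops fD(2))
    show "fG N f (gact (GG N) g x) = gact (GG N') g (fG N f x)" if "g :> G0" for g
      using PhiM[OF x that] x that by (simp add: fG_def inv_simps(2) fD(3))
    have "w' ^ (d * m) *[N'] f (Phi x) = w' ^ (d * k) *[N'] Psi (f x)" using x by (intro A.hom_Phi[OF w f]) auto
    then have "(v ^ m * v ^ k) *[N'] (w' ^ (d * m) *[N'] f (Phi x)) = (v ^ m * v ^ k) *[N'] (w' ^ (d * k) *[N'] Psi (f x))" by simp
    moreover have "(v ^ m * v ^ k) * w' ^ (d * m) = w ^ m * v ^ k" "(v ^ m * v ^ k) * w' ^ (d * k) = w ^ k * v ^ m"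
      by (simp_all add: w_eq power_mult power_mult_distrib mult_ac)
    ultimately have "(w ^ m * v ^ k) *[N'] f (Phi x) = (w ^ k * v ^ m) *[N'] Psi (f x)"
      using x fD(5) by (simp add: N'.smult_smult)
    then show "w ^ m *[GG N'] fG N f (v ^ k *[N] Phi x) = w ^ k *[GG N'] (v ^ m *[N'] Psi (fG N f x))"
      using PhiM(1)[OF x S.G.one_closed] x fD(5) by (simp add: fG_def inv_ops fD(2) N'.smult_smult)
  qed
qed

end

section \<open>Tensor structure of the functors, unit and counit\<close>

context wpair
begin

lemma bc_basis: assumes "wach_module B X" "dbasis R X I e k"
  shows "\<exists>kap. dbasis R' (FF X) ({()} \<times> I) (%(i, j). io X (e j)) kap"
  using bc_dbasis[OF S.wach_rmod[OF assms(1)] assms(2)] by (simp add: io_def)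

text \<open>A map out of F(X \<otimes> Y) involves one scalar and one tensor and is easy to define.
  The tensor structure needs the opposite direction, where the scalars of two factors would have to
  be merged, so \<open>Jf\<close> is obtained as the inverse of the bijection
  \<open>Kf\<close>.\<close>

definition "kin X Y = tlift (TA (FF X) (FF Y)) (%x y. ptens R' (FF X) (FF Y) (io X x) (io Y y))"
definition "Kf X Y = restrict (tlift (TA (FF X) (FF Y)) (%a t. the_scalar a *[TA (FF X) (FF Y)] kin X Y t)) (carrier (FF (TS X Y)))"

lemma Kf:
  fixes X Y :: "('a, 'b, 'g) fob"
  assumes X: "wach_module B X" "wach_module B Y"
  shows "Kf X Y \<in> wach_hom B' (FF (TS X Y)) (TA (FF X) (FF Y))"
    and "[|x :> X; y \<in> carrier Y|] ==>
      Kf X Y (io (TS X Y) (ptens R X Y x y)) = ptens R' (FF X) (FF Y) (io X x) (io Y y)"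
    and "bij_betw (Kf X Y) (carrier (FF (TS X Y))) (carrier (TA (FF X) (FF Y)))"
proof -
  obtain Phi k Psi m where w: "S.wm X Phi k" "S.wm Y Psi m" using X S.wach_wm by metis
  note wF = wm_F[OF w(1)] wm_F[OF w(2)]
  let ?P = "TA (FF X) (FF Y)" and ?p = "ptens R' (FF X) (FF Y)" and ?T = "TS X Y"
  note wT = S.wach_TT[OF X]
  note wP = A.wm_tens[OF wF]
  note DX = S.wmD[OF w(1)] and DY = S.wmD[OF w(2)]
  interpret XY: tpair R R X Y by (rule S.wach_tpair[OF X])
  interpret P2: tpair R' R' "FF X" "FF Y" by (rule A.wach_tpair[OF wach_F[OF X(1)] wach_F[OF X(2)]])
  interpret P: rmod R' ?P by (rule A.wmD(3)[OF wP])
  interpret Z: tpair R' R AA ?T by (rule bc_tp[OF wT])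
  interpret Zm: rmod R' "bt ?T" by (rule Z.rmod_T)
  have pin: "?p (io X x) (io Y y) :> ?P" if "x :> X" "y :> Y" for x y using that X by (simp add: A.pt_mem)
  have bal: "balanced R X Y ?P (%x y. ?p (io X x) (io Y y))" by (rule balancedI)
      (use X pin in \<open>auto simp: io_add io_smult P2.pt_add_left[unfolded bc_mod] P2.pt_add_right[unfolded bc_mod] P2.pt_balance[unfolded bc_mod]\<close>)
  note kp = XY.tlift_pt[OF P.is_abgroup bal, folded kin_def] and ka = XY.addhom_tlift[OF P.is_abgroup bal, folded kin_def]
  have kc: "kin X Y t :> ?P" if "t :> tens R X Y" for t using addhom_closed[OF ka that] .
  have ks: "kin X Y (r *[tens R X Y] t) = r *[?P] kin X Y t" if "r \<in> R" "t :> tens R X Y" for r t unfolding kin_def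
  proof (rule XY.tlift_smult[OF P.is_abgroup bal _ _ that])
    show "addhom ?P ?P ((\<odot>\<^bsub>?P\<^esub>) r)" using P.smult_r_distr P.smult_closed by (intro addhomI) auto
    show "?p (io X (r *[X] x)) (io Y y) = r *[?P] ?p (io X x) (io Y y)" if "x :> X" "y :> Y" for x y
      using that X \<open>r \<in> R\<close> P2.smult_pt[of r "io X x" "io Y y"] by (simp add: io_smult)
  qed
  let ?beta = "%a t. the_scalar a *[?P] kin X Y t"
  have bal2: "balanced R (AA :: ('a fps, ('a fps, 'b) univ) module) ?T ?P ?beta"
  proof (rule balancedI)
    fix a :: "('a fps, 'b) univ" and t assume "t :> ?T"
    then have t: "kin X Y t :> ?P" "t :> tens R X Y" using kc by auto
    show "?beta a t :> ?P" using t P.smult_closed[of "the_scalar a" "kin X Y t"] by simp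
    show "?beta (a +[AA] a') t = ?beta a t +[?P] ?beta a' t" for a'
      using P.smult_l_distr[of "the_scalar a" "the_scalar a'" "kin X Y t"] t by simp
    show "?beta (r *[AA] a) t = ?beta a (r *[?T] t)" if "r \<in> R" for r
      using P.smult_smult[of "the_scalar a" r "kin X Y t"] t ks[OF that t(2)] by (simp add: mult.commute)
    show "?beta a (t +[?T] t') = ?beta a t +[?P] ?beta a t'" if "t' :> ?T" for t'
      using P.smult_r_distr[of "the_scalar a" "kin X Y t" "kin X Y t'"] t that kc[of t'] addhom_add[OF ka, of t t'] by simp
  qed
  define h where "h = tlift ?P ?beta"
  have hp: "h (bp ?T (Scalar a) t) = a *[?P] kin X Y t" if "t :> ?T" for a t
    using Z.tlift_pt[OF P.is_abgroup bal2, of "Scalar a" t] that by (simp add: h_def)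
  have ha: "addhom (bt ?T) ?P h" using Z.addhom_tlift[OF P.is_abgroup bal2] by (simp add: h_def)
  have hs: "h (c *[bt ?T] t) = c *[?P] h t" if "t :> bt ?T" for c t unfolding h_def
  proof (rule Z.tlift_smult[OF P.is_abgroup bal2 _ _ _ that])
    show "addhom ?P ?P ((\<odot>\<^bsub>?P\<^esub>) c)" using P.smult_r_distr P.smult_closed by (intro addhomI) auto
    show "?beta (c *[AA] a) t = c *[?P] ?beta a t" if "t :> ?T" for a and t
      using P.smult_smult[of c "the_scalar a" "kin X Y t"] kc[of t] that by simp
  qed simp
  have Kh: "Kf X Y = restrict h (carrier (FF ?T))" by (simp only: Kf_def h_def)
  have ev: "Kf X Y (io ?T (ptens R X Y x y)) = ?p (io X x) (io Y y)" if "x :> X" "y :> Y" for x y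
  proof -
    have "io ?T (ptens R X Y x y) :> bt ?T" using that X by (intro io_mem) auto
    moreover have "h (io ?T (ptens R X Y x y)) = 1 *[?P] kin X Y (ptens R X Y x y)"
      unfolding io_def using that X by (intro hp) auto
    ultimately show ?thesis using that pin[OF that] P.smult_one[OF pin[OF that]] by (simp add: Kh kp)
  qed
  then show "[|x :> X; y \<in> carrier Y|] ==> Kf X Y (io ?T (ptens R X Y x y)) = ?p (io X x) (io Y y)" .
  note cl = addhom_closed[OF DX(8)] addhom_closed[OF DY(8)] addhom_closed[OF S.actionD(1)[OF DX(7)]]
    addhom_closed[OF S.actionD(1)[OF DY(7)]]
  show hom: "Kf X Y \<in> wach_hom B' (FF ?T) ?P"
  proof (rule A.wach_homL[OF wm_F[OF S.wm_tens[OF w]] wP lgen_F[OF wT S.gen2[OF X]]])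
    show "addhom (FF ?T) ?P (Kf X Y)" using ha by (simp add: Kh addhom_restrict[OF Z.abelian_group_T])
    show "Kf X Y \<in> extensional (carrier (FF ?T))" by (simp add: Kh)
    show "Kf X Y (c *[FF ?T] t) = c *[?P] Kf X Y t" if "t :> FF ?T" for c t using that hs[of t c] by (simp add: Kh)
  next
    fix g z assume g: "g :> G" and "z \<in> io ?T ` {ptens R X Y x y |x y. x :> X \<and> y :> Y}"
    then obtain x y where z: "x :> X" "y :> Y" "z = io ?T (ptens R X Y x y)" by blast
    show "Kf X Y (gact (FF ?T) g z) = gact ?P g (Kf X Y z)"
      using z g X wT cl by (simp add: io_gact ev S.TT_pure_eval(1)[OF w] A.TT_pure_eval(1)[OF wF])
  next
    fix z assume "z \<in> io ?T ` {ptens R X Y x y |x y. x :> X \<and> y :> Y}"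
    then obtain x y where z: "x :> X" "y :> Y" "z = io ?T (ptens R X Y x y)" by blast
    have pi: "ptens R X Y x y :> TS X Y" "ptens R X Y (Phi x) (Psi y) :> TS X Y" using z X cl by auto
    have "Kf X Y (FPhi ?T (tmap R X Y Phi Psi) (k + m) z) = vi ^ (k + m) *[?P] ?p (io X (Phi x)) (io Y (Psi y))"
    proof -
      have "FPhi ?T (tmap R X Y Phi Psi) (k + m) z = vi ^ (k + m) *[bt ?T] io ?T (ptens R X Y (Phi x) (Psi y))"
        unfolding z(3) io_Phi[OF S.wm_tens[OF w] pi(1)] using z by (simp add: S.TT_pure_eval(2)[OF w])
      moreover have io: "io ?T (ptens R X Y (Phi x) (Psi y)) :> bt ?T" using pi wT by (intro io_mem) auto
      moreover have "vi ^ (k + m) *[bt ?T] io ?T (ptens R X Y (Phi x) (Psi y)) :> bt ?T"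
        using io by (rule Zm.smult_closed[rotated]) simp
      ultimately show ?thesis using hs[OF io] ev[OF cl(1)[OF z(1)] cl(2)[OF z(2)]] by (simp add: Kh)
    qed
    moreover have "tmap R' (FF X) (FF Y) (FPhi X Phi k) (FPhi Y Psi m) (Kf X Y z) = vi ^ (k + m) *[?P] ?p (io X (Phi x)) (io Y (Psi y))"
      using z X cl A.TT_pure_eval(3)[OF wF, of "io X (Phi x)" "io Y (Psi y)" "vi ^ k" "vi ^ m"]
      by (simp add: ev A.TT_pure_eval(2)[OF wF] io_Phi[OF w(1)] io_Phi[OF w(2)] power_add)
    ultimately show "w' ^ (d * k + d * m) *[?P] Kf X Y (FPhi ?T (tmap R X Y Phi Psi) (k + m) z) =
        w' ^ (d * (k + m)) *[?P] tmap R' (FF X) (FF Y) (FPhi X Phi k) (FPhi Y Psi m) (Kf X Y z)" by (simp add: distrib_left)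
  qed
  \<comment> \<open>Bases of \<open>X\<close> and \<open>Y\<close> give the basis of vectors 1
    \<otimes> (x \<otimes> y) on one side and (1 \<otimes> x) \<otimes> (1 \<otimes> y) on the
    other, and \<open>Kf\<close> matches them.\<close>
  obtain I k1 J k2 where db: "dbasis R X I (%x. x) k1" "dbasis R Y J (%x. x) k2" using S.wach_dbasis X by metis
  obtain kap1 where d1: "dbasis R ?T (I \<times> J) (%(i, j). ptens R X Y i j) kap1" using S.TT_dbasis[OF X db] by auto
  obtain kap2 where d2: "dbasis R' (FF ?T) ({()} \<times> (I \<times> J)) (%(i, q). io ?T (case q of (i, j) => ptens R X Y i j)) kap2"
    using bc_basis[OF wT d1] by auto
  obtain kap3 where d3: "dbasis R' (FF X) ({()} \<times> I) (%(i, j). io X j) kap3" using bc_basis[OF X(1) db(1)] by auto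
  obtain kap4 where d4: "dbasis R' (FF Y) ({()} \<times> J) (%(i, j). io Y j) kap4" using bc_basis[OF X(2) db(2)] by auto
  obtain kap5 where d5: "dbasis R' ?P (({()} \<times> I) \<times> ({()} \<times> J)) (%(q, q'). ?p (case q of (i, j) => io X j) (case q' of (i, j) => io Y j)) kap5"
    using A.TT_dbasis[OF wach_F[OF X(1)] wach_F[OF X(2)] d3 d4] by auto
  have b: "bij_betw (%(a, (i, j)). (((), i), ((), j))) ({()} \<times> (I \<times> J)) (({()} \<times> I) \<times> ({()} \<times> J))"
    by (rule bij_betw_byWitness[where f' = "%((a, i), (b, j)). ((), (i, j))"]) auto
  show "bij_betw (Kf X Y) (carrier (FF ?T)) (carrier ?P)" by (rule A.bij_hom[OF wach_F[OF wT] A.wmD(1)[OF wP] hom d2 d5 b])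
      (use dbasisD(2)[OF db(1)] dbasisD(2)[OF db(2)] ev in auto)
qed

definition "Jf X Y = restrict (the_inv_into (carrier (FF (TS X Y))) (Kf X Y)) (carrier (TA (FF X) (FF Y)))"

lemma Jf:
  fixes X Y :: "('a, 'b, 'g) fob"
  assumes X: "wach_module B X" "wach_module B Y"
  shows "Jf X Y \<in> wach_hom B' (TA (FF X) (FF Y)) (FF (TS X Y))"
    and "[|x :> X; y \<in> carrier Y|] ==>
      Jf X Y (ptens R' (FF X) (FF Y) (io X x) (io Y y)) = io (TS X Y) (ptens R X Y x y)"
    and "bij_betw (Jf X Y) (carrier (TA (FF X) (FF Y))) (carrier (FF (TS X Y)))"
proof -
  note wT = wach_F[OF S.wach_TT[OF X]] and wP = A.wach_TT[OF wach_F[OF X(1)] wach_F[OF X(2)]]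
  show "Jf X Y \<in> wach_hom B' (TA (FF X) (FF Y)) (FF (TS X Y))"
    unfolding Jf_def by (rule A.hom_inverse(1)[OF wT wP Kf(1)[OF X] Kf(3)[OF X]])
  show "Jf X Y (ptens R' (FF X) (FF Y) (io X x) (io Y y)) = io (TS X Y) (ptens R X Y x y)"
    if "x :> X" "y :> Y"
  proof -
    have i: "io (TS X Y) (ptens R X Y x y) :> FF (TS X Y)"
      using that X io_mem[OF S.wach_TT[OF X], of "ptens R X Y x y"] by simp
    have "ptens R' (FF X) (FF Y) (io X x) (io Y y) :> TA (FF X) (FF Y)" using that X by (simp add: A.pt_mem)
    then show ?thesis
      unfolding Jf_def using the_inv_into_f_f[OF bij_betw_imp_inj_on[OF Kf(3)[OF X]] i] Kf(2)[OF X that] by simp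
  qed
  have "bij_betw (the_inv_into (carrier (FF (TS X Y))) (Kf X Y)) (carrier (TA (FF X) (FF Y))) (carrier (FF (TS X Y)))"
    by (rule bij_betw_the_inv_into[OF Kf(3)[OF X]])
  then show "bij_betw (Jf X Y) (carrier (TA (FF X) (FF Y))) (carrier (FF (TS X Y)))"
    unfolding Jf_def by (rule bij_betw_cong[THEN iffD1, rotated]) simp
qed

definition "uFf = restrict (%a. bp US a (Scalar 1)) (carrier UA)"

lemma uFf:
  defines "f \<equiv> uFf :: ('a fps, 'b) univ => ('a fps, 'b) univ"
  shows "f \<in> wach_hom B' UA (FF US)" and "f (Scalar a) = a *[bt US] io US (Scalar 1)"
    and "bij_betw f (carrier UA) (carrier (FF US))" unfolding f_def
proof -
  interpret T: tpair R' R AA "US :: ('a, 'b, 'g) fob" by (rule bc_tp) simp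
  interpret Tm: rmod R' "bt (US :: ('a, 'b, 'g) fob)" by (rule T.rmod_T)
  have o1: "(Scalar 1 :: ('a fps, 'b) univ) :> US" by simp
  have i1: "io US (Scalar 1 :: ('a fps, 'b) univ) :> bt US" using io_mem[OF S.wach_unit' o1] .
  show ev: "uFf (Scalar a :: ('a fps, 'b) univ) = a *[bt US] io US (Scalar 1)" for a
    using bp_io[OF S.wach_unit' o1, of a] by (simp add: uFf_def)
  show hom: "(uFf :: ('a fps, 'b) univ => ('a fps, 'b) univ) \<in> wach_hom B' UA (FF US)"
  proof (rule A.wach_homL[OF A.wm_unit wm_F[OF S.wm_unit] A.lgen_unit])
    show "addhom UA (FF US) (uFf :: ('a fps, 'b) univ => ('a fps, 'b) univ)"
      by (rule addhomI) (use i1 in \<open>auto simp: ev Tm.smult_l_distr\<close>)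
    show "(uFf :: ('a fps, 'b) univ => ('a fps, 'b) univ) \<in> extensional (carrier UA)" by (simp add: uFf_def)
    show "uFf (c *[UA] x) = c *[FF US] uFf x" if "x :> UA" for c and x :: "('a fps, 'b) univ"
      using that i1 by (auto simp: ev Tm.smult_smult)
  next
    fix g and z :: "('a fps, 'b) univ" assume g: "g :> G" and z: "z \<in> {Scalar 1}"
    have "gact (FF US) g (io US (Scalar 1 :: ('a fps, 'b) univ)) = io US (Scalar 1)"
      using g io_gact[OF S.wach_unit' g o1] S.act_1[of "pr g"] by (simp add: S.unit_simps(2))
    moreover have "gact UA g (Scalar 1 :: ('a fps, 'b) univ) = Scalar 1" using g by (simp add: A.unit_simps(2))
    ultimately show "uFf (gact UA g z) = gact (FF US) g (uFf z)" using z i1 by (simp add: ev)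
  next
    fix z :: "('a fps, 'b) univ" assume z: "z \<in> {Scalar 1}"
    show "w' ^ (d * 0) *[FF US] uFf (Scalar (phi (the_scalar z))) =
        w' ^ 0 *[FF US] FPhi US (%x. Scalar (b_frob B (the_scalar x))) 0 (uFf z)"
      using z i1 io_Phi[OF S.wm_unit o1] by (simp add: ev)
  qed
  obtain kap where d: "dbasis R' (FF US) ({()} \<times> {()}) (%(i, j). io US (Scalar 1 :: ('a fps, 'b) univ)) kap"
    using bc_basis[OF S.wach_unit' S.unit_dbasis] by auto
  have b: "bij_betw (%i. (i, i)) {()} ({()} \<times> {()})" by (rule bij_betw_byWitness[where f' = fst]) auto
  show "bij_betw (uFf :: ('a fps, 'b) univ => ('a fps, 'b) univ) (carrier UA) (carrier (FF US))"
    by (rule A.bij_hom[OF A.wach_unit' wach_F[OF S.wach_unit'] hom A.unit_dbasis d b]) (use ev[of 1] i1 in auto)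
qed

definition "eta X = restrict (io X) (carrier X)"

lemma io_inv: assumes X: "wach_module B X" "x :> X" shows "io X x :> inv_mod (FF X)"
proof (rule inv_I)
  show "io X x :> FF X" using X by simp
  fix h assume h: "h \<in> H"
  have "gact X \<one>\<^bsub>G\<^esub> x = x" using S.actionD(2)[OF S.wach_moduleD(6)[OF X(1)] X(2)] by simp
  then show "gact (FF X) h (io X x) = io X x" using X h by (simp add: io_gact)
qed

text \<open>A basis of \<open>X\<close> becomes a basis of the base change that consists of
  invariants, and \<open>inv_dbasis\<close> makes it a basis of the invariants over
  \<open>R\<close>. In Frobenius the \<open>vi ^ k\<close> of base change cancels the
  \<open>v ^ k\<close> of taking invariants.\<close>

lemma eta:
  fixes X :: "('a, 'b, 'g) fob"
  assumes X: "wach_module B X"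
  shows "eta X \<in> wach_hom B X (GG (FF X))" and "x :> X ==> eta X x = io X x"
    and "bij_betw (eta X) (carrier X) (carrier (GG (FF X)))"
proof -
  obtain Phi k where w: "S.wm X Phi k" using X S.wach_wm by metis
  note wF = wm_F[OF w]
  note D = S.wmD[OF w] and DF = A.wmD[OF wF]
  interpret X: rmod R X by (rule D)
  interpret F: rmod R' "FF X" by (rule DF)
  note [simp] = addhom_closed[OF D(8)] addhom_closed[OF S.actionD(1)[OF D(7)]]
  show ev: "x :> X ==> eta X x = io X x" for x by (simp add: eta_def)
  show hom: "eta X \<in> wach_hom B X (GG (FF X))"
  proof (rule S.wach_homI[OF w wm_G[OF wF] addgen_carrier])
    show "addhom X (GG (FF X)) (eta X)" by (rule addhomI) (use X in \<open>auto simp: ev io_inv io_add inv_ops\<close>)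
    show "eta X \<in> extensional (carrier X)" by (simp add: eta_def)
    fix x assume x: "x :> X"
    show "eta X (c *[X] x) = c *[GG (FF X)] eta X x" if "c \<in> R" for c using x X that by (simp add: ev io_smult inv_ops)
    show "eta X (gact X g x) = gact (GG (FF X)) g (eta X x)" if "g :> G0" for g
      using x X that by (simp add: ev inv_simps(2) io_gact)
    have ioc: "io X (Phi x) :> FF X" using x X by simp
    have "v ^ k *[FF X] FPhi X Phi k (io X x) = (v ^ k * vi ^ k) *[FF X] io X (Phi x)"
      unfolding io_Phi[OF w x] using F.smult_smult[OF _ _ ioc, of "v ^ k" "vi ^ k"] by simp
    also have "... = io X (Phi x)" using F.smult_one[OF ioc] v_power(1) by simp
    finally show "w ^ k *[GG (FF X)] eta X (Phi x) = w ^ k *[GG (FF X)] (v ^ k *[FF X] FPhi X Phi k (eta X x))"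
      using x by (simp add: ev)
  qed
  obtain I k1 where db: "dbasis R X I (%x. x) k1" using S.wach_dbasis X by metis
  obtain kap where d: "dbasis R' (FF X) ({()} \<times> I) (%(i, j). io X j) kap" using bc_basis[OF X db] by auto
  have "dbasis R (inv_mod (FF X)) ({()} \<times> I) (%(i, j). io X j) kap"
    by (rule inv_dbasis[OF DF(3,7) d]) (use dbasisD(2)[OF db] X in \<open>auto simp: io_inv\<close>)
  then have d': "dbasis R (GG (FF X)) ({()} \<times> I) (%(i, j). io X j) kap" by (rule dbasis_cong) simp_all
  have b: "bij_betw (Pair ()) I ({()} \<times> I)" by (rule bij_betw_byWitness[where f' = snd]) auto
  show "bij_betw (eta X) (carrier X) (carrier (GG (FF X)))"
    by (rule S.bij_hom[OF X wach_G[OF wach_F[OF X]] hom db d' b]) (use dbasisD(2)[OF db] ev in auto)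
qed

definition "eps N = restrict (tlift N (%a x. the_scalar a *[N] x)) (carrier (FF (GG N)))"

text \<open>An invariant basis of \<open>N\<close> is also a basis of the invariants, and
  \<open>eps\<close> sends the induced basis of the base change back to it. Equivariance holds
  because \<open>g\<close> and \<open>pr g\<close> agree on invariants; the factors
  \<open>v ^ k\<close> and \<open>vi ^ k\<close> cancel again.\<close>

lemma eps:
  fixes N :: "('a, 'b, 'g) fob"
  assumes N: "wach_module B' N"
  shows "eps N \<in> wach_hom B' (FF (GG N)) N" and "x :> inv_mod N ==> eps N (io (GG N) x) = x"
    and "bij_betw (eps N) (carrier (FF (GG N))) (carrier N)"
proof -
  obtain Phi k where w: "A.wm N Phi (d * k)" using N wm_multiple by metis
  note wG = wm_G[OF w]
  note D = A.wmD[OF w] and DG = S.wmD[OF wG] and wGN = wach_G[OF N]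
  interpret N: rmod R' N by (rule D)
  interpret T: tpair R' R AA "GG N" by (rule bc_tp[OF wGN])
  interpret Tm: rmod R' "bt (GG N)" by (rule T.rmod_T)
  note [simp] = inv_in[where N = N] addhom_closed[OF D(8)] addhom_closed[OF A.actionD(1)[OF D(7)]]
  have bal: "balanced R (AA :: ('a fps, ('a fps, 'b) univ) module) (GG N) N (%a x. the_scalar a *[N] x)"
    by (rule balancedI) (auto simp: inv_ops N.smult_l_distr N.smult_r_distr N.smult_smult mult.commute)
  define h where "h = tlift N (%(a :: ('a fps, 'b) univ) x. the_scalar a *[N] x)"
  have hp: "h (bp (GG N) (Scalar a) x) = a *[N] x" if "x :> inv_mod N" for a x
    using T.tlift_pt[OF N.is_abgroup bal, of "Scalar a" x] that by (simp add: h_def)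
  have ha: "addhom (bt (GG N)) N h" using T.addhom_tlift[OF N.is_abgroup bal] by (simp add: h_def)
  have hs: "h (c *[bt (GG N)] t) = c *[N] h t" if "t :> bt (GG N)" for c t unfolding h_def
  proof (rule T.tlift_smult[OF N.is_abgroup bal _ _ _ that])
    show "addhom N N ((\<odot>\<^bsub>N\<^esub>) c)" using N.smult_r_distr by (intro addhomI) auto
  qed (auto simp: N.smult_smult)
  have eh: "eps N = restrict h (carrier (FF (GG N)))" by (simp only: eps_def h_def)
  have ioc: "io (GG N) x :> bt (GG N)" if "x :> inv_mod N" for x using io_mem[OF wGN, of x] that by simp
  show ev: "eps N (io (GG N) x) = x" if "x :> inv_mod N" for x
    using hp[OF that, of 1] ioc[OF that] that by (simp add: eh io_def)
  show hom: "eps N \<in> wach_hom B' (FF (GG N)) N"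
  proof (rule A.wach_homL[OF wm_F[OF wG] w lgen_F'[OF wGN]])
    show "addhom (FF (GG N)) N (eps N)" using ha by (simp add: eh addhom_restrict[OF T.abelian_group_T])
    show "eps N \<in> extensional (carrier (FF (GG N)))" by (simp add: eh)
    show "eps N (c *[FF (GG N)] t) = c *[N] eps N t" if "t :> FF (GG N)" for c t using that hs[of t c] by (simp add: eh)
  next
    fix g z assume g: "g :> G" and "z \<in> io (GG N) ` carrier (GG N)"
    then obtain x where x: "x :> inv_mod N" "z = io (GG N) x" by auto
    obtain t where t: "t \<in> H" "g = pr g \<otimes>\<^bsub>G\<^esub> t" using pr_split[OF g] by blast
    have "gact N g x = gact N (pr g) (gact N t x)" using A.actionD(3)[OF D(7), of "pr g" t x] t g x by simp
    then have e: "gact N g x = gact N (pr g) x" using inv_fix[OF x(1) t(1)] by simp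
    have "gact N (pr g) x :> inv_mod N"
      using addhom_closed[OF S.actionD(1)[OF DG(7)], of "pr g" x] g x by (simp add: inv_simps(2))
    then show "eps N (gact (FF (GG N)) g z) = gact N g (eps N z)"
      using x g io_gact[OF wGN g, of x] by (simp add: ev inv_simps(2) e)
  next
    fix z assume "z \<in> io (GG N) ` carrier (GG N)"
    then obtain x where x: "x :> inv_mod N" "z = io (GG N) x" by auto
    have c: "v ^ k *[N] Phi x :> inv_mod N" using addhom_closed[OF DG(8), of x] x by simp
    have "FPhi (GG N) (%x. v ^ k *[N] Phi x) k z = vi ^ k *[bt (GG N)] io (GG N) (v ^ k *[N] Phi x)"
      using io_Phi[OF wG, of x] x by simp
    then have "eps N (FPhi (GG N) (%x. v ^ k *[N] Phi x) k z) = vi ^ k *[N] (v ^ k *[N] Phi x)"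
      using hs[OF ioc[OF c], of "vi ^ k"] ioc[OF c] ev[OF c] Tm.smult_closed[OF _ ioc[OF c], of "vi ^ k"] by (simp add: eh)
    also have "... = Phi x" using x v_power(2) by (simp add: N.smult_smult)
    finally show "w' ^ (d * k) *[N] eps N (FPhi (GG N) (%x. v ^ k *[N] Phi x) k z) = w' ^ (d * k) *[N] Phi (eps N z)"
      using x by (simp add: ev)
  qed
  obtain I and e :: "('a fps, 'b) univ => ('a fps, 'b) univ" and kap
    where db: "dbasis R' N I e kap" and e0: "\<forall>i\<in>I. e i :> inv_mod N" using inv_basis_exists[OF w] by blast
  have dG: "dbasis R (GG N) I e kap" by (rule dbasis_cong[OF inv_dbasis[OF D(3,7) db e0]]) simp_all
  obtain kap' where d: "dbasis R' (FF (GG N)) ({()} \<times> I) (%(i, j). io (GG N) (e j)) kap'" using bc_basis[OF wGN dG] by auto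
  have b: "bij_betw snd ({()} \<times> I) I" by (rule bij_betw_byWitness[where f' = "Pair ()"]) auto
  show "bij_betw (eps N) (carrier (FF (GG N))) (carrier N)"
    by (rule A.bij_hom[OF wach_F[OF wGN] N hom d db b]) (use e0 ev in auto)
qed

definition "JGf N N' = restrict (tlift (GG (TA N N')) (%x y. ptens R' N N' x y)) (carrier (TS (GG N) (GG N')))"

text \<open>Tensors of two invariant bases form an invariant basis of the tensor product, so each
  invariant tensor is an \<open>R\<close>-combination of tensors of invariants. This makes the
  structure map invertible, not merely defined.\<close>

lemma JGf:
  fixes N N' :: "('a, 'b, 'g) fob"
  assumes N: "wach_module B' N" "wach_module B' N'"
  shows "JGf N N' \<in> wach_hom B (TS (GG N) (GG N')) (GG (TA N N'))"
    and "[|x :> inv_mod N; y \<in> carrier (inv_mod N')|] ==>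
      JGf N N' (ptens R (GG N) (GG N') x y) = ptens R' N N' x y"
    and "bij_betw (JGf N N') (carrier (TS (GG N) (GG N'))) (carrier (GG (TA N N')))"
    and "[|x :> inv_mod N; y \<in> carrier (inv_mod N')|] ==> ptens R' N N' x y :> inv_mod (TA N N')"
proof -
  obtain Phi k Psi m where w: "A.wm N Phi (d * k)" "A.wm N' Psi (d * m)" using N wm_multiple by metis
  have wT: "A.wm (TA N N') (tmap R' N N' Phi Psi) (d * (k + m))" using A.wm_tens[OF w] by (simp add: distrib_left)
  note D = A.wmD[OF w(1)] and D' = A.wmD[OF w(2)] and DT = A.wmD[OF wT]
  note wG = wm_G[OF w(1)] wm_G[OF w(2)] wm_G[OF wT]
  interpret NN: tpair R' R' N N' by (rule A.wach_tpair[OF N])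
  interpret T: rmod R' "tens R' N N'" by (rule NN.rmod_T)
  note [simp] = inv_in[where N = N] inv_in[where N = N'] addhom_closed[OF D(8)] addhom_closed[OF D'(8)]
  show pin: "ptens R' N N' x y :> inv_mod (TA N N')" if "x :> inv_mod N" "y :> inv_mod N'" for x y
    using that N by (intro inv_I) (auto simp: A.TT_pure_eval(1)[OF w] inv_fix)
  let ?beta = "%x y. ptens R' N N' x y"
  have bal: "balanced R (GG N) (GG N') (GG (TA N N')) ?beta"
    by (rule balancedI) (auto simp: pin inv_ops NN.pt_add_left NN.pt_add_right NN.pt_balance)
  have lin: "?beta (c *[GG N] x) y = c *[GG (TA N N')] ?beta x y" if "x :> GG N" "y :> GG N'" for c x y
    using that by (simp add: inv_ops NN.smult_pt)
  have eq: "?beta (gact (GG N) g x) (gact (GG N') g y) = gact (GG (TA N N')) g (?beta x y)"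
    if "g :> G0" "x :> GG N" "y :> GG N'" for g x y using that by (simp add: inv_simps(2) A.TT_pure_eval(1)[OF w])
  have fr: "w ^ (k + m) *[GG (TA N N')] ?beta (v ^ k *[N] Phi x) (v ^ m *[N'] Psi y) =
      w ^ (k + m) *[GG (TA N N')] (v ^ (k + m) *[TA N N'] tmap R' N N' Phi Psi (?beta x y))"
    if "x :> GG N" "y :> GG N'" for x y
    using that A.TT_pure_eval(3)[OF w, of "Phi x" "Psi y" "v ^ k" "v ^ m"] by (simp add: A.TT_pure_eval(2)[OF w] power_add)
  note H = S.hom_tensI[OF wG bal]
  show hom: "JGf N N' \<in> wach_hom B (TS (GG N) (GG N')) (GG (TA N N'))"
    unfolding JGf_def by (rule H(1)) (rule lin eq fr; assumption)+
  show ev: "JGf N N' (ptens R (GG N) (GG N') x y) = ptens R' N N' x y" if "x :> inv_mod N" "y :> inv_mod N'" for x y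
    unfolding JGf_def by (rule H(2)) (rule lin eq fr; assumption | use that in simp)+
  obtain I and e :: "('a fps, 'b) univ => ('a fps, 'b) univ" and kap
    where db: "dbasis R' N I e kap" and e0: "\<forall>i\<in>I. e i :> inv_mod N" using inv_basis_exists[OF w(1)] by blast
  obtain I' and e' :: "('a fps, 'b) univ => ('a fps, 'b) univ" and kap'
    where db': "dbasis R' N' I' e' kap'" and e0': "\<forall>i\<in>I'. e' i :> inv_mod N'" using inv_basis_exists[OF w(2)] by blast
  have dG: "dbasis R (GG N) I e kap" by (rule dbasis_cong[OF inv_dbasis[OF D(3,7) db e0]]) simp_all
  have dG': "dbasis R (GG N') I' e' kap'" by (rule dbasis_cong[OF inv_dbasis[OF D'(3,7) db' e0']]) simp_all
  obtain kap1 where d1: "dbasis R (TS (GG N) (GG N')) (I \<times> I') (%(i, j). ptens R (GG N) (GG N') (e i) (e' j)) kap1"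
    using S.TT_dbasis[OF wach_G[OF N(1)] wach_G[OF N(2)] dG dG'] by blast
  obtain kap2 where d2: "dbasis R' (TA N N') (I \<times> I') (%(i, j). ptens R' N N' (e i) (e' j)) kap2"
    using A.TT_dbasis[OF N db db'] by blast
  have "dbasis R (inv_mod (TA N N')) (I \<times> I') (%(i, j). ptens R' N N' (e i) (e' j)) kap2"
    by (rule inv_dbasis[OF DT(3,7) d2]) (use e0 e0' pin in auto)
  then have d3: "dbasis R (GG (TA N N')) (I \<times> I') (%(i, j). ptens R' N N' (e i) (e' j)) kap2"
    by (rule dbasis_cong) simp_all
  show "bij_betw (JGf N N') (carrier (TS (GG N) (GG N'))) (carrier (GG (TA N N')))"
    by (rule S.bij_hom[OF S.wach_TT[OF wach_G[OF N(1)] wach_G[OF N(2)]] wach_G[OF A.wach_TT[OF N]] hom d1 d3 bij_betw_id])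
      (use e0 e0' ev in auto)
qed

definition "uGf = restrict id (carrier US)"

lemma inv_unit: "carrier (inv_mod UA) = Scalar ` R" by (auto simp: inv_carrier A.unit_simps(2) fixed)

lemma uGf: shows "uGf \<in> wach_hom B US (GG UA)" and "c \<in> R ==> uGf (Scalar c) = Scalar c"
    and "bij_betw uGf (carrier US) (carrier (GG UA))"
proof -
  show ev: "c \<in> R ==> uGf (Scalar c) = Scalar c" for c by (simp add: uGf_def)
  have w: "A.wm UA (%x. Scalar (phi (the_scalar x))) (d * 0)" using A.wm_unit by simp
  have phiR: "c \<in> R ==> phi c \<in> R" for c using S.frob_R[of c] by simp
  have actR: "[|g :> G0; c \<in> R|] ==> act g c \<in> R" for g c using S.act_R[of g c] by simp
  show "uGf \<in> wach_hom B US (GG UA)"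
  proof (rule S.wach_homI[OF S.wm_unit wm_G[OF w] addgen_carrier])
    show "addhom US (GG UA) uGf" by (rule addhomI) (auto simp: ev inv_unit inv_ops)
    show "uGf \<in> extensional (carrier US)" by (simp add: uGf_def)
  qed (auto simp: ev inv_unit inv_ops inv_simps(2) S.unit_simps(2) A.unit_simps(2) phiR actR)
  show "bij_betw uGf (carrier US) (carrier (GG UA))" by (rule bij_betw_byWitness[where f' = id]) (auto simp: ev inv_unit)
qed

end

section \<open>Coherence, the equivalence, and exactness\<close>

context wpair
begin

lemma lgen_F2: assumes "wach_module B X" "wach_module B Y"
  shows "A.lgen (TA (FF X) (FF Y)) {ptens R' (FF X) (FF Y) (io X x) (io Y y) | x y. x :> X \<and> y :> Y}"
  using A.lgen_TT[OF wach_F[OF assms(1)] wach_F[OF assms(2)] lgen_F'[OF assms(1)] lgen_F'[OF assms(2)]]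
  by (rule back_subst[of "A.lgen _"]) blast

lemma lgen_F3: assumes "wach_module B X" "wach_module B Y" "wach_module B Z"
  shows "A.lgen (TA (TA (FF X) (FF Y)) (FF Z))
    {ptens R' (TA (FF X) (FF Y)) (FF Z) (ptens R' (FF X) (FF Y) (io X x) (io Y y)) (io Z z) |
      x y z. x :> X \<and> y :> Y \<and> z :> Z}"
  using A.lgen_TT[OF A.wach_TT[OF wach_F[OF assms(1)] wach_F[OF assms(2)]] wach_F[OF assms(3)]
      lgen_F2[OF assms(1,2)] lgen_F'[OF assms(3)]] by (rule back_subst[of "A.lgen _"]) blast

lemma lgen_FU: assumes "wach_module B X"
  shows "A.lgen (TA UA (FF X)) {ptens R' UA (FF X) (Scalar 1) (io X x) | x. x :> X}"
    and "A.lgen (TA (FF X) UA) {ptens R' (FF X) UA (io X x) (Scalar 1) | x. x :> X}"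
  using A.lgen_TT[OF A.wach_unit' wach_F[OF assms] A.lgen_unit lgen_F'[OF assms]]
  apply (rule back_subst[of "A.lgen _"]) apply blast
  using A.lgen_TT[OF wach_F[OF assms] A.wach_unit' lgen_F'[OF assms] A.lgen_unit] by (rule back_subst[of "A.lgen _"]) blast

abbreviation (input) "idm X \<equiv> restrict id (carrier X)"

definition FT :: "('a, 'b, 'g) ftfunc"
  where "FT = \<lparr>fob = FF, far = (%(X, f, Y). (FF X, fF X Y f, FF Y)),
    tmlt = (%X Y. (TA (FF X) (FF Y), Jf X Y, FF (TS X Y))), tunt = (UA, uFf, FF US)\<rparr>"

definition GT :: "('a, 'b, 'g) ftfunc"
  where "GT = \<lparr>fob = GG, far = (%(X, f, Y). (GG X, fG X f, GG Y)),
    tmlt = (%X Y. (TS (GG X) (GG Y), JGf X Y, GG (TA X Y))), tunt = (US, uGf, GG UA)\<rparr>"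

lemma FT_simps:
  "fob FT X = FF X" "far FT (X, f, Y) = (FF X, fF X Y f, FF Y)"
  "tmlt FT X Y = (TA (FF X) (FF Y), Jf X Y, FF (TS X Y))" "tunt FT = (UA, uFf, FF US)" by (simp_all add: FT_def)

lemma GT_simps:
  "fob GT X = GG X" "far GT (X, f, Y) = (GG X, fG X f, GG Y)"
  "tmlt GT X Y = (TS (GG X) (GG Y), JGf X Y, GG (TA X Y))" "tunt GT = (US, uGf, GG UA)" by (simp_all add: GT_def)

lemma fF_id: "wach_module B X ==> fF X X (idm X) = idm (FF X)"
  by (rule A.hom_eqL[OF fF(1) A.hom_id _ _ lgen_F']) (auto simp: fF S.hom_id)

lemma fF_comp:
  assumes "wach_module B X" "wach_module B Y" "wach_module B Z" "f \<in> wach_hom B X Y" "g \<in> wach_hom B Y Z"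
  shows "fF X Z (compose (carrier X) g f) = compose (carrier (FF X)) (fF Y Z g) (fF X Y f)"
  by (rule A.hom_eqL[OF fF(1) A.hom_comp[OF _ _ _ fF(1) fF(1)] _ _ lgen_F'])
    (use assms in \<open>auto simp: fF S.hom_comp compose_eq S.wach_homD(5)\<close>)

lemmas hom_idF = A.hom_id[OF wach_F, unfolded bc_mod]

text \<open>Like the coherence identities that follow, this equates two Wach homomorphisms. Over
  A_F^+ such equations are tested on tensors of vectors 1 \<otimes> x, which generate linearly; over
  S, on additive generators.\<close>

lemma Jf_nat:
  fixes X Y :: "('a, 'b, 'g) fob"
  assumes "wach_module B X" "wach_module B Y" "wach_module B X'" "wach_module B Y'"
    and "f \<in> wach_hom B X X'" "g \<in> wach_hom B Y Y'"
  shows "compose (carrier (TA (FF X) (FF Y))) (fF (TS X Y) (TS X' Y') (S.ftar X Y X' Y' f g)) (Jf X Y) =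
    compose (carrier (TA (FF X) (FF Y))) (Jf X' Y') (A.ftar (FF X) (FF Y) (FF X') (FF Y') (fF X X' f) (fF Y Y' g))"
  by (rule A.hom_eqL[OF A.hom_comp[OF _ _ _ Jf(1) fF(1)] A.hom_comp[OF _ _ _ A.ftar(1) Jf(1)] _ _ lgen_F2])
    (use assms in \<open>auto simp: fF Jf(1,2) S.ftar A.ftar compose_eq S.wach_homD(5)\<close>)

lemma Jf_asc:
  fixes X Y Z :: "('a, 'b, 'g) fob"
  assumes "wach_module B X" "wach_module B Y" "wach_module B Z"
  defines "D \<equiv> TA (TA (FF X) (FF Y)) (FF Z)"
  shows "compose (carrier D) (fF (TS (TS X Y) Z) (TS X (TS Y Z)) (S.fasc X Y Z))
      (compose (carrier D) (Jf (TS X Y) Z) (A.ftar (TA (FF X) (FF Y)) (FF Z) (FF (TS X Y)) (FF Z) (Jf X Y) (idm (FF Z)))) =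
    compose (carrier D) (Jf X (TS Y Z)) (compose (carrier D)
      (A.ftar (FF X) (TA (FF Y) (FF Z)) (FF X) (FF (TS Y Z)) (idm (FF X)) (Jf Y Z)) (A.fasc (FF X) (FF Y) (FF Z)))"
  unfolding D_def by (rule A.hom_eqL[OF A.hom_comp[OF _ _ _ A.hom_comp[OF _ _ _ A.ftar(1) Jf(1)] fF(1)]
        A.hom_comp[OF _ _ _ A.hom_comp[OF _ _ _ A.fasc(1) A.ftar(1)] Jf(1)] _ _ lgen_F3])
    (use assms in \<open>auto simp: fF Jf(1,2) S.fasc A.fasc A.ftar hom_idF compose_eq\<close>)

lemma Jf_brd:
  fixes X Y :: "('a, 'b, 'g) fob"
  assumes "wach_module B X" "wach_module B Y"
  shows "compose (carrier (TA (FF X) (FF Y))) (fF (TS X Y) (TS Y X) (S.fbrd X Y)) (Jf X Y) =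
    compose (carrier (TA (FF X) (FF Y))) (Jf Y X) (A.fbrd (FF X) (FF Y))"
  by (rule A.hom_eqL[OF A.hom_comp[OF _ _ _ Jf(1) fF(1)] A.hom_comp[OF _ _ _ A.fbrd(1) Jf(1)] _ _ lgen_F2])
    (use assms in \<open>auto simp: fF Jf(1,2) S.fbrd A.fbrd compose_eq\<close>)

lemma uFf_1: "uFf (Scalar 1) = io US (Scalar 1)"
proof -
  interpret T: rmod R' "bt US" by (rule tpair.rmod_T[OF bc_tp]) simp
  show ?thesis using uFf(2)[of 1] io_mem[OF S.wach_unit'] by simp
qed

lemma Jf_lun:
  fixes X :: "('a, 'b, 'g) fob"
  assumes X: "wach_module B X" shows "compose (carrier (TA UA (FF X))) (fF (TS US X) X (S.flun X))
      (compose (carrier (TA UA (FF X))) (Jf US X) (A.ftar UA (FF X) (FF US) (FF X) uFf (idm (FF X)))) = A.flun (FF X)"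
  (is "?l = _")
proof (rule A.hom_eqL[OF A.hom_comp[OF _ _ _ A.hom_comp[OF _ _ _ A.ftar(1) Jf(1)] fF(1)] A.flun(1) _ _ lgen_FU(1)])
  fix z assume "z \<in> {ptens R' UA (FF X) (Scalar 1) (io X x) | x. x :> X}"
  then obtain x where z: "z = ptens R' UA (FF X) (Scalar 1) (io X x)" "x :> X" by auto
  interpret X: rmod R X by (rule S.wach_rmod[OF X])
  interpret F: rmod R' "bt X" by (rule tpair.rmod_T[OF bc_tp[OF X]])
  have "ptens R' UA (FF X) (Scalar 1) (io X x) :> TA UA (FF X)" using X z by (simp add: A.pt_mem)
  moreover have "ptens R US X (Scalar 1) x :> tens R US X" using X z by (simp add: S.pt_mem)
  ultimately show "?l z = A.flun (FF X) z"
    using X z by (simp add: compose_eq A.ftar(2) hom_idF uFf(1) uFf_1 Jf(2) fF(2) S.flun A.flun(2))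
qed (use X in \<open>auto simp: hom_idF uFf(1) S.flun(1)\<close>)

lemma Jf_run:
  fixes X :: "('a, 'b, 'g) fob"
  assumes X: "wach_module B X" shows "compose (carrier (TA (FF X) UA)) (fF (TS X US) X (S.frun X))
      (compose (carrier (TA (FF X) UA)) (Jf X US) (A.ftar (FF X) UA (FF X) (FF US) (idm (FF X)) uFf)) = A.frun (FF X)"
  (is "?l = _")
proof (rule A.hom_eqL[OF A.hom_comp[OF _ _ _ A.hom_comp[OF _ _ _ A.ftar(1) Jf(1)] fF(1)] A.frun(1) _ _ lgen_FU(2)])
  fix z assume "z \<in> {ptens R' (FF X) UA (io X x) (Scalar 1) | x. x :> X}"
  then obtain x where z: "z = ptens R' (FF X) UA (io X x) (Scalar 1)" "x :> X" by auto
  interpret X: rmod R X by (rule S.wach_rmod[OF X])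
  interpret F: rmod R' "bt X" by (rule tpair.rmod_T[OF bc_tp[OF X]])
  have "ptens R' (FF X) UA (io X x) (Scalar 1) :> TA (FF X) UA" using X z by (simp add: A.pt_mem)
  moreover have "ptens R X US x (Scalar 1) :> tens R X US" using X z by (simp add: S.pt_mem)
  ultimately show "?l z = A.frun (FF X) z"
    using X z by (simp add: compose_eq A.ftar(2) hom_idF uFf(1) uFf_1 Jf(2) fF(2) S.frun A.frun(2))
qed (use X in \<open>auto simp: hom_idF uFf(1) S.frun(1)\<close>)

lemma tensor_functor_FT: "tensor_functor (wach_cat B) (wach_cat B') FT" unfolding tensor_functor_def is_functor_def
proof (intro conjI ballI impI)
  let ?C = "wach_cat B" and ?D = "wach_cat B'"
  note cs = S.wach_cat_simps A.wach_cat_simps FT_simps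
  show "fob FT X \<in> Obj ?D" if "X \<in> Obj ?C" for X using that by (auto simp: cs)
  show "in_hom ?D (far FT f) (fob FT (Dom ?C f)) (fob FT (Cod ?C f))" if "f \<in> Arr ?C" for f
    using that by (auto elim!: S.ArrE simp: cs A.in_hom_wach fF(1))
  show "far FT (Idn ?C X) = Idn ?D (fob FT X)" if "X \<in> Obj ?C" for X using that fF_id by (auto simp: cs)
  show "far FT (g \<bullet>[?C] f) = far FT g \<bullet>[?D] far FT f" if a: "f \<in> Arr ?C" "g \<in> Arr ?C" "Dom ?C g = Cod ?C f" for f g
  proof -
    obtain X f' Y where F: "f = (X, f', Y)" "wach_module B X" "wach_module B Y" "f' \<in> wach_hom B X Y" using a(1) by (rule S.ArrE)
    obtain g' Z where F': "g = (Y, g', Z)" "wach_module B Z" "g' \<in> wach_hom B Y Z"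
      using S.ArrE[OF a(2)] a(3) F(1) S.wach_cat_simps(3,4) by metis
    show ?thesis using fF_comp[OF F(2,3) F'(2) F(4) F'(3)] F(1) F'(1) by (simp add: cs)
  qed
  show "iso_arr ?D (tmlt FT X Y) (tob ?D (fob FT X) (fob FT Y)) (fob FT (tob ?C X Y))"
    if "X \<in> Obj ?C" "Y \<in> Obj ?C" for X Y using that unfolding cs by (intro A.iso_of_bij Jf(1,3)) auto
  show "far FT (tar ?C f g) \<bullet>[?D] tmlt FT (Dom ?C f) (Dom ?C g) = tmlt FT (Cod ?C f) (Cod ?C g) \<bullet>[?D] tar ?D (far FT f) (far FT g)"
    if a: "f \<in> Arr ?C" "g \<in> Arr ?C" for f g
  proof -
    obtain X f' X' where F: "f = (X, f', X')" "wach_module B X" "wach_module B X'" "f' \<in> wach_hom B X X'" using a(1) by (rule S.ArrE)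
    obtain Y g' Y' where H: "g = (Y, g', Y')" "wach_module B Y" "wach_module B Y'" "g' \<in> wach_hom B Y Y'" using a(2) by (rule S.ArrE)
    show ?thesis using Jf_nat[OF F(2) H(2) F(3) H(3) F(4) H(4)] F(1) H(1) by (simp add: cs)
  qed
  show "iso_arr ?D (tunt FT) (tun ?D) (fob FT (tun ?C))" unfolding cs by (intro A.iso_of_bij uFf(1,3)) auto
  show "far FT (asc ?C X Y Z) \<bullet>[?D] tmlt FT (tob ?C X Y) Z \<bullet>[?D] tar ?D (tmlt FT X Y) (Idn ?D (fob FT Z)) =
      tmlt FT X (tob ?C Y Z) \<bullet>[?D] tar ?D (Idn ?D (fob FT X)) (tmlt FT Y Z) \<bullet>[?D] asc ?D (fob FT X) (fob FT Y) (fob FT Z)"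
    if "X \<in> Obj ?C" "Y \<in> Obj ?C" "Z \<in> Obj ?C" for X Y Z using Jf_asc[of X Y Z] that by (simp add: cs)
  show "far FT (brd ?C X Y) \<bullet>[?D] tmlt FT X Y = tmlt FT Y X \<bullet>[?D] brd ?D (fob FT X) (fob FT Y)"
    if "X \<in> Obj ?C" "Y \<in> Obj ?C" for X Y using Jf_brd[of X Y] that by (simp add: cs)
  show "far FT (lun ?C X) \<bullet>[?D] tmlt FT (tun ?C) X \<bullet>[?D] tar ?D (tunt FT) (Idn ?D (fob FT X)) = lun ?D (fob FT X)"
    if "X \<in> Obj ?C" for X using Jf_lun[of X] that by (simp add: cs)
  show "far FT (run ?C X) \<bullet>[?D] tmlt FT X (tun ?C) \<bullet>[?D] tar ?D (Idn ?D (fob FT X)) (tunt FT) = run ?D (fob FT X)"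
    if "X \<in> Obj ?C" for X using Jf_run[of X] that by (simp add: cs)
qed

lemma fG_eval: "x :> inv_mod N ==> fG N f x = f x" by (simp add: fG_def)

lemmas fG_closed = fG(3)[rotated 2]
lemmas hom_idG = S.hom_id[OF wach_G, unfolded inv_mod]

lemma fG_id: "wach_module B' X ==> fG X (idm X) = idm (GG X)"
  by (rule S.hom_eqI[OF fG(1) S.hom_id _ _ addgen_carrier]) (auto simp: fG(1) fG_eval fG_closed A.hom_id dest: inv_in)

lemma fG_comp:
  fixes X Y Z :: "('a, 'b, 'g) fob"
  assumes "wach_module B' X" "wach_module B' Y" "wach_module B' Z" "f \<in> wach_hom B' X Y" "g \<in> wach_hom B' Y Z"
  shows "fG X (compose (carrier X) g f) = compose (carrier (GG X)) (fG Y g) (fG X f)"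
  by (rule S.hom_eqI[OF fG(1) S.hom_comp[OF _ _ _ fG(1) fG(1)] _ _ addgen_carrier])
    (use assms in \<open>auto simp: fG(1) fG_eval fG_closed A.hom_comp compose_eq scal' inv_in[where N = X] inv_in[where N = Y] inv_in[where N = Z]\<close>)

lemma JGf_nat:
  fixes X Y :: "('a, 'b, 'g) fob"
  assumes "wach_module B' X" "wach_module B' Y" "wach_module B' X'" "wach_module B' Y'"
    and "f \<in> wach_hom B' X X'" "g \<in> wach_hom B' Y Y'"
  shows "compose (carrier (TS (GG X) (GG Y))) (fG (TA X Y) (A.ftar X Y X' Y' f g)) (JGf X Y) =
    compose (carrier (TS (GG X) (GG Y))) (JGf X' Y') (S.ftar (GG X) (GG Y) (GG X') (GG Y') (fG X f) (fG Y g))"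
  by (rule S.hom_eqI[OF S.hom_comp[OF _ _ _ JGf(1) fG(1)] S.hom_comp[OF _ _ _ S.ftar(1) JGf(1)] _ _ S.gen2])
    (use assms in \<open>auto simp: fG(1) fG_eval fG_closed JGf S.ftar A.ftar compose_eq UNIV_I[folded scal'] inv_in[where N = X] inv_in[where N = Y]\<close>)

lemma JGf_asc:
  fixes X Y Z :: "('a, 'b, 'g) fob"
  assumes "wach_module B' X" "wach_module B' Y" "wach_module B' Z"
  defines "D \<equiv> TS (TS (GG X) (GG Y)) (GG Z)"
  shows "compose (carrier D) (fG (TA (TA X Y) Z) (A.fasc X Y Z))
      (compose (carrier D) (JGf (TA X Y) Z) (S.ftar (TS (GG X) (GG Y)) (GG Z) (GG (TA X Y)) (GG Z) (JGf X Y) (idm (GG Z)))) =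
    compose (carrier D) (JGf X (TA Y Z)) (compose (carrier D)
      (S.ftar (GG X) (TS (GG Y) (GG Z)) (GG X) (GG (TA Y Z)) (idm (GG X)) (JGf Y Z)) (S.fasc (GG X) (GG Y) (GG Z)))"
  unfolding D_def by (rule S.hom_eqI[OF S.hom_comp[OF _ _ _ S.hom_comp[OF _ _ _ S.ftar(1) JGf(1)] fG(1)]
        S.hom_comp[OF _ _ _ S.hom_comp[OF _ _ _ S.fasc(1) S.ftar(1)] JGf(1)] _ _ S.gen3])
    (use assms in \<open>auto simp: fG(1) fG_eval fG_closed JGf S.fasc A.fasc S.ftar hom_idG compose_eq UNIV_I[folded scal'] inv_in[where N = X] inv_in[where N = Y] inv_in[where N = Z]\<close>)

lemma JGf_brd:
  fixes X Y :: "('a, 'b, 'g) fob"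
  assumes "wach_module B' X" "wach_module B' Y"
  shows "compose (carrier (TS (GG X) (GG Y))) (fG (TA X Y) (A.fbrd X Y)) (JGf X Y) =
    compose (carrier (TS (GG X) (GG Y))) (JGf Y X) (S.fbrd (GG X) (GG Y))"
  by (rule S.hom_eqI[OF S.hom_comp[OF _ _ _ JGf(1) fG(1)] S.hom_comp[OF _ _ _ S.fbrd(1) JGf(1)] _ _ S.gen2])
    (use assms in \<open>auto simp: fG(1) fG_eval fG_closed JGf S.fbrd A.fbrd compose_eq UNIV_I[folded scal'] inv_in[where N = X] inv_in[where N = Y]\<close>)

lemma JGf_lun:
  fixes X :: "('a, 'b, 'g) fob"
  assumes X: "wach_module B' X" shows "compose (carrier (TS US (GG X))) (fG (TA UA X) (A.flun X))
      (compose (carrier (TS US (GG X))) (JGf UA X) (S.ftar US (GG X) (GG UA) (GG X) uGf (idm (GG X)))) = S.flun (GG X)"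
  by (rule S.hom_eqI[OF S.hom_comp[OF _ _ _ S.hom_comp[OF _ _ _ S.ftar(1) JGf(1)] fG(1)] S.flun(1) _ _ S.gen2])
    (use X in \<open>auto simp: fG(1) fG_eval fG_closed JGf S.ftar hom_idG uGf S.flun A.flun compose_eq inv_unit inv_ops UNIV_I[folded scal'] inv_in[where N = X]\<close>)

lemma JGf_run:
  fixes X :: "('a, 'b, 'g) fob"
  assumes X: "wach_module B' X" shows "compose (carrier (TS (GG X) US)) (fG (TA X UA) (A.frun X))
      (compose (carrier (TS (GG X) US)) (JGf X UA) (S.ftar (GG X) US (GG X) (GG UA) (idm (GG X)) uGf)) = S.frun (GG X)"
  by (rule S.hom_eqI[OF S.hom_comp[OF _ _ _ S.hom_comp[OF _ _ _ S.ftar(1) JGf(1)] fG(1)] S.frun(1) _ _ S.gen2])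
    (use X in \<open>auto simp: fG(1) fG_eval fG_closed JGf S.ftar hom_idG uGf S.frun A.frun compose_eq inv_unit inv_ops UNIV_I[folded scal'] inv_in[where N = X]\<close>)

lemma tensor_functor_GT: "tensor_functor (wach_cat B') (wach_cat B) GT" unfolding tensor_functor_def is_functor_def
proof (intro conjI ballI impI)
  let ?C = "wach_cat B'" and ?D = "wach_cat B"
  note cs = S.wach_cat_simps A.wach_cat_simps GT_simps
  show "fob GT X \<in> Obj ?D" if "X \<in> Obj ?C" for X using that by (auto simp: cs)
  show "in_hom ?D (far GT f) (fob GT (Dom ?C f)) (fob GT (Cod ?C f))" if "f \<in> Arr ?C" for f
    using that by (auto elim!: A.ArrE simp: cs S.in_hom_wach fG(1))
  show "far GT (Idn ?C X) = Idn ?D (fob GT X)" if "X \<in> Obj ?C" for X using that fG_id by (auto simp: cs)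
  show "far GT (g \<bullet>[?C] f) = far GT g \<bullet>[?D] far GT f" if a: "f \<in> Arr ?C" "g \<in> Arr ?C" "Dom ?C g = Cod ?C f" for f g
  proof -
    obtain X f' Y where F: "f = (X, f', Y)" "wach_module B' X" "wach_module B' Y" "f' \<in> wach_hom B' X Y" using a(1) by (rule A.ArrE)
    obtain g' Z where F': "g = (Y, g', Z)" "wach_module B' Z" "g' \<in> wach_hom B' Y Z"
      using A.ArrE[OF a(2)] a(3) F(1) A.wach_cat_simps(3,4) by metis
    show ?thesis using fG_comp[OF F(2,3) F'(2) F(4) F'(3)] F(1) F'(1) by (simp add: cs)
  qed
  show "iso_arr ?D (tmlt GT X Y) (tob ?D (fob GT X) (fob GT Y)) (fob GT (tob ?C X Y))"
    if "X \<in> Obj ?C" "Y \<in> Obj ?C" for X Y using that unfolding cs by (intro S.iso_of_bij JGf(1,3)) auto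
  show "far GT (tar ?C f g) \<bullet>[?D] tmlt GT (Dom ?C f) (Dom ?C g) = tmlt GT (Cod ?C f) (Cod ?C g) \<bullet>[?D] tar ?D (far GT f) (far GT g)"
    if a: "f \<in> Arr ?C" "g \<in> Arr ?C" for f g
  proof -
    obtain X f' X' where F: "f = (X, f', X')" "wach_module B' X" "wach_module B' X'" "f' \<in> wach_hom B' X X'" using a(1) by (rule A.ArrE)
    obtain Y g' Y' where H: "g = (Y, g', Y')" "wach_module B' Y" "wach_module B' Y'" "g' \<in> wach_hom B' Y Y'" using a(2) by (rule A.ArrE)
    show ?thesis using JGf_nat[OF F(2) H(2) F(3) H(3) F(4) H(4)] F(1) H(1) by (simp add: cs)
  qed
  show "iso_arr ?D (tunt GT) (tun ?D) (fob GT (tun ?C))" unfolding cs by (intro S.iso_of_bij uGf(1,3)) auto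
  show "far GT (asc ?C X Y Z) \<bullet>[?D] tmlt GT (tob ?C X Y) Z \<bullet>[?D] tar ?D (tmlt GT X Y) (Idn ?D (fob GT Z)) =
      tmlt GT X (tob ?C Y Z) \<bullet>[?D] tar ?D (Idn ?D (fob GT X)) (tmlt GT Y Z) \<bullet>[?D] asc ?D (fob GT X) (fob GT Y) (fob GT Z)"
    if "X \<in> Obj ?C" "Y \<in> Obj ?C" "Z \<in> Obj ?C" for X Y Z using JGf_asc[of X Y Z] that by (simp add: cs)
  show "far GT (brd ?C X Y) \<bullet>[?D] tmlt GT X Y = tmlt GT Y X \<bullet>[?D] brd ?D (fob GT X) (fob GT Y)"
    if "X \<in> Obj ?C" "Y \<in> Obj ?C" for X Y using JGf_brd[of X Y] that by (simp add: cs)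
  show "far GT (lun ?C X) \<bullet>[?D] tmlt GT (tun ?C) X \<bullet>[?D] tar ?D (tunt GT) (Idn ?D (fob GT X)) = lun ?D (fob GT X)"
    if "X \<in> Obj ?C" for X using JGf_lun[of X] that by (simp add: cs)
  show "far GT (run ?C X) \<bullet>[?D] tmlt GT X (tun ?C) \<bullet>[?D] tar ?D (Idn ?D (fob GT X)) (tunt GT) = run ?D (fob GT X)"
    if "X \<in> Obj ?C" for X using JGf_run[of X] that by (simp add: cs)
qed

lemma eta_nat:
  fixes X Y :: "('a, 'b, 'g) fob"
  assumes "wach_module B X" "wach_module B Y" "f \<in> wach_hom B X Y"
  shows "compose (carrier X) (fG (FF X) (fF X Y f)) (eta X) = compose (carrier X) (eta Y) f"
  by (rule S.hom_eqI[OF S.hom_comp[OF _ _ _ eta(1) fG(1)[OF _ _ fF(1)]] S.hom_comp[OF _ _ _ assms(3) eta(1)] _ _ addgen_carrier])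
    (use assms in \<open>auto simp: eta(2) fG_eval io_inv fF(2) compose_eq S.wach_homD(5)\<close>)

lemma eta_tens:
  fixes X Y :: "('a, 'b, 'g) fob"
  assumes "wach_module B X" "wach_module B Y"
  shows "compose (carrier (TS X Y)) (eta (TS X Y)) (idm (TS X Y)) =
    compose (carrier (TS X Y)) (compose (carrier (TS (GG (FF X)) (GG (FF Y)))) (fG (TA (FF X) (FF Y)) (Jf X Y)) (JGf (FF X) (FF Y)))
      (S.ftar X Y (GG (FF X)) (GG (FF Y)) (eta X) (eta Y))" by (rule S.hom_eqI[OF S.hom_comp[OF _ _ _ S.hom_id eta(1)]
        S.hom_comp[OF _ _ _ S.ftar(1) S.hom_comp[OF _ _ _ JGf(1) fG(1)[OF _ _ Jf(1)]]] _ _ S.gen2])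
    (use assms in \<open>auto simp: eta(1,2) fG_eval io_inv JGf S.ftar(2) Jf(2) compose_eq\<close>)

lemma eta_unit:
  "compose (carrier (US :: ('a, 'b, 'g) fob)) (eta US) (idm US) =
    compose (carrier (US :: ('a, 'b, 'g) fob)) (fG UA uFf) uGf" by (rule S.hom_eqI[OF S.hom_comp[OF _ _ _ S.hom_id eta(1)]
        S.hom_comp[OF _ _ _ uGf(1) fG(1)[OF _ _ uFf(1)]] _ _ addgen_carrier])
    (auto simp: eta(2) fG_eval uGf uFf compose_eq inv_unit io_smult[OF S.wach_unit', symmetric])

lemma eps_nat:
  fixes N M :: "('a, 'b, 'g) fob"
  assumes "wach_module B' N" "wach_module B' M" "f \<in> wach_hom B' N M"
  shows "compose (carrier (FF (GG N))) f (eps N) = compose (carrier (FF (GG N))) (eps M) (fF (GG N) (GG M) (fG N f))"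
  by (rule A.hom_eqL[OF A.hom_comp[OF _ _ _ eps(1) assms(3)] A.hom_comp[OF _ _ _ fF(1)[OF _ _ fG(1)] eps(1)] _ _ lgen_F'])
    (use assms in \<open>auto simp: eps(2) fF(2) fG(1) fG_eval fG_closed compose_eq\<close>)

lemma eps_tens:
  fixes N M :: "('a, 'b, 'g) fob"
  assumes "wach_module B' N" "wach_module B' M"
  defines "D \<equiv> TA (FF (GG N)) (FF (GG M))"
  shows "compose (carrier D) (eps (TA N M)) (compose (carrier D) (fF (TS (GG N) (GG M)) (GG (TA N M)) (JGf N M)) (Jf (GG N) (GG M))) =
    compose (carrier D) (idm (TA N M)) (A.ftar (FF (GG N)) (FF (GG M)) N M (eps N) (eps M))" unfolding D_def
  by (rule A.hom_eqL[OF A.hom_comp[OF _ _ _ A.hom_comp[OF _ _ _ Jf(1) fF(1)[OF _ _ JGf(1)]] eps(1)]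
        A.hom_comp[OF _ _ _ A.ftar(1) A.hom_id] _ _ lgen_F2])
    (use assms in \<open>auto simp: eps(1,2) fF(2) JGf Jf(2) A.ftar(2) compose_eq inv_in[where N = N] inv_in[where N = M]\<close>)

lemma eps_unit:
  "compose (carrier (UA :: ('a, 'b, 'g) fob)) (eps UA) (compose (carrier (UA :: ('a, 'b, 'g) fob)) (fF US (GG UA) uGf) uFf) = idm UA"
  by (rule A.hom_eqL[OF A.hom_comp[OF _ _ _ A.hom_comp[OF _ _ _ uFf(1) fF(1)[OF _ _ uGf(1)]] eps(1)] A.hom_id _ _ A.lgen_unit])
    (auto simp: eps(2) fF(2) uGf uFf_1 compose_eq inv_unit)

lemma base_change_func: "base_change B B' pr = \<lparr>fob = FF, far = (%(X, f, Y). (FF X, fF X Y f, FF Y))\<rparr>"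
  by (simp add: base_change_def Let_def fF_def)

lemma invariants_func: "invariants B B' H = \<lparr>fob = GG, far = (%(X, f, Y). (GG X, fG X f, GG Y))\<rparr>"
  by (simp add: invariants_def Let_def fG_def)

theorem equivalence:
  "tensor_equivalence (wach_cat B :: ('a, 'b, 'g) fcat) (wach_cat B')
    (base_change B B' pr) (invariants B B' H)"
proof -
  let ?C = "wach_cat B :: ('a, 'b, 'g) fcat" and ?D = "wach_cat B' :: ('a, 'b, 'g) fcat"
  note cs = S.wach_cat_simps A.wach_cat_simps FT_simps GT_simps
  \<comment> \<open>The functors of the statement carry no tensor structure; extending them by the
    structure fields of \<open>FT\<close> and \<open>GT\<close> gives exactly these two.\<close>
  have ext: "func.extend (base_change B B' pr) (tfunc.fields (tmlt FT) (tunt FT)) = (FT :: ('a, 'b, 'g) ftfunc)"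
    "func.extend (invariants B B' H) (tfunc.fields (tmlt GT) (tunt GT)) = (GT :: ('a, 'b, 'g) ftfunc)"
    by (simp_all add: base_change_func invariants_func FT_def GT_def func.defs tfunc.defs)
  have 1: "tensor_nat_iso ?C ?C (id_tfunc ?C) (comp_tfunc ?C GT FT) (%X. (X, eta X, GG (FF X)))"
    unfolding tensor_nat_iso_def id_tfunc_def comp_tfunc_def
  proof (intro conjI ballI, goal_cases)
    case (1 X)
    then show ?case by (simp add: cs) (intro S.iso_of_bij eta; simp)
  next
    case (2 f)
    then show ?case by (rule S.ArrE) (simp add: cs eta_nat)
  next
    case (3 X Y)
    then show ?case using eta_tens[of X Y] by (simp add: cs)
  next
    case 4
    show ?case using eta_unit by (simp add: cs)
  qed
  have 2: "tensor_nat_iso ?D ?D (comp_tfunc ?D FT GT) (id_tfunc ?D) (%N. (FF (GG N), eps N, N))"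
    unfolding tensor_nat_iso_def id_tfunc_def comp_tfunc_def
  proof (intro conjI ballI, goal_cases)
    case (1 X)
    then show ?case by (simp add: cs) (intro A.iso_of_bij eps; simp)
  next
    case (2 f)
    then show ?case by (rule A.ArrE) (use eps_nat in \<open>simp add: cs\<close>)
  next
    case (3 X Y)
    then show ?case using eps_tens[of X Y] by (simp add: cs)
  next
    case 4
    show ?case using eps_unit by (simp add: cs)
  qed
  show ?thesis unfolding tensor_equivalence_def Let_def
    by (intro conjI exI[of _ "tmlt FT"] exI[of _ "tunt FT"] exI[of _ "tmlt GT"] exI[of _ "tunt GT"]
        exI[of _ "%X. (X, eta X, GG (FF X))"] exI[of _ "%N. (FF (GG N), eps N, N)"])
      (simp_all only: ext S.tensor_category_wach A.tensor_category_wach tensor_functor_FT tensor_functor_GT 1 2)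
qed

text \<open>Exactness on the left is formal. For surjectivity a preimage of an invariant vector is
  averaged; morphisms commute with averaging, so it remains a preimage.\<close>

lemma exact_G: "preserves_short_exact B' (invariants B B' H :: ('a, 'b, 'g) ffunc)" unfolding preserves_short_exact_def
proof (intro ballI impI)
  fix F F' :: "('a, 'b, 'g) far"
  assume a: "F \<in> Arr (wach_cat B')" "F' \<in> Arr (wach_cat B')" and ex: "short_exact F F'"
  obtain X f Y where F: "F = (X, f, Y)" "wach_module B' X" "wach_module B' Y" "f \<in> wach_hom B' X Y" using a(1) by (rule A.ArrE)
  obtain Y' g Z where Y': "F' = (Y', g, Z)" "wach_module B' Y'" "wach_module B' Z" "g \<in> wach_hom B' Y' Z" using a(2) by (rule A.ArrE)
  have "Y' = Y" using ex unfolding F(1) Y'(1) short_exact_def by simp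
  with Y' have F': "F' = (Y, g, Z)" "wach_module B' Z" "g \<in> wach_hom B' Y Z" by simp_all
  from ex have e: "inj_on f (carrier X)" "f ` carrier X = {y \<in> carrier Y. g y = 0[Z]}" "g ` carrier Y = carrier Z"
    unfolding F F' short_exact_def by auto
  note fD = A.wach_homD[OF F(4)] and gD = A.wach_homD[OF F'(3)]
  note aX = A.wach_rmod[OF F(2)] A.wach_moduleD(6)[OF F(2)] and aY = A.wach_rmod[OF F(3)] A.wach_moduleD(6)[OF F(3)]
    and aZ = A.wach_rmod[OF F'(2)] A.wach_moduleD(6)[OF F'(2)]
  interpret Y: rmod R' Y by (rule aY)
  interpret Z: rmod R' Z by (rule aZ)
  note avY = avg[OF aY] and avZ = avg[OF aZ]
  have av: "g (avg Y y) = avg Z (g y)" if y: "y :> Y" for y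
  proof -
    have cl: "gact Y h y :> Y" if "h \<in> H" for h using that y addhom_closed[OF A.actionD(1)[OF aY(2)]] by simp
    have "g (finsum Y (%h. gact Y h y) H) = finsum Z (%h. g (gact Y h y)) H"
      using cl H_fin by (intro addhom_finsum[OF Y.is_abgroup Z.is_abgroup gD(1)]) auto
    also have "... = finsum Z (%h. gact Z h (g y)) H"
      using y cl gD(5) by (intro Z.finsum_cong') (auto simp: gD(3)[symmetric])
    finally show ?thesis using cl by (simp add: avg_def gD(2) Y.finsum_closed scal')
  qed
  have "fG X f ` carrier (inv_mod X) = {y \<in> carrier (inv_mod Y). fG Y g y = 0[Z]}"
  proof (intro equalityI subsetI)
    fix y assume "y \<in> fG X f ` carrier (inv_mod X)"
    then obtain x where x: "x :> inv_mod X" "y = f x" by (auto simp: fG_eval)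
    have "f x :> inv_mod Y" by (rule fG(3)[OF F(2-4) x(1)])
    moreover have "g (f x) = 0[Z]" using e(2) inv_in[OF x(1)] by blast
    ultimately show "y \<in> {y \<in> carrier (inv_mod Y). fG Y g y = 0[Z]}" using x by (simp add: fG_eval)
  next
    fix y assume "y \<in> {y \<in> carrier (inv_mod Y). fG Y g y = 0[Z]}"
    then have y: "y :> inv_mod Y" "g y = 0[Z]" by (auto simp: fG_eval)
    then obtain x where x: "x :> X" "y = f x" using e(2) inv_in[OF y(1)] by blast
    have "x :> inv_mod X"
    proof (rule inv_I[OF x(1)])
      fix h assume h: "h \<in> H"
      have "f (gact X h x) = f x" using fD(3)[of h x] h x inv_fix[OF y(1) h] by simp
      then show "gact X h x = x" using e(1) x(1) h addhom_closed[OF A.actionD(1)[OF aX(2)]] by (auto dest!: inj_onD)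
    qed
    then show "y \<in> fG X f ` carrier (inv_mod X)" using x by (auto simp: fG_eval image_iff)
  qed
  moreover have "fG Y g ` carrier (inv_mod Y) = carrier (inv_mod Z)"
  proof (intro equalityI subsetI)
    fix z assume "z \<in> fG Y g ` carrier (inv_mod Y)"
    then show "z :> inv_mod Z" using fG(3)[OF F(3) F'(2,3)] by (auto simp: fG_eval)
  next
    fix z assume z: "z :> inv_mod Z"
    have "z \<in> g ` carrier Y" using e(3) inv_in[OF z] by simp
    then obtain y where y: "y :> Y" "g y = z" by blast
    then have "z = fG Y g (avg Y y)" using av[OF y(1)] avZ(2)[OF z] avY(1) by (simp add: fG_eval)
    then show "z \<in> fG Y g ` carrier (inv_mod Y)" using avY(1)[OF y(1)] by blast
  qed
  moreover have "inj_on (fG X f) (carrier (inv_mod X))" using e(1) by (auto simp: inj_on_def fG_eval dest: inv_in)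
  ultimately show "short_exact (far (invariants B B' H) F) (far (invariants B B' H) F')"
    using F'(2) by (simp add: invariants_func F F' short_exact_def inv_ops)
qed

text \<open>Freeness of \<open>Z\<close> gives a linear section \<open>s\<close> of \<open>g\<close>
  and from it a linear retraction \<open>r\<close> of \<open>f\<close> with f r + s g = 1. Base
  change preserves these identities, and they imply exactness. The splitting is one of modules,
  which is all that exactness refers to.\<close>

lemma exact_F: "preserves_short_exact B (base_change B B' pr :: ('a, 'b, 'g) ffunc)" unfolding preserves_short_exact_def
proof (intro ballI impI)
  fix F F' :: "('a, 'b, 'g) far"
  assume a: "F \<in> Arr (wach_cat B)" "F' \<in> Arr (wach_cat B)" and ex: "short_exact F F'"
  obtain X f Y where F: "F = (X, f, Y)" "wach_module B X" "wach_module B Y" "f \<in> wach_hom B X Y" using a(1) by (rule S.ArrE)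
  obtain Y' g Z where Y': "F' = (Y', g, Z)" "wach_module B Y'" "wach_module B Z" "g \<in> wach_hom B Y' Z" using a(2) by (rule S.ArrE)
  have "Y' = Y" using ex unfolding F(1) Y'(1) short_exact_def by simp
  with Y' have F': "F' = (Y, g, Z)" "wach_module B Z" "g \<in> wach_hom B Y Z" by simp_all
  from ex have e: "inj_on f (carrier X)" "f ` carrier X = {y \<in> carrier Y. g y = 0[Z]}" "g ` carrier Y = carrier Z"
    unfolding F F' short_exact_def by auto
  note fD = S.wach_homD[OF F(4)] and gD = S.wach_homD[OF F'(3)]
  interpret X: rmod R X by (rule S.wach_rmod[OF F(2)])
  interpret Y: rmod R Y by (rule S.wach_rmod[OF F(3)])
  interpret Z: rmod R Z by (rule S.wach_rmod[OF F'(2)])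
  obtain I k where db: "dbasis R Z I (%x. x) k" using S.wach_dbasis[OF F'(2)] by auto
  note d = dbasisD[OF db]
  have "\<forall>i\<in>I. \<exists>y\<in>carrier Y. g y = i" using d(2) e(3)[symmetric] by auto
  then obtain y where y: "\<forall>i\<in>I. y i :> Y \<and> g (y i) = i" by metis
  define s where "s z = finsum Y (%i. k i z *[Y] y i) I" for z
  have sc: "s z :> Y" if "z :> Z" for z unfolding s_def using that y d(3) by (intro Y.finsum_closed) auto
  have sa: "addhom Z Y s"
  proof (rule addhomI[OF sc])
    fix z z' assume z: "z :> Z" "z' :> Z"
    have "s (z +[Z] z') = finsum Y (%i. k i z *[Y] y i +[Y] k i z' *[Y] y i) I"
      unfolding s_def using z y d by (intro Y.finsum_cong') (auto simp: Y.smult_l_distr)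
    also have "... = s z +[Y] s z'" unfolding s_def using z y d by (intro Y.finsum_addf) auto
    finally show "s (z +[Z] z') = s z +[Y] s z'" .
  qed
  have sl: "\<forall>c\<in>R. \<forall>z\<in>carrier Z. s (c *[Z] z) = c *[Y] s z"
  proof (intro ballI)
    fix c z assume z: "c \<in> R" "z :> Z"
    have "s (c *[Z] z) = finsum Y (%i. c *[Y] (k i z *[Y] y i)) I"
      unfolding s_def using z y d by (intro Y.finsum_cong') (auto simp: Y.smult_smult)
    also have "... = c *[Y] s z" unfolding s_def using z y d by (intro Y.smult_finsum[symmetric]) auto
    finally show "s (c *[Z] z) = c *[Y] s z" .
  qed
  have gs: "g (s z) = z" if z: "z :> Z" for z
  proof -
    have "g (s z) = finsum Z (%i. g (k i z *[Y] y i)) I"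
      unfolding s_def using z y d by (intro addhom_finsum[OF Y.is_abgroup Z.is_abgroup gD(1)]) auto
    also have "... = finsum Z (%i. k i z *[Z] i) I" using z y d by (intro Z.finsum_cong') (auto simp: gD(2))
    finally show ?thesis using d(7)[OF z] by simp
  qed
  \<comment> \<open>The projection onto the kernel of \<open>g\<close> along \<open>s\<close>. By
    exactness it factors through \<open>f\<close>, and the factor is \<open>r\<close>.\<close>
  define q where "q t = t -[Y] s (g t)" for t
  have qc: "q t :> Y" and qs: "q t +[Y] s (g t) = t" if "t :> Y" for t
    unfolding q_def using that sc gD(5) by (simp_all add: Y.diff_add_cancel)
  have qa: "q (t +[Y] t') = q t +[Y] q t'" if "t :> Y" "t' :> Y" for t t' unfolding q_def using that sc[OF gD(5)]
    by (simp add: addhom_add[OF gD(1)] addhom_add[OF sa] gD(5) Y.minus_eq Y.minus_add Y.a_ac)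
  have ql: "q (c *[Y] t) = c *[Y] q t" if "c \<in> R" "t :> Y" for c t
    unfolding q_def using that sl sc[OF gD(5)] by (simp add: gD(2,5) Y.smult_diff)
  have "\<exists>x\<in>carrier X. f x = q t" if t: "t :> Y" for t
  proof -
    have "g (q t) = 0[Z]"
      unfolding q_def using t sc gD(5) gs addhom_diff[OF Y.is_abgroup Z.is_abgroup gD(1)] by (simp add: Z.r_neg Z.minus_eq)
    then have "q t \<in> f ` carrier X" using e(2) qc[OF t] by simp
    then show ?thesis by auto
  qed
  then obtain r where r: "\<forall>t\<in>carrier Y. r t :> X \<and> f (r t) = q t" by metis
  have finj: "x = x'" if "f x = f x'" "x :> X" "x' :> X" for x x' using that e(1) by (auto dest: inj_onD)
  have gf: "g (f x) = 0[Z]" if "x :> X" for x using that e(2) by blast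
  have s0: "s 0[Z] = 0[Y]" by (rule addhom_zero[OF Z.is_abgroup Y.is_abgroup sa])
  have rc: "r t :> X" and fr: "f (r t) = q t" if "t :> Y" for t using r that by auto
  have rf: "r (f x) = x" if x: "x :> X" for x
  proof (rule finj[OF _ rc x])
    show "f (r (f x)) = f x" using x by (simp add: fr fD(5) q_def gf s0 Y.minus_eq)
  qed (use x fD(5) in simp)
  have ra: "addhom Y X r"
  proof (rule addhomI)
    fix t t' assume t: "t :> Y" "t' :> Y"
    show "r (t +[Y] t') = r t +[X] r t'" by (rule finj) (use t in \<open>simp_all add: rc fr addhom_add[OF fD(1)] qa\<close>)
  qed (rule rc)
  have rl: "\<forall>c\<in>R. \<forall>t\<in>carrier Y. r (c *[Y] t) = c *[X] r t"
  proof (intro ballI)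
    fix c t assume t: "c \<in> R" "t :> Y"
    show "r (c *[Y] t) = c *[X] r t" by (rule finj) (use t in \<open>simp_all add: rc fr fD(2) ql\<close>)
  qed
  have fl: "\<forall>c\<in>R. \<forall>x\<in>carrier X. f (c *[X] x) = c *[Y] f x" and gl: "\<forall>c\<in>R. \<forall>x\<in>carrier Y. g (c *[Y] x) = c *[Z] g x"
    using fD(2) gD(2) by auto
  define f' g' r' s' where "f' = tmap R (AA :: ('a fps, ('a fps, 'b) univ) module) Y id f"
    and "g' = tmap R (AA :: ('a fps, ('a fps, 'b) univ) module) Z id g"
    and "r' = tmap R (AA :: ('a fps, ('a fps, 'b) univ) module) X id r"
    and "s' = tmap R (AA :: ('a fps, ('a fps, 'b) univ) module) Y id s"
  note maps = f'_def g'_def r'_def s'_def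
  note tf = bc_map[OF F(2,3) fD(1) fl, folded maps] and tg = bc_map[OF F(3) F'(2) gD(1) gl, folded maps]
    and tr = bc_map[OF F(3,2) ra rl, folded maps] and ts = bc_map[OF F'(2) F(3) sa sl, folded maps]
  interpret TX: tpair R' R AA X by (rule bc_tp[OF F(2)])
  interpret TY: tpair R' R AA Y by (rule bc_tp[OF F(3)])
  interpret TZ: tpair R' R AA Z by (rule bc_tp[OF F'(2)])
  interpret BX: rmod R' "bt X" by (rule TX.rmod_T)
  interpret BY: rmod R' "bt Y" by (rule TY.rmod_T)
  interpret BZ: rmod R' "bt Z" by (rule TZ.rmod_T)
  note cl [simp] = addhom_closed[OF tf(1)] addhom_closed[OF tg(1)] addhom_closed[OF tr(1)] addhom_closed[OF ts(1)]
  note zz [simp] = addhom_zero[OF BX.is_abgroup BY.is_abgroup tf(1)] addhom_zero[OF BY.is_abgroup BZ.is_abgroup tg(1)]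
    addhom_zero[OF BY.is_abgroup BX.is_abgroup tr(1)] addhom_zero[OF BZ.is_abgroup BY.is_abgroup ts(1)]
  note aa = addhom_add[OF tf(1)] addhom_add[OF tg(1)] addhom_add[OF tr(1)] addhom_add[OF ts(1)]
  have 1: "r' (f' t) = t" if "t :> bt X" for t
    using that by (induction rule: TX.T_induct) (auto simp: tf(2) tr(2) fD(5) rf aa)
  have 2: "g' (f' t) = 0[bt Z]" if "t :> bt X" for t
    using that by (induction rule: TX.T_induct) (auto simp: tf(2) tg(2) fD(5) gf aa TZ.pt_zero_right)
  have 3: "g' (s' t) = t" if "t :> bt Z" for t using that by (induction rule: TZ.T_induct) (auto simp: ts(2) tg(2) sc gs aa)
  have 4: "f' (r' t) +[bt Y] s' (g' t) = t" if "t :> bt Y" for t using that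
  proof (induction rule: TY.T_induct)
    case (pure a t)
    then obtain c where c: "a = Scalar c" by auto
    show ?case using pure(2) sc by (simp add: c tf(2) tg(2) tr(2) ts(2) rc fr gD(5) qc qs TY.pt_add_right[symmetric])
  next
    case (add u v)
    have "f' (r' (u +[bt Y] v)) +[bt Y] s' (g' (u +[bt Y] v)) =
        (f' (r' u) +[bt Y] s' (g' u)) +[bt Y] (f' (r' v) +[bt Y] s' (g' v))" using add(1,2) by (simp add: aa BY.a_ac)
    then show ?case using add(3,4) by simp
  qed auto
  have "inj_on f' (carrier (bt X))" using 1 by (metis inj_onI)
  moreover have "f' ` carrier (bt X) = {t \<in> carrier (bt Y). g' t = 0[bt Z]}"
  proof (intro equalityI subsetI)
    fix t assume t: "t \<in> {t \<in> carrier (bt Y). g' t = 0[bt Z]}"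
    then have "f' (r' t) = t" using 4[of t] by simp
    then show "t \<in> f' ` carrier (bt X)" using t by (metis (mono_tags, lifting) cl(3) image_eqI mem_Collect_eq)
  qed (use 2 in auto)
  moreover have "g' ` carrier (bt Y) = carrier (bt Z)" using 3 by (auto simp: image_iff) (metis cl(4))
  ultimately show "short_exact (far (base_change B B' pr) F) (far (base_change B B' pr) F')"
    by (simp add: base_change_func F F' short_exact_def fF_def maps image_restrict_eq inj_on_restrict_eq restrict_apply cong: conj_cong)
qed

end

section \<open>Arithmetic of the cyclotomic power series ring\<close>

lemma unital_homD: assumes "unital_hom f"
  shows "f 1 = 1" "f (x + y) = f x + f y" "f (x * y) = f x * f y" "f 0 = 0" "f (- x) = - f x" "f (x - y) = f x - f y"
    and "f (of_nat n) = of_nat n" "f (x ^ n) = f x ^ n" "f (sum g I) = (\<Sum>i\<in>I. f (g i))" "f (prod g I) = (\<Prod>i\<in>I. f (g i))"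
proof -
  show f: "f 1 = 1" "f (x + y) = f x + f y" "f (x * y) = f x * f y" for x y using assms by (auto simp: unital_hom_def)
  show 0: "f 0 = 0" using f(2)[of 0 0] by simp
  show m: "f (- x) = - f x" for x using f(2)[of x "- x"] 0 by (simp add: eq_neg_iff_add_eq_0 add.commute)
  show "f (x - y) = f x - f y" using f(2)[of x "- y"] m by simp
  show "f (of_nat n) = of_nat n" by (induction n) (auto simp: f 0)
  show "f (x ^ n) = f x ^ n" by (induction n) (auto simp: f)
  show "f (sum g I) = (\<Sum>i\<in>I. f (g i))" by (induction I rule: infinite_finite_induct) (auto simp: f 0)
  show "f (prod g I) = (\<Prod>i\<in>I. f (g i))" by (induction I rule: infinite_finite_induct) (auto simp: f)
qed

text \<open>The falling factorial. For \<open>n > k\<close> a factor vanishes and so does the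
  binomial coefficient; hence the truncated subtraction in the induction is harmless.\<close>

lemma prod_diff_of_nat:
  "(\<Prod>i<n. of_nat k - of_nat i) = (of_nat (fact n * (k choose n)) :: 'a::comm_ring_1)"
proof (induction n)
  case (Suc n)
  have "Suc n * (k choose Suc n) = (k choose n) * (k - n)"
    using binomial_absorb_comp[of k n] binomial_absorption[of n k] by (cases "n \<le> k") (auto simp: mult.commute)
  then have "fact (Suc n) * (k choose Suc n) = fact n * (k choose n) * (k - n)"
    unfolding fact_Suc by (metis mult.assoc mult.commute of_nat_id)
  moreover have "of_nat (fact n * (k choose n)) * (of_nat k - of_nat n) = (of_nat (fact n * (k choose n) * (k - n)) :: 'a)"
    by (cases "n \<le> k") (auto simp: of_nat_diff binomial_eq_0)
  ultimately show ?case using Suc by simp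
qed simp

locale witt =
  fixes p :: nat and \<pi> :: "'a::idom => 'k::field" and \<sigma> :: "'a => 'a"
  assumes prime_p: "prime p" and p3: "p \<ge> 3" and char_k: "CHAR('k) = p"
    and W: "witt_ring p \<pi>" and frob: "witt_frobenius p \<pi> \<sigma>"
begin

abbreviation (input) P :: 'a where "P \<equiv> of_nat p"
abbreviation (input) ZZ :: "'a set" where "ZZ \<equiv> Zp p"

lemma pi: "unital_hom \<pi>" "surj \<pi>" "\<pi> x = 0 \<longleftrightarrow> P dvd x" using W by (auto simp: witt_ring_def)

lemma sg: "unital_hom \<sigma>" using frob by (auto simp: witt_frobenius_def)

lemma P_nz [simp]: "P \<noteq> 0" using W by (auto simp: witt_ring_def) (metis mult_cancel_left1 mult_zero_left zero_neq_one)

lemma separated: "(!!n. P ^ n dvd x) ==> x = 0" using W by (auto simp: witt_ring_def)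

lemma limit: "(!!n. P ^ n dvd s (Suc n) - s n) ==> \<exists>x. \<forall>n. P ^ n dvd x - s n"
  using W by (auto simp: witt_ring_def)

lemma P_dvd_of_nat: "P dvd of_nat n \<longleftrightarrow> p dvd n"
  using pi(3)[of "of_nat n"] by (simp add: unital_homD[OF pi(1)] of_nat_eq_0_iff_char_dvd char_k)

text \<open>The partial geometric sums of \<open>- (P * b)\<close> form a Cauchy sequence.
  Completeness provides the limit, and separatedness shows that it is the inverse.\<close>

lemma unit_1: "\<exists>y. (1 + P * b) * y = 1"
proof -
  define s where "s n = (\<Sum>i<n. (- (P * b)) ^ i)" for n
  have "P ^ n dvd s (Suc n) - s n" for n by (simp add: s_def power_mult_distrib power_minus[of "P * b"])
  then obtain y where y: "!!n. P ^ n dvd y - s n" using limit[of s] by auto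
  have "(1 + P * b) * y - 1 = 0"
  proof (rule separated)
    fix n
    have "(1 + P * b) * s n = 1 - (- (P * b)) ^ n" using one_diff_power_eq[of "- (P * b)" n] by (simp add: s_def)
    then have "(1 + P * b) * y - 1 = (1 + P * b) * (y - s n) - P ^ n * (- b) ^ n"
      by (simp add: algebra_simps power_mult_distrib[symmetric])
    then show "P ^ n dvd (1 + P * b) * y - 1" using y[of n] by simp
  qed
  then show ?thesis by auto
qed

lemma unit: "\<not> P dvd x ==> \<exists>y. x * y = 1"
proof -
  assume "\<not> P dvd x"
  then have x: "\<pi> x \<noteq> 0" by (simp add: pi)
  obtain z where "\<pi> z = inverse (\<pi> x)" using pi(2) by (metis surjD)
  then have "\<pi> (x * z - 1) = 0" using x by (simp add: unital_homD[OF pi(1)])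
  then obtain b where "x * z - 1 = P * b" unfolding pi(3) by auto
  then have "x * z = 1 + P * b" by (simp add: algebra_simps)
  then show ?thesis using unit_1[of b] by (metis mult.assoc)
qed

lemma of_nat_factor: assumes "n > 0" obtains v m y where "of_nat n = P ^ v * m" "m * y = 1"
proof -
  have "n \<noteq> 0" "\<not> is_unit p" using assms prime_p by (auto simp: prime_nat_iff)
  then obtain m where m: "n = p ^ multiplicity p n * m" "\<not> p dvd m" by (rule multiplicity_decompose')
  then obtain y where y: "(of_nat m :: 'a) * y = 1" using unit[of "of_nat m"] P_dvd_of_nat by auto
  have "of_nat n = P ^ multiplicity p n * of_nat m" using m(1) by (metis of_nat_mult of_nat_power)
  then show ?thesis by (rule that[OF _ y])
qed

lemma char0 [simp]: "(of_nat n :: 'a) = 0 \<longleftrightarrow> n = 0"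
  using of_nat_factor[of n] by (metis P_nz gr0I mult_eq_0_iff mult_zero_left of_nat_0 power_not_zero zero_neq_one)

lemma dvd_P_cancel: "P ^ (n + k) dvd P ^ k * x ==> P ^ n dvd x" using prime_p by (auto simp: power_add mult.commute)

text \<open>\<open>fact n\<close> is a power of \<open>p\<close> times a unit, so dividing by it
  loses a fixed amount \<open>v\<close> of divisibility by \<open>p\<close>, whatever
  \<open>k\<close> and \<open>x\<close> are.\<close>

lemma fact_cancel: "\<exists>v. \<forall>k x. P ^ k dvd of_nat (fact n) * x \<longrightarrow> P ^ k dvd P ^ v * x"
proof -
  obtain v m y where v: "(of_nat (fact n) :: 'a) = P ^ v * m" "m * y = 1" by (rule of_nat_factor[of "fact n"]) auto
  have "P ^ k dvd P ^ v * x" if "P ^ k dvd of_nat (fact n) * x" for k x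
  proof -
    from that have "P ^ k dvd y * (of_nat (fact n) * x)" by simp
    also have "y * (of_nat (fact n) * x) = P ^ v * x * (m * y)" by (simp add: v(1) algebra_simps)
    finally show ?thesis by (simp add: v)
  qed
  then show ?thesis by blast
qed

section \<open>The p-adic integers inside the Witt vectors\<close>

lemma Zp_iff: "x \<in> ZZ \<longleftrightarrow> (\<forall>n. \<exists>k. P ^ n dvd x - of_nat k)" by (simp add: Zp_def)

lemma Zp_of_nat [simp, intro]: "of_nat n \<in> ZZ" unfolding Zp_iff by (metis diff_self dvd_0_right)

lemma Zp_1 [simp, intro]: "1 \<in> ZZ" using Zp_of_nat[of 1] by simp

lemma Zp_add [simp, intro]: assumes "x \<in> ZZ" "y \<in> ZZ" shows "x + y \<in> ZZ" unfolding Zp_iff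
proof
  fix n
  obtain k l where "P ^ n dvd x - of_nat k" "P ^ n dvd y - of_nat l" using assms unfolding Zp_iff by meson
  then have "P ^ n dvd (x - of_nat k) + (y - of_nat l)" by (rule dvd_add)
  then show "\<exists>k. P ^ n dvd x + y - of_nat k" by (intro exI[of _ "k + l"]) (simp add: algebra_simps)
qed

lemma Zp_mult [simp, intro]: assumes "x \<in> ZZ" "y \<in> ZZ" shows "x * y \<in> ZZ" unfolding Zp_iff
proof
  fix n
  obtain k l where "P ^ n dvd x - of_nat k" "P ^ n dvd y - of_nat l" using assms unfolding Zp_iff by meson
  then have "P ^ n dvd (x - of_nat k) * y + of_nat k * (y - of_nat l)" by simp
  then show "\<exists>k. P ^ n dvd x * y - of_nat k" by (intro exI[of _ "k * l"]) (simp add: algebra_simps)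
qed

text \<open>Reduction modulo \<open>p ^ n\<close> replaces an approximating integer by the natural
  number that the definition asks for. Negatives become manageable in this way.\<close>

lemma Zp_intI: assumes "!!n. \<exists>k. P ^ n dvd x - of_int k" shows "x \<in> ZZ" unfolding Zp_iff
proof
  fix n
  obtain k where k: "P ^ n dvd x - of_int k" using assms by blast
  define l where "l = nat (k mod int (p ^ n))"
  have "k = int l + int (p ^ n) * (k div int (p ^ n))" using prime_p by (simp add: l_def prime_gt_0_nat)
  then have "(of_int k :: 'a) = of_int (int l + int (p ^ n) * (k div int (p ^ n)))" by (rule arg_cong)
  then have "x - of_nat l = (x - of_int k) + P ^ n * of_int (k div int (p ^ n))" by simp
  then show "\<exists>k. P ^ n dvd x - of_nat k" using k by (metis dvd_add dvd_triv_left)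
qed

lemma Zp_diff [simp, intro]: assumes "x \<in> ZZ" "y \<in> ZZ" shows "x - y \<in> ZZ"
proof (rule Zp_intI)
  fix n
  obtain k l where "P ^ n dvd x - of_nat k" "P ^ n dvd y - of_nat l" using assms unfolding Zp_iff by meson
  then have "P ^ n dvd (x - of_nat k) - (y - of_nat l)" by (rule dvd_diff)
  then show "\<exists>k. P ^ n dvd x - y - of_int k" by (intro exI[of _ "int k - int l"]) (simp add: algebra_simps)
qed

lemma Zp_power [simp, intro]: "x \<in> ZZ ==> x ^ n \<in> ZZ" by (induction n) auto

lemma Zp_divide_P: assumes "P * z \<in> ZZ" shows "z \<in> ZZ" unfolding Zp_iff
proof
  fix n
  obtain k where k: "P ^ Suc n dvd P * z - of_nat k" using assms unfolding Zp_iff by blast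
  then have "P dvd P * z - of_nat k" by (meson dvd_trans dvd_power zero_less_Suc)
  then have "P dvd of_nat k" by (metis dvd_diff_right_iff dvd_triv_left)
  then obtain l where l: "k = p * l" by (auto simp: P_dvd_of_nat)
  have "P * P ^ n dvd P * (z - of_nat l)" using k by (simp add: l algebra_simps)
  then have "P ^ n dvd z - of_nat l" using P_nz by (simp only: dvd_mult_cancel_left) simp
  then show "\<exists>k. P ^ n dvd z - of_nat k" ..
qed

text \<open>\<open>\<sigma>\<close> fixes natural numbers and preserves divisibility by powers of
  \<open>p\<close>, hence fixes their closure.\<close>

lemma sg_Zp: assumes "x \<in> ZZ" shows "\<sigma> x = x"
proof -
  have "\<sigma> x - x = 0"
  proof (rule separated)
    fix n
    obtain k c where k: "x - of_nat k = P ^ n * c" using assms unfolding Zp_iff by (meson dvd_def)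
    then have "\<sigma> (x - of_nat k) = P ^ n * \<sigma> c" by (simp add: unital_homD[OF sg])
    then have "\<sigma> x - x = P ^ n * \<sigma> c - P ^ n * c" using k by (simp add: unital_homD[OF sg] algebra_simps)
    then show "P ^ n dvd \<sigma> x - x" by simp
  qed
  then show ?thesis by simp
qed

text \<open>Let \<open>p ^ v\<close> be the \<open>p\<close>-part of \<open>fact n\<close> and
  approximate \<open>x\<close> by a natural number \<open>k\<close> modulo \<open>p ^ v\<close>. The
  product for \<open>k\<close> is \<open>fact n\<close> times a binomial coefficient, so the product
  for \<open>x\<close> is divisible by \<open>p ^ v\<close>, hence by \<open>fact n\<close>. Thus
  the coefficients described in \<open>qpow\<close> exist.\<close>

lemma qpow_fact: assumes "x \<in> ZZ"
  shows "of_nat (fact n) * (qpow x $ n) = (\<Prod>i<n. x - of_nat i)"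
proof -
  obtain v m y where v: "(of_nat (fact n) :: 'a) = P ^ v * m" "m * y = 1" by (rule of_nat_factor[of "fact n"]) auto
  obtain k where k: "P ^ v dvd x - of_nat k" using assms unfolding Zp_iff by blast
  have "P ^ v dvd (\<Prod>i\<in>I. x - of_nat i) - (\<Prod>i\<in>I. of_nat k - of_nat i)" if "finite I" for I :: "nat set"
    using that
  proof (induction I)
    case (insert j I)
    have "(\<Prod>i\<in>insert j I. x - of_nat i) - (\<Prod>i\<in>insert j I. of_nat k - of_nat i) =
      (x - of_nat k) * (\<Prod>i\<in>I. x - of_nat i) + (of_nat k - of_nat j) * ((\<Prod>i\<in>I. x - of_nat i) - (\<Prod>i\<in>I. of_nat k - of_nat i))"
      using insert.hyps by (simp add: algebra_simps)
    then show ?case using insert.IH k by simp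
  qed simp
  then have "P ^ v dvd (\<Prod>i<n. x - of_nat i) - (\<Prod>i<n. of_nat k - of_nat i)" by simp
  moreover have "P ^ v dvd (\<Prod>i<n. of_nat k - of_nat i)" by (simp add: prod_diff_of_nat v(1))
  ultimately have "P ^ v dvd (\<Prod>i<n. x - of_nat i)" by (metis diff_add_cancel dvd_add)
  then obtain e where e: "(\<Prod>i<n. x - of_nat i) = P ^ v * e" by auto
  have "of_nat (fact n) * (y * e) = P ^ v * e * (m * y)" by (simp add: v(1) algebra_simps)
  then have ex: "of_nat (fact n) * (y * e) = (\<Prod>i<n. x - of_nat i)" using v(2) e by simp
  have "\<exists>!c. of_nat (fact n) * c = (\<Prod>i<n. x - of_nat i)"
    using ex by (metis char0 fact_nonzero mult_left_cancel)
  from theI'[OF this] show ?thesis by (simp add: qpow_def)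
qed

lemma qpow_0 [simp]: "qpow x $ 0 = (1 :: 'a)" by (simp add: qpow_def)

lemma qpow_Suc: assumes "x \<in> ZZ" shows "of_nat (Suc n) * (qpow x $ Suc n) = (x - of_nat n) * (qpow x $ n)"
proof -
  have "of_nat (fact n) * (of_nat (Suc n) * (qpow x $ Suc n)) = of_nat (fact n) * ((x - of_nat n) * (qpow x $ n))"
    using qpow_fact[OF assms, of "Suc n"] qpow_fact[OF assms, of n] by (simp add: algebra_simps)
  then show ?thesis by (metis char0 fact_nonzero mult_left_cancel)
qed

lemma qpow_1 [simp]: "x \<in> ZZ ==> qpow x $ Suc 0 = x" using qpow_Suc[of x 0] by simp

text \<open>All identities between the power series \<^term>\<open>qpow x\<close> follow from the uniqueness of the solution
  of this differential equation.\<close>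

lemma qpow_deriv: "x \<in> ZZ ==> (1 + fps_X) * fps_deriv (qpow x) = fps_const x * qpow x"
proof (rule fps_ext)
  fix n assume x: "x \<in> ZZ"
  have "((1 + fps_X) * fps_deriv (qpow x)) $ n = of_nat (Suc n) * (qpow x $ Suc n) + of_nat n * (qpow x $ n)"
    by (cases n) (simp_all add: distrib_right)
  then show "((1 + fps_X) * fps_deriv (qpow x)) $ n = (fps_const x * qpow x) $ n"
    using qpow_Suc[OF x, of n] by (simp add: algebra_simps)
qed

text \<open>Comparing coefficients gives a recursion that expresses \<open>n + 1\<close> times
  coefficient \<open>n + 1\<close> through coefficient \<open>n\<close>; in characteristic zero it
  determines \<open>f\<close>.\<close>

lemma qpow_unique:
  assumes x: "x \<in> ZZ" and f: "f $ 0 = 1" "(1 + fps_X) * fps_deriv f = fps_const x * f"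
  shows "f = qpow x"
proof (rule fps_ext)
  fix n
  show "f $ n = qpow x $ n"
  proof (induction n)
    case (Suc n)
    have "((1 + fps_X) * fps_deriv f) $ n = of_nat (Suc n) * (f $ Suc n) + of_nat n * (f $ n)"
      by (cases n) (simp_all add: distrib_right)
    then have "of_nat (Suc n) * (f $ Suc n) = (x - of_nat n) * (f $ n)"
      using arg_cong[OF f(2), of "%f. f $ n"] by (simp add: algebra_simps)
    then have "of_nat (Suc n) * (f $ Suc n) = of_nat (Suc n) * (qpow x $ Suc n)" by (simp only: Suc qpow_Suc[OF x])
    then show ?case using char0[of "Suc n"] by (simp only: mult_cancel_left) simp
  qed (simp add: f)
qed

lemma qpow_add: assumes "x \<in> ZZ" "y \<in> ZZ" shows "qpow (x + y) = qpow x * qpow y"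
proof (rule qpow_unique[symmetric])
  have "(1 + fps_X) * fps_deriv (qpow x * qpow y) =
      qpow x * ((1 + fps_X) * fps_deriv (qpow y)) + ((1 + fps_X) * fps_deriv (qpow x)) * qpow y" by (simp add: algebra_simps)
  then show "(1 + fps_X) * fps_deriv (qpow x * qpow y) = fps_const (x + y) * (qpow x * qpow y)"
    unfolding qpow_deriv[OF assms(1)] qpow_deriv[OF assms(2)] by (simp add: algebra_simps fps_const_add[symmetric] del: fps_const_add)
qed (use assms in auto)

lemma qpow_of_nat: "qpow (of_nat n) = (1 + fps_X :: 'a fps) ^ n"
proof (induction n)
  case 0
  show ?case by (rule qpow_unique[symmetric]) (use Zp_of_nat[of 0] in auto)
next
  case (Suc n)
  have "1 + fps_X = qpow (1 :: 'a)" by (rule qpow_unique) auto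
  then show ?case using qpow_add[of 1 "of_nat n"] Suc by simp
qed

lemma qpow_one: "qpow (1 :: 'a) = 1 + fps_X" using qpow_of_nat[of 1] by simp

text \<open>The substitution q \<mapsto> q^x: the action of the group element with character value
  \<open>x\<close> and, for \<open>x = P\<close>, the part of Frobenius that does not touch
  coefficients. One operator for both makes their commutation an instance of
  \<open>T_T\<close>.\<close>

definition T :: "'a => 'a fps => 'a fps" where "T x f = f oo (qpow x - 1)"

lemma T_simps [simp]: "T x 1 = 1" "T x 0 = 0" "T x (fps_const c) = fps_const c" "T x f $ 0 = f $ 0" by (simp_all add: T_def)

lemma T_hom: "T x (f + g) = T x f + T x g" "T x (f - g) = T x f - T x g" "T x (f * g) = T x f * T x g"
  "T x (f ^ n) = T x f ^ n" "T x (sum h I) = (\<Sum>i\<in>I. T x (h i))" "T x fps_X = qpow x - 1"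
  by (simp_all add: T_def fps_compose_add_distrib fps_compose_sub_distrib fps_compose_mult_distrib
      fps_compose_power fps_compose_sum_distrib)

text \<open>By the chain rule the substituted series satisfies the differential equation with
  exponent \<open>x * y\<close>.\<close>

lemma T_qpow: assumes "x \<in> ZZ" "y \<in> ZZ" shows "T x (qpow y) = qpow (x * y)"
proof (rule qpow_unique)
  have b: "(qpow x - 1 :: 'a fps) $ 0 = 0" by simp
  have "(1 + fps_X) * fps_deriv (T x (qpow y)) = T x (fps_deriv (qpow y)) * ((1 + fps_X) * fps_deriv (qpow x))"
    using fps_compose_deriv[OF b, of "qpow y"] by (simp add: T_def algebra_simps)
  also have "... = fps_const x * (T x (1 + fps_X) * T x (fps_deriv (qpow y)))"
    unfolding qpow_deriv[OF assms(1)] by (simp add: T_hom algebra_simps)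
  also have "... = fps_const x * (fps_const y * T x (qpow y))"
    unfolding T_hom(3)[symmetric] qpow_deriv[OF assms(2)] by (simp add: T_hom(3))
  finally show "(1 + fps_X) * fps_deriv (T x (qpow y)) = fps_const (x * y) * T x (qpow y)"
    by (simp add: mult.assoc[symmetric])
qed (use assms in auto)

lemma T_T: assumes "x \<in> ZZ" "y \<in> ZZ" shows "T x (T y f) = T (x * y) f"
proof -
  have "(qpow x - 1 :: 'a fps) $ 0 = 0" "(qpow y - 1 :: 'a fps) $ 0 = 0" by simp_all
  then have "T x (T y f) = f oo T x (qpow y - 1)" unfolding T_def by (rule fps_compose_assoc[symmetric])
  also have "T x (qpow y - 1) = qpow (x * y) - 1" using T_qpow[OF assms] by (simp add: T_hom)
  finally show ?thesis by (simp add: T_def)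
qed

lemma T_1 [simp]: "T 1 f = f" by (simp add: T_def qpow_one)

text \<open>To first order q^x - 1 is \<open>x\<close> times mu, so each factor mu contributes a
  factor \<open>x\<close> to the leading coefficient. The structure of the invariants is derived
  from this.\<close>

lemma T_order: assumes "x \<in> ZZ" shows "\<exists>h. T x (fps_X ^ m * g) = fps_X ^ m * h \<and> h $ 0 = x ^ m * (g $ 0)"
proof -
  define k where "k = fps_shift 1 (qpow x - 1)"
  have "qpow x - 1 = fps_X * k" by (rule fps_ext) (auto simp: k_def)
  then have "T x (fps_X ^ m * g) = fps_X ^ m * (k ^ m * T x g)" by (simp add: T_hom power_mult_distrib mult.assoc)
  moreover have "k $ 0 = x" using assms by (simp add: k_def)
  ultimately show ?thesis by (intro exI[of _ "k ^ m * T x g"]) (simp add: fps_nth_power_0)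
qed

text \<open>The Witt Frobenius on coefficients; the full Frobenius is this followed by the
  substitution \<open>T P\<close>.\<close>

definition sm :: "'a fps => 'a fps" where "sm f = Abs_fps (%n. \<sigma> (f $ n))"

lemma sm_hom: "sm (f + g) = sm f + sm g" "sm (f * g) = sm f * sm g" "sm 1 = 1" "sm (f ^ n) = sm f ^ n" "sm (f - g) = sm f - sm g"
proof -
  show 1: "sm (f + g) = sm f + sm g" "sm (f - g) = sm f - sm g" "sm 1 = 1" for f g
    by (rule fps_ext; simp add: sm_def unital_homD[OF sg])+
  show 2: "sm (f * g) = sm f * sm g" for f g by (rule fps_ext) (simp add: sm_def fps_mult_nth unital_homD[OF sg])
  show "sm (f ^ n) = sm f ^ n" by (induction n) (simp_all add: 1 2)
qed

lemma sm_qpow: "x \<in> ZZ ==> sm (qpow x) = qpow x"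
proof (rule qpow_unique)
  assume x: "x \<in> ZZ"
  have "sm (fps_deriv f) = fps_deriv (sm f)" for f by (rule fps_ext) (simp add: sm_def unital_homD[OF sg] del: of_nat_Suc)
  moreover have "sm fps_X = fps_X" "sm (fps_const x) = fps_const x"
    by (rule fps_ext; simp add: sm_def unital_homD[OF sg] sg_Zp[OF x])+
  ultimately show "(1 + fps_X) * fps_deriv (sm (qpow x)) = fps_const x * sm (qpow x)"
    using arg_cong[OF qpow_deriv[OF x], of sm] by (simp add: sm_hom)
qed (auto simp: sm_def unital_homD[OF sg])

lemma sm_T: assumes "x \<in> ZZ" shows "sm (T x f) = T x (sm f)"
proof (rule fps_ext)
  fix n
  have "\<sigma> (((qpow x - 1) ^ i) $ n) = ((qpow x - 1) ^ i) $ n" for i n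
    using arg_cong[OF sm_hom(4)[of "qpow x - 1" i], of "%f. f $ n"] by (simp add: sm_hom(3,5) sm_qpow[OF assms]) (simp add: sm_def)
  then show "sm (T x f) $ n = T x (sm f) $ n" by (simp add: T_def fps_compose_nth sm_def unital_homD[OF sg])
qed

lemma A_frob_eq: "A_frob p \<sigma> f = T P (sm f)" by (simp add: A_frob_def T_def sm_def qpow_of_nat)

lemma A_act_eq: "A_act \<chi> g f = T (\<chi> g) f" by (simp add: A_act_def T_def)

lemma frob_T: "x \<in> ZZ ==> T x (A_frob p \<sigma> f) = A_frob p \<sigma> (T x f)"
  by (simp add: A_frob_eq T_T sm_T mult.commute)

lemma frob_hom: "A_frob p \<sigma> (f + g) = A_frob p \<sigma> f + A_frob p \<sigma> g" "A_frob p \<sigma> (f * g) = A_frob p \<sigma> f * A_frob p \<sigma> g"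
  "A_frob p \<sigma> 1 = 1" "A_frob p \<sigma> (f ^ n) = A_frob p \<sigma> f ^ n" "A_frob p \<sigma> f $ 0 = \<sigma> (f $ 0)"
  by (simp_all add: A_frob_eq sm_hom T_hom) (simp add: sm_def)

lemma frob_X: "A_frob p \<sigma> fps_X = fps_X * q_p p"
proof -
  have "sm fps_X = fps_X" by (rule fps_ext) (simp add: sm_def unital_homD[OF sg])
  moreover have "(1 + fps_X :: 'a fps) ^ p - 1 = fps_X * q_p p"
    using power_diff_1_eq[of "1 + fps_X :: 'a fps" p] by (simp add: q_p_def)
  ultimately show ?thesis by (simp add: A_frob_eq T_hom qpow_of_nat)
qed

end

text \<open>Induction on the degree: each root splits off a linear factor, by the quotient formula
  of \<open>polyfun_diff\<close>. It is applied to polynomials X^r - 1.\<close>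

lemma card_roots_le:
  fixes c :: "nat => 'a::idom"
  assumes "finite X" "\<forall>z\<in>X. (\<Sum>i\<le>n. c i * z ^ i) = 0" "c n \<noteq> 0"
  shows "card X \<le> n" using assms
proof (induction n arbitrary: X c)
  case 0
  then show ?case by (cases "X = {}") auto
next
  case (Suc n)
  show ?case
  proof (cases "X = {}")
    case False
    then obtain a where a: "a \<in> X" by auto
    define b where "b j = (\<Sum>i=Suc j..Suc n. c i * a ^ (i - j - 1))" for j
    have "(\<Sum>i\<le>n. b i * z ^ i) = 0" if "z \<in> X - {a}" for z
      using polyfun_diff[of "Suc n" c z a] that a Suc.prems(2) by (auto simp: b_def lessThan_Suc_atMost)
    then have "card (X - {a}) \<le> n" using Suc.prems by (intro Suc.IH[of _ b]) (auto simp: b_def)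
    then show ?thesis using a Suc.prems(1) by simp
  qed simp
qed

section \<open>Teichmuller lifts and the invariants of the torsion subgroup\<close>

context witt
begin

abbreviation (input) m0 :: "'a fps" where "m0 \<equiv> mu0 p"
abbreviation (input) qp :: "'a fps" where "qp \<equiv> q_p p"
abbreviation (input) tc :: "nat => 'a" where "tc \<equiv> teich p"

lemma p_pos [simp]: "p > 0" "Suc (p - Suc 0) = p" "Suc (p - 2) = p - 1" using p3 by auto

lemma of_nat_p_k: "(of_nat p :: 'k) = 0" using of_nat_eq_0_iff_char_dvd[where 'a = 'k, of p] char_k by simp

lemma pi_eq: "\<pi> x = \<pi> y \<longleftrightarrow> P dvd x - y"
  using pi(3)[of "x - y"] by (simp add: unital_homD[OF pi(1)])

text \<open>x^p - y^p is x - y times a sum of \<open>p\<close> terms, all congruent to y^(p-1)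
  modulo \<open>p\<close>, so one power of \<open>p\<close> is gained.\<close>

lemma power_p_lift: assumes "P ^ Suc k dvd x - y" shows "P ^ Suc (Suc k) dvd x ^ p - y ^ p"
proof -
  have "P dvd x - y" using assms by (meson dvd_trans dvd_power zero_less_Suc)
  then have xy: "\<pi> x = \<pi> y" by (simp add: pi_eq)
  have "\<pi> (\<Sum>i<p. y ^ (p - Suc i) * x ^ i) = (\<Sum>i<p. \<pi> y ^ (p - 1))"
    by (simp add: unital_homD[OF pi(1)] xy power_add[symmetric])
  then have "P dvd (\<Sum>i<p. y ^ (p - Suc i) * x ^ i)" by (simp add: pi(3)[symmetric] of_nat_p_k)
  with assms have "P ^ Suc k * P dvd (x - y) * (\<Sum>i<p. y ^ (p - Suc i) * x ^ i)" by (rule mult_dvd_mono)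
  then show ?thesis by (simp add: power_diff_sumr2 mult.commute mult.left_commute)
qed

text \<open>Since x = x^p and y = y^p, the lifting of congruences can be iterated without
  end.\<close>

lemma teich_unique: assumes "x ^ p = x" "y ^ p = y" "P dvd x - y" shows "x = y"
proof -
  have "P ^ Suc n dvd x - y" for n by (induction n) (use assms power_p_lift[of _ x y] in auto)
  then have "P ^ n dvd x - y" for n by (meson dvd_trans le_imp_power_dvd lessI less_imp_le)
  then show ?thesis using separated[of "x - y"] by simp
qed

text \<open>The lift is the limit of a^(p^n). Fermat's congruence starts the convergence and
  \<open>power_p_lift\<close> propagates it.\<close>

lemma teich_exists: "\<exists>x\<in>ZZ. x ^ p = x \<and> P dvd x - of_nat a"
proof -
  define s :: "nat => 'a" where "s n = of_nat a ^ (p ^ n)" for n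
  have ss: "s (Suc n) = s n ^ p" for n by (simp add: s_def power_mult[symmetric] mult.commute)
  have "(of_nat a :: 'k) ^ p = of_nat a"
  proof (induction a)
    case (Suc a)
    have "(1 + of_nat a :: 'k) ^ p = 1 ^ p + of_nat a ^ p" by (rule freshmans_dream) (simp_all add: char_k prime_p)
    then show ?case using Suc by simp
  qed (use p3 in simp)
  then have s0: "P ^ Suc 0 dvd s (Suc 0) - s 0" using pi_eq[of "s (Suc 0)" "s 0"] by (simp add: s_def unital_homD[OF pi(1)])
  have s: "P ^ Suc n dvd s (Suc n) - s n" for n
  proof (induction n)
    case (Suc n)
    from power_p_lift[OF this] show ?case by (simp only: ss)
  qed (rule s0)
  then have "P ^ n dvd s (Suc n) - s n" for n by (meson dvd_trans le_imp_power_dvd lessI less_imp_le)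
  then obtain x where x: "!!n. P ^ n dvd x - s n" using limit[of s] by auto
  have xZ: "x \<in> ZZ" unfolding Zp_iff using x by (metis s_def of_nat_power)
  have "x ^ p - x = 0"
  proof (rule separated)
    fix n
    have "P ^ n dvd x ^ p - s n ^ p" using x[of n] by (metis dvd_mult2 power_diff_sumr2)
    moreover have "P ^ n dvd x - s (Suc n)" using x[of "Suc n"] by (meson dvd_trans le_imp_power_dvd lessI less_imp_le)
    ultimately have "P ^ n dvd (x ^ p - s n ^ p) - (x - s (Suc n))" by (rule dvd_diff)
    then show "P ^ n dvd x ^ p - x" by (simp add: ss)
  qed
  moreover have "P dvd x - of_nat a"
  proof -
    have "P dvd (x - s 1) + (s 1 - s 0)" using x[of 1] s0 by (intro dvd_add) auto
    then show ?thesis by (simp add: s_def)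
  qed
  ultimately show ?thesis using xZ by auto
qed

lemma teich: "tc a \<in> ZZ" "tc a ^ p = (tc a :: 'a)" "P dvd tc a - of_nat a"
proof -
  have "\<exists>!x. x \<in> ZZ \<and> x ^ p = x \<and> P dvd x - of_nat a" using teich_exists[of a] teich_unique
    by (metis (no_types, opaque_lifting) pi_eq)
  from theI'[OF this] show "tc a \<in> ZZ" "tc a ^ p = (tc a :: 'a)" "P dvd tc a - of_nat a" unfolding teich_def by auto
qed

text \<open>The values of the character on the torsion subgroup. Describing them by an equation
  makes the group structure visible, which the indexing by residues hides.\<close>

definition MU :: "'a set" where "MU = {x \<in> ZZ. x ^ (p - 1) = 1}"

lemma MU_mult: "x \<in> MU ==> y \<in> MU ==> x * y \<in> MU" and MU_1: "1 \<in> MU" and MU_Zp: "x \<in> MU ==> x \<in> ZZ"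
  by (auto simp: MU_def power_mult_distrib)

lemma MU_p: "x \<in> MU ==> x ^ p = x" using power_Suc[of x "p - 1"] by (simp add: MU_def)

lemma pi_tc: "\<pi> (tc a) = of_nat a" using teich(3)[of a] by (simp add: pi_eq[symmetric] unital_homD[OF pi(1)])

lemma tc_MU: assumes "a \<in> {1..<p}" shows "tc a \<in> MU"
proof -
  have "\<pi> (tc a) \<noteq> 0" using pi_tc of_nat_eq_0_iff_char_dvd[where 'a = 'k, of a] char_k assms by (auto dest: dvd_imp_le)
  then have "tc a \<noteq> 0" by (auto simp: unital_homD[OF pi(1)])
  moreover have "tc a * tc a ^ (p - 1) = tc a * 1" using teich(2)[of a] power_Suc[of "tc a" "p - 1"] by simp
  ultimately show ?thesis using teich(1)[of a] by (simp add: MU_def)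
qed

lemma teich_rep: assumes x: "x \<in> ZZ" "x * y = 1" shows "\<exists>a\<in>{1..<p}. \<pi> x = \<pi> (tc a)"
proof -
  obtain k where k: "P ^ 1 dvd x - of_nat k" using x unfolding Zp_iff by blast
  have "of_nat k = of_nat (k mod p) + P * of_nat (k div p)" by (metis mod_mult_div_eq of_nat_add of_nat_mult)
  then have "P dvd of_nat k - of_nat (k mod p)" by simp
  then have pk: "\<pi> x = of_nat (k mod p)" using k by (simp add: pi_eq[symmetric] unital_homD[OF pi(1)])
  have "\<pi> (x * y) = 1" unfolding x(2) by (simp add: unital_homD[OF pi(1)])
  then have "k mod p \<noteq> 0" using pk by (intro notI) (simp add: unital_homD[OF pi(1)])
  then show ?thesis using pk by (intro bexI[of _ "k mod p"]) (simp_all add: pi_tc)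
qed

text \<open>Lifts are told apart by their residues; conversely a root of unity is the lift of its
  residue, by uniqueness.\<close>

lemma teich_bij: "bij_betw tc {1..<p} MU"
proof (rule bij_betw_imageI)
  have le: "a = b" if "a \<le> b" "b < p" "(of_nat a :: 'k) = of_nat b" for a b
  proof -
    have "(of_nat (b - a) :: 'k) = 0" using that by (simp add: of_nat_diff)
    then have "p dvd b - a" using of_nat_eq_0_iff_char_dvd char_k by metis
    then show ?thesis using that by (cases "b - a = 0") (auto dest: dvd_imp_le)
  qed
  have of_k: "a = b" if "a < p" "b < p" "(of_nat a :: 'k) = of_nat b" for a b
    using that le[of a b] le[of b a] by (cases "a \<le> b") auto
  show "inj_on tc {1..<p}" by (rule inj_onI) (metis pi_tc of_k atLeastLessThan_iff)
  have "x \<in> tc ` {1..<p}" if x: "x \<in> MU" for x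
  proof -
    have "x * x ^ (p - 2) = 1" using x power_Suc[of x "p - 2"] by (simp add: MU_def)
    then obtain a where a: "a \<in> {1..<p}" "\<pi> x = \<pi> (tc a)" using teich_rep[OF MU_Zp[OF x]] by blast
    have "x = tc a" by (rule teich_unique) (use MU_p[OF x] teich(2) a in \<open>auto simp: pi_eq[symmetric]\<close>)
    then show ?thesis using a by auto
  qed
  then show "tc ` {1..<p} = MU" using tc_MU by auto
qed

lemma card_MU: "card MU = p - 1" and finite_MU: "finite MU"
  using bij_betw_same_card[OF teich_bij] bij_betw_finite[OF teich_bij] by auto

text \<open>With \<open>r = m mod (p - 1)\<close> all \<open>p - 1\<close> elements of
  \<open>MU\<close> are roots of X^r - 1, too many unless \<open>r = 0\<close>. This takes the place
  of cyclicity of the group.\<close>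

lemma MU_power: assumes "!!x. x \<in> MU ==> x ^ m = 1" shows "p - 1 dvd m"
proof (rule ccontr)
  assume "\<not> p - 1 dvd m"
  define r where "r = m mod (p - 1)"
  have r: "0 < r" "r < p - 1" using p3 \<open>\<not> p - 1 dvd m\<close> by (auto simp: r_def mod_greater_zero_iff_not_dvd)
  have "x ^ r = 1" if x: "x \<in> MU" for x
  proof -
    have "x ^ m = (x ^ (p - 1)) ^ (m div (p - 1)) * x ^ r" unfolding r_def power_mult[symmetric] power_add[symmetric] by simp
    then show ?thesis using assms[OF x] x by (simp add: MU_def)
  qed
  then have "\<forall>x\<in>MU. (\<Sum>i\<le>r. (if i = 0 then - 1 else if i = r then 1 else 0) * x ^ i) = 0"
    using root_polyfun[of r _ 1] r(1) by auto
  then have "p - 1 \<le> r"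
    using card_roots_le[OF finite_MU, of "%i. if i = 0 then - 1 else if i = r then 1 else 0" r] r(1) card_MU by auto
  then show False using r by simp
qed

lemma mu0_eq: "m0 = (\<Sum>x\<in>MU. qpow x - 1 :: 'a fps)"
  unfolding mu0_def using sum.reindex_bij_betw[OF teich_bij, of "%x. qpow x - 1"] by simp

lemma MU_bij: "z \<in> MU ==> bij_betw ((*) z) MU MU"
proof (rule bij_betw_byWitness[where f' = "(*) (z ^ (p - 2))"])
  assume z: "z \<in> MU"
  have e: "z ^ (p - 2) * z = 1" using z power_Suc2[of z "p - 2"] by (simp add: MU_def)
  have "z ^ n \<in> MU" for n by (induction n) (use z MU_1 MU_mult in auto)
  then show "(*) z ` MU \<subseteq> MU" "(*) (z ^ (p - 2)) ` MU \<subseteq> MU" using z MU_mult by auto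
  show "\<forall>a\<in>MU. z ^ (p - 2) * (z * a) = a" "\<forall>a\<in>MU. z * (z ^ (p - 2) * a) = a"
    using e by (auto simp: mult.assoc[symmetric]) (metis e mult.commute mult_1)
qed

text \<open>The invariants of the torsion subgroup in A_F^+, later identified with S in
  \<open>S_ring_eq\<close>. Membership is easier to check in this form than as a composite with
  mu_0.\<close>

definition Inv :: "'a fps set" where "Inv = {f. \<forall>x\<in>MU. T x f = f}"

lemma mu0_Inv: "m0 \<in> Inv"
proof -
  have "T z (m0) = m0" if z: "z \<in> MU" for z
  proof -
    have "T z (m0) = (\<Sum>x\<in>MU. qpow (z * x) - 1)" using z by (simp add: mu0_eq T_hom T_qpow MU_Zp)
    also have "... = m0" unfolding mu0_eq by (rule sum.reindex_bij_betw[OF MU_bij[OF z]])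
    finally show ?thesis .
  qed
  then show ?thesis by (simp add: Inv_def)
qed

text \<open>The leading coefficient is nonzero and gets multiplied by \<open>x ^ m\<close>, so
  \<open>x ^ m = 1\<close> on \<open>MU\<close> and \<open>p - 1\<close> divides the order
  \<open>m\<close>; the vanishing constant term excludes \<open>m = 0\<close>.\<close>

lemma Inv_order: assumes f: "f \<in> Inv" "f $ 0 = 0" shows "\<exists>g. f = fps_X ^ (p - 1) * g"
proof (cases "f = 0")
  case False
  define m g where "m = subdegree f" and "g = fps_shift m f"
  have fm: "f = fps_X ^ m * g" using subdegree_decompose[of f] by (simp add: m_def g_def mult.commute)
  have g0: "g $ 0 \<noteq> 0" using False by (simp add: g_def m_def)
  have "p - 1 dvd m"
  proof (rule MU_power)
    fix x assume x: "x \<in> MU"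
    obtain h where h: "T x f = fps_X ^ m * h" "h $ 0 = x ^ m * (g $ 0)" using T_order[OF MU_Zp[OF x], of m g] fm by auto
    have "fps_X ^ m * h = fps_X ^ m * g" using f(1) x h(1) fm by (simp add: Inv_def)
    then have "h = g" by simp
    then show "x ^ m = 1" using h(2) g0 by simp
  qed
  moreover have "m \<noteq> 0" using f(2) g0 fm by (auto simp: fps_mult_nth_0 intro: ccontr)
  ultimately obtain k where "m = (p - 1) + k" by (metis dvd_imp_le gr0I le_Suc_ex)
  then have "f = fps_X ^ (p - 1) * (fps_X ^ k * g)" using fm by (simp add: power_add mult.assoc)
  then show ?thesis by blast
qed auto

lemma Inv_ring: "sring Inv" by (unfold_locales) (auto simp: Inv_def T_hom, metis T_hom(2) T_simps(2) diff_0)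

lemma Inv_frob: "f \<in> Inv ==> A_frob p \<sigma> f \<in> Inv" by (auto simp: Inv_def frob_T MU_Zp)

lemma Inv_T: "f \<in> Inv ==> x \<in> ZZ ==> T x f \<in> Inv"
  by (auto simp: Inv_def T_T MU_Zp) (metis T_T MU_Zp mult.commute)

lemma Inv_cancel: "a * b \<in> Inv ==> a \<in> Inv ==> a \<noteq> 0 ==> b \<in> Inv" by (auto simp: Inv_def T_hom)

lemma fps_unit: assumes "\<not> P dvd f $ 0" shows "\<exists>g. f * g = 1"
  using unit[OF assms] fps_right_inverse[of f] by blast

text \<open>Invariance puts the order at \<open>p - 1\<close> or higher. Multiply the coefficient
  there by \<open>fact (p - 1)\<close>: modulo \<open>p\<close> the term for \<open>a\<close> is a
  (a - 1) ... (a - p + 2), which vanishes unless a = p - 1 and is then \<open>fact (p - 1)\<close>.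
  So the coefficient is 1 modulo \<open>p\<close>.\<close>

lemma mu0_factor: "\<exists>u ui. m0 = fps_X ^ (p - 1) * u \<and> u * ui = 1"
proof -
  have "m0 $ 0 = 0" by (simp add: mu0_eq fps_sum_nth)
  then obtain u where u: "m0 = fps_X ^ (p - 1) * u" using Inv_order[OF mu0_Inv] by blast
  then have u0: "u $ 0 = m0 $ (p - 1)" by (simp add: fps_X_power_mult_nth)
  have "of_nat (fact (p - 1)) * (m0 $ (p - 1)) = (\<Sum>a\<in>{1..<p}. \<Prod>i<p - 1. tc a - of_nat i)"
    using p3 teich(1) by (simp add: mu0_def fps_sum_nth sum_distrib_left qpow_fact)
  then have "\<pi> (of_nat (fact (p - 1)) * (m0 $ (p - 1))) = (\<Sum>a\<in>{1..<p}. \<Prod>i<p - 1. of_nat a - of_nat i)"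
    using teich(3) by (simp add: unital_homD[OF pi(1)] pi_eq[symmetric])
  also have "... = (\<Sum>a\<in>{1..<p}. if a = p - 1 then of_nat (fact (p - 1)) else 0)"
  proof (rule sum.cong[OF refl])
    fix a assume a: "a \<in> {1..<p}"
    then have "a choose (p - 1) = (if a = p - 1 then 1 else 0)" by auto
    then show "(\<Prod>i<p - 1. of_nat a - of_nat i) = (if a = p - 1 then of_nat (fact (p - 1)) else 0 :: 'k)"
      by (simp add: prod_diff_of_nat del: of_nat_fact)
  qed
  also have "... = of_nat (fact (p - 1))" using p3 by (simp del: of_nat_fact)
  finally have e: "\<pi> (of_nat (fact (p - 1)) * (m0 $ (p - 1))) = of_nat (fact (p - 1))" .
  have "\<not> p dvd fact (p - 1)" using prime_dvd_fact_iff[OF prime_p, of "p - 1"] p3 by simp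
  then have "(of_nat (fact (p - 1)) :: 'k) \<noteq> 0" using of_nat_eq_0_iff_char_dvd[where 'a = 'k] char_k by metis
  with e have "\<not> P dvd u $ 0" using u0 by (auto simp: pi(3)[symmetric] unital_homD[OF pi(1)])
  then show ?thesis using fps_unit u by blast
qed

lemma mu0_nz: "m0 \<noteq> (0 :: 'a fps)" using mu0_factor by (metis mult_eq_0_iff mult_zero_left power_not_zero fps_X_neq_zero zero_neq_one)

lemma Inv_dvd: assumes "f \<in> Inv" "f $ 0 = 0" shows "\<exists>g\<in>Inv. f = m0 * g"
proof -
  obtain g where g: "f = fps_X ^ (p - 1) * g" using Inv_order assms by blast
  obtain u ui where u: "m0 = fps_X ^ (p - 1) * u" "u * ui = 1" using mu0_factor by blast
  have "m0 * (ui * g) = fps_X ^ (p - 1) * g * (u * ui)" unfolding u(1) by (simp add: algebra_simps)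
  then have "f = m0 * (ui * g)" using u(2) g by (metis mult_1_right)
  then show ?thesis using Inv_cancel[of "m0" "ui * g"] mu0_Inv mu0_nz assms(1) by auto
qed

lemma mu0_0: "m0 $ 0 = (0 :: 'a)" by (simp add: mu0_eq fps_sum_nth)

lemma mu0_pow_low: "n < m ==> (m0 ^ m) $ n = (0 :: 'a)" using startsby_zero_power_prefix[OF mu0_0] by auto

text \<open>Iterated division: the constant term is subtracted, the rest is divisible by mu_0, and
  the quotient is invariant again.\<close>

lemma Inv_expand: assumes f: "f \<in> Inv"
  shows "\<exists>s. (\<forall>n. s n \<in> Inv) \<and> (\<forall>n. f = (\<Sum>i<n. fps_const (s i $ 0) * m0 ^ i) + m0 ^ n * s n)"
proof -
  interpret sring Inv by (rule Inv_ring)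
  have "\<exists>g. g \<in> Inv \<and> f' = fps_const (f' $ 0) + m0 * g" if "f' \<in> Inv" for f'
  proof -
    have "f' - fps_const (f' $ 0) \<in> Inv" using that by (auto simp: Inv_def T_hom)
    then show ?thesis using Inv_dvd[of "f' - fps_const (f' $ 0)"] by (auto simp: algebra_simps)
  qed
  then obtain D where D: "!!f'. f' \<in> Inv ==> D f' \<in> Inv \<and> f' = fps_const (f' $ 0) + m0 * D f'" by metis
  define s where "s n = (D ^^ n) f" for n
  have sI: "s n \<in> Inv" for n by (induction n) (use f D in \<open>auto simp: s_def\<close>)
  have ss: "s n = fps_const (s n $ 0) + m0 * s (Suc n)" for n using D[OF sI[of n]] by (simp add: s_def)
  have "f = (\<Sum>i<n. fps_const (s i $ 0) * m0 ^ i) + m0 ^ n * s n" for n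
  proof (induction n)
    case (Suc n)
    then show ?case by (subst (asm) ss[of n]) (simp add: algebra_simps)
  qed (simp add: s_def)
  then show ?thesis using sI by blast
qed

text \<open>One inclusion is the invariance of mu_0. For the other, the remainder after
  \<open>n + 1\<close> divisions does not affect coefficient \<open>n\<close>, because mu_0 has no
  constant term.\<close>

lemma S_ring_eq: "S_ring p = Inv"
proof (intro equalityI subsetI)
  fix f :: "'a fps" assume "f \<in> S_ring p"
  then obtain g where g: "f = g oo m0" by (auto simp: S_ring_def)
  have "T x f = f" if x: "x \<in> MU" for x
  proof -
    have "(qpow x - 1 :: 'a fps) $ 0 = 0" by simp
    then have "T x f = g oo T x m0" unfolding T_def g using mu0_0 by (rule fps_compose_assoc[symmetric])
    then show ?thesis using mu0_Inv x g by (simp add: Inv_def)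
  qed
  then show "f \<in> Inv" by (simp add: Inv_def)
next
  fix f assume "f \<in> Inv"
  then obtain s where part: "!!n. f = (\<Sum>i<n. fps_const (s i $ 0) * m0 ^ i) + m0 ^ n * s n" using Inv_expand by blast
  have "f = Abs_fps (%n. s n $ 0) oo m0"
  proof (rule fps_ext)
    fix n
    have "f $ n = (\<Sum>i<Suc n. fps_const (s i $ 0) * m0 ^ i) $ n + (m0 ^ Suc n * s (Suc n)) $ n"
      using arg_cong[OF part[of "Suc n"], of "%f. f $ n"] by (simp only: fps_add_nth)
    moreover have "(m0 ^ Suc n * s (Suc n)) $ n = 0"
      unfolding fps_mult_nth by (rule sum.neutral) (use mu0_pow_low[of _ "Suc n"] in auto)
    ultimately show "f $ n = (Abs_fps (%n. s n $ 0) oo m0) $ n"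
      by (simp add: fps_sum_nth fps_compose_nth lessThan_Suc_atMost atLeast0AtMost del: sum.lessThan_Suc)
  qed
  then show "f \<in> S_ring p" by (auto simp: S_ring_def)
qed

text \<open>mu_0 + p is 1 plus the sum of all q^[a], and [p]_q is 1 plus the sum of all q^a, so it
  suffices to compare q^[a] with q^a. Here [a] - a = p z, and q^(pz) arises from q^z by q \<mapsto>
  q^p, which sends mu to mu [p]_q; so the two agree modulo mu [p]_q.\<close>

lemma pt_factor: "\<exists>e ei. m0 + of_nat p = qp * e \<and> e * ei = (1 :: 'a fps)"
proof -
  have "\<exists>h. qpow (tc a) = (1 + fps_X) ^ a + fps_X * qp * h" if "a \<in> {1..<p}" for a
  proof -
    obtain z where z: "tc a - of_nat a = P * z" using teich(3) by auto
    have zZ: "z \<in> ZZ" by (rule Zp_divide_P) (use z teich(1)[of a] Zp_diff[of "tc a" "of_nat a"] in simp)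
    have az: "tc a = of_nat a + P * z" using z by (simp add: algebra_simps)
    define k where "k = fps_shift 1 (qpow z)"
    have "qpow z = 1 + fps_X * k" by (rule fps_ext) (auto simp: k_def)
    then have "T P (qpow z) = 1 + (qpow P - 1) * T P k" by (simp add: T_hom)
    also have "qpow P - 1 = fps_X * qp" using power_diff_1_eq[of "1 + fps_X :: 'a fps" p] by (simp add: q_p_def qpow_of_nat)
    finally have "qpow (P * z) = 1 + fps_X * qp * T P k" using zZ by (simp add: T_qpow)
    then have "qpow (tc a) = (1 + fps_X) ^ a * (1 + fps_X * qp * T P k)"
      unfolding az using qpow_add[of "of_nat a" "P * z"] zZ by (simp add: qpow_of_nat)
    then have "qpow (tc a) = (1 + fps_X) ^ a + fps_X * qp * ((1 + fps_X) ^ a * T P k)" by (simp add: algebra_simps)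
    then show ?thesis by blast
  qed
  then obtain h where h: "!!a. a \<in> {1..<p} ==> qpow (tc a) = (1 + fps_X) ^ a + fps_X * qp * h a" by metis
  \<comment> \<open>The congruence holds modulo mu [p]_q and not only modulo [p]_q; the extra mu
    gives \<open>e\<close> the constant term 1.\<close>
  define e where "e = 1 + fps_X * (\<Sum>a\<in>{1..<p}. h a)"
  have "m0 = (\<Sum>a\<in>{1..<p}. qpow (tc a)) - of_nat (p - 1)" by (simp add: mu0_def sum_subtractf)
  then have "m0 + of_nat p = 1 + (\<Sum>a\<in>{1..<p}. qpow (tc a))" using p3 by (simp add: of_nat_diff algebra_simps)
  also have "(\<Sum>a\<in>{1..<p}. qpow (tc a)) = (\<Sum>a\<in>{1..<p}. (1 + fps_X) ^ a) + fps_X * qp * (\<Sum>a\<in>{1..<p}. h a)"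
    by (simp add: h sum.distrib sum_distrib_left)
  also have "1 + ((\<Sum>a\<in>{1..<p}. (1 + fps_X) ^ a) + fps_X * qp * (\<Sum>a\<in>{1..<p}. h a)) = qp * e"
  proof -
    have "qp = (\<Sum>a\<in>{0..<p}. (1 + fps_X) ^ a :: 'a fps)" by (simp add: q_p_def lessThan_atLeast0)
    also have "... = 1 + (\<Sum>a\<in>{1..<p}. (1 + fps_X) ^ a)" using sum.atLeast_Suc_lessThan[of 0 p "%a. (1 + fps_X) ^ a :: 'a fps"] by simp
    finally have "1 + (\<Sum>a\<in>{1..<p}. (1 + fps_X) ^ a) = qp" by simp
    then show ?thesis by (simp only: e_def add.assoc[symmetric] distrib_left mult_1_right mult.assoc mult.left_commute)
  qed
  finally have "m0 + of_nat p = qp * e" .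
  moreover have "\<not> P dvd e $ 0" using P_dvd_of_nat[of 1] prime_p by (auto simp: e_def)
  ultimately show ?thesis using fps_unit by blast
qed

lemma q_p_nz: "qp \<noteq> (0 :: 'a fps)"
proof
  assume "qp = (0 :: 'a fps)"
  then have "qp $ 0 = (0 :: 'a)" by simp
  then show False using p3 by (simp add: q_p_def fps_sum_nth fps_nth_power_0)
qed

lemma pt_Inv: "m0 + of_nat p \<in> Inv"
proof -
  interpret sring Inv by (rule Inv_ring)
  show ?thesis using mu0_Inv by simp
qed

text \<open>phi(mu_0) = phi(mu)^(p-1) phi(u) and phi(mu) = mu [p]_q. Replacing mu^(p-1) and [p]_q by
  mu_0 and mu_0 + p costs only units, and the resulting unit is invariant as a quotient of
  invariants.\<close>

lemma frob_mu0: "\<exists>e\<in>Inv. \<exists>ei\<in>Inv. A_frob p \<sigma> (m0) = m0 * ((m0 + of_nat p) ^ (p - 1) * e) \<and> e * ei = 1"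
proof -
  interpret sring Inv by (rule Inv_ring)
  obtain u ui where u: "m0 = fps_X ^ (p - 1) * u" "u * ui = 1" using mu0_factor by blast
  obtain e ei where e: "m0 + of_nat p = qp * e" "e * ei = (1 :: 'a fps)" using pt_factor by blast
  let ?phi = "A_frob p \<sigma>" and ?w = "(m0 + of_nat p) ^ (p - 1) :: 'a fps"
  define c where "c = ui * ei ^ (p - 1) * ?phi u"
  define d where "d = u * e ^ (p - 1) * ?phi ui"
  have "c * d = (u * ui) * (e * ei) ^ (p - 1) * ?phi (u * ui)" by (simp add: c_def d_def frob_hom power_mult_distrib mult_ac)
  then have cd: "c * d = 1" using u e by (simp add: frob_hom)
  have "m0 * (?w * c) = fps_X ^ (p - 1) * qp ^ (p - 1) * ?phi u * ((u * ui) * (e * ei) ^ (p - 1))"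
    unfolding e(1) by (subst u(1)) (simp add: c_def power_mult_distrib mult_ac)
  also have "... = ?phi (m0)" using u e by (simp add: frob_hom frob_X power_mult_distrib)
  finally have eq: "?phi (m0) = m0 * (?w * c)" by simp
  have "m0 * ?w * c \<in> Inv" using Inv_frob[OF mu0_Inv] eq by (simp add: mult.assoc)
  moreover have "m0 * ?w \<in> Inv" using mu0_Inv pt_Inv by auto
  moreover have "m0 * ?w \<noteq> 0" using mu0_nz q_p_nz e by auto
  ultimately have cI: "c \<in> Inv" by (rule Inv_cancel)
  have "c \<noteq> 0" using cd by auto
  then have "d \<in> Inv" using Inv_cancel[of c d] cd cI one_R by simp
  then show ?thesis using cI cd eq by blast
qed

end

section \<open>Adic filtrations in terms of coefficients\<close>

lemma adic_powerI:
  assumes R: "sring (b_scal B)" and mu: "b_mu B \<in> b_scal B" and x: "!!i. i \<le> n ==> x i \<in> b_scal B"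
  shows "(\<Sum>i\<le>n. of_nat (b_prime B) ^ (n - i) * b_mu B ^ i * x i) \<in> adic_power B (regon (b_scal B)) n"
proof -
  interpret sring "b_scal B" by fact
  interpret N: rmod "b_scal B" "regon (b_scal B)" by (rule rmod_regon)
  let ?Z = "{(of_nat (b_prime B) ^ i * b_mu B ^ (n - i)) *[regon (b_scal B)] x | i x. i \<le> n \<and> x :> regon (b_scal B)}"
  have Z: "?Z \<subseteq> carrier (regon (b_scal B))" using mu by auto
  note cl = N.span_closed[OF Z]
  have "(\<Sum>i\<in>I. of_nat (b_prime B) ^ (n - i) * b_mu B ^ i * x i) \<in> span_on (b_scal B) (regon (b_scal B)) ?Z"
    if "finite I" "I \<subseteq> {..n}" for I using that
  proof (induction I)
    case empty
    then show ?case using cl(2) by simp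
  next
    case (insert i I)
    have i: "(of_nat (b_prime B) ^ (n - i) * b_mu B ^ (n - (n - i))) *[regon (b_scal B)] x i \<in> ?Z"
      using insert.prems x[of i] by (intro CollectI exI[of _ "n - i"] exI[of _ "x i"]) auto
    then have "of_nat (b_prime B) ^ (n - i) * b_mu B ^ i * x i \<in> span_on (b_scal B) (regon (b_scal B)) ?Z"
      using insert.prems span_on_incl[OF i] by simp
    then show ?case using insert cl(3) by simp
  qed
  then show ?thesis by (simp add: adic_power_def)
qed

context witt
begin

lemma adic_expandI:
  assumes "sring (b_scal B)" "b_mu B \<in> b_scal B" "b_prime B = p" "!!a. fps_const a \<in> b_scal B" "r \<in> b_scal B"
    and f: "f = (\<Sum>i<n. fps_const (a i) * b_mu B ^ i) + b_mu B ^ n * r" and a: "!!i. i < n ==> P ^ (n - i) dvd a i"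
  shows "f \<in> adic_power B (regon (b_scal B)) n"
proof -
  obtain b where b: "!!i. i < n ==> a i = P ^ (n - i) * b i" using a unfolding dvd_def by metis
  define x where "x i = (if i < n then fps_const (b i) else r)" for i
  have "f = (\<Sum>i<n. of_nat p ^ (n - i) * b_mu B ^ i * x i) + b_mu B ^ n * r"
    unfolding f by (intro arg_cong2[of _ _ _ _ "(+)"] sum.cong refl)
      (simp add: b x_def fps_of_nat[symmetric] fps_const_mult[symmetric] fps_const_power[symmetric] mult_ac del: fps_const_mult fps_const_power)
  also have "... = (\<Sum>i\<le>n. of_nat (b_prime B) ^ (n - i) * b_mu B ^ i * x i)"
    by (simp add: lessThan_Suc_atMost[symmetric] x_def assms(3))
  finally show ?thesis using adic_powerI[of B n x] assms by (auto simp: x_def)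
qed

text \<open>If \<open>x\<close> is 1 modulo \<open>P ^ (n + v)\<close>, then q^x and q agree modulo
  \<open>P ^ n\<close> in degrees up to \<open>n\<close>; the surplus \<open>v\<close> pays for the
  denominators of the binomial coefficients. Powers, and hence composites, inherit the
  congruence.\<close>

lemma T_continuous: "\<exists>m. \<forall>x\<in>ZZ. P ^ m dvd x - 1 \<longrightarrow> (\<forall>i<n. P ^ n dvd (T x c - c) $ i)"
proof -
  obtain v where v: "!!k x. P ^ k dvd of_nat (fact n) * x ==> P ^ k dvd P ^ v * x" using fact_cancel by blast
  have "\<forall>i<n. P ^ n dvd (T x c - c) $ i" if x: "x \<in> ZZ" "P ^ (n + v) dvd x - 1" for x
  proof -
    define eq where "eq f g \<longleftrightarrow> (\<forall>i\<le>n. P ^ n dvd (f - g) $ i)" for f g :: "'a fps"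
    have eq_mult: "eq (f * g) (f' * g')" if "eq f f'" "eq g g'" for f g f' g'
    proof -
      have "f * g - f' * g' = f * (g - g') + (f - f') * g'" by (simp add: algebra_simps)
      then show ?thesis using that by (auto simp: eq_def fps_mult_nth intro!: dvd_add dvd_sum)
    qed
    define y where "y = x - 1"
    have y: "y \<in> ZZ" "x = 1 + y" using x by (auto simp: y_def)
    have qy: "P ^ n dvd qpow y $ i" if i: "0 < i" "i \<le> n" for i
    proof -
      \<comment> \<open>For \<open>i > 0\<close> the factor at \<open>j = 0\<close> is
        \<open>y\<close> itself, which carries all the divisibility.\<close>
      have "(\<Prod>j<i. y - of_nat j) = y * (\<Prod>j\<in>{..<i} - {0}. y - of_nat j)"
        using i by (subst prod.remove[of _ 0]) auto
      then have "P ^ (n + v) dvd of_nat (fact i) * (qpow y $ i)" using x(2) qpow_fact[OF y(1), of i] by (simp add: y_def)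
      moreover have "fact i dvd (fact n :: nat)" using i by (intro fact_dvd)
      then have "of_nat (fact i) dvd (of_nat (fact n) :: 'a)" by (auto simp: dvd_def simp del: of_nat_fact)
      ultimately have "P ^ (n + v) dvd of_nat (fact n) * (qpow y $ i)" by (meson dvd_trans mult_dvd_mono dvd_refl)
      then show ?thesis using v dvd_P_cancel by blast
    qed
    have "eq (qpow x - 1) fps_X" unfolding eq_def
    proof (intro allI impI)
      fix i assume i: "i \<le> n"
      have q: "P ^ n dvd (qpow y - 1) $ j" if "j \<le> n" for j using qy[of j] that by (cases j) auto
      have E: "qpow x - 1 - fps_X = (1 + fps_X) * (qpow y - 1)"
        using qpow_add[of 1 y] y by (simp add: qpow_one algebra_simps)
      have "(qpow x - 1 - fps_X) $ i = (qpow y - 1) $ i + (if i = 0 then 0 else (qpow y - 1) $ (i - 1))"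
        unfolding E by (simp add: distrib_right del: fps_sub_nth)
      then show "P ^ n dvd (qpow x - 1 - fps_X) $ i" using q[of i] q[of "i - 1"] i by (simp del: fps_sub_nth)
    qed
    then have pw: "eq ((qpow x - 1) ^ j) (fps_X ^ j)" for j by (induction j) (auto intro: eq_mult, simp add: eq_def)
    show ?thesis
    proof (intro allI impI)
      fix i assume "i < n"
      have "c = c oo fps_X" by simp
      then have "(T x c - c) $ i = (\<Sum>j=0..i. c $ j * (((qpow x - 1) ^ j - fps_X ^ j) $ i))"
        by (simp add: T_def fps_compose_nth sum_subtractf right_diff_distrib) (simp add: mult_delta_right)
      then show "P ^ n dvd (T x c - c) $ i" using pw \<open>i < n\<close> by (auto simp: eq_def intro!: dvd_sum simp del: fps_sub_nth)
    qed
  qed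
  then show ?thesis by blast
qed

text \<open>The j-th power of mu_0 starts in degree \<open>(p - 1) * j\<close> with a unit
  coefficient. The expansion in mu_0 is therefore found from the coefficients of \<open>f\<close> in
  these degrees by a triangular system, and divisibility follows by induction on
  \<open>j\<close>.\<close>

lemma Inv_adic:
  assumes f: "f \<in> Inv" and cf: "!!i. i < (p - 1) * n ==> P ^ ((p - 1) * n - i) dvd f $ i"
  shows "\<exists>a r. r \<in> Inv \<and> f = (\<Sum>i<n. fps_const (a i) * m0 ^ i) + m0 ^ n * r \<and> (\<forall>i<n. P ^ (n - i) dvd a i)"
proof -
  obtain s where s: "!!n. s n \<in> Inv" "!!n. f = (\<Sum>i<n. fps_const (s i $ 0) * m0 ^ i) + m0 ^ n * s n"
    using Inv_expand[OF f] by blast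
  obtain u ui where u: "m0 = fps_X ^ (p - 1) * u" "u * ui = 1" using mu0_factor by blast
  have mp: "m0 ^ i = fps_X ^ ((p - 1) * i) * u ^ i" for i by (simp add: u(1) power_mult_distrib power_mult)
  have "P ^ (n - j) dvd s j $ 0" if "j < n" for j using that
  proof (induction j rule: less_induct)
    case (less j)
    let ?k = "(p - 1) * j"
    have "?k < (p - 1) * n" using less.prems p3 by simp
    then have "P ^ ((p - 1) * n - ?k) dvd f $ ?k" by (rule cf)
    \<comment> \<open>The index \<open>(p - 1) * n\<close> in the hypothesis is chosen so that
      degree \<open>(p - 1) * j\<close> still has at least \<open>n - j\<close> powers of
      \<open>p\<close>.\<close>
    moreover have "n - j \<le> (p - 1) * n - ?k" using p3 mult_le_mono1[of 1 "p - 1" "n - j"] by (simp add: diff_mult_distrib2)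
    ultimately have "P ^ (n - j) dvd f $ ?k" by (meson dvd_trans le_imp_power_dvd)
    moreover have "f $ ?k = (\<Sum>i<j. s i $ 0 * ((m0 ^ i) $ ?k)) + s j $ 0 * (u $ 0) ^ j"
    proof -
      have "f $ ?k = (\<Sum>i<Suc j. s i $ 0 * ((m0 ^ i) $ ?k)) + (m0 ^ Suc j * s (Suc j)) $ ?k"
        using arg_cong[OF s(2)[of "Suc j"], of "%f. f $ ?k"] by (simp only: fps_add_nth fps_sum_nth fps_mult_left_const_nth)
      moreover have "(m0 ^ Suc j * s (Suc j)) $ ?k = 0" using p3 unfolding mp mult.assoc by (simp add: fps_X_power_mult_nth)
      moreover have "(m0 ^ j) $ ?k = (u $ 0) ^ j" unfolding mp by (simp add: fps_X_power_mult_nth fps_nth_power_0)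
      ultimately show ?thesis by simp
    qed
    moreover have "P ^ (n - j) dvd (\<Sum>i<j. s i $ 0 * ((m0 ^ i) $ ?k))"
    proof (intro dvd_sum dvd_mult2)
      fix i assume i: "i \<in> {..<j}"
      then have "P ^ (n - i) dvd s i $ 0" using less by auto
      moreover have "P ^ (n - j) dvd P ^ (n - i)" using i by (intro le_imp_power_dvd) auto
      ultimately show "P ^ (n - j) dvd s i $ 0" by (rule dvd_trans[rotated])
    qed
    ultimately have "P ^ (n - j) dvd s j $ 0 * (u $ 0) ^ j" by (simp only: dvd_add_right_iff)
    then have "P ^ (n - j) dvd s j $ 0 * (u $ 0) ^ j * (ui $ 0) ^ j" by (rule dvd_mult2)
    moreover have "u $ 0 * ui $ 0 = 1" using arg_cong[OF u(2), of "%f. f $ 0"] by simp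
    then have "s j $ 0 * (u $ 0) ^ j * (ui $ 0) ^ j = s j $ 0" by (simp only: mult.assoc power_mult_distrib[symmetric]) simp
    ultimately show ?case by (simp only:)
  qed
  then show ?thesis by (intro exI[of _ "%i. s i $ 0"] exI[of _ "s n"] conjI s allI impI) simp
qed

end

section \<open>The cyclotomic Galois group\<close>

locale witt_galois = witt p \<pi> \<sigma> for p and \<pi> :: "'a::idom => 'k::field" and \<sigma> +
  fixes \<Gamma> :: "'g monoid" (structure) and \<chi> :: "'g => 'a"
  assumes grp: "group \<Gamma>" and iso: "\<chi> \<in> iso \<Gamma> (Zp_units p)"
begin

sublocale \<Gamma>: group \<Gamma> by (rule grp)

lemma chi: "g \<in> carrier \<Gamma> ==> \<chi> g \<in> ZZ" "g \<in> carrier \<Gamma> ==> \<exists>y\<in>ZZ. \<chi> g * y = 1"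
  "[|g \<in> carrier \<Gamma>; h \<in> carrier \<Gamma>|] ==> \<chi> (g \<otimes> h) = \<chi> g * \<chi> h"
  "[|g \<in> carrier \<Gamma>; h \<in> carrier \<Gamma>; \<chi> g = \<chi> h|] ==> g = h"
  "[|x \<in> ZZ; y \<in> ZZ; x * y = 1|] ==> \<exists>g\<in>carrier \<Gamma>. \<chi> g = x"
proof -
  have c: "\<chi> ` carrier \<Gamma> = {x \<in> ZZ. \<exists>y\<in>ZZ. x * y = 1}" "inj_on \<chi> (carrier \<Gamma>)"
    using iso by (auto simp: iso_def bij_betw_def Zp_units_def)
  show "g \<in> carrier \<Gamma> ==> \<chi> g \<in> ZZ" "g \<in> carrier \<Gamma> ==> \<exists>y\<in>ZZ. \<chi> g * y = 1" using c(1) by auto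
  show "[|g \<in> carrier \<Gamma>; h \<in> carrier \<Gamma>|] ==> \<chi> (g \<otimes> h) = \<chi> g * \<chi> h"
    using iso by (auto simp: iso_def hom_def Zp_units_def)
  show "[|g \<in> carrier \<Gamma>; h \<in> carrier \<Gamma>; \<chi> g = \<chi> h|] ==> g = h" using c(2) by (auto dest: inj_onD)
  assume "x \<in> ZZ" "y \<in> ZZ" "x * y = 1"
  then have "x \<in> \<chi> ` carrier \<Gamma>" unfolding c(1) by auto
  then show "\<exists>g\<in>carrier \<Gamma>. \<chi> g = x" by auto
qed

lemma chi_one [simp]: "\<chi> \<one> = 1"
proof -
  have "\<chi> \<one> * \<chi> \<one> = \<chi> \<one>" using chi(3)[of "\<one>" "\<one>"] by simp
  moreover have "\<chi> \<one> \<noteq> 0" using chi(2)[of "\<one>"] by auto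
  ultimately show ?thesis by simp
qed

lemma comm: "g \<in> carrier \<Gamma> ==> h \<in> carrier \<Gamma> ==> g \<otimes> h = h \<otimes> g"
  by (rule chi(4)) (auto simp: chi(3) mult.commute)

lemma chi_inv: "g \<in> carrier \<Gamma> ==> \<chi> g * \<chi> (inv\<^bsub>\<Gamma>\<^esub> g) = 1"
  using chi(3)[of g "inv\<^bsub>\<Gamma>\<^esub> g"] by simp

definition UA :: "nat => 'g set" where "UA m = {g \<in> carrier \<Gamma>. P ^ m dvd \<chi> g - 1}"
abbreviation (input) "\<Gamma>0 \<equiv> Gamma_0 p \<Gamma> \<chi>"
abbreviation (input) "H \<equiv> Gamma_tor p \<Gamma> \<chi>"
definition US :: "nat => 'g set" where "US m = UA m \<inter> \<Gamma>0"

lemma Gamma_0_eq: "\<Gamma>0 = {g \<in> carrier \<Gamma>. P dvd \<chi> g - 1}"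
proof -
  have "(\<exists>z\<in>ZZ. \<chi> g = 1 + P * z) \<longleftrightarrow> P dvd \<chi> g - 1" if g: "g \<in> carrier \<Gamma>" for g
  proof
    assume "P dvd \<chi> g - 1"
    then obtain z where z: "\<chi> g - 1 = P * z" by auto
    then have "z \<in> ZZ" using Zp_divide_P[of z] Zp_diff[OF chi(1)[OF g] Zp_1] by simp
    then show "\<exists>z\<in>ZZ. \<chi> g = 1 + P * z" using z by (auto simp: algebra_simps)
  qed auto
  then show ?thesis by (auto simp: Gamma_0_def)
qed

lemma Gamma_tor_eq: "H = {g \<in> carrier \<Gamma>. \<chi> g \<in> MU}"
  using bij_betw_imp_surj_on[OF teich_bij] by (auto simp: Gamma_tor_def)

lemma UA_mult: "g \<in> UA m ==> h \<in> UA m ==> g \<otimes> h \<in> UA m" and UA_inv: "g \<in> UA m ==> inv\<^bsub>\<Gamma>\<^esub> g \<in> UA m"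
proof -
  assume g: "g \<in> UA m"
  have "\<chi> (inv\<^bsub>\<Gamma>\<^esub> g) - 1 = - (\<chi> (inv\<^bsub>\<Gamma>\<^esub> g) * (\<chi> g - 1))"
    using chi_inv[of g] g by (simp add: UA_def algebra_simps)
  then show "inv\<^bsub>\<Gamma>\<^esub> g \<in> UA m" using g by (simp add: UA_def)
  assume h: "h \<in> UA m"
  have "\<chi> (g \<otimes> h) - 1 = \<chi> g * (\<chi> h - 1) + (\<chi> g - 1)" using g h by (simp add: UA_def chi(3) algebra_simps)
  moreover have "P ^ m dvd \<chi> g * (\<chi> h - 1) + (\<chi> g - 1)" using g h by (auto simp: UA_def intro!: dvd_add dvd_mult)
  ultimately have "P ^ m dvd \<chi> (g \<otimes> h) - 1" by (simp only:)
  then show "g \<otimes> h \<in> UA m" using g h by (simp add: UA_def)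
qed

lemma Gamma_0_UA: "\<Gamma>0 = UA 1" by (simp add: Gamma_0_eq UA_def)

lemma sub_0: "subgroup \<Gamma>0 \<Gamma>"
  unfolding Gamma_0_UA by (rule \<Gamma>.subgroupI) (auto simp: UA_mult UA_inv, auto simp: UA_def intro!: exI[of _ "\<one>"])

lemma sub_tor: "subgroup H \<Gamma>"
proof (rule \<Gamma>.subgroupI)
  show "H \<noteq> {}" using MU_1 by (auto simp: Gamma_tor_eq intro!: exI[of _ "\<one>"])
  fix g assume g: "g \<in> H"
  then have e: "\<chi> g * \<chi> (inv\<^bsub>\<Gamma>\<^esub> g) = 1" using chi_inv by (simp add: Gamma_tor_eq)
  then have "(\<chi> g * \<chi> (inv\<^bsub>\<Gamma>\<^esub> g)) ^ (p - 1) = 1" by simp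
  then have "\<chi> (inv\<^bsub>\<Gamma>\<^esub> g) ^ (p - 1) = 1" using g by (simp add: Gamma_tor_eq MU_def power_mult_distrib)
  then show "inv\<^bsub>\<Gamma>\<^esub> g \<in> H" using g chi(1) by (simp add: Gamma_tor_eq MU_def)
qed (auto simp: Gamma_tor_eq chi(3) MU_mult)

lemma tor_bij: "bij_betw \<chi> H MU"
proof (rule bij_betw_imageI)
  show "inj_on \<chi> H" by (rule inj_onI) (auto simp: Gamma_tor_eq intro: chi(4))
  have "x \<in> \<chi> ` H" if x: "x \<in> MU" for x
  proof -
    have "x * x ^ (p - 2) = 1" using x power_Suc[of x "p - 2"] by (simp add: MU_def)
    then obtain g where "g \<in> carrier \<Gamma>" "\<chi> g = x" using chi(5)[of x "x ^ (p - 2)"] MU_Zp[OF x] by auto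
    then show ?thesis using x by (auto simp: Gamma_tor_eq)
  qed
  then show "\<chi> ` H = MU" by (auto simp: Gamma_tor_eq)
qed

text \<open>The character of a Gamma_0 part is 1 modulo \<open>p\<close>, so the torsion parts have
  the same residue and, being Teichmuller lifts, coincide.\<close>

lemma Gamma_split_unique:
  assumes "h \<in> \<Gamma>0" "h' \<in> \<Gamma>0" "t \<in> H" "t' \<in> H" "h \<otimes> t = h' \<otimes> t'"
  shows "h = h'"
proof -
  have c: "h \<in> carrier \<Gamma>" "h' \<in> carrier \<Gamma>" "t \<in> carrier \<Gamma>" "t' \<in> carrier \<Gamma>" using assms by (auto simp: Gamma_0_eq Gamma_tor_eq)
  have "\<pi> (\<chi> h) = \<pi> 1" "\<pi> (\<chi> h') = \<pi> 1" using assms by (auto simp: Gamma_0_eq pi_eq simp del: unital_homD)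
  moreover have "\<pi> (\<chi> h * \<chi> t) = \<pi> (\<chi> h' * \<chi> t')" using arg_cong[OF assms(5), of \<chi>] c by (simp add: chi(3))
  ultimately have "P dvd \<chi> t - \<chi> t'" by (simp add: unital_homD[OF pi(1)] pi_eq[symmetric])
  moreover have "\<chi> t \<in> MU" "\<chi> t' \<in> MU" using assms by (auto simp: Gamma_tor_eq)
  ultimately have "\<chi> t = \<chi> t'" using teich_unique[OF MU_p MU_p] by blast
  then have "t = t'" using c chi(4) by blast
  then show ?thesis using assms(5) c by simp
qed

text \<open>The torsion part is the element whose character is the Teichmuller lift of the residue
  of \<open>\<chi> g\<close>; the character of the quotient is then 1 modulo
  \<open>p\<close>.\<close>

lemma Gamma_split: assumes g: "g \<in> carrier \<Gamma>" shows "\<exists>h\<in>\<Gamma>0. \<exists>t\<in>H. g = h \<otimes> t"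
proof -
  obtain y where "\<chi> g * y = 1" using chi(2)[OF g] by auto
  then obtain a where a: "a \<in> {1..<p}" "\<pi> (\<chi> g) = \<pi> (tc a)" using teich_rep[OF chi(1)[OF g]] by blast
  have "tc a \<in> \<chi> ` H" unfolding bij_betw_imp_surj_on[OF tor_bij] by (rule tc_MU[OF a(1)])
  then obtain t where t: "t \<in> H" "\<chi> t = tc a" by auto
  have tc: "t \<in> carrier \<Gamma>" using t by (simp add: Gamma_tor_eq)
  have "\<chi> (g \<otimes> inv\<^bsub>\<Gamma>\<^esub> t) - 1 = (\<chi> g - \<chi> t) * \<chi> (inv\<^bsub>\<Gamma>\<^esub> t)" using g tc chi_inv[OF tc] by (simp add: chi(3) algebra_simps)
  moreover have "P dvd \<chi> g - \<chi> t" using a t by (simp add: pi_eq)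
  ultimately have "g \<otimes> inv\<^bsub>\<Gamma>\<^esub> t \<in> \<Gamma>0" using g tc by (simp add: Gamma_0_eq)
  moreover have "g = g \<otimes> inv\<^bsub>\<Gamma>\<^esub> t \<otimes> t" using g tc by (simp add: \<Gamma>.m_assoc)
  ultimately show ?thesis using t(1) by blast
qed

lemma pr_eqI: "h \<in> \<Gamma>0 ==> t \<in> H ==> Gamma_pr p \<Gamma> \<chi> (h \<otimes> t) = h"
  unfolding Gamma_pr_def by (rule the_equality) (auto dest: Gamma_split_unique)

lemma nbhd: "g \<in> carrier \<Gamma> ==> (\<otimes>) g ` UA m = {h \<in> carrier \<Gamma>. P ^ m dvd \<chi> h - \<chi> g}"
proof (intro equalityI subsetI)
  fix h assume g: "g \<in> carrier \<Gamma>" and "h \<in> (\<otimes>) g ` UA m"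
  then obtain k where k: "h = g \<otimes> k" "k \<in> carrier \<Gamma>" "P ^ m dvd \<chi> k - 1" by (auto simp: UA_def)
  have "\<chi> h - \<chi> g = \<chi> g * (\<chi> k - 1)" using k g by (simp add: chi(3) algebra_simps)
  then show "h \<in> {h \<in> carrier \<Gamma>. P ^ m dvd \<chi> h - \<chi> g}" using k g by simp
next
  fix h assume g: "g \<in> carrier \<Gamma>" and "h \<in> {h \<in> carrier \<Gamma>. P ^ m dvd \<chi> h - \<chi> g}"
  then have h: "h \<in> carrier \<Gamma>" "P ^ m dvd \<chi> h - \<chi> g" by auto
  have "\<chi> (inv\<^bsub>\<Gamma>\<^esub> g \<otimes> h) - 1 = \<chi> (inv\<^bsub>\<Gamma>\<^esub> g) * (\<chi> h - \<chi> g)"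
    using g h chi_inv[OF g] by (simp add: chi(3) algebra_simps)
  then have "inv\<^bsub>\<Gamma>\<^esub> g \<otimes> h \<in> UA m" using g h by (simp add: UA_def)
  moreover have "h = g \<otimes> (inv\<^bsub>\<Gamma>\<^esub> g \<otimes> h)" using g h by (simp add: \<Gamma>.m_assoc[symmetric])
  ultimately show "h \<in> (\<otimes>) g ` UA m" by blast
qed

lemma top_open: "g \<in> carrier \<Gamma> ==> openin (Gamma_top p \<Gamma> \<chi>) ((\<otimes>) g ` UA m)"
  unfolding nbhd Gamma_top_def by (rule topology_generated_by_Basis) blast

lemma top_nbhd: assumes "openin (Gamma_top p \<Gamma> \<chi>) V" "g \<in> V" shows "\<exists>m. \<forall>h\<in>UA m. g \<otimes> h \<in> V"
proof -
  have "g \<in> carrier \<Gamma> \<and> (\<exists>m. {h \<in> carrier \<Gamma>. P ^ m dvd \<chi> h - \<chi> g} \<subseteq> V)"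
    using assms unfolding Gamma_top_def openin_topology_generated_by_iff
  proof (induction V rule: generate_topology_on.induct)
    case (Int a b)
    then obtain m n where m: "{h \<in> carrier \<Gamma>. P ^ m dvd \<chi> h - \<chi> g} \<subseteq> a" "{h \<in> carrier \<Gamma>. P ^ n dvd \<chi> h - \<chi> g} \<subseteq> b" by auto
    have "P ^ m dvd P ^ max m n" "P ^ n dvd P ^ max m n" by (auto intro: le_imp_power_dvd)
    then have "P ^ m dvd \<chi> h - \<chi> g" "P ^ n dvd \<chi> h - \<chi> g" if "P ^ max m n dvd \<chi> h - \<chi> g" for h
      using that dvd_trans by blast+
    then have "{h \<in> carrier \<Gamma>. P ^ max m n dvd \<chi> h - \<chi> g} \<subseteq> a \<inter> b" using m by auto
    then show ?case using Int by blast
  next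
    case (UN K)
    then obtain k where k: "k \<in> K" "g \<in> k" by auto
    then have "g \<in> carrier \<Gamma> \<and> (\<exists>m. {h \<in> carrier \<Gamma>. P ^ m dvd \<chi> h - \<chi> g} \<subseteq> k)" using UN.IH by simp
    then show ?case using k(1) by (meson Union_upper subset_trans)
  next
    case (Basis V)
    then obtain g' n where g': "V = {h \<in> carrier \<Gamma>. P ^ n dvd \<chi> h - \<chi> g'}" by auto
    have "{h \<in> carrier \<Gamma>. P ^ n dvd \<chi> h - \<chi> g} \<subseteq> V"
    proof
      fix h assume "h \<in> {h \<in> carrier \<Gamma>. P ^ n dvd \<chi> h - \<chi> g}"
      then have h: "h \<in> carrier \<Gamma>" "P ^ n dvd \<chi> h - \<chi> g" by auto
      moreover have "P ^ n dvd \<chi> g - \<chi> g'" using Basis g' by auto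
      ultimately have "P ^ n dvd (\<chi> h - \<chi> g) + (\<chi> g - \<chi> g')" by (intro dvd_add)
      then show "h \<in> V" using h g' by simp
    qed
    then show ?case using Basis.prems g' by auto
  qed auto
  then obtain m where "(\<otimes>) g ` UA m \<subseteq> V" using nbhd by auto
  then show ?thesis by auto
qed

lemma top_space: "topspace (Gamma_top p \<Gamma> \<chi>) = carrier \<Gamma>"
proof -
  have "g \<in> \<Union>{{h \<in> carrier \<Gamma>. P ^ n dvd \<chi> h - \<chi> g} | g n. g \<in> carrier \<Gamma>}" if "g \<in> carrier \<Gamma>" for g
  proof (rule UnionI)
    show "{h \<in> carrier \<Gamma>. P ^ 0 dvd \<chi> h - \<chi> g} \<in> {{h \<in> carrier \<Gamma>. P ^ n dvd \<chi> h - \<chi> g} | g n. g \<in> carrier \<Gamma>}" using that by blast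
  qed (use that in simp)
  then show ?thesis by (auto simp: Gamma_top_def topology_generated_by_topspace)
qed

section \<open>The two bases as instances of the general setting\<close>

abbreviation (input) "BA \<equiv> wach_base_A p \<sigma> \<Gamma> \<chi>"
abbreviation (input) "BS \<equiv> wach_base_S p \<sigma> \<Gamma> \<chi>"

lemma A_simps: "b_prime BA = p" "b_scal BA = UNIV" "b_frob BA = A_frob p \<sigma>" "b_grp BA = \<Gamma>" "b_top BA = Gamma_top p \<Gamma> \<chi>"
  "b_act BA g f = T (\<chi> g) f" "b_mu BA = fps_X" "b_xi BA = qp" by (simp_all add: wach_base_A_def A_act_eq)

lemma S_simps: "b_prime BS = p" "b_scal BS = Inv" "b_frob BS = A_frob p \<sigma>" "b_grp BS = \<Gamma>\<lparr>carrier := \<Gamma>0\<rparr>"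
  "b_top BS = subtopology (Gamma_top p \<Gamma> \<chi>) \<Gamma>0" "b_act BS g f = T (\<chi> g) f" "b_mu BS = m0" "b_xi BS = m0 + of_nat p"
  by (simp_all add: wach_base_S_def A_act_eq S_ring_eq)

text \<open>A crude criterion: degree \<open>i\<close> would need only \<open>P ^ (n - i)\<close>,
  but uniform divisibility by \<open>P ^ n\<close> is what \<open>T_continuous\<close>
  delivers.\<close>

lemma A_adicI: assumes "!!i. i < n ==> P ^ n dvd f $ i" shows "f \<in> adic_power BA (regon UNIV) n"
proof -
  have "f = (\<Sum>i<n. fps_const (f $ i) * fps_X ^ i) + fps_X ^ n * fps_shift n f"
  proof (rule fps_ext)
    fix k
    have "(\<Sum>i<n. fps_const (f $ i) * fps_X ^ i) $ k = (if k < n then f $ k else 0)"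
      by (simp add: fps_sum_nth fps_X_power_nth mult_delta_right)
    then show "f $ k = ((\<Sum>i<n. fps_const (f $ i) * fps_X ^ i) + fps_X ^ n * fps_shift n f) $ k"
      by (auto simp: fps_X_power_mult_nth)
  qed
  moreover have "P ^ (n - i) dvd f $ i" if "i < n" for i
    using assms[OF that] by (meson dvd_trans le_imp_power_dvd diff_le_self)
  ultimately have "f \<in> adic_power BA (regon (b_scal BA)) n"
    by (intro adic_expandI[where r = "fps_shift n f" and a = "%i. f $ i"]) (auto simp: A_simps sring_UNIV)
  then show ?thesis by (simp add: A_simps)
qed

text \<open>Multiplying by a power series moves coefficients only to higher degrees, where less
  divisibility is demanded, so the condition describes a submodule containing the
  generators.\<close>

lemma A_adicD: assumes "f \<in> adic_power BA (regon UNIV) n" "i < n" shows "P ^ (n - i) dvd f $ i"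
proof -
  interpret N: rmod UNIV "regon (UNIV :: 'a fps set)" by (rule sring.rmod_regon[OF sring_UNIV])
  let ?Z = "{(of_nat p ^ i * fps_X ^ (n - i)) *[regon (UNIV :: 'a fps set)] x | i x. i \<le> n \<and> x :> regon UNIV}"
  have "f \<in> span_on UNIV (regon UNIV) ?Z" using assms(1) by (simp add: adic_power_def A_simps)
  moreover have "?Z \<subseteq> carrier (regon UNIV)" by auto
  ultimately have "\<forall>i<n. P ^ (n - i) dvd f $ i"
  proof (induction f rule: N.span_induct)
    case (base f)
    then obtain j x where f: "f = of_nat p ^ j * (fps_X ^ (n - j) * x)" "j \<le> n" by (auto simp: mult.assoc)
    have "f $ i = P ^ j * ((fps_X ^ (n - j) * x) $ i)" for i unfolding f fps_of_nat[symmetric] fps_const_power by simp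
    moreover have "P ^ (n - i) dvd P ^ j" if "i \<ge> n - j" for i using that by (intro le_imp_power_dvd) auto
    ultimately show ?case by (auto simp: fps_X_power_mult_nth)
  next
    case (smult c x)
    then show ?case
    proof (intro allI impI)
      fix i assume i: "i < n"
      have "P ^ (n - i) dvd x $ j" if "j \<le> i" for j
      proof -
        have "P ^ (n - j) dvd x $ j" using smult(3) that i by simp
        moreover have "P ^ (n - i) dvd P ^ (n - j)" using that by (intro le_imp_power_dvd) auto
        ultimately show ?thesis by (rule dvd_trans[rotated])
      qed
      then show "P ^ (n - i) dvd (c *[regon UNIV] x) $ i" by (auto simp: fps_mult_nth intro!: dvd_sum dvd_mult)
    qed
  qed auto
  then show ?thesis using assms(2) by simp
qed

text \<open>mu_0 counts as mu^(p-1), hence the factor \<open>p - 1\<close> between the indices of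
  the two filtrations.\<close>

lemma adic_comp: assumes f: "f \<in> Inv" "f \<in> adic_power BA (regon UNIV) ((p - 1) * n)" shows "f \<in> adic_power BS (regon Inv) n"
proof -
  obtain a r where ar: "r \<in> Inv" "f = (\<Sum>i<n. fps_const (a i) * m0 ^ i) + m0 ^ n * r" "\<forall>i<n. P ^ (n - i) dvd a i"
    using Inv_adic[OF f(1) A_adicD[OF f(2)]] by blast
  then have "f \<in> adic_power BS (regon (b_scal BS)) n"
    by (intro adic_expandI[where r = r and a = a]) (auto simp: S_simps Inv_ring mu0_Inv, simp add: Inv_def)
  then show ?thesis by (simp add: S_simps)
qed

lemma T_cont: "\<exists>m. \<forall>g\<in>UA m. T (\<chi> g) c - c \<in> adic_power BA (regon UNIV) n"
proof -
  obtain m where m: "\<forall>x\<in>ZZ. P ^ m dvd x - 1 \<longrightarrow> (\<forall>i<n. P ^ n dvd (T x c - c) $ i)" using T_continuous by blast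
  then show ?thesis by (intro exI[of _ m]) (auto simp: UA_def chi(1) simp del: fps_sub_nth intro!: A_adicI)
qed

lemma UA_facts: "UA m \<subseteq> carrier \<Gamma>" "\<one> \<in> UA m" "m \<le> n ==> UA n \<subseteq> UA m"
  by (auto simp: UA_def intro: dvd_trans[OF le_imp_power_dvd])

text \<open>Here phi(mu)/mu is [p]_q itself, so the divisibilities between \<open>w\<close> and
  \<open>b_xi\<close> are trivial.\<close>

lemma wbase_A: "wbase BA qp UA"
proof (unfold_locales, unfold A_simps)
  show "\<exists>d\<in>UNIV. T (\<chi> g) c - c = fps_X * d" for g c
  proof
    show "T (\<chi> g) c - c = fps_X * fps_shift 1 (T (\<chi> g) c - c)" by (rule fps_ext) auto
  qed simp
  show "\<exists>c\<in>UNIV. qp = qp * c" "\<exists>c\<in>UNIV. \<exists>n. qp * c = qp ^ n"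
    by (auto intro: exI[of _ 1] simp del: mult_cancel_left1) (metis mult.right_neutral power_one_right)
qed (use UA_facts in \<open>auto simp: frob_hom T_hom chi T_T frob_T frob_X q_p_nz grp top_space intro: top_nbhd top_open T_cont\<close>)

lemma US_facts: "US m \<subseteq> \<Gamma>0" "\<one> \<in> US m" "m \<le> n ==> US n \<subseteq> US m"
  unfolding US_def using UA_facts(2) UA_facts(3)[of m n] subgroup.one_closed[OF sub_0] by blast+

lemma act_mod_Inv: assumes "c \<in> Inv" "x \<in> ZZ" shows "\<exists>d\<in>Inv. T x c - c = m0 * d"
proof -
  interpret sring Inv by (rule Inv_ring)
  show ?thesis by (rule Inv_dvd) (use assms Inv_T in auto)
qed

lemma Gamma_0_carrier: "g \<in> \<Gamma>0 ==> g \<in> carrier \<Gamma>" by (simp add: Gamma_0_eq)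

lemma nbhd_S: "g \<in> \<Gamma>0 ==> (\<otimes>) g ` US m = (\<otimes>) g ` UA m \<inter> \<Gamma>0"
proof (intro equalityI subsetI)
  interpret subgroup \<Gamma>0 \<Gamma> by (rule sub_0)
  fix x assume g: "g \<in> \<Gamma>0" and "x \<in> (\<otimes>) g ` UA m \<inter> \<Gamma>0"
  then obtain h where h: "x = g \<otimes> h" "h \<in> UA m" "g \<otimes> h \<in> \<Gamma>0" by auto
  then have "inv\<^bsub>\<Gamma>\<^esub> g \<otimes> (g \<otimes> h) \<in> \<Gamma>0" using g by simp
  moreover have "h \<in> carrier \<Gamma>" using h(2) UA_facts(1) by blast
  then have "inv\<^bsub>\<Gamma>\<^esub> g \<otimes> (g \<otimes> h) = h" using g by (simp add: \<Gamma>.m_assoc[symmetric])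
  ultimately show "x \<in> (\<otimes>) g ` US m" using h by (auto simp: US_def)
next
  fix x assume "g \<in> \<Gamma>0" "x \<in> (\<otimes>) g ` US m"
  then show "x \<in> (\<otimes>) g ` UA m \<inter> \<Gamma>0" using subgroup.m_closed[OF sub_0] by (auto simp: US_def)
qed

text \<open>Here phi(mu_0)/mu_0 is a unit times the (p-1)-st power of mu_0 + p. Bounds by powers of
  \<open>w\<close> and of \<open>b_xi\<close> therefore differ in the exponent, which the definition
  of a Wach module leaves free.\<close>

lemma wbase_S:
  assumes e: "e \<in> Inv" "ei \<in> Inv" "A_frob p \<sigma> m0 = m0 * ((m0 + of_nat p) ^ (p - 1) * e)" "e * ei = 1"
  shows "wbase BS ((m0 + of_nat p) ^ (p - 1) * e) US"
proof -
  interpret R: sring Inv by (rule Inv_ring)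
  let ?x = "m0 + of_nat p" and ?w = "(m0 + of_nat p) ^ (p - 1) * e"
  have w: "?x \<in> Inv" "?w \<in> Inv" using pt_Inv e by auto
  have "?x \<noteq> 0" using pt_factor q_p_nz by (metis mult_eq_0_iff mult_zero_left zero_neq_one)
  then have wn: "?w \<noteq> 0" using e(4) by auto
  have 1: "\<exists>c\<in>Inv. ?w = ?x * c"
    using w e by (intro bexI[of _ "?x ^ (p - 2) * e"]) (auto simp: mult.assoc[symmetric] power_Suc[symmetric] simp del: power_Suc)
  have 2: "\<exists>c\<in>Inv. \<exists>n. ?w * c = ?x ^ n"
    using e by (intro bexI[of _ ei] exI[of _ "p - 1"]) (auto simp: mult.assoc)
  have op: "\<exists>m. \<forall>h\<in>US m. g \<otimes> h \<in> V" if V: "openin (subtopology (Gamma_top p \<Gamma> \<chi>) \<Gamma>0) V" "g \<in> V" for V g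
  proof -
    obtain V' where V': "openin (Gamma_top p \<Gamma> \<chi>) V'" "V = V' \<inter> \<Gamma>0" using V(1) by (auto simp: openin_subtopology)
    then obtain m where "\<forall>h\<in>UA m. g \<otimes> h \<in> V'" using top_nbhd[of V' g] V(2) by auto
    then show ?thesis using V(2) V'(2) subgroup.m_closed[OF sub_0] by (auto simp: US_def)
  qed
  have op': "openin (subtopology (Gamma_top p \<Gamma> \<chi>) \<Gamma>0) ((\<otimes>) g ` US m)" if "g \<in> \<Gamma>0" for g m
    unfolding nbhd_S[OF that] openin_subtopology using top_open[OF Gamma_0_carrier[OF that]] by blast
  have cont: "\<exists>m. \<forall>g\<in>US m. T (\<chi> g) c - c \<in> adic_power BS (regon Inv) n" if c: "c \<in> Inv" for c n
  proof -
    obtain m where m: "\<forall>g\<in>UA m. T (\<chi> g) c - c \<in> adic_power BA (regon UNIV) ((p - 1) * n)" using T_cont by blast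
    have "T (\<chi> g) c - c \<in> Inv" if "g \<in> UA m" for g using that Inv_T[OF c chi(1)] UA_facts(1)[of m] c by auto
    then show ?thesis using m by (intro exI[of _ m]) (auto simp: US_def intro: adic_comp)
  qed
  have top: "topspace (subtopology (Gamma_top p \<Gamma> \<chi>) \<Gamma>0) = \<Gamma>0"
    using Gamma_0_carrier by (auto simp: top_space)
  show ?thesis
  proof (rule wbase.intro, unfold S_simps)
    show "Group.group (\<Gamma>\<lparr>carrier := \<Gamma>0\<rparr>)" by (rule subgroup.subgroup_is_group[OF sub_0 grp])
    show "\<exists>m. \<forall>h\<in>US m. g \<otimes>\<^bsub>\<Gamma>\<lparr>carrier := \<Gamma>0\<rparr>\<^esub> h \<in> V" if "openin (subtopology (Gamma_top p \<Gamma> \<chi>) \<Gamma>0) V" "g \<in> V" for V g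
      using op[OF that] by simp
    show "openin (subtopology (Gamma_top p \<Gamma> \<chi>) \<Gamma>0) ((\<otimes>\<^bsub>\<Gamma>\<lparr>carrier := \<Gamma>0\<rparr>\<^esub>) g ` US m)" if "g :> \<Gamma>\<lparr>carrier := \<Gamma>0\<rparr>" for g m
      using op'[of g m] that by simp
    show "\<exists>d\<in>Inv. T (\<chi> g) c - c = m0 * d" if "g :> \<Gamma>\<lparr>carrier := \<Gamma>0\<rparr>" "c \<in> Inv" for g c
      using that by (intro act_mod_Inv) (auto simp: chi(1) Gamma_0_carrier)
    show "\<exists>m. \<forall>g\<in>US m. T (\<chi> g) c - c \<in> adic_power BS (regon Inv) n" if "c \<in> Inv" for c n by (rule cont[OF that])
    show "US m \<subseteq> carrier (\<Gamma>\<lparr>carrier := \<Gamma>0\<rparr>)" "\<one>\<^bsub>\<Gamma>\<lparr>carrier := \<Gamma>0\<rparr>\<^esub> \<in> US m" for m using US_facts by auto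
    show "US n \<subseteq> US m" if "m \<le> n" for m n by (rule US_facts(3)[OF that])
    show "topspace (subtopology (Gamma_top p \<Gamma> \<chi>) \<Gamma>0) = carrier (\<Gamma>\<lparr>carrier := \<Gamma>0\<rparr>)" by (simp only: top) simp
    show "A_frob p \<sigma> m0 = m0 * ?w" by (rule e)
    show "?w \<in> Inv" "?w \<noteq> 0" "?x \<in> Inv" by (rule w wn)+
    show "\<exists>c\<in>Inv. ?w = ?x * c" "\<exists>c\<in>Inv. \<exists>n. ?w * c = ?x ^ n" by (rule 1 2)+
  qed (auto simp: Inv_ring frob_hom T_hom chi T_T frob_T Inv_frob Inv_T Gamma_0_carrier mu0_Inv mu0_nz)
qed

text \<open>\<open>p - 1\<close> occurs twice: as the order of mu_0 as a power series in mu, and as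
  the order of the torsion subgroup. The latter is invertible because \<open>p\<close> does not
  divide it, which makes averaging possible.\<close>

lemma wpair_SA: "\<exists>w u ui ci. wpair BS BA w qp US UA (Gamma_pr p \<Gamma> \<chi>) H (p - 1) u ui ci"
proof -
  obtain e ei where e: "e \<in> Inv" "ei \<in> Inv" "A_frob p \<sigma> m0 = m0 * ((m0 + of_nat p) ^ (p - 1) * e)" "e * ei = 1"
    using frob_mu0 by blast
  obtain u ui where u: "m0 = fps_X ^ (p - 1) * u" "u * ui = 1" using mu0_factor by blast
  have "\<not> p dvd p - 1" using p3 by (auto dest: dvd_imp_le)
  then obtain c where c: "(of_nat (p - 1) :: 'a) * c = 1" using unit[of "of_nat (p - 1)"] P_dvd_of_nat by auto
  have card: "card H = p - 1" "finite H"
    using bij_betw_same_card[OF tor_bij] bij_betw_finite[OF tor_bij] card_MU finite_MU by auto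
  have ci: "of_nat (card H) * fps_const c = (1 :: 'a fps)" unfolding card fps_of_nat[symmetric] fps_const_mult c by simp
  have fixed: "Inv = {c. \<forall>h\<in>H. T (\<chi> h) c = c}"
    unfolding Inv_def bij_betw_imp_surj_on[OF tor_bij, symmetric] by auto
  note m0 = subgroup.m_closed[OF sub_0] and mt = subgroup.m_closed[OF sub_tor]
  have tc: "t \<in> carrier \<Gamma>" if "t \<in> H" for t using that by (simp add: Gamma_tor_eq)
  have pr: "Gamma_pr p \<Gamma> \<chi> g \<in> \<Gamma>0" "\<exists>t\<in>H. g = Gamma_pr p \<Gamma> \<chi> g \<otimes> t" if g: "g \<in> carrier \<Gamma>" for g
    using Gamma_split[OF g] by (auto simp: pr_eqI)
  have pr_mult: "Gamma_pr p \<Gamma> \<chi> (g \<otimes> h) = Gamma_pr p \<Gamma> \<chi> g \<otimes> Gamma_pr p \<Gamma> \<chi> h"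
    if gh: "g \<in> carrier \<Gamma>" "h \<in> carrier \<Gamma>" for g h
  proof -
    obtain t where t: "t \<in> H" "g = Gamma_pr p \<Gamma> \<chi> g \<otimes> t" using pr gh by blast
    obtain t' where t': "t' \<in> H" "h = Gamma_pr p \<Gamma> \<chi> h \<otimes> t'" using pr gh by blast
    define a b where "a = Gamma_pr p \<Gamma> \<chi> g" and "b = Gamma_pr p \<Gamma> \<chi> h"
    have ab: "a \<in> \<Gamma>0" "b \<in> \<Gamma>0" "g = a \<otimes> t" "h = b \<otimes> t'" using pr gh t t' by (auto simp: a_def b_def)
    have "a \<otimes> t \<otimes> (b \<otimes> t') = a \<otimes> b \<otimes> (t \<otimes> t')"
      by (rule chi(4)) (use ab tc[OF t(1)] tc[OF t'(1)] Gamma_0_carrier in \<open>auto simp: chi(3)\<close>)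
    then have "Gamma_pr p \<Gamma> \<chi> (g \<otimes> h) = a \<otimes> b" using pr_eqI[of "a \<otimes> b" "t \<otimes> t'"] ab m0 mt t(1) t'(1) by simp
    then show ?thesis by (simp add: a_def b_def)
  qed
  have pr_0: "Gamma_pr p \<Gamma> \<chi> g = g" if "g \<in> \<Gamma>0" for g
    using pr_eqI[OF that subgroup.one_closed[OF sub_tor]] Gamma_0_carrier[OF that] by simp
  have pr_t: "Gamma_pr p \<Gamma> \<chi> t = \<one>" if "t \<in> H" for t
    using pr_eqI[OF subgroup.one_closed[OF sub_0] that] tc[OF that] by simp
  have nu: "\<exists>c'\<in>Inv. c = m0 * c'" if "c \<in> Inv" "c = fps_X * x" for c x by (rule Inv_dvd) (use that in auto)
  have act: "b_act BS = b_act BA" by (intro ext) (simp add: A_simps S_simps)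
  have "wpair_axioms BS BA US UA (Gamma_pr p \<Gamma> \<chi>) H (p - 1) u ui (fps_const c)"
  proof (rule wpair_axioms.intro, unfold act A_simps S_simps)
    show "Inv = {c. \<forall>h\<in>H. T (\<chi> h) c = c}" by (rule fixed)
    show "g \<otimes> h = h \<otimes> g" if "g \<in> carrier \<Gamma>" "h \<in> H" for g h using that comm tc by blast
    show "\<exists>t\<in>H. g = Gamma_pr p \<Gamma> \<chi> g \<otimes> t" if "g \<in> carrier \<Gamma>" for g by (rule pr(2)[OF that])
    \<comment> \<open>Level \<open>Suc m\<close> is at least 1, which forces elements into Gamma_0,
      and at least \<open>m\<close>.\<close>
    show "\<exists>m'. UA m' \<subseteq> US m" for m
      using UA_facts(3)[of m "Suc m"] UA_facts(3)[of 1 "Suc m"] by (intro exI[of _ "Suc m"]) (auto simp: US_def Gamma_0_UA)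
    show "\<exists>m'. US m' \<subseteq> UA m" for m by (auto simp: US_def)
    show "\<exists>k. \<forall>c\<in>Inv. c \<in> adic_power BA (regon UNIV) k \<longrightarrow> c \<in> adic_power BS (regon Inv) n" for n
      using adic_comp by blast
    show "\<exists>c'\<in>Inv. c = m0 * c'" if "c \<in> Inv" "c = fps_X * x" for c x by (rule nu[OF that])
    show "of_nat (card H) * fps_const c = (1 :: 'a fps)" by (rule ci)
  qed (use u card sub_tor pr(1) pr_mult pr_0 pr_t Gamma_0_carrier p3 in auto)
  then show ?thesis using wpair.intro[OF wbase_S[OF e] wbase_A] by blast
qed

end

theorem theorem3p9:
  fixes p :: nat
    and \<pi> :: "'a::idom \<Rightarrow> 'k::field"
    and \<sigma> :: "'a \<Rightarrow> 'a"
    and \<Gamma> :: "'g monoid"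
    and \<chi> :: "'g \<Rightarrow> 'a"
  assumes "prime p" and "p \<ge> 3"
    and "CHAR('k) = p" and "surj (\<lambda>x::'k. x ^ p)"
    and "witt_ring p \<pi>" and "witt_frobenius p \<pi> \<sigma>"
    and "group \<Gamma>" and "\<chi> \<in> iso \<Gamma> (Zp_units p)"
  shows
    "let S = wach_base_S p \<sigma> \<Gamma> \<chi>;
         A = wach_base_A p \<sigma> \<Gamma> \<chi>;
         WS = wach_cat S :: (('a fps, 'b, 'g) wach_ob, ('a fps, 'b, 'g) wach_ar) tcat;
         WA = wach_cat A :: (('a fps, 'b, 'g) wach_ob, ('a fps, 'b, 'g) wach_ar) tcat;
         F = base_change S A (Gamma_pr p \<Gamma> \<chi>);
         G = invariants S A (Gamma_tor p \<Gamma> \<chi>)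
     in tensor_equivalence WS WA F G \<and>
        preserves_short_exact S F \<and> preserves_short_exact A G"
proof -
  have "witt_galois p \<pi> \<sigma> \<Gamma> \<chi>" by (intro witt_galois.intro witt.intro witt_galois_axioms.intro assms)
  from witt_galois.wpair_SA[OF this] obtain w u ui ci where
    w: "wpair (wach_base_S p \<sigma> \<Gamma> \<chi>) (wach_base_A p \<sigma> \<Gamma> \<chi>) w (q_p p) (witt_galois.US p \<Gamma> \<chi>) (witt_galois.UA p \<Gamma> \<chi>)
      (Gamma_pr p \<Gamma> \<chi>) (Gamma_tor p \<Gamma> \<chi>) (p - 1) u ui ci" by (elim exE)
  show ?thesis
    unfolding Let_def by (intro conjI wpair.equivalence[OF w] wpair.exact_F[OF w] wpair.exact_G[OF w])
qed

end
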